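(* Let $K$ be a field, let $f,f_1,\ldots,f_r\in K[x_1,\ldots,x_n]$ ($r\ge1$), let $I=(f_1,\ldots,f_r)$ and $B=K[x_1,\ldots,x_n]/I$, and let $\bar f$ be the image of $f$ in $B$. Let $J$ be the ideal of $K[x_1,\ldots,x_n]$ generated by the $(r+1)\times(r+1)$-minors of the $(r+1)\times n$ matrix whose $i$-th row, for $1\le i\le r$, is $(\partial f_i/\partial x_1,\ldots,\partial f_i/\partial x_n)$ and whose last row is $(\partial f/\partial x_1,\ldots,\partial f/\partial x_n)$. If $f_1,\ldots,f_r$ define a smooth complete intersection in $\mathbf{A}^n$, then \[ H^{n-r}(\Omega^{\bullet}_{B/K},\phi_{\bar f})\simeq K[x_1,\ldots,x_n]/(I+J) \] as $B$-modules.
   Context: That $f_1,\ldots,f_r$ define a smooth complete intersection in $\mathbf{A}^n$ means that $\mathrm{Spec}(B)$ is a smooth $K$-scheme, purely of codimension $r$ in $\mathbf{A}^n$. $\Omega^k_{B/K}$ is the module of Kähler differential $k$-forms of $B$ over $K$ (zero for $k<0$), $d_{B/K}$ is the exterior derivative, and the differential of the complex $(\Omega^{\bullet}_{B/K},\phi_{\bar f})$ is $\phi_{\bar f}:\Omega^k_{B/K}\to\Omega^{k+1}_{B/K}$, $\phi_{\bar f}(\omega)=d_{B/K}\bar f\wedge\omega$. *)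

theory Defs
  imports
    "HOL-Algebra.QuotRing"
    "HOL-Algebra.Module"
    "HOL-Algebra.Algebraic_Closure_Type"
    "HOL-Library.Poly_Mapping"
    "HOL-Library.Extended_Nat"
    "Jordan_Normal_Form.Determinant"
    "Jordan_Normal_Form.DL_Submatrix"
begin

section \<open>Modules given by generators and relations\<close>

text \<open>The ring fields \<open>mult\<close> and \<open>one\<close> of a \<open>module\<close> record play no role in \<^locale>\<open>module\<close>
  and are left undefined.\<close>

definition free_module :: "('r, 'x) ring_scheme \<Rightarrow> 's set \<Rightarrow> ('r, 's \<Rightarrow> 'r) module" where
  "free_module R S =
    \<lparr>carrier = {g. (\<forall>s\<in>S. g s \<in> carrier R) \<and> (\<forall>s. s \<notin> S \<longrightarrow> g s = \<zero>\<^bsub>R\<^esub>) \<and> finite {s. g s \<noteq> \<zero>\<^bsub>R\<^esub>}},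
     monoid.mult = undefined, monoid.one = undefined,
     ring.zero = (\<lambda>_. \<zero>\<^bsub>R\<^esub>),
     ring.add = (\<lambda>g h s. g s \<oplus>\<^bsub>R\<^esub> h s),
     module.smult = (\<lambda>a g s. a \<otimes>\<^bsub>R\<^esub> g s)\<rparr>"

definition free_gen :: "('r, 'x) ring_scheme \<Rightarrow> 's \<Rightarrow> 's \<Rightarrow> 'r" where
  "free_gen R s = (\<lambda>t. if t = s then \<one>\<^bsub>R\<^esub> else \<zero>\<^bsub>R\<^esub>)"

definition submodule_span :: "('r, 'x) ring_scheme \<Rightarrow> ('r, 'm, 'y) module_scheme \<Rightarrow> 'm set \<Rightarrow> 'm set" where
  "submodule_span R M S = (\<lambda>N. submodule N R M) hull S"

definition quot_module :: "('r, 'm, 'y) module_scheme \<Rightarrow> 'm set \<Rightarrow> ('r, 'm set) module" where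
  "quot_module M N =
    \<lparr>carrier = a_rcosets\<^bsub>M\<^esub> N,
     monoid.mult = undefined, monoid.one = undefined,
     ring.zero = N,
     ring.add = set_add M,
     module.smult = (\<lambda>a A. \<Union>x\<in>A. N +>\<^bsub>M\<^esub> (a \<odot>\<^bsub>M\<^esub> x))\<rparr>"

definition module_iso ::
  "('r, 'x) ring_scheme \<Rightarrow> ('r, 'm, 'y) module_scheme \<Rightarrow> ('r, 'n, 'z) module_scheme \<Rightarrow> bool" where
  "module_iso R M N \<longleftrightarrow> module R M \<and> module R N \<and>
    (\<exists>h. bij_betw h (carrier M) (carrier N) \<and>
      (\<forall>x\<in>carrier M. \<forall>y\<in>carrier M. h (x \<oplus>\<^bsub>M\<^esub> y) = h x \<oplus>\<^bsub>N\<^esub> h y) \<and>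
      (\<forall>a\<in>carrier R. \<forall>x\<in>carrier M. h (a \<odot>\<^bsub>M\<^esub> x) = a \<odot>\<^bsub>N\<^esub> h x))"


section \<open>Exterior powers\<close>

text \<open>The degree is an integer: for \<open>k < 0\<close> there are no tuples of length \<open>k\<close>, so the exterior
  power is the zero module, while for \<open>k = 0\<close> it is free on the empty tuple, i.e. a copy of \<open>R\<close>.\<close>

definition tuples :: "('r, 'm, 'y) module_scheme \<Rightarrow> int \<Rightarrow> 'm list set" where
  "tuples M k = {l. int (length l) = k \<and> set l \<subseteq> carrier M}"

text \<open>The relations make the tuple symbol \<open>(m\<^sub>1,\<dots>,m\<^sub>k)\<close> multilinear and alternating.\<close>

definition exterior_rels ::
  "('r, 'x) ring_scheme \<Rightarrow> ('r, 'm, 'y) module_scheme \<Rightarrow> int \<Rightarrow> ('m list \<Rightarrow> 'r) set" where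
  "exterior_rels R M k = (let F = free_module R (tuples M k); e = free_gen R in
     {e (l[i := x \<oplus>\<^bsub>M\<^esub> y]) \<ominus>\<^bsub>F\<^esub> (e (l[i := x]) \<oplus>\<^bsub>F\<^esub> e (l[i := y])) | l i x y.
        l \<in> tuples M k \<and> i < length l \<and> x \<in> carrier M \<and> y \<in> carrier M}
   \<union> {e (l[i := a \<odot>\<^bsub>M\<^esub> x]) \<ominus>\<^bsub>F\<^esub> a \<odot>\<^bsub>F\<^esub> e (l[i := x]) | l i a x.
        l \<in> tuples M k \<and> i < length l \<and> a \<in> carrier R \<and> x \<in> carrier M}
   \<union> {e l | l. l \<in> tuples M k \<and> (\<exists>i j. i < j \<and> j < length l \<and> l ! i = l ! j)})"

definition exterior_rel_span ::
  "('r, 'x) ring_scheme \<Rightarrow> ('r, 'm, 'y) module_scheme \<Rightarrow> int \<Rightarrow> ('m list \<Rightarrow> 'r) set" where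
  "exterior_rel_span R M k = submodule_span R (free_module R (tuples M k)) (exterior_rels R M k)"

definition exterior_power ::
  "('r, 'x) ring_scheme \<Rightarrow> ('r, 'm, 'y) module_scheme \<Rightarrow> int \<Rightarrow> ('r, ('m list \<Rightarrow> 'r) set) module" where
  "exterior_power R M k = quot_module (free_module R (tuples M k)) (exterior_rel_span R M k)"

text \<open>On free modules, \<open>prepend R m\<close> is the linear map sending the symbol \<open>(m\<^sub>1,\<dots>,m\<^sub>k)\<close> to
  \<open>(m,m\<^sub>1,\<dots>,m\<^sub>k)\<close>. It induces \<open>\<omega> \<mapsto> m \<and> \<omega>\<close> on exterior powers; since it respects the relations,
  the union below is a single coset.\<close>

definition prepend :: "('r, 'x) ring_scheme \<Rightarrow> 'm \<Rightarrow> ('m list \<Rightarrow> 'r) \<Rightarrow> 'm list \<Rightarrow> 'r" where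
  "prepend R m g = (\<lambda>l. case l of [] \<Rightarrow> \<zero>\<^bsub>R\<^esub> | x # xs \<Rightarrow> if x = m then g xs else \<zero>\<^bsub>R\<^esub>)"

definition wedge_left ::
  "('r, 'x) ring_scheme \<Rightarrow> ('r, 'm, 'y) module_scheme \<Rightarrow> 'm \<Rightarrow> int
    \<Rightarrow> ('m list \<Rightarrow> 'r) set \<Rightarrow> ('m list \<Rightarrow> 'r) set" where
  "wedge_left R M m k \<omega> =
    (\<Union>g\<in>\<omega>. exterior_rel_span R M (k + 1) +>\<^bsub>free_module R (tuples M (k + 1))\<^esub> prepend R m g)"


section \<open>Kaehler differentials\<close>

text \<open>Here \<open>\<kappa> : K \<rightarrow> B\<close> is the structure map of a commutative \<open>K\<close>-algebra \<open>B\<close>; the module of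
  differentials has one generator for each \<open>b \<in> B\<close>, subject to additivity, the Leibniz rule and
  the vanishing of the differentials of constants.\<close>

definition kaehler_rels ::
  "('a, 'x) ring_scheme \<Rightarrow> ('b, 'y) ring_scheme \<Rightarrow> ('a \<Rightarrow> 'b) \<Rightarrow> ('b \<Rightarrow> 'b) set" where
  "kaehler_rels K B \<kappa> = (let F = free_module B (carrier B); \<delta> = free_gen B in
     {\<delta> (a \<oplus>\<^bsub>B\<^esub> b) \<ominus>\<^bsub>F\<^esub> (\<delta> a \<oplus>\<^bsub>F\<^esub> \<delta> b) | a b. a \<in> carrier B \<and> b \<in> carrier B}
   \<union> {\<delta> (a \<otimes>\<^bsub>B\<^esub> b) \<ominus>\<^bsub>F\<^esub> (a \<odot>\<^bsub>F\<^esub> \<delta> b \<oplus>\<^bsub>F\<^esub> b \<odot>\<^bsub>F\<^esub> \<delta> a) | a b. a \<in> carrier B \<and> b \<in> carrier B}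
   \<union> {\<delta> (\<kappa> c) | c. c \<in> carrier K})"

definition kaehler_rel_span ::
  "('a, 'x) ring_scheme \<Rightarrow> ('b, 'y) ring_scheme \<Rightarrow> ('a \<Rightarrow> 'b) \<Rightarrow> ('b \<Rightarrow> 'b) set" where
  "kaehler_rel_span K B \<kappa> = submodule_span B (free_module B (carrier B)) (kaehler_rels K B \<kappa>)"

definition kaehler ::
  "('a, 'x) ring_scheme \<Rightarrow> ('b, 'y) ring_scheme \<Rightarrow> ('a \<Rightarrow> 'b) \<Rightarrow> ('b, ('b \<Rightarrow> 'b) set) module" where
  "kaehler K B \<kappa> = quot_module (free_module B (carrier B)) (kaehler_rel_span K B \<kappa>)"

text \<open>The universal derivation, i.e. the exterior derivative on functions.\<close>

definition kaehler_d ::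
  "('a, 'x) ring_scheme \<Rightarrow> ('b, 'y) ring_scheme \<Rightarrow> ('a \<Rightarrow> 'b) \<Rightarrow> 'b \<Rightarrow> ('b \<Rightarrow> 'b) set" where
  "kaehler_d K B \<kappa> b = kaehler_rel_span K B \<kappa> +>\<^bsub>free_module B (carrier B)\<^esub> free_gen B b"

definition kaehler_forms ::
  "('a, 'x) ring_scheme \<Rightarrow> ('b, 'y) ring_scheme \<Rightarrow> ('a \<Rightarrow> 'b) \<Rightarrow> int
    \<Rightarrow> ('b, (('b \<Rightarrow> 'b) set list \<Rightarrow> 'b) set) module" where
  "kaehler_forms K B \<kappa> k = exterior_power B (kaehler K B \<kappa>) k"

definition d_wedge ::
  "('a, 'x) ring_scheme \<Rightarrow> ('b, 'y) ring_scheme \<Rightarrow> ('a \<Rightarrow> 'b) \<Rightarrow> 'b \<Rightarrow> int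
    \<Rightarrow> (('b \<Rightarrow> 'b) set list \<Rightarrow> 'b) set \<Rightarrow> (('b \<Rightarrow> 'b) set list \<Rightarrow> 'b) set" where
  "d_wedge K B \<kappa> b k = wedge_left B (kaehler K B \<kappa>) (kaehler_d K B \<kappa> b) k"

definition cohomology ::
  "(int \<Rightarrow> ('r, 'm) module) \<Rightarrow> (int \<Rightarrow> 'm \<Rightarrow> 'm) \<Rightarrow> int \<Rightarrow> ('r, 'm set) module" where
  "cohomology C \<phi> k =
    quot_module ((C k)\<lparr>carrier := a_kernel (C k) (C (k + 1)) (\<phi> k)\<rparr>) (\<phi> (k - 1) ` carrier (C (k - 1)))"


section \<open>Smoothness and codimension\<close>

text \<open>Infinitesimal lifting for a commutative \<open>K\<close>-algebra \<open>\<kappa> : K \<rightarrow> B\<close>: every \<open>K\<close>-algebra map from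
  \<open>B\<close> to a quotient \<open>C/N\<close> with \<open>N\<^sup>2 = 0\<close> lifts to \<open>C\<close>. HOL cannot quantify over types, so the
  test algebras \<open>C\<close> have their carrier in the fixed type \<open>'c\<close>. For \<open>B = P/I\<close> with \<open>P\<close> a
  polynomial ring over \<open>K\<close>, lifting in general is equivalent to lifting the identity of \<open>P/I\<close>
  to the single algebra \<open>P/I\<^sup>2\<close>, so the choice of \<open>'c\<close> is immaterial as soon as \<open>P/I\<^sup>2\<close> lives
  in it, e.g. when \<open>'c\<close> is the type of sets of elements of \<open>P\<close>.\<close>

definition formally_smooth ::
  "'c itself \<Rightarrow> ('a, 'x) ring_scheme \<Rightarrow> ('b, 'y) ring_scheme \<Rightarrow> ('a \<Rightarrow> 'b) \<Rightarrow> bool" where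
  "formally_smooth _ K B \<kappa> \<longleftrightarrow>
    (\<forall>(C :: 'c ring) \<gamma> N u.
      cring C \<and> \<gamma> \<in> Ring.ring_hom K C \<and> ideal N C \<and> (\<forall>x\<in>N. \<forall>y\<in>N. x \<otimes>\<^bsub>C\<^esub> y = \<zero>\<^bsub>C\<^esub>) \<and>
      u \<in> Ring.ring_hom B (C Quot N) \<and> (\<forall>c\<in>carrier K. u (\<kappa> c) = N +>\<^bsub>C\<^esub> \<gamma> c) \<longrightarrow>
      (\<exists>v\<in>Ring.ring_hom B C. (\<forall>c\<in>carrier K. v (\<kappa> c) = \<gamma> c) \<and> (\<forall>b\<in>carrier B. N +>\<^bsub>C\<^esub> v b = u b)))"

text \<open>The codimension of \<open>V(p)\<close> in \<open>Spec R\<close>: the supremum of the lengths of chains of irreducible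
  closed sets starting at \<open>V(p)\<close>, i.e. of chains of primes ending at \<open>p\<close>.\<close>

definition prime_height :: "('a, 'x) ring_scheme \<Rightarrow> 'a set \<Rightarrow> enat" where
  "prime_height R p =
    Sup {enat d | d. \<exists>q. (\<forall>i\<le>d. primeideal (q i) R) \<and> (\<forall>i<d. q i \<subset> q (Suc i)) \<and> q d = p}"

definition minimal_prime_over :: "('a, 'x) ring_scheme \<Rightarrow> 'a set \<Rightarrow> 'a set \<Rightarrow> bool" where
  "minimal_prime_over R I p \<longleftrightarrow>
    primeideal p R \<and> I \<subseteq> p \<and> (\<forall>q. primeideal q R \<and> I \<subseteq> q \<and> q \<subseteq> p \<longrightarrow> q = p)"

text \<open>Every irreducible component of \<open>V(I)\<close> has codimension \<open>r\<close> in \<open>Spec R\<close> (vacuous if \<open>V(I)\<close>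
  is empty).\<close>

definition purely_of_codim :: "('a, 'x) ring_scheme \<Rightarrow> 'a set \<Rightarrow> nat \<Rightarrow> bool" where
  "purely_of_codim R I r \<longleftrightarrow> (\<forall>p. minimal_prime_over R I p \<longrightarrow> prime_height R p = enat r)"


section \<open>Polynomials and complete intersections in affine space\<close>

text \<open>A polynomial maps exponent vectors to coefficients. The variables of \<open>mpoly_ring n\<close> are
  numbered \<open>0, \<dots>, n - 1\<close>.\<close>

type_synonym 'k mpol = "(nat \<Rightarrow>\<^sub>0 nat) \<Rightarrow>\<^sub>0 'k"

definition mpoly_ring :: "nat \<Rightarrow> 'k::field mpol ring" where
  "mpoly_ring n = ring_of_type_algebra\<lparr>carrier := {p. \<forall>m\<in>Poly_Mapping.keys p. Poly_Mapping.keys m \<subseteq> {..<n}}\<rparr>"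

definition partial_deriv :: "nat \<Rightarrow> 'k::field mpol \<Rightarrow> 'k mpol" where
  "partial_deriv j p = (\<Sum>m\<in>Poly_Mapping.keys p.
     Poly_Mapping.single (m - Poly_Mapping.single j 1)
       (of_nat (Poly_Mapping.lookup m j) * Poly_Mapping.lookup p m))"

definition minors :: "nat \<Rightarrow> 'a::comm_ring_1 mat \<Rightarrow> 'a set" where
  "minors k A = {det (submatrix A R C) | R C.
     R \<subseteq> {..<dim_row A} \<and> C \<subseteq> {..<dim_col A} \<and> card R = k \<and> card C = k}"

text \<open>Of the sequence \<open>fs\<close> only \<open>fs 0, \<dots>, fs (r - 1)\<close> matter.\<close>

definition ci_ideal :: "nat \<Rightarrow> nat \<Rightarrow> (nat \<Rightarrow> 'k::field mpol) \<Rightarrow> 'k mpol set" where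
  "ci_ideal n r fs = Idl\<^bsub>mpoly_ring n\<^esub> (fs ` {..<r})"

definition coord_ring :: "nat \<Rightarrow> nat \<Rightarrow> (nat \<Rightarrow> 'k::field mpol) \<Rightarrow> 'k mpol set ring" where
  "coord_ring n r fs = mpoly_ring n Quot ci_ideal n r fs"

definition coord_class :: "nat \<Rightarrow> nat \<Rightarrow> (nat \<Rightarrow> 'k::field mpol) \<Rightarrow> 'k mpol \<Rightarrow> 'k mpol set" where
  "coord_class n r fs p = ci_ideal n r fs +>\<^bsub>mpoly_ring n\<^esub> p"

definition coord_const :: "nat \<Rightarrow> nat \<Rightarrow> (nat \<Rightarrow> 'k::field mpol) \<Rightarrow> 'k \<Rightarrow> 'k mpol set" where
  "coord_const n r fs c = coord_class n r fs (Poly_Mapping.single 0 c)"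

text \<open>Smooth means formally smooth and locally of finite presentation; the latter holds
  automatically for the finitely presented algebra \<^const>\<open>coord_ring\<close>.\<close>

definition smooth_complete_intersection :: "nat \<Rightarrow> nat \<Rightarrow> (nat \<Rightarrow> 'k::field mpol) \<Rightarrow> bool" where
  "smooth_complete_intersection n r fs \<longleftrightarrow>
    formally_smooth TYPE('k mpol set) (ring_of_type_algebra :: 'k ring)
      (coord_ring n r fs) (coord_const n r fs) \<and>
    purely_of_codim (mpoly_ring n) (ci_ideal n r fs) r"

definition jacobian :: "nat \<Rightarrow> nat \<Rightarrow> (nat \<Rightarrow> 'k::field mpol) \<Rightarrow> 'k mpol \<Rightarrow> 'k mpol mat" where
  "jacobian n r fs f = mat (r + 1) n (\<lambda>(i, j). partial_deriv j (if i < r then fs i else f))"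

definition jacobian_ideal :: "nat \<Rightarrow> nat \<Rightarrow> (nat \<Rightarrow> 'k::field mpol) \<Rightarrow> 'k mpol \<Rightarrow> 'k mpol set" where
  "jacobian_ideal n r fs f = Idl\<^bsub>mpoly_ring n\<^esub> (minors (r + 1) (jacobian n r fs f))"

text \<open>For ideals \<open>I \<subseteq> L\<close> of \<open>R\<close>, the ring \<open>R/L\<close> as a module over \<open>R/I\<close>: the union in
  \<^const>\<open>rcoset_mult\<close> yields \<open>(a + I) \<cdot> (x + L) = a x + L\<close>.\<close>

definition quot_as_module :: "('a, 'x) ring_scheme \<Rightarrow> 'a set \<Rightarrow> ('a set, 'a set) module" where
  "quot_as_module R L =
    \<lparr>carrier = carrier (R Quot L), monoid.mult = monoid.mult (R Quot L), monoid.one = monoid.one (R Quot L),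
     ring.zero = ring.zero (R Quot L), ring.add = ring.add (R Quot L), module.smult = rcoset_mult R L\<rparr>"

end

(* Let D be the Jacobian matrix of f_1, ..., f_r and put P = K[x_1, ..., x_n], s = n - r.

   Smoothness splits P/I^2 -> P/I by an algebra map, which gives n x r matrices A with
   f = (D A) f modulo I^2. At a prime where some entry of 1 - D A is nonzero one of the f_i would
   locally be superfluous, so a minimal prime over I would have height < r. Hence det(D A) is a unit
   modulo I, and after a correction D A = 1 modulo I.

   The differentials of B are P^n modulo the rows of D and modulo I. An alternating s-form T on P^n
   with values in a B-module that kills the rows of D extends, by wedging with the r functionals given
   by the columns of A, to an n-form, so T(w) = det(D; w) theta for a fixed theta. Thus the
   forms of degree s + 1 vanish and w -> det(D; w) embeds the forms of degree s in B; it is onto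
   because det(D A) = 1 modulo I is a combination of the maximal minors of D. The image of
   df wedge (-) corresponds to the ideal generated by the det(D; df; w'), that is, by the maximal minors
   of the matrix with df as additional row.

   The height bound needs no Noetherian theory: if u I lies in an ideal with c generators for some u
   outside the minimal prime p, and there is a chain of more than c + 1 primes ending in p, then
   monomials in elements that witness the strict inclusions are too many to be linearly
   independent modulo the polynomials that vanish to high order along p, while a nonzero
   polynomial of low degree in the variables algebraic over the others cannot vanish so. *)

theory Submission
  imports Defs "HOL-Library.Function_Algebras" "HOL-Computational_Algebra.Polynomial"
begin

section \<open>Alternating forms modulo a submodule\<close>

text \<open>The obstacle is the layering of quotients: a form is a coset of formal sums of lists of
  cosets of formal sums of cosets of polynomials. Hardly anything is computed there. Cosets are
  lifted to functions with values in the ring of polynomials in all variables, which is a type class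
  ring, and equality in a quotient becomes congruence modulo the subspace of lifted relations. The
  variables beyond the n-th are harmless: ideals are pulled back along the retraction that kills
  them.

  That det(D A) is a unit modulo I needs two primes. If it is no unit, some prime m contains it
  together with I. The entries of 1 - D A are tested at m, whereas the codimension speaks of minimal
  primes over I; so a minimal prime inside m is taken, and an entry outside m stays outside it. Both
  primes are complements of maximal multiplicative sets. This also yields, without any chain
  condition, that every element of the minimal prime p is nilpotent modulo I after localisation at
  p, which feeds the height bound.

  If n < r, then B turns out to be the zero ring and the claim degenerates; integer degrees let it
  be stated uniformly.\<close>

definition unitv :: "nat \<Rightarrow> nat \<Rightarrow> 'a::zero_neq_one" where
  "unitv c = (\<lambda>j. if j = c then 1 else 0)"

definition linfun :: "((nat \<Rightarrow> 'a::comm_ring_1) \<Rightarrow> 'a) \<Rightarrow> bool" where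
  "linfun a \<longleftrightarrow> (\<forall>c x y. a (\<lambda>j. c * x j + y j) = c * a x + a y)"

text \<open>The columns form an arbitrary list, possibly out of order or with repetitions, so that
  deleting or appending a column stays within the notation. Vectors are functions on all of
  \<open>nat\<close>, of which only the entries at \<open>cs\<close> are seen.\<close>

definition detl :: "nat list \<Rightarrow> (nat \<Rightarrow> 'a::comm_ring_1) list \<Rightarrow> 'a" where
  "detl cs vs = det (mat (length cs) (length cs) (\<lambda>(i, j). (vs ! i) (cs ! j)))"

text \<open>Laplace expansion along the row of \<open>v\<close>: the cofactors do not see that row,
  so one coefficient vector \<open>cf\<close> serves all \<open>v\<close>.\<close>

lemma detl_expand_at:
  assumes "length xs + length ys + 1 = length cs"
  shows "\<exists>cf. \<forall>v. detl cs (xs @ v # ys) = (\<Sum>j<length cs. v (cs ! j) * cf j)"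
proof -
  let ?m = "length cs" and ?i = "length xs"
  define A where "A v = mat ?m ?m (\<lambda>(i, j). ((xs @ v # ys) ! i) (cs ! j))" for v
  have del: "mat_delete (A v) ?i j = mat_delete (A w) ?i j" for v w j
    by (rule eq_matI) (use assms in \<open>auto simp: A_def mat_delete_def nth_append\<close>)
  \<comment> \<open>The zero row is only a placeholder; by \<open>del\<close> every other row gives
    the same cofactors.\<close>
  have "detl cs (xs @ v # ys) = (\<Sum>j<?m. v (cs ! j) * cofactor (A (\<lambda>_. 0)) ?i j)" for v
  proof -
    have "detl cs (xs @ v # ys) = (\<Sum>j<?m. A v $$ (?i, j) * cofactor (A v) ?i j)"
      unfolding detl_def A_def[symmetric]
      by (rule laplace_expansion_row) (use assms in \<open>auto simp: A_def\<close>)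
    also have "\<dots> = (\<Sum>j<?m. v (cs ! j) * cofactor (A (\<lambda>_. 0)) ?i j)"
      by (intro sum.cong arg_cong2[of _ _ _ _ "(*)"] refl)
        (use assms in \<open>auto simp: A_def cofactor_def del[unfolded A_def, of v _ "\<lambda>_. 0"]\<close>)
    finally show ?thesis .
  qed
  then show ?thesis by blast
qed

lemma detl_eq_zero:
  assumes "i < j" "j < length cs" "vs ! i = vs ! j"
  shows "detl cs vs = 0"
  unfolding detl_def
  by (rule det_identical_rows[of _ "length cs" i j]) (use assms in \<open>auto simp: row_def\<close>)

lemma detl_columns_eq_zero:
  assumes "\<not> distinct cs"
  shows "detl cs vs = 0"
proof -
  obtain i j where "i < length cs" "j < length cs" "i \<noteq> j" "cs ! i = cs ! j"
    using assms by (auto simp: distinct_conv_nth)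
  then show ?thesis unfolding detl_def
    by (intro det_identical_columns[of _ "length cs" i j]) (auto simp: col_def)
qed

lemma detl_Cons:
  assumes "length cs = Suc (length vs)"
  shows "detl cs (v # vs) =
    (\<Sum>j<length cs. v (cs ! j) * ((-1) ^ j * detl (take j cs @ drop (Suc j) cs) vs))"
proof -
  let ?m = "length cs"
  define A where "A = mat ?m ?m (\<lambda>(i, j). ((v # vs) ! i) (cs ! j))"
  have "detl cs (v # vs) = (\<Sum>j<?m. A $$ (0, j) * cofactor A 0 j)"
    unfolding detl_def A_def[symmetric]
    by (rule laplace_expansion_row) (use assms in \<open>auto simp: A_def\<close>)
  also have "\<dots> = (\<Sum>j<?m. v (cs ! j) * ((-1) ^ j * detl (take j cs @ drop (Suc j) cs) vs))"
  proof (intro sum.cong arg_cong2[of _ _ _ _ "(*)"] refl)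
    fix j assume j: "j \<in> {..<?m}"
    have "0 < ?m" using assms by simp
    then show "A $$ (0, j) = v (cs ! j)" using j by (simp add: A_def)
    have "mat_delete A 0 j = mat (length (take j cs @ drop (Suc j) cs)) (length (take j cs @ drop (Suc j) cs))
        (\<lambda>(i, k). (vs ! i) ((take j cs @ drop (Suc j) cs) ! k))"
      by (rule eq_matI) (use assms j in \<open>auto simp: A_def mat_delete_def nth_append min_def\<close>)
    then show "cofactor A 0 j = (-1) ^ j * detl (take j cs @ drop (Suc j) cs) vs"
      by (simp add: cofactor_def detl_def)
  qed
  finally show ?thesis .
qed

text \<open>Expansion along the last row with the term of the last column split off. If
  \<open>v\<close> is the unit vector at a column \<open>c\<close> outside \<open>cs\<close>, that
  term alone remains: bordering does not change a determinant.\<close>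

lemma detl_snoc:
  assumes "length cs = length vs"
  shows "detl (cs @ [c]) (vs @ [v]) = v c * detl cs vs +
    (\<Sum>j<length cs. v (cs ! j) * ((-1) ^ (length cs + j) * detl (take j cs @ drop (Suc j) cs @ [c]) vs))"
proof -
  let ?m = "length cs"
  define A where "A = mat (Suc ?m) (Suc ?m) (\<lambda>(i, j). ((vs @ [v]) ! i) ((cs @ [c]) ! j))"
  have A: "A \<in> carrier_mat (Suc ?m) (Suc ?m)" by (simp add: A_def)
  have "detl (cs @ [c]) (vs @ [v]) = (\<Sum>j<Suc ?m. A $$ (?m, j) * cofactor A ?m j)"
    unfolding detl_def using laplace_expansion_row[OF A, of ?m] by (simp add: A_def)
  also have "\<dots> = (\<Sum>j<?m. A $$ (?m, j) * cofactor A ?m j) + A $$ (?m, ?m) * cofactor A ?m ?m" by simp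
  also have "(\<Sum>j<?m. A $$ (?m, j) * cofactor A ?m j) =
    (\<Sum>j<?m. v (cs ! j) * ((-1) ^ (?m + j) * detl (take j cs @ drop (Suc j) cs @ [c]) vs))"
  proof (intro sum.cong arg_cong2[of _ _ _ _ "(*)"] refl)
    fix j assume j: "j \<in> {..<?m}"
    show "A $$ (?m, j) = v (cs ! j)" using j assms by (auto simp: A_def nth_append)
    let ?cs = "take j cs @ drop (Suc j) cs @ [c]"
    have "length ?cs = ?m" using j by auto
    have "mat_delete A ?m j = mat (length ?cs) (length ?cs) (\<lambda>(i, k). (vs ! i) (?cs ! k))"
    proof (rule eq_matI)
      fix i k assume "i < dim_row (mat (length ?cs) (length ?cs) (\<lambda>(i, k). (vs ! i) (?cs ! k)))"
        "k < dim_col (mat (length ?cs) (length ?cs) (\<lambda>(i, k). (vs ! i) (?cs ! k)))"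
      then have ik: "i < ?m" "k < ?m" using j by auto
      have "(cs @ [c]) ! (if k < j then k else Suc k) = ?cs ! k"
        using ik j by (auto simp: nth_append min_def)
      then show "mat_delete A ?m j $$ (i, k) = mat (length ?cs) (length ?cs) (\<lambda>(i, k). (vs ! i) (?cs ! k)) $$ (i, k)"
        using ik j assms \<open>length ?cs = ?m\<close> by (auto simp: A_def mat_delete_def nth_append)
    qed (use j in \<open>auto simp: A_def mat_delete_def\<close>)
    then show "cofactor A ?m j = (-1) ^ (?m + j) * detl ?cs vs"
      by (simp add: cofactor_def detl_def)
  qed
  also have "A $$ (?m, ?m) = v c" using assms by (auto simp: A_def nth_append)
  also have "cofactor A ?m ?m = detl cs vs"
  proof -
    have "mat_delete A ?m ?m = mat ?m ?m (\<lambda>(i, k). (vs ! i) (cs ! k))"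
      by (rule eq_matI) (use assms in \<open>auto simp: A_def mat_delete_def nth_append\<close>)
    then show ?thesis by (simp add: cofactor_def detl_def)
  qed
  finally show ?thesis by (simp add: add.commute)
qed

text \<open>Forms with values in a quotient module are handled as functions into the module itself,
  every identity being required only modulo the submodule \<open>N\<close>.\<close>

locale form_mod = Modules.module scale
  for scale :: "'a::comm_ring_1 \<Rightarrow> 'g::ab_group_add \<Rightarrow> 'g" (infixr \<open>*s\<close> 75) +
  fixes N :: "'g set"
  assumes N: "subspace N"
begin

definition eqN :: "'g \<Rightarrow> 'g \<Rightarrow> bool" (infix \<open>\<approx>\<close> 50) where "x \<approx> y \<longleftrightarrow> x - y \<in> N"

lemma N_zero: "0 \<in> N" and N_add: "x \<in> N \<Longrightarrow> y \<in> N \<Longrightarrow> x + y \<in> N"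
  and N_diff: "x \<in> N \<Longrightarrow> y \<in> N \<Longrightarrow> x - y \<in> N" and N_neg: "x \<in> N \<Longrightarrow> - x \<in> N"
  and N_scale: "x \<in> N \<Longrightarrow> c *s x \<in> N"
  using N by (auto intro: subspace_0 subspace_add subspace_diff subspace_neg subspace_scale)

lemma eqN_refl [simp]: "x \<approx> x" by (simp add: eqN_def N_zero)
lemma eqN_sym: "x \<approx> y \<Longrightarrow> y \<approx> x" using N_neg[of "x - y"] by (simp add: eqN_def)
lemma eqN_trans [trans]: "x \<approx> y \<Longrightarrow> y \<approx> z \<Longrightarrow> x \<approx> z"
  using N_add[of "x - y" "y - z"] by (simp add: eqN_def)
lemma eqN_add: "x \<approx> y \<Longrightarrow> u \<approx> v \<Longrightarrow> x + u \<approx> y + v"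
  using N_add[of "x - y" "u - v"] by (simp add: eqN_def algebra_simps)
lemma eqN_diff: "x \<approx> y \<Longrightarrow> u \<approx> v \<Longrightarrow> x - u \<approx> y - v"
  using N_diff[of "x - y" "u - v"] by (simp add: eqN_def algebra_simps)
lemma eqN_scale: "x \<approx> y \<Longrightarrow> c *s x \<approx> c *s y"
  using N_scale[of "x - y" c] by (simp add: eqN_def scale_right_diff_distrib)
lemma eqN_sum: "(\<And>i. i \<in> S \<Longrightarrow> f i \<approx> g i) \<Longrightarrow> sum f S \<approx> sum g S"
  by (induction S rule: infinite_finite_induct) (auto intro: eqN_add)
lemma eqN_zero_iff: "x \<approx> 0 \<longleftrightarrow> x \<in> N" by (simp add: eqN_def)
lemma eqN_mem: "x \<approx> y \<Longrightarrow> y \<in> N \<Longrightarrow> x \<in> N"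
  using N_add[of "x - y" y] by (simp add: eqN_def)

text \<open>Vanishing is demanded for equal neighbours; \<open>altform_dup\<close> extends it to
  equal arguments at any distance. Additivity and homogeneity are packed into one condition.\<close>

definition altform :: "nat \<Rightarrow> ((nat \<Rightarrow> 'a) list \<Rightarrow> 'g) \<Rightarrow> bool" where
  "altform k T \<longleftrightarrow>
    (\<forall>xs c x y ys. length xs + length ys + 1 = k \<longrightarrow>
      T (xs @ (\<lambda>j. c * x j + y j) # ys) \<approx> c *s T (xs @ x # ys) + T (xs @ y # ys)) \<and>
    (\<forall>xs x ys. length xs + length ys + 2 = k \<longrightarrow> T (xs @ x # x # ys) \<in> N)"

lemma altform_lin: "altform k T \<Longrightarrow> length xs + length ys + 1 = k \<Longrightarrow>
    T (xs @ (\<lambda>j. c * x j + y j) # ys) \<approx> c *s T (xs @ x # ys) + T (xs @ y # ys)"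
  by (simp add: altform_def)

lemma altform_adj: "altform k T \<Longrightarrow> length xs + length ys + 2 = k \<Longrightarrow> T (xs @ x # x # ys) \<in> N"
  by (simp add: altform_def)

lemma altform_Cons: "altform (Suc k) T \<Longrightarrow> altform k (\<lambda>l. T (w # l))"
  unfolding altform_def
  by (metis (no_types, lifting) add_Suc append_Cons length_Cons)

lemma altform_zero:
  assumes "altform k T" "length xs + length ys + 1 = k"
  shows "T (xs @ (\<lambda>_. 0) # ys) \<in> N"
proof -
  have "T (xs @ (\<lambda>_. 0) # ys) \<approx> T (xs @ (\<lambda>_. 0) # ys) + T (xs @ (\<lambda>_. 0) # ys)"
    using altform_lin[OF assms, of 1 "\<lambda>_. 0" "\<lambda>_. 0"] by simp
  then have "- T (xs @ (\<lambda>_. 0) # ys) \<in> N" by (simp add: eqN_def)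
  then show ?thesis using N_neg by force
qed

lemma altform_add:
  assumes "altform k T" "length xs + length ys + 1 = k"
  shows "T (xs @ (\<lambda>j. x j + y j) # ys) \<approx> T (xs @ x # ys) + T (xs @ y # ys)"
  using altform_lin[OF assms, of 1 x y] by simp

lemma altform_sum:
  assumes T: "altform k T" "length xs + length ys + 1 = k" and "finite S"
  shows "T (xs @ (\<lambda>j. \<Sum>i\<in>S. c i * x i j) # ys) \<approx> (\<Sum>i\<in>S. c i *s T (xs @ x i # ys))"
  using \<open>finite S\<close>
proof (induction S rule: finite_induct)
  case empty
  then show ?case using altform_zero[OF T] by (simp add: eqN_zero_iff)
next
  case (insert i S)
  have "T (xs @ (\<lambda>j. c i * x i j + (\<Sum>i\<in>S. c i * x i j)) # ys) \<approx>
     c i *s T (xs @ x i # ys) + T (xs @ (\<lambda>j. \<Sum>i\<in>S. c i * x i j) # ys)"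
    by (rule altform_lin[OF T])
  also have "\<dots> \<approx> c i *s T (xs @ x i # ys) + (\<Sum>i\<in>S. c i *s T (xs @ x i # ys))"
    by (intro eqN_add eqN_refl insert.IH)
  finally show ?case using insert by simp
qed

text \<open>Polarisation: the form vanishes at the repeated argument x + y, and of the four terms of
  its expansion the two with repeated arguments vanish too.\<close>

lemma altform_swap:
  assumes T: "altform k T" and k: "length xs + length ys + 2 = k"
  shows "T (xs @ x # y # ys) \<approx> - T (xs @ y # x # ys)"
proof -
  let ?z = "\<lambda>j. x j + y j"
  have 1: "T (xs @ u # ?z # ys) \<approx> T (xs @ u # x # ys) + T (xs @ u # y # ys)" for u
    using altform_add[OF T, of "xs @ [u]" ys x y] k by simp
  have "T (xs @ ?z # ?z # ys) \<approx> T (xs @ x # ?z # ys) + T (xs @ y # ?z # ys)"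
    using altform_add[OF T, of xs "?z # ys" x y] k by simp
  also have "\<dots> \<approx> (T (xs @ x # x # ys) + T (xs @ x # y # ys)) + (T (xs @ y # x # ys) + T (xs @ y # y # ys))"
    by (intro eqN_add 1)
  finally have "T (xs @ ?z # ?z # ys) - ((T (xs @ x # x # ys) + T (xs @ x # y # ys)) + (T (xs @ y # x # ys) + T (xs @ y # y # ys))) \<in> N"
    by (simp only: eqN_def)
  from N_diff[OF altform_adj[OF T k, of ?z] this]
  have "T (xs @ x # x # ys) + T (xs @ x # y # ys) + (T (xs @ y # x # ys) + T (xs @ y # y # ys)) \<in> N"
    by (simp only: diff_diff_eq2 add_diff_cancel_left')
  from N_diff[OF N_diff[OF this altform_adj[OF T k, of x]] altform_adj[OF T k, of y]]
  show ?thesis by (simp add: eqN_def algebra_simps)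
qed

lemma altform_dup:
  assumes T: "altform k T"
  shows "length xs + length ys + length zs + 2 = k \<Longrightarrow> T (xs @ x # ys @ x # zs) \<in> N"
proof (induction ys arbitrary: xs)
  case Nil
  then show ?case using altform_adj[OF T] by simp
next
  case (Cons y ys)
  have "T (xs @ x # y # ys @ x # zs) \<approx> - T (xs @ y # x # ys @ x # zs)"
    by (rule altform_swap[OF T]) (use Cons.prems in simp)
  moreover have "T ((xs @ [y]) @ x # ys @ x # zs) \<in> N"
    by (rule Cons.IH) (use Cons.prems in simp)
  ultimately show ?case using eqN_mem N_neg by simp
qed

lemma altform_move:
  assumes T: "altform k T"
  shows "length xs + length ys + length zs + 1 = k \<Longrightarrow>
    T (xs @ x # ys @ zs) \<approx> (-1) ^ length ys *s T (xs @ ys @ x # zs)"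
proof (induction ys arbitrary: xs)
  case Nil
  then show ?case by simp
next
  case (Cons y ys)
  have "T (xs @ x # y # ys @ zs) \<approx> - T (xs @ y # x # ys @ zs)"
    by (rule altform_swap[OF T]) (use Cons.prems in simp)
  moreover have "T ((xs @ [y]) @ x # ys @ zs) \<approx> (-1) ^ length ys *s T ((xs @ [y]) @ ys @ x # zs)"
    by (rule Cons.IH) (use Cons.prems in simp)
  then have "(-1) *s T ((xs @ [y]) @ x # ys @ zs) \<approx> (-1) *s (-1) ^ length ys *s T ((xs @ [y]) @ ys @ x # zs)"
    by (rule eqN_scale)
  ultimately show ?case by (simp add: eqN_trans)
qed

text \<open>Unrolled, this is the alternating sum over i of a(w_i) T(ws without w_i), that is, the
  value at \<open>ws\<close> of the wedge product of the functional \<open>a\<close> with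
  \<open>T\<close>. The degree of the form goes up by one.\<close>

primrec contr :: "((nat \<Rightarrow> 'a) \<Rightarrow> 'a) \<Rightarrow> (nat \<Rightarrow> 'a) list \<Rightarrow> ((nat \<Rightarrow> 'a) list \<Rightarrow> 'g) \<Rightarrow> 'g" where
  "contr a [] T = 0"
| "contr a (w # ws) T = a w *s T ws - contr a ws (\<lambda>l. T (w # l))"

lemma contr_cong:
  "(\<And>l. Suc (length l) = length ws \<Longrightarrow> T l \<approx> T' l) \<Longrightarrow> contr a ws T \<approx> contr a ws T'"
  by (induction ws arbitrary: T T') (auto intro!: eqN_diff eqN_scale)

lemma contr_lincomb:
  "contr a ws (\<lambda>l. c *s T l + T' l) = c *s contr a ws T + contr a ws T'"
  by (induction ws arbitrary: T T')
    (simp_all add: scale_right_distrib scale_right_diff_distrib scale_left_commute mult.commute)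

lemma contr_mem:
  assumes "subspace U"
  shows "(\<And>l. Suc (length l) = length ws \<Longrightarrow> T l \<in> U) \<Longrightarrow> contr a ws T \<in> U"
  by (induction ws arbitrary: T)
    (auto intro!: subspace_diff[OF assms] subspace_scale[OF assms] subspace_0[OF assms])

lemma contr_lin:
  assumes a: "linfun a"
  shows "altform k T \<Longrightarrow> length xs + length ys = k \<Longrightarrow>
    contr a (xs @ (\<lambda>j. c * x j + y j) # ys) T \<approx> c *s contr a (xs @ x # ys) T + contr a (xs @ y # ys) T"
proof (induction xs arbitrary: T k)
  case Nil
  have "contr a ys (\<lambda>l. T ((\<lambda>j. c * x j + y j) # l)) \<approx> contr a ys (\<lambda>l. c *s T (x # l) + T (y # l))"
    using altform_lin[OF Nil(1), of "[]"] Nil(2) by (intro contr_cong) auto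
  also have "\<dots> = c *s contr a ys (\<lambda>l. T (x # l)) + contr a ys (\<lambda>l. T (y # l))"
    by (rule contr_lincomb)
  finally have "contr a ys (\<lambda>l. T ((\<lambda>j. c * x j + y j) # l)) \<approx> c *s contr a ys (\<lambda>l. T (x # l)) + contr a ys (\<lambda>l. T (y # l))" .
  then have "a (\<lambda>j. c * x j + y j) *s T ys - contr a ys (\<lambda>l. T ((\<lambda>j. c * x j + y j) # l)) \<approx>
     (c * a x + a y) *s T ys - (c *s contr a ys (\<lambda>l. T (x # l)) + contr a ys (\<lambda>l. T (y # l)))"
    using a by (intro eqN_diff) (auto simp: linfun_def)
  then show ?case
    by (simp add: scale_left_distrib scale_right_diff_distrib add_diff_add)
next
  case (Cons w xs)
  obtain k' where k': "k = Suc k'" using Cons.prems by (cases k) auto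
  have "a w *s T (xs @ (\<lambda>j. c * x j + y j) # ys) - contr a (xs @ (\<lambda>j. c * x j + y j) # ys) (\<lambda>l. T (w # l))
    \<approx> a w *s (c *s T (xs @ x # ys) + T (xs @ y # ys)) -
      (c *s contr a (xs @ x # ys) (\<lambda>l. T (w # l)) + contr a (xs @ y # ys) (\<lambda>l. T (w # l)))"
    using Cons.prems k' by (intro eqN_diff eqN_scale altform_lin[of k] Cons.IH[of k'] altform_Cons) auto
  then show ?case
    by (simp add: scale_right_distrib scale_right_diff_distrib scale_left_commute algebra_simps)
qed

text \<open>The two terms in which one of the equal neighbours is fed to \<open>a\<close> cancel; in
  every other term \<open>T\<close> still receives both.\<close>

lemma contr_adj:
  shows "altform k T \<Longrightarrow> length xs + length ys + 1 = k \<Longrightarrow> contr a (xs @ x # x # ys) T \<in> N"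
proof (induction xs arbitrary: T k)
  case Nil
  have "contr a ys (\<lambda>l. T (x # x # l)) \<in> N"
    by (rule contr_mem[OF N]) (use altform_adj[OF Nil(1), of "[]"] Nil(2) in auto)
  then show ?case by simp
next
  case (Cons w xs)
  obtain k' where k': "k = Suc k'" using Cons.prems by (cases k) auto
  show ?case
  proof -
    have "a w *s T (xs @ x # x # ys) \<in> N"
      by (intro N_scale altform_adj[OF Cons.prems(1)]) (use Cons.prems in simp)
    moreover have "contr a (xs @ x # x # ys) (\<lambda>l. T (w # l)) \<in> N"
      by (rule Cons.IH[of k']) (use Cons.prems k' altform_Cons in auto)
    ultimately show ?thesis by (simp add: N_diff)
  qed
qed

lemma altform_contr: "altform k T \<Longrightarrow> linfun a \<Longrightarrow> altform (Suc k) (\<lambda>ws. contr a ws T)"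
  unfolding altform_def[of "Suc k"] by (intro conjI allI impI contr_lin contr_adj) auto

primrec contrs :: "((nat \<Rightarrow> 'a) \<Rightarrow> 'a) list \<Rightarrow> ((nat \<Rightarrow> 'a) list \<Rightarrow> 'g) \<Rightarrow> (nat \<Rightarrow> 'a) list \<Rightarrow> 'g" where
  "contrs [] T = T"
| "contrs (a # as) T = (\<lambda>ws. contr a ws (contrs as T))"

lemma altform_contrs:
  "altform k T \<Longrightarrow> (\<And>a. a \<in> set as \<Longrightarrow> linfun a) \<Longrightarrow> altform (length as + k) (contrs as T)"
  by (induction as) (auto intro: altform_contr)

text \<open>Says that a form descends to the quotient by the vector \<open>D\<close>, without
  forming that quotient.\<close>

definition kills :: "nat \<Rightarrow> ((nat \<Rightarrow> 'a) list \<Rightarrow> 'g) \<Rightarrow> (nat \<Rightarrow> 'a) \<Rightarrow> bool" where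
  "kills k T D \<longleftrightarrow> (\<forall>l. length l = k \<longrightarrow> D \<in> set l \<longrightarrow> T l \<in> N)"

text \<open>In each term of the alternating sum \<open>D\<close> is either fed to \<open>a\<close>,
  whose value there annihilates everything modulo \<open>N\<close>, or it is left as an argument of
  \<open>T\<close>.\<close>

lemma kills_contr:
  assumes "\<And>g. a D *s g \<in> N"
  shows "kills k T D \<Longrightarrow> kills (Suc k) (\<lambda>ws. contr a ws T) D"
proof -
  have "contr a l T \<in> N" if "kills k T D" "length l = Suc k" "D \<in> set l" for l
    using that
  proof (induction l arbitrary: k T)
    case (Cons w ws)
    show ?case
    proof (cases "D = w")
      case True
      have "contr a ws (\<lambda>l. T (w # l)) \<in> N"
        by (rule contr_mem[OF N]) (use Cons.prems True in \<open>auto simp: kills_def\<close>)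
      then show ?thesis using True assms by (auto intro: N_diff)
    next
      case False
      then have D: "D \<in> set ws" using Cons.prems by auto
      then obtain k' where k': "k = Suc k'" using Cons.prems by (cases k) auto
      have "contr a ws (\<lambda>l. T (w # l)) \<in> N"
        by (rule Cons.IH[of k']) (use Cons.prems D k' in \<open>auto simp: kills_def\<close>)
      moreover have "T ws \<in> N" using Cons.prems D by (auto simp: kills_def)
      ultimately show ?thesis by (auto intro: N_diff N_scale)
    qed
  qed simp
  then show "kills k T D \<Longrightarrow> kills (Suc k) (\<lambda>ws. contr a ws T) D" by (simp add: kills_def)
qed

lemma kills_contrs:
  "(\<And>a g. a \<in> set as \<Longrightarrow> a D *s g \<in> N) \<Longrightarrow> kills k T D \<Longrightarrow> kills (length as + k) (contrs as T) D"
  by (induction as) (auto intro: kills_contr)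

text \<open>By duality only the term that feeds each vector of \<open>Ds\<close> to its own
  functional survives. If the first vector is not taken by the first functional, it remains an
  argument of the form built from the other functionals, and these vanish on it modulo
  \<open>N\<close>, as does \<open>T\<close>.\<close>

lemma contrs_eval:
  assumes "length as = length Ds"
    and "\<And>i j g. i < length Ds \<Longrightarrow> j < length Ds \<Longrightarrow> ((as ! i) (Ds ! j) - (if i = j then 1 else 0)) *s g \<in> N"
    and "\<And>D. D \<in> set Ds \<Longrightarrow> kills k T D" and "length w = k"
  shows "contrs as T (Ds @ w) \<approx> T w"
  using assms
proof (induction as Ds rule: list_induct2)
  case (Cons a as D Ds)
  have IH: "contrs as T (Ds @ w) \<approx> T w"
  proof (rule Cons.IH)
    fix i j g assume "i < length Ds" "j < length Ds"
    then show "((as ! i) (Ds ! j) - (if i = j then 1 else 0)) *s g \<in> N"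
      using Cons.prems(1)[of "Suc i" "Suc j" g] by simp
  qed (use Cons.prems in auto)
  have 1: "a D *s g \<approx> g" for g
    using Cons.prems(1)[of 0 0 g] by (simp add: eqN_def scale_left_diff_distrib)
  have "b D *s g \<in> N" if b: "b \<in> set as" for b g
  proof -
    obtain i where "i < length as" "b = as ! i" using b by (auto simp: in_set_conv_nth)
    then show ?thesis using Cons.prems(1)[of "Suc i" 0 g] Cons.hyps by simp
  qed
  then have "kills (length as + k) (contrs as T) D"
    by (rule kills_contrs) (use Cons.prems in auto)
  then have "contr a (Ds @ w) (\<lambda>l. contrs as T (D # l)) \<in> N"
    by (intro contr_mem[OF N]) (use Cons in \<open>auto simp: kills_def\<close>)
  then have "a D *s contrs as T (Ds @ w) - contr a (Ds @ w) (\<lambda>l. contrs as T (D # l)) \<approx> contrs as T (Ds @ w) - 0"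
    by (intro eqN_diff 1) (simp add: eqN_zero_iff)
  then show ?case using IH by (simp add: eqN_trans)
qed simp

text \<open>Subtracting multiples of the first argument from the others changes nothing. Afterwards
  the entries at \<open>c\<close> are zero, so that an induction on the columns can drop
  \<open>c\<close>.\<close>

lemma altform_clear:
  assumes F: "altform (Suc (length pre + length vs)) F"
  shows "F (unitv c # pre @ vs) \<approx> F (unitv c # pre @ map (\<lambda>v. v(c := 0)) vs)"
  using F
proof (induction vs arbitrary: pre)
  case (Cons v vs)
  let ?v = "v(c := 0)"
  have v: "v = (\<lambda>j. v c * unitv c j + ?v j)" by (auto simp: unitv_def)
  have "F ((unitv c # pre) @ (\<lambda>j. v c * unitv c j + ?v j) # vs) \<approx>
    v c *s F ((unitv c # pre) @ unitv c # vs) + F ((unitv c # pre) @ ?v # vs)"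
    by (rule altform_lin[OF Cons.prems]) simp
  also have "\<dots> \<approx> 0 + F ((unitv c # pre) @ ?v # vs)"
    using altform_dup[OF Cons.prems, of "[]" pre vs "unitv c"]
    by (intro eqN_add eqN_refl) (auto simp: eqN_zero_iff intro: N_scale)
  also have "0 + F ((unitv c # pre) @ ?v # vs) \<approx> F (unitv c # (pre @ [?v]) @ map (\<lambda>v. v(c := 0)) vs)"
    using Cons.IH[of "pre @ [?v]"] Cons.prems by (simp only: append_assoc append_Cons append_Nil eqN_refl list.size length_append add_0 add_Suc add_Suc_right add_0_right)
  finally show ?case by (simp only: v[symmetric] append_assoc append_Cons append_Nil list.map add_0)
qed simp

lemma altform_expand_first:
  assumes F: "altform (Suc (length vs)) F" and cs: "distinct cs"
    and v: "\<And>j. j \<notin> set cs \<Longrightarrow> v j = 0"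
  shows "F (v # vs) \<approx> (\<Sum>j<length cs. v (cs ! j) *s F (unitv (cs ! j) # map (\<lambda>v. v(cs ! j := 0)) vs))"
proof -
  have "v = (\<lambda>i. \<Sum>j<length cs. v (cs ! j) * unitv (cs ! j) i)"
  proof
    fix i
    have "(\<Sum>j<length cs. v (cs ! j) * unitv (cs ! j) i) = (\<Sum>c\<in>set cs. v c * unitv c i)"
      by (rule sum.reindex_bij_betw[OF bij_betw_nth[OF cs refl refl], of "\<lambda>c. v c * unitv c i"])
    also have "\<dots> = (\<Sum>c\<in>set cs. if i = c then v c else 0)"
      by (rule sum.cong) (auto simp: unitv_def)
    also have "\<dots> = v i" using v by auto
    finally show "v i = (\<Sum>j<length cs. v (cs ! j) * unitv (cs ! j) i)" by simp
  qed
  then have "F (v # vs) = F ([] @ (\<lambda>i. \<Sum>j<length cs. v (cs ! j) * unitv (cs ! j) i) # vs)" by simp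
  also have "\<dots> \<approx> (\<Sum>j<length cs. v (cs ! j) *s F ([] @ unitv (cs ! j) # vs))"
    by (rule altform_sum[OF F]) auto
  also have "\<dots> \<approx> (\<Sum>j<length cs. v (cs ! j) *s F (unitv (cs ! j) # map (\<lambda>v. v(cs ! j := 0)) vs))"
    using altform_clear[of "[]" vs F] F by (intro eqN_sum eqN_scale) auto
  finally show ?thesis .
qed

text \<open>The first argument is expanded in unit vectors and its column is cleared in the
  remaining arguments, which leaves a form of one degree less on one column less. Moving the unit
  vector to its place in the list produces exactly the sign of the Laplace expansion.\<close>

lemma altform_top_degree:
  assumes "altform (length cs) F" "length vs = length cs" "distinct cs"
    and "\<And>v j. v \<in> set vs \<Longrightarrow> j \<notin> set cs \<Longrightarrow> v j = 0"
  shows "F vs \<approx> detl cs vs *s F (map unitv cs)"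
  using assms
proof (induction "length vs" arbitrary: vs cs F)
  case 0
  then show ?case by (simp add: detl_def)
next
  case (Suc k)
  obtain v vs' where vs': "vs = v # vs'" using Suc.hyps(2) by (cases vs) auto
  let ?del = "\<lambda>j. take j cs @ drop (Suc j) cs"
  let ?kill = "\<lambda>c. map (\<lambda>v. v(c := 0)) vs'"
  note prems = Suc.prems[unfolded vs'] and IH = Suc.hyps(1)
  have k: "k = length vs'" using Suc.hyps(2) vs' by simp
  have F: "altform (Suc (length vs')) F" using prems by simp
  have "F (v # vs') \<approx> (\<Sum>j<length cs. v (cs ! j) *s F (unitv (cs ! j) # ?kill (cs ! j)))"
    by (rule altform_expand_first[OF F]) (use prems in auto)
  also have "\<dots> \<approx> (\<Sum>j<length cs. v (cs ! j) *s (detl (?del j) vs' *s ((-1) ^ j *s F (map unitv cs))))"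
  proof (intro eqN_sum eqN_scale)
    fix j assume "j \<in> {..<length cs}"
    then have j: "j < length cs" by simp
    have split: "cs = take j cs @ cs ! j # drop (Suc j) cs" using id_take_nth_drop[OF j] .
    have dis: "distinct (take j cs @ cs ! j # drop (Suc j) cs)" using split prems(3) by metis
    have set_cs: "set cs = insert (cs ! j) (set (?del j))" by (subst split) auto
    have len: "length (?del j) = length vs'" using j prems(2) by auto
    have "F (unitv (cs ! j) # ?kill (cs ! j)) \<approx> detl (?del j) (?kill (cs ! j)) *s F (unitv (cs ! j) # map unitv (?del j))"
    proof (rule IH)
      show "k = length (?kill (cs ! j))" by (simp add: k)
      show "altform (length (?del j)) (\<lambda>l. F (unitv (cs ! j) # l))" using altform_Cons[OF F] len by simp
      show "w i = 0" if "w \<in> set (?kill (cs ! j))" "i \<notin> set (?del j)" for w i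
        using that set_cs prems(4) by auto
    qed (use len dis in auto)
    \<comment> \<open>Clearing the column \<open>cs ! j\<close> is invisible to a minor that omits
      this column.\<close>
    also have "detl (?del j) (?kill (cs ! j)) = detl (?del j) vs'"
      unfolding detl_def
    proof (intro arg_cong[of _ _ det] eq_matI)
      fix i k assume "i < dim_row (mat (length (?del j)) (length (?del j)) (\<lambda>(i, k). (vs' ! i) (?del j ! k)))"
        "k < dim_col (mat (length (?del j)) (length (?del j)) (\<lambda>(i, k). (vs' ! i) (?del j ! k)))"
      then have ik: "i < length (?del j)" "k < length (?del j)" by auto
      then have "?del j ! k \<noteq> cs ! j" using dis nth_mem[OF ik(2)] by auto
      then show "mat (length (?del j)) (length (?del j)) (\<lambda>(i, k). (?kill (cs ! j) ! i) (?del j ! k)) $$ (i, k) =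
        mat (length (?del j)) (length (?del j)) (\<lambda>(i, k). (vs' ! i) (?del j ! k)) $$ (i, k)"
        using ik len by simp
    qed auto
    also have "detl (?del j) vs' *s F (unitv (cs ! j) # map unitv (?del j)) \<approx>
        detl (?del j) vs' *s ((-1) ^ j *s F (map unitv cs))"
    proof (rule eqN_scale)
      have "F ([] @ unitv (cs ! j) # map unitv (take j cs) @ map unitv (drop (Suc j) cs)) \<approx>
        (-1) ^ length (map (unitv :: nat \<Rightarrow> nat \<Rightarrow> 'a) (take j cs)) *s F ([] @ map unitv (take j cs) @ unitv (cs ! j) # map unitv (drop (Suc j) cs))"
        by (rule altform_move[OF F]) (use len in auto)
      moreover have "map unitv (take j cs) @ unitv (cs ! j) # map unitv (drop (Suc j) cs) = (map unitv cs :: (nat \<Rightarrow> 'a) list)"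
        by (subst (4) split) simp
      ultimately show "F (unitv (cs ! j) # map unitv (?del j)) \<approx> (-1) ^ j *s F (map unitv cs)"
        using j by (simp add: min_def)
    qed
    finally show "F (unitv (cs ! j) # ?kill (cs ! j)) \<approx> detl (?del j) vs' *s ((-1) ^ j *s F (map unitv cs))" .
  qed
  also have "\<dots> = detl cs (v # vs') *s F (map unitv cs)"
    using prems(2) by (subst detl_Cons) (simp_all add: scale_sum_left mult.commute mult.left_commute)
  finally show ?case unfolding vs' .
qed

text \<open>Every expansion step uses up one column and one argument. The columns run out first, and
  then the expansion of the next argument is an empty sum.\<close>

lemma altform_above_top_degree:
  assumes "altform (length vs) F" "length cs < length vs" "distinct cs"
    and "\<And>v j. v \<in> set vs \<Longrightarrow> j \<notin> set cs \<Longrightarrow> v j = 0"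
  shows "F vs \<in> N"
  using assms
proof (induction "length vs" arbitrary: vs cs F)
  case 0
  then show ?case by simp
next
  case (Suc k)
  obtain v vs' where vs': "vs = v # vs'" using Suc.hyps(2) by (cases vs) auto
  note prems = Suc.prems[unfolded vs'] and IH = Suc.hyps(1)
  let ?del = "\<lambda>j. take j cs @ drop (Suc j) cs"
  let ?kill = "\<lambda>c. map (\<lambda>v. v(c := 0)) vs'"
  have F: "altform (Suc (length vs')) F" using prems by simp
  have "F (v # vs') \<approx> (\<Sum>j<length cs. v (cs ! j) *s F (unitv (cs ! j) # ?kill (cs ! j)))"
    by (rule altform_expand_first[OF F]) (use prems in auto)
  moreover have "(\<Sum>j<length cs. v (cs ! j) *s F (unitv (cs ! j) # ?kill (cs ! j))) \<in> N"
  proof (intro subspace_sum[OF N] N_scale)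
    fix j assume "j \<in> {..<length cs}"
    then have j: "j < length cs" by simp
    have split: "cs = take j cs @ cs ! j # drop (Suc j) cs" using id_take_nth_drop[OF j] .
    have dis: "distinct (take j cs @ cs ! j # drop (Suc j) cs)" using split prems(3) by metis
    have set_cs: "set cs = insert (cs ! j) (set (?del j))" by (subst split) auto
    show "F (unitv (cs ! j) # ?kill (cs ! j)) \<in> N"
    proof (rule IH[where vs = "?kill (cs ! j)" and cs = "?del j" and F = "\<lambda>l. F (unitv (cs ! j) # l)"])
      show "k = length (?kill (cs ! j))" using Suc.hyps(2) vs' by simp
      show "altform (length (?kill (cs ! j))) (\<lambda>l. F (unitv (cs ! j) # l))" using altform_Cons[OF F] by simp
      show "w i = 0" if "w \<in> set (?kill (cs ! j))" "i \<notin> set (?del j)" for w i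
        using that set_cs prems(4) by auto
      show "length (?del j) < length (?kill (cs ! j))" using prems(2) j by simp
      show "distinct (?del j)" using dis by auto
    qed
  qed
  ultimately show ?case unfolding vs' by (rule eqN_mem)
qed


text \<open>The functionals \<open>as\<close> are dual to the vectors \<open>Ds\<close> killed by \<open>T\<close>. Wedging \<open>T\<close> with them gives
  an alternating form of degree \<open>length Ds + s\<close>, whose value on \<open>Ds @ w\<close> is \<open>T w\<close>; in top
  degree it is a multiple of the determinant.\<close>

lemma altform_eq_detl_scale:
  assumes T: "altform s T" and as: "\<And>a. a \<in> set as \<Longrightarrow> linfun a" "length as = length Ds"
    and dual: "\<And>i j g. i < length Ds \<Longrightarrow> j < length Ds \<Longrightarrow> ((as ! i) (Ds ! j) - (if i = j then 1 else 0)) *s g \<in> N"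
    and kills: "\<And>D. D \<in> set Ds \<Longrightarrow> kills s T D" and w: "length w = s"
    and supp: "\<And>v j. v \<in> set Ds \<union> set w \<Longrightarrow> j \<ge> n \<Longrightarrow> v j = 0"
  shows "length Ds + s = n \<Longrightarrow> T w \<approx> detl [0..<n] (Ds @ w) *s contrs as T (map unitv [0..<n])"
    and "n < length Ds + s \<Longrightarrow> T w \<in> N"
proof -
  have eval: "T w \<approx> contrs as T (Ds @ w)"
    by (rule eqN_sym, rule contrs_eval[OF as(2) dual kills w])
  have alt: "altform (length as + s) (contrs as T)" by (rule altform_contrs[OF T as(1)])
  show "T w \<approx> detl [0..<n] (Ds @ w) *s contrs as T (map unitv [0..<n])" if "length Ds + s = n"
    by (rule eqN_trans[OF eval], rule altform_top_degree) (use that alt as w supp in auto)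
  show "T w \<in> N" if "n < length Ds + s"
    by (rule eqN_mem[OF eval], rule altform_above_top_degree[where cs = "[0..<n]"]) (use that alt as w supp in auto)
qed

end

section \<open>Ideals generated by minors\<close>

definition is_idl :: "'a::comm_ring_1 set \<Rightarrow> bool" where
  "is_idl J \<longleftrightarrow> 0 \<in> J \<and> (\<forall>x\<in>J. \<forall>y\<in>J. x + y \<in> J) \<and> (\<forall>c. \<forall>x\<in>J. c * x \<in> J)"

lemma is_idlD:
  assumes "is_idl J"
  shows "0 \<in> J" "x \<in> J \<Longrightarrow> y \<in> J \<Longrightarrow> x + y \<in> J" "x \<in> J \<Longrightarrow> c * x \<in> J" "x \<in> J \<Longrightarrow> x * c \<in> J"
    "x \<in> J \<Longrightarrow> - x \<in> J" "x \<in> J \<Longrightarrow> y \<in> J \<Longrightarrow> x - y \<in> J"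
proof -
  show "0 \<in> J" "x \<in> J \<Longrightarrow> y \<in> J \<Longrightarrow> x + y \<in> J" "x \<in> J \<Longrightarrow> c * x \<in> J" "x \<in> J \<Longrightarrow> x * c \<in> J" for x y c
    using assms by (auto simp: is_idl_def mult.commute)
  show neg: "x \<in> J \<Longrightarrow> - x \<in> J" for x using assms[unfolded is_idl_def] by (metis mult_minus1)
  show "x \<in> J \<Longrightarrow> y \<in> J \<Longrightarrow> x - y \<in> J"
    using assms neg[of y] by (metis is_idl_def uminus_add_conv_diff add.commute)
qed

lemma is_idl_sum: "is_idl J \<Longrightarrow> (\<And>i. i \<in> S \<Longrightarrow> f i \<in> J) \<Longrightarrow> sum f S \<in> J"
  by (induction S rule: infinite_finite_induct) (auto intro: is_idlD)

text \<open>The factor \<open>e\<close> is the determinant of the 0-1 matrix that picks the columns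
  \<open>cs\<close> out of \<open>cs0\<close>: the sign of a permutation, or 0 if \<open>cs\<close>
  repeats a column.\<close>

lemma detl_reindex:
  assumes "distinct cs0" "set cs \<subseteq> set cs0" "length cs = length cs0"
  shows "\<exists>e. \<forall>vs. detl cs vs = detl cs0 vs * e"
proof -
  let ?k = "length cs0"
  define E :: "'a mat" where "E = mat ?k ?k (\<lambda>(a, j). if cs0 ! a = cs ! j then 1 else 0)"
  have "detl cs vs = detl cs0 vs * det E" for vs :: "(nat \<Rightarrow> 'a) list"
  proof -
    let ?M = "mat ?k ?k (\<lambda>(i, j). (vs ! i) (cs0 ! j))"
    have "mat ?k ?k (\<lambda>(i, j). (vs ! i) (cs ! j)) = ?M * E"
    proof (rule eq_matI)
      fix i j assume "i < dim_row (?M * E)" "j < dim_col (?M * E)"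
      then have ij: "i < ?k" "j < ?k" by (auto simp: E_def)
      then obtain a where a: "a < ?k" "cs0 ! a = cs ! j"
        using assms by (metis in_set_conv_nth nth_mem subset_code(1))
      have "(?M * E) $$ (i, j) = (\<Sum>b<?k. (vs ! i) (cs0 ! b) * (if cs0 ! b = cs ! j then 1 else 0))"
        using ij by (simp add: E_def scalar_prod_def atLeast0LessThan)
      also have "\<dots> = (\<Sum>b<?k. if b = a then (vs ! i) (cs0 ! b) else 0)"
      proof (intro sum.cong refl)
        fix b assume "b \<in> {..<?k}"
        then have "cs0 ! b = cs ! j \<longleftrightarrow> b = a"
          using a nth_eq_iff_index_eq[OF assms(1)] by (metis lessThan_iff)
        then show "(vs ! i) (cs0 ! b) * (if cs0 ! b = cs ! j then 1 else 0) = (if b = a then (vs ! i) (cs0 ! b) else 0)"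
          by simp
      qed
      also have "\<dots> = (vs ! i) (cs ! j)" using a by simp
      finally show "mat ?k ?k (\<lambda>(i, j). (vs ! i) (cs ! j)) $$ (i, j) = (?M * E) $$ (i, j)"
        using ij by simp
    qed (auto simp: E_def)
    then show ?thesis
      unfolding detl_def assms(3) by (simp add: det_mult[of _ ?k] E_def)
  qed
  then show ?thesis by blast
qed

text \<open>Bordering by unit vectors at the missing columns turns a minor into an n x n determinant
  of the same value. Thus evaluating a determinantal form at all tuples of vectors captures every
  minor of the fixed rows \<open>tops\<close>.\<close>

lemma detl_mem_of_extensions:
  assumes J: "is_idl J"
    and full: "\<And>ws. length tops + length ws = n \<Longrightarrow> (\<And>w j. w \<in> set ws \<Longrightarrow> j \<ge> n \<Longrightarrow> w j = 0) \<Longrightarrow>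
      detl [0..<n] (tops @ ws) \<in> J"
  shows "set cs \<subseteq> {..<n} \<Longrightarrow> length cs = length tops + length ws \<Longrightarrow>
    (\<And>w j. w \<in> set ws \<Longrightarrow> j \<ge> n \<Longrightarrow> w j = 0) \<Longrightarrow> detl cs (tops @ ws) \<in> J"
proof (induction "n - length cs" arbitrary: cs ws rule: less_induct)
  case less
  show ?case
  proof (cases "distinct cs")
    case False
    then show ?thesis by (simp add: detl_columns_eq_zero is_idlD[OF J])
  next
    case dis: True
    have "length cs \<le> n" using card_mono[OF _ less.prems(1)] distinct_card[OF dis] by simp
    show ?thesis
    proof (cases "length cs = n")
      case True
      then obtain e where "detl cs (tops @ ws) = detl [0..<n] (tops @ ws) * e"
        using detl_reindex[of "[0..<n]" cs] less.prems(1) by (auto simp: lessThan_atLeast0)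
      then show ?thesis using full[of ws] less.prems True by (auto intro!: is_idlD[OF J])
    next
      case False
      then have "set cs \<noteq> {..<n}" using distinct_card[OF dis] by (metis card_lessThan)
      then obtain c where c: "c < n" "c \<notin> set cs" using less.prems(1) by auto
      have "detl (cs @ [c]) (tops @ (ws @ [unitv c])) \<in> J"
      proof (rule less.hyps)
        show "n - length (cs @ [c]) < n - length cs" using False \<open>length cs \<le> n\<close> by simp
        show "w j = 0" if "w \<in> set (ws @ [unitv c])" "n \<le> j" for w j
          using that less.prems(3) c(1) by (auto simp: unitv_def)
      qed (use less.prems c in auto)
      moreover have "detl (cs @ [c]) ((tops @ ws) @ [unitv c]) = detl cs (tops @ ws)"
      proof -
        have "unitv c (cs ! j) = (0::'a)" if "j < length cs" for j
          using c nth_mem[OF that] by (auto simp: unitv_def)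
        then show ?thesis using less.prems by (subst detl_snoc) (simp_all add: unitv_def)
      qed
      ultimately show ?thesis by simp
    qed
  qed
qed

text \<open>Repeated expansion along the last row leaves only minors of the rows
  \<open>tops\<close>; those with a repeated column are zero.\<close>

lemma detl_mem_of_minors:
  assumes J: "is_idl J"
    and min: "\<And>cs. distinct cs \<Longrightarrow> set cs \<subseteq> {..<n} \<Longrightarrow> length cs = length tops \<Longrightarrow> detl cs tops \<in> J"
  shows "set cs \<subseteq> {..<n} \<Longrightarrow> length cs = length tops + length ws \<Longrightarrow> detl cs (tops @ ws) \<in> J"
proof (induction ws arbitrary: cs rule: rev_induct)
  case Nil
  then show ?case
    by (cases "distinct cs") (auto intro: min simp: detl_columns_eq_zero is_idlD[OF J])
next
  case (snoc w ws)
  obtain cs' c where cs: "cs = cs' @ [c]" using snoc.prems(2) by (cases cs rule: rev_cases) auto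
  have 1: "detl (take j cs' @ drop (Suc j) cs' @ [c]) (tops @ ws) \<in> J" if "j < length cs'" for j
  proof (rule snoc.IH)
    show "set (take j cs' @ drop (Suc j) cs' @ [c]) \<subseteq> {..<n}"
      using snoc.prems(1) cs set_take_subset[of j cs'] set_drop_subset[of "Suc j" cs'] by auto
  qed (use that snoc.prems cs in auto)
  have 2: "detl cs' (tops @ ws) \<in> J" by (rule snoc.IH) (use snoc.prems cs in auto)
  have "detl (cs' @ [c]) ((tops @ ws) @ [w]) \<in> J"
    using snoc.prems cs 1 2 by (subst detl_snoc) (auto intro!: is_idlD(2,3)[OF J] is_idl_sum[OF J])
  then show ?case using cs by simp
qed

text \<open>The Cauchy--Binet formula, as a statement about ideals.\<close>

lemma det_prod_mem_minors:
  fixes a :: "nat \<Rightarrow> nat \<Rightarrow> 'a::comm_ring_1"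
  assumes J: "is_idl J"
    and min: "\<And>cs. set cs \<subseteq> {..<n} \<Longrightarrow> length cs = length Ds \<Longrightarrow> detl cs Ds \<in> J"
  shows "det (mat (length Ds) (length Ds) (\<lambda>(i, k). \<Sum>j<n. (Ds ! i) j * a k j)) \<in> J"
proof -
  let ?r = "length Ds"
  define L :: "(nat \<Rightarrow> 'a) \<Rightarrow> nat \<Rightarrow> 'a" where "L v = (\<lambda>i. \<Sum>j<n. (Ds ! i) j * v j)" for v
  have L_unit: "L (unitv c) i = (Ds ! i) c" if "c < n" for c i
  proof -
    have "L (unitv c) i = (\<Sum>j<n. if j = c then (Ds ! i) c else 0)"
      unfolding L_def by (rule sum.cong) (auto simp: unitv_def)
    then show ?thesis using that by simp
  qed
  \<comment> \<open>By multilinearity the columns of the second factor are replaced by unit vectors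
    one after the other. Since \<open>L (unitv c)\<close> is column c of the first factor, what
    remains in the end is a minor of \<open>Ds\<close>.\<close>
  have "detl [0..<?r] (map L (map unitv cs @ vs)) \<in> J"
    if "set cs \<subseteq> {..<n}" "length cs + length vs = ?r" for cs vs
    using that
  proof (induction vs arbitrary: cs)
    case Nil
    let ?M = "mat ?r ?r (\<lambda>(i, k). (Ds ! i) (cs ! k))"
    have "(mat ?r ?r (\<lambda>(k, i). (map L (map unitv cs) ! k) ([0..<?r] ! i))) = transpose_mat ?M"
      by (rule eq_matI) (use Nil nth_mem[of _ cs] in \<open>auto simp: L_unit subset_eq\<close>)
    then have "detl [0..<?r] (map L (map unitv cs)) = det (transpose_mat ?M)"
      by (simp add: detl_def)
    also have "\<dots> = det ?M" by (rule det_transpose[of _ ?r]) simp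
    also have "\<dots> = detl cs Ds" using Nil by (simp add: detl_def)
    finally show ?case using min[of cs] Nil by simp
  next
    case (Cons v vs)
    let ?xs = "map L (map unitv cs)" and ?ys = "map L vs"
    obtain cf where cf: "\<And>v. detl [0..<?r] (?xs @ v # ?ys) = (\<Sum>i<length [0..<?r]. v ([0..<?r] ! i) * cf i)"
      using detl_expand_at[of ?xs ?ys "[0..<?r]"] Cons.prems by auto
    have "detl [0..<?r] (?xs @ L v # ?ys) = (\<Sum>i<?r. \<Sum>j<n. v j * ((Ds ! i) j * cf i))"
      unfolding cf by (intro sum.cong) (auto simp: L_def sum_distrib_left sum_distrib_right ac_simps)
    also have "\<dots> = (\<Sum>j<n. v j * (\<Sum>i<?r. (Ds ! i) j * cf i))"
      by (subst sum.swap) (simp add: sum_distrib_left)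
    also have "\<dots> = (\<Sum>j<n. v j * detl [0..<?r] (map L (map unitv (cs @ [j]) @ vs)))"
      using cf[of "L (unitv _)"] by (intro sum.cong) (auto simp: L_unit)
    also have "\<dots> \<in> J"
      by (intro is_idl_sum[OF J] is_idlD(3)[OF J] Cons.IH) (use Cons.prems in auto)
    finally show ?case by simp
  qed
  from this[of "[]" "map a [0..<?r]"]
  have "detl [0..<?r] (map L (map a [0..<?r])) \<in> J" by simp
  moreover have "det (mat ?r ?r (\<lambda>(i, k). \<Sum>j<n. (Ds ! i) j * a k j)) = detl [0..<?r] (map L (map a [0..<?r]))"
  proof -
    let ?M = "mat ?r ?r (\<lambda>(i, k). \<Sum>j<n. (Ds ! i) j * a k j)"
    have "det ?M = det (transpose_mat ?M)" by (rule det_transpose[symmetric, of _ ?r]) simp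
    also have "transpose_mat ?M = mat ?r ?r (\<lambda>(k, i). (map L (map a [0..<?r]) ! k) ([0..<?r] ! i))"
      by (rule eq_matI) (auto simp: L_def)
    finally show ?thesis by (simp add: detl_def)
  qed
  ultimately show ?thesis by simp
qed

text \<open>The matrix has exactly \<open>k\<close> rows, so the row set of the minor is forced to
  be everything; \<open>pick C\<close> enumerates the columns in increasing order.\<close>

lemma minors_eq_detl:
  assumes "length tops = k" "p \<in> minors k (mat k n (\<lambda>(i, j). (tops ! i) j))"
  shows "\<exists>cs. distinct cs \<and> set cs \<subseteq> {..<n} \<and> length cs = k \<and> p = detl cs tops"
proof -
  let ?A = "mat k n (\<lambda>(i, j). (tops ! i) j)"
  obtain R C where RC: "R \<subseteq> {..<k}" "C \<subseteq> {..<n}" "card R = k" "card C = k" and p: "p = det (submatrix ?A R C)"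
    using assms(2) by (auto simp: minors_def)
  have R: "R = {..<k}" using RC by (metis card_lessThan card_subset_eq finite_lessThan)
  have fC: "finite C" using RC finite_subset by blast
  let ?cs = "map (pick C) [0..<k]"
  have pickR: "pick R i = i" if "i < k" for i
  proof -
    have "card {a \<in> R. a < i} = i" using that R by (metis (no_types, lifting) Collect_cong card_Collect_less_nat lessThan_iff less_trans)
    then show ?thesis using pick_card_in_set[of i R] R that by simp
  qed
  have pickC: "pick C j \<in> C" if "j < k" for j using pick_in_set_le[of j C] that RC by simp
  have "inj_on (pick C) {0..<k}"
    by (rule linorder_inj_onI) (use pick_mono_le[of _ C] RC in \<open>auto, fastforce\<close>)
  then have "distinct ?cs" by (simp add: distinct_map)
  moreover have "set ?cs \<subseteq> {..<n}" using pickC RC(2) by fastforce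
  moreover have "p = detl ?cs tops"
  proof -
    have "{i. i < k \<and> i \<in> R} = R" "{j. j < n \<and> j \<in> C} = C" using RC by auto
    then have "submatrix ?A R C = mat k k (\<lambda>(i, j). (tops ! i) (?cs ! j))"
      unfolding submatrix_def using RC(3,4) pickC pickR subsetD[OF RC(2)] by (intro eq_matI) auto
    then show ?thesis unfolding p detl_def by simp
  qed
  ultimately show ?thesis by (intro exI[of _ ?cs]) simp
qed

text \<open>\<open>minors\<close> offers each set of columns in increasing order only; any other
  order differs from it by the factor of \<open>detl_reindex\<close>.\<close>

lemma detl_mem_idl_minors:
  fixes tops :: "(nat \<Rightarrow> 'a::comm_ring_1) list"
  assumes J: "is_idl J" and "minors k (mat k n (\<lambda>(i, j). (tops ! i) j)) \<subseteq> J" "length tops = k"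
    and cs: "distinct cs" "set cs \<subseteq> {..<n}" "length cs = k"
  shows "detl cs tops \<in> J"
proof -
  let ?A = "mat k n (\<lambda>(i, j). (tops ! i) j)" and ?C = "set cs"
  let ?cs = "map (pick ?C) [0..<k]"
  have card: "card ?C = k" using cs distinct_card by metis
  have pickC: "pick ?C j \<in> ?C" if "j < k" for j using pick_in_set_le[of j ?C] that card by simp
  have inj: "inj_on (pick ?C) {0..<k}"
    by (rule linorder_inj_onI) (use pick_mono_le[of _ ?C] card in \<open>auto, fastforce\<close>)
  have "set ?cs = ?C"
    by (rule card_subset_eq) (use pickC card card_image[OF inj] in auto)
  moreover have "distinct ?cs" using inj by (simp add: distinct_map)
  ultimately obtain e :: 'a where "\<forall>vs. detl cs vs = detl ?cs vs * e"
    using detl_reindex[of ?cs cs] cs(3) by (metis length_map length_upt minus_nat.diff_0 order_refl)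
  then have e: "detl cs tops = detl ?cs tops * e" by blast
  have pick: "pick {..<k} i = i" if "i < k" for i
  proof -
    have "{a \<in> {..<k}. a < i} = {..<i}" using that by auto
    then show ?thesis using pick_card_in_set[of i "{..<k}"] that by simp
  qed
  have "{i. i < k \<and> i \<in> {..<k}} = {..<k}" "{j. j < n \<and> j \<in> ?C} = ?C" using cs by auto
  then have "submatrix ?A {..<k} ?C = mat k k (\<lambda>(i, j). (tops ! i) (?cs ! j))"
    unfolding submatrix_def using card pickC pick subsetD[OF cs(2)] by (intro eq_matI) auto
  then have "detl ?cs tops = det (submatrix ?A {..<k} ?C)" by (simp add: detl_def)
  moreover have "det (submatrix ?A {..<k} ?C) \<in> minors k ?A"
    unfolding minors_def
    by (intro CollectI exI[of _ "{..<k}"] exI[of _ ?C] conjI) (use card cs in auto)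
  ultimately show ?thesis using e assms(2) by (auto intro: is_idlD[OF J])
qed

section \<open>Polynomials\<close>

abbreviation "mkeys \<equiv> Poly_Mapping.keys"
abbreviation "coef \<equiv> Poly_Mapping.lookup"
abbreviation "pmono \<equiv> Poly_Mapping.single"

text \<open>For \<open>{..<n}\<close> this is the carrier of \<open>mpoly_ring n\<close>; other sets
  of variables occur as transcendence bases in the height bound.\<close>

definition poly_in :: "nat set \<Rightarrow> 'k::field mpol set" where
  "poly_in V = {p. \<forall>m\<in>mkeys p. mkeys m \<subseteq> V}"

definition var :: "nat \<Rightarrow> 'k::field mpol" where
  "var j = pmono (pmono j 1) 1"

definition const :: "'k::field \<Rightarrow> 'k mpol" where
  "const c = pmono 0 c"

lemma poly_eq_sum: "p = (\<Sum>m\<in>mkeys p. pmono m (coef p m))"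
proof (rule poly_mapping_eqI)
  fix k
  have "coef (\<Sum>m\<in>mkeys p. pmono m (coef p m)) k = (\<Sum>m\<in>mkeys p. if m = k then coef p m else 0)"
    unfolding lookup_sum by (rule sum.cong) (auto simp: lookup_single when_def)
  also have "\<dots> = coef p k" by (simp add: in_keys_iff)
  finally show "coef p k = coef (\<Sum>m\<in>mkeys p. pmono m (coef p m)) k" by simp
qed

lemma poly_in_mono: "V \<subseteq> W \<Longrightarrow> poly_in V \<subseteq> poly_in W"
  by (auto simp: poly_in_def)

lemma poly_in_single: "mkeys m \<subseteq> V \<Longrightarrow> pmono m c \<in> poly_in V"
  by (simp add: poly_in_def)

lemma poly_in_const [simp]: "const c \<in> poly_in V"
  by (simp add: const_def poly_in_single)

lemma const_zero [simp]: "const 0 = 0" and const_one [simp]: "const 1 = 1"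
  and const_add: "const (a + b) = const a + const b" and const_mult: "const (a * b) = const a * const b"
  by (simp_all add: const_def single_add mult_single)

lemma poly_in_0 [simp]: "0 \<in> poly_in V" and poly_in_1 [simp]: "1 \<in> poly_in V"
  using poly_in_const[of 0 V] poly_in_const[of 1 V] by simp_all

lemma poly_in_var: "j \<in> V \<Longrightarrow> var j \<in> poly_in V"
  by (simp add: var_def poly_in_single)

lemma poly_in_add: "p \<in> poly_in V \<Longrightarrow> q \<in> poly_in V \<Longrightarrow> p + q \<in> poly_in V"
  using keys_add[of p q] by (auto simp: poly_in_def)

lemma poly_in_uminus: "p \<in> poly_in V \<Longrightarrow> - p \<in> poly_in V"
  by (simp add: poly_in_def in_keys_iff)

lemma poly_in_diff: "p \<in> poly_in V \<Longrightarrow> q \<in> poly_in V \<Longrightarrow> p - q \<in> poly_in V"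
  using poly_in_add[of p V "- q"] poly_in_uminus[of q V] by simp

lemma poly_in_mult: "p \<in> poly_in V \<Longrightarrow> q \<in> poly_in V \<Longrightarrow> p * q \<in> poly_in V"
proof -
  assume *: "p \<in> poly_in V" "q \<in> poly_in V"
  have "mkeys m \<subseteq> V" if m: "m \<in> mkeys (p * q)" for m
  proof -
    obtain a b where "m = a + b" "a \<in> mkeys p" "b \<in> mkeys q" using keys_mult[of p q] m by auto
    then show ?thesis using * keys_add[of a b] by (force simp: poly_in_def)
  qed
  then show ?thesis by (simp add: poly_in_def)
qed

lemma poly_in_power: "p \<in> poly_in V \<Longrightarrow> p ^ k \<in> poly_in V"
  by (induction k) (auto intro: poly_in_mult)

lemma poly_in_sum: "(\<And>i. i \<in> S \<Longrightarrow> f i \<in> poly_in V) \<Longrightarrow> sum f S \<in> poly_in V"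
  by (induction S rule: infinite_finite_induct) (auto intro: poly_in_add)

lemma poly_in_prod: "(\<And>i. i \<in> S \<Longrightarrow> f i \<in> poly_in V) \<Longrightarrow> prod f S \<in> poly_in V"
  by (induction S rule: infinite_finite_induct) (auto intro: poly_in_mult)

lemmas poly_in_intros = poly_in_0 poly_in_1 poly_in_const poly_in_add poly_in_diff poly_in_uminus
  poly_in_mult poly_in_power poly_in_sum poly_in_prod

definition mdeg :: "nat set \<Rightarrow> (nat \<Rightarrow>\<^sub>0 nat) \<Rightarrow> nat" where
  "mdeg Z m = (\<Sum>i\<in>mkeys m \<inter> Z. coef m i)"

lemma mdeg_superset: "finite S \<Longrightarrow> mkeys m \<subseteq> S \<Longrightarrow> mdeg Z m = (\<Sum>i\<in>S \<inter> Z. coef m i)"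
  unfolding mdeg_def by (rule sum.mono_neutral_left) (auto simp: in_keys_iff)

lemma mdeg_add: "mdeg Z (a + b) = mdeg Z a + mdeg Z b"
proof -
  let ?S = "mkeys a \<union> mkeys b"
  have "mdeg Z (a + b) = (\<Sum>i\<in>?S \<inter> Z. coef (a + b) i)"
    by (rule mdeg_superset) (use keys_add[of a b] in auto)
  also have "\<dots> = mdeg Z a + mdeg Z b"
    by (simp add: lookup_add sum.distrib mdeg_superset[of ?S a] mdeg_superset[of ?S b])
  finally show ?thesis .
qed

lemma mdeg_0 [simp]: "mdeg Z 0 = 0" by (simp add: mdeg_def)

lemma mdeg_single: "mdeg Z (pmono i k) = (if i \<in> Z then k else 0)"
  by (simp add: mdeg_def)

lemma monomial_split: "i \<in> mkeys m \<Longrightarrow> m = pmono i 1 + (m - pmono i 1)" for m :: "nat \<Rightarrow>\<^sub>0 nat"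
  by (rule poly_mapping_eqI) (auto simp: lookup_add lookup_minus lookup_single when_def in_keys_iff)

lemma monomial_induct [case_names zero add]:
  fixes m :: "nat \<Rightarrow>\<^sub>0 nat"
  assumes "Q 0" and "\<And>i m. Q m \<Longrightarrow> Q (pmono i 1 + m)"
  shows "Q m"
proof (induction "mdeg UNIV m" arbitrary: m rule: less_induct)
  case less
  show ?case
  proof (cases "m = 0")
    case False
    then obtain i where i: "i \<in> mkeys m" using keys_eq_empty by blast
    have m: "m = pmono i 1 + (m - pmono i 1)" by (rule monomial_split[OF i])
    have "mdeg UNIV m = 1 + mdeg UNIV (m - pmono i 1)"
      by (subst m) (simp add: mdeg_add mdeg_single)
    then have "Q (m - pmono i 1)" by (intro less) simp
    then show ?thesis using assms(2)[of "m - pmono i 1" i] m by simp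
  qed (use assms in simp)
qed

lemma mono_add_var: "pmono (pmono i 1 + m) c = var i * pmono m c"
  by (simp add: var_def mult_single)

lemma keys_monomial_add: "mkeys (a + b) = mkeys a \<union> mkeys b" for a b :: "nat \<Rightarrow>\<^sub>0 nat"
  by (auto simp: in_keys_iff lookup_add)

lemma poly_in_induct [consumes 1, case_names const var add mult]:
  assumes "p \<in> poly_in V"
    and "\<And>c. Q (const c)" and "\<And>j. j \<in> V \<Longrightarrow> Q (var j)"
    and add: "\<And>p q. p \<in> poly_in V \<Longrightarrow> q \<in> poly_in V \<Longrightarrow> Q p \<Longrightarrow> Q q \<Longrightarrow> Q (p + q)"
    and mult: "\<And>p q. p \<in> poly_in V \<Longrightarrow> q \<in> poly_in V \<Longrightarrow> Q p \<Longrightarrow> Q q \<Longrightarrow> Q (p * q)"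
  shows "Q p"
proof -
  have "mkeys m \<subseteq> V \<Longrightarrow> Q (pmono m c)" for m c
  proof (induction m rule: monomial_induct)
    case zero
    then show ?case using assms(2) by (simp add: const_def)
  next
    case (add i m)
    then have "i \<in> V" "mkeys m \<subseteq> V" by (auto simp: keys_monomial_add)
    then show ?case
      unfolding mono_add_var by (intro mult poly_in_var poly_in_single assms(3) add.IH)
  qed
  then have pmono: "Q (pmono m (coef p m))" if "m \<in> mkeys p" for m
    using that assms(1) by (auto simp: poly_in_def)
  have "Q (\<Sum>m\<in>S. pmono m (coef p m)) \<and> (\<Sum>m\<in>S. pmono m (coef p m)) \<in> poly_in V"
    if "finite S" "S \<subseteq> mkeys p" for S
    using that
  proof (induction S)
    case empty
    then show ?case using assms(2)[of 0] by simp
  next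
    case (insert m S)
    have "pmono m (coef p m) \<in> poly_in V"
      using insert.prems assms(1) by (intro poly_in_single) (auto simp: poly_in_def)
    then show ?case using insert pmono by (auto intro!: add poly_in_add)
  qed
  then show ?thesis using poly_eq_sum[of p] by (metis finite_keys order_refl)
qed

subsection \<open>Substitution\<close>

definition ring_hom_of_field :: "('k::field \<Rightarrow> 'b::comm_ring_1) \<Rightarrow> bool" where
  "ring_hom_of_field \<phi> \<longleftrightarrow> \<phi> 0 = 0 \<and> \<phi> 1 = 1 \<and> (\<forall>a b. \<phi> (a + b) = \<phi> a + \<phi> b) \<and> (\<forall>a b. \<phi> (a * b) = \<phi> a * \<phi> b)"

definition mon_eval :: "(nat \<Rightarrow> 'b::comm_ring_1) \<Rightarrow> (nat \<Rightarrow>\<^sub>0 nat) \<Rightarrow> 'b" where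
  "mon_eval s m = (\<Prod>i\<in>mkeys m. s i ^ coef m i)"

definition subst_poly :: "('k::field \<Rightarrow> 'b::comm_ring_1) \<Rightarrow> (nat \<Rightarrow> 'b) \<Rightarrow> 'k mpol \<Rightarrow> 'b" where
  "subst_poly \<phi> s p = (\<Sum>m\<in>mkeys p. \<phi> (coef p m) * mon_eval s m)"

lemma mon_eval_add: "mon_eval s (a + b) = mon_eval s a * mon_eval s b"
proof -
  have sup: "mon_eval s m = (\<Prod>i\<in>S. s i ^ coef m i)" if "finite S" "mkeys m \<subseteq> S" for m S
    unfolding mon_eval_def using that by (intro prod.mono_neutral_left) (auto simp: in_keys_iff)
  let ?S = "mkeys a \<union> mkeys b"
  show ?thesis
    by (simp add: sup[of ?S] keys_monomial_add lookup_add power_add prod.distrib)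
qed

context
  fixes \<phi> :: "'k::field \<Rightarrow> 'b::comm_ring_1" and s :: "nat \<Rightarrow> 'b"
  assumes \<phi>: "ring_hom_of_field \<phi>"
begin

lemma subst_poly_superset:
  "finite S \<Longrightarrow> mkeys p \<subseteq> S \<Longrightarrow> subst_poly \<phi> s p = (\<Sum>m\<in>S. \<phi> (coef p m) * mon_eval s m)"
  unfolding subst_poly_def
  by (rule sum.mono_neutral_left) (use \<phi> in \<open>auto simp: in_keys_iff ring_hom_of_field_def\<close>)

lemma subst_poly_add: "subst_poly \<phi> s (p + q) = subst_poly \<phi> s p + subst_poly \<phi> s q"
proof -
  let ?S = "mkeys p \<union> mkeys q"
  have "subst_poly \<phi> s (p + q) = (\<Sum>m\<in>?S. \<phi> (coef (p + q) m) * mon_eval s m)"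
    by (rule subst_poly_superset) (use keys_add[of p q] in auto)
  then show ?thesis
    using \<phi> by (simp add: subst_poly_superset[of ?S p] subst_poly_superset[of ?S q]
      ring_hom_of_field_def lookup_add algebra_simps sum.distrib)
qed

lemma subst_poly_mono: "subst_poly \<phi> s (pmono m c) = \<phi> c * mon_eval s m"
  using subst_poly_superset[of "{m}" "pmono m c"] by simp

lemma subst_poly_0 [simp]: "subst_poly \<phi> s 0 = 0"
  by (simp add: subst_poly_def)

lemma subst_poly_sum: "subst_poly \<phi> s (sum f S) = (\<Sum>i\<in>S. subst_poly \<phi> s (f i))"
  by (induction S rule: infinite_finite_induct) (simp_all add: subst_poly_add)

lemma subst_poly_mult: "subst_poly \<phi> s (p * q) = subst_poly \<phi> s p * subst_poly \<phi> s q"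
proof -
  have "p * q = (\<Sum>m\<in>mkeys p. pmono m (coef p m)) * (\<Sum>m\<in>mkeys q. pmono m (coef q m))"
    using poly_eq_sum[of p] poly_eq_sum[of q] by metis
  also have "\<dots> = (\<Sum>m\<in>mkeys p. \<Sum>l\<in>mkeys q. pmono (m + l) (coef p m * coef q l))"
    by (simp add: sum_product mult_single)
  finally have "subst_poly \<phi> s (p * q) = (\<Sum>m\<in>mkeys p. \<Sum>l\<in>mkeys q. \<phi> (coef p m * coef q l) * mon_eval s (m + l))"
    by (simp only: subst_poly_sum subst_poly_mono)
  also have "\<dots> = subst_poly \<phi> s p * subst_poly \<phi> s q"
    using \<phi> by (simp add: subst_poly_def sum_product ring_hom_of_field_def mon_eval_add ac_simps)
  finally show ?thesis .
qed

lemma subst_poly_const: "subst_poly \<phi> s (const c) = \<phi> c"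
  by (simp add: const_def subst_poly_mono mon_eval_def)

lemma subst_poly_1: "subst_poly \<phi> s 1 = 1"
  using subst_poly_const[of 1] \<phi> by (simp add: ring_hom_of_field_def)

lemma subst_poly_var: "subst_poly \<phi> s (var j) = s j"
  using \<phi> by (simp add: var_def subst_poly_mono mon_eval_def ring_hom_of_field_def)

lemma subst_poly_uminus: "subst_poly \<phi> s (- p) = - subst_poly \<phi> s p"
  using subst_poly_add[of p "- p"] by (simp add: eq_neg_iff_add_eq_0 add.commute)

lemma subst_poly_diff: "subst_poly \<phi> s (p - q) = subst_poly \<phi> s p - subst_poly \<phi> s q"
  using subst_poly_add[of p "- q"] by (simp add: subst_poly_uminus)

end

lemma ring_hom_const: "ring_hom_of_field const"
  by (simp add: ring_hom_of_field_def const_add const_mult)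

text \<open>The retraction of the ring of polynomials in all variables onto
  \<open>poly_in {..<n}\<close>. Through it the whole polynomial type, which is a class instance,
  can stand in for the carrier of \<open>mpoly_ring n\<close>.\<close>

definition retr :: "nat \<Rightarrow> 'k::field mpol \<Rightarrow> 'k mpol" where
  "retr n = subst_poly const (\<lambda>i. if i < n then var i else 0)"

lemma retr_hom:
  "retr n 0 = 0" "retr n 1 = 1" "retr n (p + q) = retr n p + retr n q" "retr n (p * q) = retr n p * retr n q"
  "retr n (- p) = - retr n p" "retr n (p - q) = retr n p - retr n q"
  "retr n (const c) = const c" "retr n (var j) = (if j < n then var j else 0)"
  by (simp_all add: retr_def subst_poly_1 subst_poly_add subst_poly_mult subst_poly_uminus
    subst_poly_diff subst_poly_const subst_poly_var ring_hom_const)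

lemma retr_in: "retr n p \<in> poly_in {..<n}"
proof -
  have "p \<in> poly_in UNIV" by (simp add: poly_in_def)
  then show ?thesis
    by (induction rule: poly_in_induct) (auto simp: retr_hom intro!: poly_in_intros poly_in_var)
qed

lemma retr_id: "p \<in> poly_in {..<n} \<Longrightarrow> retr n p = p"
  by (induction rule: poly_in_induct) (auto simp: retr_hom)

subsection \<open>Partial derivatives\<close>

lemma partial_deriv_superset: "finite S \<Longrightarrow> mkeys p \<subseteq> S \<Longrightarrow> partial_deriv j p =
    (\<Sum>m\<in>S. pmono (m - pmono j 1) (of_nat (coef m j) * coef p m))"
  unfolding partial_deriv_def by (rule sum.mono_neutral_left) (auto simp: in_keys_iff)

lemma partial_deriv_add: "partial_deriv j (p + q) = partial_deriv j p + partial_deriv j q"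
proof -
  let ?S = "mkeys p \<union> mkeys q"
  have "partial_deriv j (p + q) = (\<Sum>m\<in>?S. pmono (m - pmono j 1) (of_nat (coef m j) * coef (p + q) m))"
    by (rule partial_deriv_superset) (use keys_add[of p q] in auto)
  then show ?thesis
    by (simp add: partial_deriv_superset[of ?S p] partial_deriv_superset[of ?S q] lookup_add
      algebra_simps sum.distrib single_add)
qed

lemma partial_deriv_0 [simp]: "partial_deriv j 0 = 0"
  by (simp add: partial_deriv_def)

lemma partial_deriv_mono: "partial_deriv j (pmono m c) = pmono (m - pmono j 1) (of_nat (coef m j) * c)"
  using partial_deriv_superset[of "{m}" "pmono m c" j] by simp

lemma partial_deriv_sum: "partial_deriv j (sum f S) = (\<Sum>i\<in>S. partial_deriv j (f i))"
  by (induction S rule: infinite_finite_induct) (simp_all add: partial_deriv_add)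

lemma partial_deriv_uminus: "partial_deriv j (- p) = - partial_deriv j p"
  using partial_deriv_add[of j p "- p"] by (simp add: eq_neg_iff_add_eq_0 add.commute)

lemma partial_deriv_diff: "partial_deriv j (p - q) = partial_deriv j p - partial_deriv j q"
  using partial_deriv_add[of j p "- q"] by (simp add: partial_deriv_uminus)

lemma partial_deriv_mult:
  "partial_deriv j (p * q) = p * partial_deriv j q + q * partial_deriv j p"
proof -
  \<comment> \<open>Subtraction of exponents is truncated at 0, but if x_j does not occur in
    \<open>m\<close>, the factor \<open>of_nat (coef m j)\<close> vanishes and the wrong exponent is
    harmless.\<close>
  have shift: "pmono (m - pmono j 1) (of_nat (coef m j) * a) * pmono l b = pmono (m + l - pmono j 1) (of_nat (coef m j) * (a * b))"
    for m l :: "nat \<Rightarrow>\<^sub>0 nat" and a b :: 'a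
  proof (cases "j \<in> mkeys m")
    case True
    then have "m + l - pmono j 1 = (m - pmono j 1) + l"
      using monomial_split[OF True] by (metis add.assoc add_diff_cancel_left')
    then show ?thesis by (simp add: mult_single mult.assoc)
  qed (simp add: in_keys_iff)
  have single: "partial_deriv j (pmono m a * pmono l b) = pmono m a * partial_deriv j (pmono l b) + pmono l b * partial_deriv j (pmono m a)"
    for m l :: "nat \<Rightarrow>\<^sub>0 nat" and a b :: 'a
    using shift[of m a l b] shift[of l b m a]
    by (simp add: mult_single partial_deriv_mono lookup_add mult.commute add.commute distrib_right single_add[symmetric] ring_distribs)
  let ?p = "\<Sum>m\<in>mkeys p. pmono m (coef p m)" and ?q = "\<Sum>m\<in>mkeys q. pmono m (coef q m)"
  have "partial_deriv j (?p * ?q) = ?p * partial_deriv j ?q + ?q * partial_deriv j ?p"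
  proof -
    have "partial_deriv j (?p * ?q) = (\<Sum>m\<in>mkeys p. \<Sum>l\<in>mkeys q.
        pmono m (coef p m) * partial_deriv j (pmono l (coef q l)) + pmono l (coef q l) * partial_deriv j (pmono m (coef p m)))"
      by (simp add: sum_product partial_deriv_sum single)
    also have "\<dots> = ?p * partial_deriv j ?q + ?q * partial_deriv j ?p"
      unfolding partial_deriv_sum sum_product sum.distrib by (subst (2) sum.swap) simp
    finally show ?thesis .
  qed
  then show ?thesis using poly_eq_sum[of p] poly_eq_sum[of q] by metis
qed

lemma partial_deriv_const [simp]: "partial_deriv j (const c) = 0"
  by (simp add: const_def partial_deriv_mono)

lemma partial_deriv_var: "partial_deriv j (var i) = (if i = j then 1 else 0)"
  by (auto simp: var_def partial_deriv_mono lookup_single)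

lemma partial_deriv_in: "p \<in> poly_in V \<Longrightarrow> partial_deriv j p \<in> poly_in V"
  by (induction rule: poly_in_induct)
    (auto simp: partial_deriv_add partial_deriv_mult partial_deriv_var intro: poly_in_intros)

section \<open>Linear algebra over a domain of coefficients\<close>

definition is_prm :: "'a::comm_ring_1 set \<Rightarrow> bool" where
  "is_prm J \<longleftrightarrow> is_idl J \<and> 1 \<notin> J \<and> (\<forall>x y. x * y \<in> J \<longrightarrow> x \<in> J \<or> y \<in> J)"

lemma is_prmD: "is_prm J \<Longrightarrow> is_idl J" "is_prm J \<Longrightarrow> 1 \<notin> J" "is_prm J \<Longrightarrow> x * y \<in> J \<Longrightarrow> x \<notin> J \<Longrightarrow> y \<in> J"
  by (auto simp: is_prm_def)

lemma is_prm_power: "is_prm J \<Longrightarrow> x \<notin> J \<Longrightarrow> x ^ k \<notin> J"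
  by (induction k) (auto simp: is_prm_def)

text \<open>Since \<open>A\<close> meets the prime \<open>p\<close> only in 0, it is a domain
  embedded in the residue ring of \<open>p\<close>. It will be the polynomial ring in a
  transcendence basis modulo \<open>p\<close>; linear algebra over its field of fractions is done by
  clearing denominators.\<close>

locale coeff_ring =
  fixes A p :: "'a::comm_ring_1 set"
  assumes A_closed: "0 \<in> A" "1 \<in> A" "\<And>x y. x \<in> A \<Longrightarrow> y \<in> A \<Longrightarrow> x + y \<in> A"
      "\<And>x y. x \<in> A \<Longrightarrow> y \<in> A \<Longrightarrow> x * y \<in> A" "\<And>x. x \<in> A \<Longrightarrow> - x \<in> A"
    and p: "is_prm p" and A_p: "\<And>x. x \<in> A \<Longrightarrow> x \<in> p \<Longrightarrow> x = 0"
begin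

lemma nz_mult: "a \<in> A \<Longrightarrow> b \<in> A \<Longrightarrow> a \<noteq> 0 \<Longrightarrow> b \<noteq> 0 \<Longrightarrow> a * b \<noteq> 0"
  using is_prmD(3)[OF p, of a b] A_p[of a] A_p[of b] is_idlD(1)[OF is_prmD(1)[OF p]] by (cases "a \<in> p") auto

lemma one_nz: "(1::'a) \<noteq> 0"
  using is_prmD(2)[OF p] is_idlD(1)[OF is_prmD(1)[OF p]] by auto

lemma A_diff: "x \<in> A \<Longrightarrow> y \<in> A \<Longrightarrow> x - y \<in> A"
  using A_closed(3)[of x "- y"] A_closed(5) by simp

lemma A_sum: "(\<And>i. i \<in> S \<Longrightarrow> f i \<in> A) \<Longrightarrow> sum f S \<in> A"
  by (induction S rule: infinite_finite_induct) (auto intro: A_closed)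

definition amod :: "'a set \<Rightarrow> bool" where
  "amod V \<longleftrightarrow> 0 \<in> V \<and> (\<forall>x\<in>V. \<forall>y\<in>V. x + y \<in> V) \<and> (\<forall>a\<in>A. \<forall>x\<in>V. a * x \<in> V)"

lemma amodD: "amod V \<Longrightarrow> 0 \<in> V" "amod V \<Longrightarrow> x \<in> V \<Longrightarrow> y \<in> V \<Longrightarrow> x + y \<in> V"
  "amod V \<Longrightarrow> a \<in> A \<Longrightarrow> x \<in> V \<Longrightarrow> a * x \<in> V"
  by (auto simp: amod_def)

lemma amod_diff: "amod V \<Longrightarrow> x \<in> V \<Longrightarrow> y \<in> V \<Longrightarrow> x - y \<in> V"
  using amodD(2)[of V x "(-1) * y"] amodD(3)[of V "-1" y] A_closed(2,5) by simp

lemma amod_sum: "amod V \<Longrightarrow> (\<And>i. i \<in> S \<Longrightarrow> f i \<in> V) \<Longrightarrow> sum f S \<in> V"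
  by (induction S rule: infinite_finite_induct) (auto intro: amodD)

text \<open>Takes the place of extending scalars to the field of fractions of
  \<open>A\<close>.\<close>

definition sat :: "'a set \<Rightarrow> 'a set" where
  "sat V = {w. \<exists>\<kappa>\<in>A. \<kappa> \<noteq> 0 \<and> \<kappa> * w \<in> V}"

lemma satI: "\<kappa> \<in> A \<Longrightarrow> \<kappa> \<noteq> 0 \<Longrightarrow> \<kappa> * w \<in> V \<Longrightarrow> w \<in> sat V"
  by (auto simp: sat_def)

lemma sat_superset: "V \<subseteq> sat V"
  by (auto intro!: satI[of 1] simp: A_closed(2) one_nz)

lemma amod_sat:
  assumes V: "amod V"
  shows "amod (sat V)"
  unfolding amod_def
proof (intro conjI ballI)
  show "0 \<in> sat V" using amodD(1)[OF V] sat_superset by auto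
next
  fix x y assume "x \<in> sat V" "y \<in> sat V"
  then obtain a b where ab: "a \<in> A" "a \<noteq> 0" "a * x \<in> V" "b \<in> A" "b \<noteq> 0" "b * y \<in> V"
    by (auto simp: sat_def)
  have "(a * b) * (x + y) = b * (a * x) + a * (b * y)" by (simp add: algebra_simps)
  also have "\<dots> \<in> V" by (intro amodD[OF V] ab)
  finally show "x + y \<in> sat V" using ab by (intro satI[of "a * b"] A_closed nz_mult)
next
  fix a x assume "a \<in> A" "x \<in> sat V"
  then obtain b where b: "b \<in> A" "b \<noteq> 0" "b * x \<in> V" by (auto simp: sat_def)
  have "b * (a * x) \<in> V" using amodD(3)[OF V \<open>a \<in> A\<close> b(3)] by (simp add: ac_simps)
  then show "a * x \<in> sat V" using b by (intro satI[of b])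
qed

lemma sat_cancel: "a \<in> A \<Longrightarrow> a \<noteq> 0 \<Longrightarrow> a * w \<in> sat V \<Longrightarrow> w \<in> sat V"
proof -
  assume a: "a \<in> A" "a \<noteq> 0" "a * w \<in> sat V"
  then obtain b where b: "b \<in> A" "b \<noteq> 0" "b * (a * w) \<in> V" by (auto simp: sat_def)
  then show "w \<in> sat V" using a by (intro satI[of "b * a"] A_closed(4) nz_mult) (auto simp: mult.assoc)
qed

definition spn :: "'a set \<Rightarrow> 'a set" where
  "spn G = {(\<Sum>g\<in>G. a g * g) | a. \<forall>g\<in>G. a g \<in> A}"

lemma amod_spn: "amod (spn G)"
  unfolding amod_def
proof (intro conjI ballI)
  show "0 \<in> spn G" unfolding spn_def by (rule CollectI, rule exI[of _ "\<lambda>_. 0"]) (simp add: A_closed)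
next
  fix x y assume "x \<in> spn G" "y \<in> spn G"
  then obtain a b where "x = (\<Sum>g\<in>G. a g * g)" "y = (\<Sum>g\<in>G. b g * g)" "\<forall>g\<in>G. a g \<in> A" "\<forall>g\<in>G. b g \<in> A"
    by (auto simp: spn_def)
  then show "x + y \<in> spn G" unfolding spn_def
    by (intro CollectI exI[of _ "\<lambda>g. a g + b g"]) (auto simp: distrib_right sum.distrib A_closed)
next
  fix c x assume "c \<in> A" "x \<in> spn G"
  then obtain a where "x = (\<Sum>g\<in>G. a g * g)" "\<forall>g\<in>G. a g \<in> A" by (auto simp: spn_def)
  then show "c * x \<in> spn G" using \<open>c \<in> A\<close> unfolding spn_def
    by (intro CollectI exI[of _ "\<lambda>g. c * a g"]) (auto simp: sum_distrib_left mult.assoc A_closed)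
qed

lemma spn_mem:
  assumes "finite G" "g \<in> G" "a \<in> A"
  shows "a * g \<in> spn G"
proof -
  have "(\<Sum>x\<in>G. (if x = g then a else 0) * x) = (\<Sum>x\<in>G. if x = g then a * g else 0)"
    by (rule sum.cong) auto
  then have "(\<Sum>x\<in>G. (if x = g then a else 0) * x) = a * g" using assms by simp
  then show ?thesis unfolding spn_def
    by (intro CollectI exI[of _ "\<lambda>x. if x = g then a else 0"]) (auto simp: A_closed assms)
qed

text \<open>The elements that lie in the linear span of \<open>G\<close> once \<open>Q\<close> is
  divided out and the nonzero elements of \<open>A\<close> are inverted.\<close>

definition RG :: "'a set \<Rightarrow> 'a set \<Rightarrow> 'a set" where
  "RG G Q = sat {s + r | s r. s \<in> spn G \<and> r \<in> Q}"

lemma amod_spn_plus: "is_idl Q \<Longrightarrow> amod {s + r | s r. s \<in> spn G \<and> r \<in> Q}"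
  unfolding amod_def
proof (intro conjI ballI)
  assume Q: "is_idl Q"
  let ?V = "{s + r | s r. s \<in> spn G \<and> r \<in> Q}"
  show "0 \<in> ?V" by (rule CollectI, rule exI[of _ 0], rule exI[of _ 0]) (simp add: amodD(1)[OF amod_spn] is_idlD(1)[OF Q])
  fix x assume "x \<in> ?V"
  then obtain s r where x: "x = s + r" "s \<in> spn G" "r \<in> Q" by auto
  show "x + y \<in> ?V" if y: "y \<in> ?V" for y
  proof -
    obtain s' r' where "y = s' + r'" "s' \<in> spn G" "r' \<in> Q" using y by auto
    then show ?thesis using x
      by (intro CollectI exI[of _ "s + s'"] exI[of _ "r + r'"]) (auto intro: amodD[OF amod_spn] is_idlD[OF Q])
  qed
  show "a * x \<in> ?V" if "a \<in> A" for a
    using x that by (intro CollectI exI[of _ "a * s"] exI[of _ "a * r"])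
      (auto intro: amodD[OF amod_spn] is_idlD[OF Q] simp: distrib_left)
qed

lemma amod_RG: "is_idl Q \<Longrightarrow> amod (RG G Q)"
  unfolding RG_def by (intro amod_sat amod_spn_plus)

lemma RG_spn: "is_idl Q \<Longrightarrow> s \<in> spn G \<Longrightarrow> r \<in> Q \<Longrightarrow> s + r \<in> RG G Q"
  unfolding RG_def by (rule subsetD[OF sat_superset]) blast

lemma RG_gen: "is_idl Q \<Longrightarrow> finite G \<Longrightarrow> g \<in> G \<Longrightarrow> g \<in> RG G Q"
  using RG_spn[of Q "1 * g" G 0] spn_mem[of G g 1] is_idlD(1)[of Q] A_closed(2) by simp

lemma RG_idl: "is_idl Q \<Longrightarrow> r \<in> Q \<Longrightarrow> r \<in> RG G Q"
  using RG_spn[of Q 0 G r] amodD(1)[OF amod_spn] by simp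

lemma RG_cancel: "a \<in> A \<Longrightarrow> a \<noteq> 0 \<Longrightarrow> a * w \<in> RG G Q \<Longrightarrow> w \<in> RG G Q"
  unfolding RG_def by (rule sat_cancel)

lemma RG_E:
  assumes "w \<in> RG G Q"
  obtains \<kappa> a where "\<kappa> \<in> A" "\<kappa> \<noteq> 0" "\<And>g. g \<in> G \<Longrightarrow> a g \<in> A" "\<kappa> * w - (\<Sum>g\<in>G. a g * g) \<in> Q"
proof -
  obtain \<kappa> s r where "\<kappa> \<in> A" "\<kappa> \<noteq> 0" "\<kappa> * w = s + r" "s \<in> spn G" "r \<in> Q"
    using assms by (auto simp: RG_def sat_def)
  moreover from this obtain a where "s = (\<Sum>g\<in>G. a g * g)" "\<forall>g\<in>G. a g \<in> A" by (auto simp: spn_def)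
  ultimately show ?thesis using that[of \<kappa> a] by simp
qed

lemma RG_mult:
  assumes Q: "is_idl Q" and G: "finite G" "finite G'" and w: "w \<in> RG G Q" "w' \<in> RG G' Q"
  shows "w * w' \<in> RG ((\<lambda>(g, h). g * h) ` (G \<times> G')) Q"
proof -
  let ?H = "(\<lambda>(g, h). g * h) ` (G \<times> G')"
  obtain \<kappa> a where 1: "\<kappa> \<in> A" "\<kappa> \<noteq> 0" "\<And>g. g \<in> G \<Longrightarrow> a g \<in> A" "\<kappa> * w - (\<Sum>g\<in>G. a g * g) \<in> Q"
    using w(1) by (rule RG_E) blast
  obtain \<mu> b where 2: "\<mu> \<in> A" "\<mu> \<noteq> 0" "\<And>g. g \<in> G' \<Longrightarrow> b g \<in> A" "\<mu> * w' - (\<Sum>g\<in>G'. b g * g) \<in> Q"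
    using w(2) by (rule RG_E) blast
  let ?s = "\<Sum>g\<in>G. a g * g" and ?t = "\<Sum>g\<in>G'. b g * g"
  have "?s * ?t = (\<Sum>g\<in>G. \<Sum>h\<in>G'. (a g * b h) * (g * h))" by (simp add: sum_product ac_simps)
  also have "\<dots> \<in> spn ?H"
    using 1 2 G by (intro amod_sum[OF amod_spn] spn_mem A_closed) auto
  finally have st: "?s * ?t \<in> spn ?H" .
  have "(\<kappa> * \<mu>) * (w * w') = ?s * ?t + ((\<kappa> * w - ?s) * (\<mu> * w') + ?s * (\<mu> * w' - ?t))"
    by (simp add: algebra_simps)
  also have "\<dots> \<in> RG ?H Q"
    using 1 2 by (intro RG_spn[OF Q st] is_idlD(2)[OF Q] is_idlD(3)[OF Q] is_idlD(4)[OF Q]) auto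
  finally show ?thesis
    by (rule RG_cancel[OF A_closed(4)[OF 1(1) 2(1)] nz_mult[OF 1(1) 2(1) 1(2) 2(2)]])
qed

text \<open>Gaussian elimination without division: the pivot row \<open>t0\<close> is subtracted
  from the others after cross-multiplication, and the relation found for the smaller system is
  extended to \<open>t0\<close>.\<close>

lemma linear_dependence:
  assumes "finite S" "finite T" "card S < card T" "\<And>t x. t \<in> T \<Longrightarrow> x \<in> S \<Longrightarrow> v t x \<in> A"
  shows "\<exists>c. (\<forall>t\<in>T. c t \<in> A) \<and> (\<exists>t\<in>T. c t \<noteq> 0) \<and> (\<forall>x\<in>S. (\<Sum>t\<in>T. c t * v t x) = 0)"
  using assms
proof (induction S arbitrary: T v rule: finite_induct)
  case empty
  then obtain t0 where "t0 \<in> T" by fastforce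
  then show ?case using A_closed one_nz by (intro exI[of _ "\<lambda>_. 1"]) auto
next
  case (insert x S)
  show ?case
  proof (cases "\<forall>t\<in>T. v t x = 0")
    case True
    obtain c where "\<forall>t\<in>T. c t \<in> A" "\<exists>t\<in>T. c t \<noteq> 0" "\<forall>x\<in>S. (\<Sum>t\<in>T. c t * v t x) = 0"
      using insert.IH[of T v] insert.prems insert.hyps by auto
    then show ?thesis using True by (intro exI[of _ c]) auto
  next
    case False
    then obtain t0 where t0: "t0 \<in> T" "v t0 x \<noteq> 0" by auto
    let ?T = "T - {t0}"
    let ?v = "\<lambda>t y. v t0 x * v t y - v t x * v t0 y"
    have "card S < card ?T" using insert t0 by (simp add: card_Diff_singleton)
    then obtain c where c: "\<forall>t\<in>?T. c t \<in> A" "\<exists>t\<in>?T. c t \<noteq> 0" "\<forall>y\<in>S. (\<Sum>t\<in>?T. c t * ?v t y) = 0"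
      using insert.IH[of ?T ?v] insert.prems t0 by (auto intro!: A_diff A_closed)
    \<comment> \<open>The coefficient at \<open>t0\<close> is chosen such that the coordinate
      \<open>x\<close> cancels as well; the others are scaled by the nonzero pivot and so stay
      nontrivial.\<close>
    let ?c = "\<lambda>t. if t = t0 then - (\<Sum>t\<in>?T. c t * v t x) else v t0 x * c t"
    have sum_c: "(\<Sum>t\<in>T. ?c t * v t y) = (\<Sum>t\<in>?T. c t * ?v t y)" for y
    proof -
      have "(\<Sum>t\<in>T. ?c t * v t y) = ?c t0 * v t0 y + (\<Sum>t\<in>?T. ?c t * v t y)"
        using t0 insert.prems by (simp add: sum.remove)
      also have "(\<Sum>t\<in>?T. ?c t * v t y) = (\<Sum>t\<in>?T. (v t0 x * c t) * v t y)"
        by (rule sum.cong) auto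
      also have "?c t0 * v t0 y + \<dots> = (\<Sum>t\<in>?T. c t * ?v t y)"
        by (simp add: sum_distrib_right sum_distrib_left sum_subtractf algebra_simps)
      finally show ?thesis .
    qed
    have "\<forall>y\<in>insert x S. (\<Sum>t\<in>T. ?c t * v t y) = 0"
      unfolding sum_c using c(3) by (simp add: mult.commute)
    moreover have "\<forall>t\<in>T. ?c t \<in> A"
      using c(1) t0 insert.prems by (auto intro!: A_closed A_sum)
    moreover have "\<exists>t\<in>T. ?c t \<noteq> 0"
    proof -
      obtain t where t: "t \<in> ?T" "c t \<noteq> 0" using c(2) by auto
      then have "v t0 x * c t \<noteq> 0" using c(1) t0 insert.prems by (intro nz_mult) auto
      then show ?thesis using t by (intro bexI[of _ t]) auto
    qed
    ultimately show ?thesis by (intro exI[of _ ?c] conjI)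
  qed
qed

text \<open>The denominators \<open>\<kappa> t\<close> are absorbed into the coefficients of the
  relation. They are nonzero in a domain, so the relation remains nontrivial.\<close>

lemma RG_dependence:
  assumes Q: "is_idl Q" and G: "finite G" and T: "finite T" "card G < card T"
    and w: "\<And>t. t \<in> T \<Longrightarrow> w t \<in> RG G Q"
  shows "\<exists>c. (\<forall>t\<in>T. c t \<in> A) \<and> (\<exists>t\<in>T. c t \<noteq> 0) \<and> (\<Sum>t\<in>T. c t * w t) \<in> Q"
proof -
  have "\<forall>t\<in>T. \<exists>\<kappa> a. \<kappa> \<in> A \<and> \<kappa> \<noteq> 0 \<and> (\<forall>g\<in>G. a g \<in> A) \<and> \<kappa> * w t - (\<Sum>g\<in>G. a g * g) \<in> Q"
  proof
    fix t assume "t \<in> T"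
    from w[OF this] show "\<exists>\<kappa> a. \<kappa> \<in> A \<and> \<kappa> \<noteq> 0 \<and> (\<forall>g\<in>G. a g \<in> A) \<and> \<kappa> * w t - (\<Sum>g\<in>G. a g * g) \<in> Q"
      by (rule RG_E) blast
  qed
  then obtain \<kappa> a where \<kappa>: "\<And>t. t \<in> T \<Longrightarrow> \<kappa> t \<in> A \<and> \<kappa> t \<noteq> 0 \<and> (\<forall>g\<in>G. a t g \<in> A) \<and> \<kappa> t * w t - (\<Sum>g\<in>G. a t g * g) \<in> Q"
    by metis
  obtain c where c: "\<forall>t\<in>T. c t \<in> A" "\<exists>t\<in>T. c t \<noteq> 0" "\<forall>g\<in>G. (\<Sum>t\<in>T. c t * a t g) = 0"
    using linear_dependence[OF G T, of a] \<kappa> by auto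
  have "(\<Sum>t\<in>T. c t * (\<kappa> t * w t - (\<Sum>g\<in>G. a t g * g))) = (\<Sum>t\<in>T. c t * \<kappa> t * w t)"
  proof -
    have "(\<Sum>t\<in>T. c t * (\<Sum>g\<in>G. a t g * g)) = (\<Sum>g\<in>G. (\<Sum>t\<in>T. c t * a t g) * g)"
      unfolding sum_distrib_left sum_distrib_right by (subst sum.swap) (simp add: mult.assoc)
    then have "(\<Sum>t\<in>T. c t * (\<Sum>g\<in>G. a t g * g)) = 0" using c(3) by simp
    then show ?thesis by (simp add: right_diff_distrib sum_subtractf mult.assoc)
  qed
  moreover have "(\<Sum>t\<in>T. c t * (\<kappa> t * w t - (\<Sum>g\<in>G. a t g * g))) \<in> Q"
    using \<kappa> by (intro is_idl_sum[OF Q] is_idlD(3)[OF Q]) auto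
  ultimately have "(\<Sum>t\<in>T. (c t * \<kappa> t) * w t) \<in> Q" by simp
  moreover have "\<exists>t\<in>T. c t * \<kappa> t \<noteq> 0" using c \<kappa> nz_mult by metis
  ultimately show ?thesis
    using c(1) \<kappa> by (intro exI[of _ "\<lambda>t. c t * \<kappa> t"]) (auto intro: A_closed)
qed

end

section \<open>Taylor expansion\<close>

definition cpoly :: "'k::field \<Rightarrow> (nat \<Rightarrow>\<^sub>0 nat) \<Rightarrow>\<^sub>0 'k mpol" where
  "cpoly c = pmono 0 (const c)"

text \<open>This is F(x + T) with a new variable T_i for each i in \<open>Z\<close>, as a polynomial
  in T with coefficients in x. These coefficients are Hasse derivatives, which measure orders of
  vanishing in every characteristic.\<close>

definition taylor :: "nat set \<Rightarrow> 'k::field mpol \<Rightarrow> (nat \<Rightarrow>\<^sub>0 nat) \<Rightarrow>\<^sub>0 'k mpol" where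
  "taylor Z = subst_poly cpoly (\<lambda>i. pmono 0 (var i) + (if i \<in> Z then pmono (pmono i 1) 1 else 0))"

lemma ring_hom_cpoly: "ring_hom_of_field cpoly"
  by (simp add: ring_hom_of_field_def cpoly_def const_add const_mult single_add mult_single)

lemma taylor_0: "taylor Z 0 = 0"
 
 
 
 
 
 
  unfolding taylor_def by (rule subst_poly_0[OF ring_hom_cpoly])
lemma taylor_1: "taylor Z 1 = 1"
 
 
 
 
 
 
  unfolding taylor_def by (rule subst_poly_1[OF ring_hom_cpoly])
lemma taylor_add: "taylor Z (p + q) = taylor Z p + taylor Z q"
 
 
 
 
 
 
  unfolding taylor_def by (rule subst_poly_add[OF ring_hom_cpoly])
lemma taylor_mult: "taylor Z (p * q) = taylor Z p * taylor Z q"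
 
 
 
 
 
 
  unfolding taylor_def by (rule subst_poly_mult[OF ring_hom_cpoly])
lemma taylor_const: "taylor Z (const c) = cpoly c"
 
 
 
 
 
 
  unfolding taylor_def by (rule subst_poly_const[OF ring_hom_cpoly])
lemma taylor_var: "taylor Z (var j) = pmono 0 (var j) + (if j \<in> Z then pmono (pmono j 1) 1 else 0)"
 
 
 
 
 
 
  unfolding taylor_def by (rule subst_poly_var[OF ring_hom_cpoly])
lemma taylor_sum: "taylor Z (sum f S) = (\<Sum>i\<in>S. taylor Z (f i))"
 
 
 
 
 
 
  unfolding taylor_def by (rule subst_poly_sum[OF ring_hom_cpoly])

lemmas taylor_hom = taylor_0 taylor_1 taylor_add taylor_mult taylor_const taylor_var taylor_sum

definition low_coeffs_in :: "'b::comm_ring_1 set \<Rightarrow> nat \<Rightarrow> ((nat \<Rightarrow>\<^sub>0 nat) \<Rightarrow>\<^sub>0 'b) set" where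
  "low_coeffs_in p k = {H. \<forall>\<alpha>. mdeg UNIV \<alpha> < k \<longrightarrow> coef H \<alpha> \<in> p}"

lemma Sum_any_mem_idl: "is_idl J \<Longrightarrow> (\<And>x. f x \<in> J) \<Longrightarrow> Sum_any f \<in> J"
  unfolding Sum_any.expand_set by (rule is_idl_sum)

text \<open>If \<alpha> = l + q has degree below a + b, then l has degree below a or q has degree
  below b, so each summand of the convolution contains a factor in \<open>p\<close>.\<close>

lemma low_coeffs_mult:
  assumes p: "is_idl p" and H: "H \<in> low_coeffs_in p a" "H' \<in> low_coeffs_in p b"
  shows "H * H' \<in> low_coeffs_in p (a + b)"
  unfolding low_coeffs_in_def
proof (intro CollectI allI impI)
  fix \<alpha> :: "nat \<Rightarrow>\<^sub>0 nat" assume \<alpha>: "mdeg UNIV \<alpha> < a + b"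
  show "coef (H * H') \<alpha> \<in> p"
    unfolding lookup_mult
  proof (rule Sum_any_mem_idl[OF p])
    fix l
    show "coef H l * (\<Sum>q. coef H' q when \<alpha> = l + q) \<in> p"
    proof (cases "mdeg UNIV l < a")
      case True
      then show ?thesis using H(1) by (auto simp: low_coeffs_in_def intro: is_idlD(4)[OF p])
    next
      case False
      have "(coef H' q when \<alpha> = l + q) \<in> p" for q
        using H(2) \<alpha> False by (auto simp: when_def low_coeffs_in_def mdeg_add is_idlD(1)[OF p])
      then show ?thesis by (intro is_idlD(3)[OF p] Sum_any_mem_idl[OF p])
    qed
  qed
qed

text \<open>The polynomials that vanish to order \<open>k\<close> along \<open>p\<close> in the
  directions of \<open>Z\<close>. This filtration is multiplicative and contains the powers of
  \<open>p\<close>, and \<open>taylor_power_degree\<close> bounds its members from below in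
  degree.\<close>

definition taylor_power :: "nat set \<Rightarrow> 'k::field mpol set \<Rightarrow> nat \<Rightarrow> 'k mpol set" where
  "taylor_power Z p k = {F. taylor Z F \<in> low_coeffs_in p k}"

lemma low_coeffs_0 [simp]: "H \<in> low_coeffs_in p 0" by (simp add: low_coeffs_in_def)

lemma taylor_power_mult:
  "is_idl p \<Longrightarrow> F \<in> taylor_power Z p a \<Longrightarrow> F' \<in> taylor_power Z p b \<Longrightarrow> F * F' \<in> taylor_power Z p (a + b)"
  by (simp add: taylor_power_def taylor_hom low_coeffs_mult)

lemma is_idl_taylor_power:
  assumes p: "is_idl p"
  shows "is_idl (taylor_power Z p k)"
  unfolding is_idl_def
proof (intro conjI ballI allI)
  fix c x assume "x \<in> taylor_power Z p k"
  then show "c * x \<in> taylor_power Z p k"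
    using taylor_power_mult[OF p, of c Z 0 x k] by (simp add: taylor_power_def)
next
  show "0 \<in> taylor_power Z p k"
    by (simp add: taylor_power_def low_coeffs_in_def taylor_0 is_idlD(1)[OF p])
  fix x y assume "x \<in> taylor_power Z p k" "y \<in> taylor_power Z p k"
  then show "x + y \<in> taylor_power Z p k"
    by (simp add: taylor_power_def low_coeffs_in_def taylor_add lookup_add is_idlD(2)[OF p])
qed

text \<open>Setting the new variables to 0 is a ring homomorphism that undoes the shift of the old
  ones.\<close>

lemma taylor_coeff_zero:
  "coef (taylor Z F) 0 = F"
proof -
  have "coef (H * H') (0 :: nat \<Rightarrow>\<^sub>0 nat) = coef H 0 * coef H' 0" for H H' :: "(nat \<Rightarrow>\<^sub>0 nat) \<Rightarrow>\<^sub>0 'a mpol"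
  proof -
    have z: "0 = l + q \<longleftrightarrow> l = 0 \<and> q = 0" for l q :: "nat \<Rightarrow>\<^sub>0 nat"
    proof
      assume "0 = l + q"
      then have "mkeys l \<union> mkeys q = {}" using keys_monomial_add[of l q] by simp
      then show "l = 0 \<and> q = 0" by simp
    qed simp
    have 1: "(\<Sum>q. coef H' q when 0 = l + q) = (coef H' 0 when l = 0)" for l
      unfolding z by (cases "l = 0") (simp_all add: when_def)
    show ?thesis unfolding lookup_mult 1 by (simp add: mult_when)
  qed
  note mult = this
  have "F \<in> poly_in UNIV" by (simp add: poly_in_def)
  then show ?thesis
    by (induction rule: poly_in_induct)
      (auto simp: taylor_hom cpoly_def lookup_add mult lookup_single when_def dest: arg_cong[of _ _ mkeys])
qed

lemma ideal_subset_taylor_power: "F \<in> p \<Longrightarrow> F \<in> taylor_power Z p 1"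
proof -
  have *: "mdeg UNIV \<alpha> < 1 \<Longrightarrow> \<alpha> = 0" for \<alpha> :: "nat \<Rightarrow>\<^sub>0 nat"
    by (auto simp: mdeg_def in_keys_iff intro!: poly_mapping_eqI)
  then show "F \<in> p \<Longrightarrow> F \<in> taylor_power Z p 1"
    unfolding taylor_power_def low_coeffs_in_def by (auto dest!: *[simplified] simp: taylor_coeff_zero)
qed

definition zpart :: "nat set \<Rightarrow> (nat \<Rightarrow>\<^sub>0 nat) \<Rightarrow> nat \<Rightarrow>\<^sub>0 nat" where
  "zpart Z m = (\<Sum>i\<in>mkeys m \<inter> Z. pmono i (coef m i))"

lemma coef_zpart: "coef (zpart Z m) j = (if j \<in> Z then coef m j else 0)"
proof -
  have "coef (zpart Z m) j = (\<Sum>i\<in>mkeys m \<inter> Z. if i = j then coef m i else 0)"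
    unfolding zpart_def lookup_sum by (rule sum.cong) (auto simp: lookup_single when_def)
  then show ?thesis by (auto simp: in_keys_iff)
qed

lemma zpart_add: "zpart Z (a + b) = zpart Z a + zpart Z b"
  by (rule poly_mapping_eqI) (simp add: coef_zpart lookup_add)

lemma zpart_single: "zpart Z (pmono i 1) = (if i \<in> Z then pmono i 1 else 0)"
  by (rule poly_mapping_eqI) (auto simp: coef_zpart lookup_single when_def)

lemma zpart_split: "m = zpart Z m + zpart (- Z) m"
  by (rule poly_mapping_eqI) (simp add: coef_zpart lookup_add)

lemma mdeg_zpart: "mdeg UNIV (zpart Z m) = mdeg Z m"
proof -
  have "mkeys (zpart Z m) = mkeys m \<inter> Z" by (auto simp: in_keys_iff coef_zpart split: if_splits)
  then show ?thesis by (simp add: mdeg_def coef_zpart)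
qed

text \<open>The part of top degree in the new variables of the Taylor expansion of \<^term>\<open>pmono m c\<close>.\<close>

definition taylor_top :: "nat set \<Rightarrow> (nat \<Rightarrow>\<^sub>0 nat) \<Rightarrow> 'k::field \<Rightarrow> (nat \<Rightarrow>\<^sub>0 nat) \<Rightarrow>\<^sub>0 'k mpol" where
  "taylor_top Z m c = pmono (zpart Z m) (pmono (zpart (- Z) m) c)"

definition tdeg_less :: "nat \<Rightarrow> ((nat \<Rightarrow>\<^sub>0 nat) \<Rightarrow>\<^sub>0 'b::comm_ring_1) set" where
  "tdeg_less k = {H. \<forall>\<alpha>. mdeg UNIV \<alpha> \<ge> k \<longrightarrow> coef H \<alpha> = 0}"

lemma tdeg_less_add: "H \<in> tdeg_less k \<Longrightarrow> H' \<in> tdeg_less k \<Longrightarrow> H + H' \<in> tdeg_less k"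
  by (simp add: tdeg_less_def lookup_add)

lemma tdeg_less_mono: "H \<in> tdeg_less k \<Longrightarrow> k \<le> l \<Longrightarrow> H \<in> tdeg_less l"
  by (simp add: tdeg_less_def)

lemma tdeg_less_pmono: "mdeg UNIV \<alpha> < k \<Longrightarrow> pmono \<alpha> x \<in> tdeg_less k"
  by (auto simp: tdeg_less_def lookup_single when_def)

lemma tdeg_less_pmono_mult: "H \<in> tdeg_less k \<Longrightarrow> pmono \<alpha> x * H \<in> tdeg_less (mdeg UNIV \<alpha> + k)"
  unfolding tdeg_less_def
proof (intro CollectI allI impI)
  fix \<beta> assume H: "H \<in> {H. \<forall>\<alpha>. mdeg UNIV \<alpha> \<ge> k \<longrightarrow> coef H \<alpha> = 0}" and \<beta>: "mdeg UNIV \<beta> \<ge> mdeg UNIV \<alpha> + k"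
  have inner: "(\<Sum>q. coef H q when \<beta> = \<alpha> + q) = 0"
  proof -
    have "(coef H q when \<beta> = \<alpha> + q) = 0" for q
      using H \<beta> by (auto simp: when_def mdeg_add)
    then show ?thesis by simp
  qed
  have "coef (pmono \<alpha> x) l * (\<Sum>q. coef H q when \<beta> = l + q) = 0" for l
    using inner by (cases "l = \<alpha>") (auto simp: lookup_single when_def)
  then show "coef (pmono \<alpha> x * H) \<beta> = 0"
    by (simp add: lookup_mult)
qed

text \<open>A further factor x_i with i in \<open>Z\<close> becomes x_i + T_i, of which only T_i
  raises the degree in the new variables; a factor outside \<open>Z\<close> is not shifted at
  all.\<close>

lemma taylor_minus_top:
  "taylor Z (pmono m c) - taylor_top Z m c \<in> tdeg_less (mdeg Z m)"
proof (induction m rule: monomial_induct)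
  case zero
  have "zpart V (0 :: nat \<Rightarrow>\<^sub>0 nat) = 0" for V by (rule poly_mapping_eqI) (simp add: coef_zpart)
  then show ?case by (simp add: taylor_top_def taylor_hom(5)[unfolded const_def] cpoly_def const_def tdeg_less_def)
next
  case (add i m)
  let ?T = "taylor_top Z m c" and ?L = "taylor Z (pmono m c) - taylor_top Z m c"
  have T: "?T \<in> tdeg_less (Suc (mdeg Z m))"
    unfolding taylor_top_def by (rule tdeg_less_pmono) (simp add: mdeg_zpart)
  have eq: "taylor Z (pmono (pmono i 1 + m) c) = taylor Z (var i) * (?T + ?L)"
    unfolding mono_add_var taylor_hom(4) by simp
  show ?case
  proof (cases "i \<in> Z")
    case True
    have top: "taylor_top Z (pmono i 1 + m) c = pmono (pmono i 1) 1 * ?T"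
      using True by (simp add: taylor_top_def zpart_add zpart_single mult_single del: One_nat_def)
    have "taylor Z (pmono (pmono i 1 + m) c) - taylor_top Z (pmono i 1 + m) c =
      pmono 0 (var i) * ?T + (pmono 0 (var i) * ?L + pmono (pmono i 1) 1 * ?L)"
      unfolding eq top taylor_hom using True by (simp add: algebra_simps)
    also have "\<dots> \<in> tdeg_less (Suc (mdeg Z m))"
      using tdeg_less_pmono_mult[OF T, of 0 "var i"] tdeg_less_pmono_mult[OF add.IH, of 0 "var i"]
        tdeg_less_pmono_mult[OF add.IH, of "pmono i 1" 1]
      by (intro tdeg_less_add) (auto simp: mdeg_single intro: tdeg_less_mono)
    finally show ?thesis using True by (simp add: mdeg_add mdeg_single)
  next
    case False
    have top: "taylor_top Z (pmono i 1 + m) c = pmono 0 (var i) * ?T"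
      using False by (simp add: taylor_top_def zpart_add zpart_single mult_single var_def del: One_nat_def)
    have "taylor Z (pmono (pmono i 1 + m) c) - taylor_top Z (pmono i 1 + m) c = pmono 0 (var i) * ?L"
      unfolding eq top taylor_hom using False by (simp add: algebra_simps)
    also have "\<dots> \<in> tdeg_less (mdeg Z m)"
      using tdeg_less_pmono_mult[OF add.IH, of 0 "var i"] by simp
    finally show ?thesis using False by (simp add: mdeg_add mdeg_single)
  qed
qed

text \<open>For a monomial \<open>m0\<close> of \<open>F\<close> of largest degree in
  \<open>Z\<close>, the Taylor coefficient at the \<open>Z\<close>-part of \<open>m0\<close> comes
  from leading parts only, hence involves only the variables \<open>Y\<close>. It lies in
  \<open>p\<close> because its order is below \<open>k\<close>, so it is 0; but it contains the
  coefficient of \<open>F\<close> at \<open>m0\<close>.\<close>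

lemma taylor_power_degree:
  assumes A_p: "\<And>x. x \<in> poly_in Y \<Longrightarrow> x \<in> p \<Longrightarrow> x = 0"
    and F: "F \<in> poly_in (Y \<union> Z)" "F \<in> taylor_power Z p k" and deg: "\<And>m. m \<in> mkeys F \<Longrightarrow> mdeg Z m < k"
    and "is_idl p"
  shows "F = 0"
proof (rule ccontr)
  assume "F \<noteq> 0"
  then have "mkeys F \<noteq> {}" by simp
  then obtain m0 where m0: "m0 \<in> mkeys F" and max: "\<And>m. m \<in> mkeys F \<Longrightarrow> mdeg Z m \<le> mdeg Z m0"
    using obtains_MAX[of "mkeys F" "mdeg Z"] by (metis Max_ge finite_imageI finite_keys imageI)
  let ?\<alpha> = "zpart Z m0"
  let ?G = "\<Sum>m\<in>mkeys F. coef (taylor_top Z m (coef F m)) ?\<alpha>"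
  have "coef (taylor Z F) ?\<alpha> = (\<Sum>m\<in>mkeys F. coef (taylor Z (pmono m (coef F m))) ?\<alpha>)"
    by (subst poly_eq_sum[of F]) (simp add: taylor_hom lookup_sum)
  also have "\<dots> = ?G"
  proof (rule sum.cong[OF refl])
    fix m assume "m \<in> mkeys F"
    then have "coef (taylor Z (pmono m (coef F m)) - taylor_top Z m (coef F m)) ?\<alpha> = 0"
      using taylor_minus_top[of Z m "coef F m"] max by (simp add: tdeg_less_def mdeg_zpart)
    then show "coef (taylor Z (pmono m (coef F m))) ?\<alpha> = coef (taylor_top Z m (coef F m)) ?\<alpha>"
      by (simp add: lookup_minus)
  qed
  finally have "coef (taylor Z F) ?\<alpha> = ?G" .
  moreover have "coef (taylor Z F) ?\<alpha> \<in> p"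
    using F(2) deg[OF m0] by (auto simp: taylor_power_def low_coeffs_in_def mdeg_zpart)
  ultimately have "?G \<in> p" by (simp only:)
  moreover have "?G \<in> poly_in Y"
  proof (rule poly_in_sum)
    fix m assume "m \<in> mkeys F"
    then have "mkeys m \<subseteq> Y \<union> Z" using F(1) by (auto simp: poly_in_def)
    moreover have "mkeys (zpart (- Z) m) \<subseteq> mkeys m - Z" by (auto simp: in_keys_iff coef_zpart split: if_splits)
    ultimately have "mkeys (zpart (- Z) m) \<subseteq> Y" by blast
    then show "coef (taylor_top Z m (coef F m)) ?\<alpha> \<in> poly_in Y"
      by (auto simp: taylor_top_def lookup_single when_def intro: poly_in_single)
  qed
  ultimately have "?G = 0" by (intro A_p)
  moreover have "coef ?G (zpart (- Z) m0) = coef F m0"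
  proof -
    have "coef ?G (zpart (- Z) m0) = (\<Sum>m\<in>mkeys F. if m = m0 then coef F m else 0)"
      unfolding lookup_sum
    proof (rule sum.cong[OF refl])
      fix m
      show "coef (coef (taylor_top Z m (coef F m)) ?\<alpha>) (zpart (- Z) m0) = (if m = m0 then coef F m else 0)"
        using zpart_split[of m Z] zpart_split[of m0 Z]
        by (auto simp: taylor_top_def lookup_single when_def)
    qed
    then show ?thesis using m0 by simp
  qed
  ultimately show False using m0 by (simp add: in_keys_iff)
qed

section \<open>Heights of minimal primes\<close>

lemma poly_in_insert_univariate:
  assumes "F \<in> poly_in (insert z V)"
  shows "\<exists>f :: 'k::field mpol poly. (\<forall>i. coeff f i \<in> poly_in V) \<and> poly f (var z) = F"
  using assms
proof (induction rule: poly_in_induct)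
  case (const c)
  show ?case by (rule exI[of _ "[:const c:]"]) (auto simp: coeff_pCons split: nat.split)
next
  case (var j)
  show ?case
  proof (cases "j = z")
    case True
    then show ?thesis by (intro exI[of _ "[:0, 1:]"]) (auto simp: coeff_pCons split: nat.split)
  next
    case False
    then show ?thesis
      using var by (intro exI[of _ "[:var j:]"]) (auto simp: coeff_pCons poly_in_var split: nat.split)
  qed
next
  case (add F G)
  then obtain f g :: "'k mpol poly" where "\<forall>i. coeff f i \<in> poly_in V" "poly f (var z) = F" "\<forall>i. coeff g i \<in> poly_in V" "poly g (var z) = G"
    by blast
  then show ?case by (intro exI[of _ "f + g"]) (auto intro: poly_in_add)
next
  case (mult F G)
  then obtain f g :: "'k mpol poly" where "\<forall>i. coeff f i \<in> poly_in V" "poly f (var z) = F" "\<forall>i. coeff g i \<in> poly_in V" "poly g (var z) = G"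
    by blast
  then show ?case by (intro exI[of _ "f * g"]) (auto simp: coeff_mult intro!: poly_in_sum poly_in_mult)
qed

lemma coeff_ring_poly_in:
  assumes "is_prm p" "\<And>x. x \<in> poly_in Y \<Longrightarrow> x \<in> p \<Longrightarrow> x = 0"
  shows "coeff_ring (poly_in Y) p"
  by unfold_locales (use assms in \<open>auto intro: poly_in_add poly_in_mult poly_in_uminus\<close>)

text \<open>\<open>Y\<close> is a transcendence basis of the variables modulo \<open>p\<close>:
  independent by \<open>Y_p\<close>, maximal by \<open>Y_max\<close>. Minimality of \<open>p\<close>
  over \<open>I\<close> is used in the form \<open>rad\<close>, local nilpotence; \<open>gen\<close>
  says that near \<open>p\<close> the ideal \<open>I\<close> is generated by \<open>c\<close>
  elements; \<open>retract\<close> reduces to polynomials in the first \<open>n\<close>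
  variables.\<close>

locale height_setting =
  fixes n c :: nat and Y :: "nat set" and p I :: "'k::field mpol set" and g :: "nat \<Rightarrow> 'k mpol" and u :: "'k mpol"
  assumes p_prm: "is_prm p" and Y: "Y \<subseteq> {..<n}"
    and Y_p: "\<And>x. x \<in> poly_in Y \<Longrightarrow> x \<in> p \<Longrightarrow> x = 0"
    and Y_max: "\<And>z. z < n \<Longrightarrow> z \<notin> Y \<Longrightarrow> \<exists>F\<in>poly_in (insert z Y). F \<in> p \<and> F \<noteq> 0"
    and I: "is_idl I" "I \<subseteq> p"
    and rad: "\<And>x. x \<in> p \<Longrightarrow> \<exists>s k. s \<notin> p \<and> s * x ^ k \<in> I"
    and retract: "\<And>w. \<exists>w'\<in>poly_in {..<n}. w - w' \<in> I"
    and u: "u \<in> poly_in {..<n}" "u \<notin> p"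
    and g: "\<And>i. i < c \<Longrightarrow> g i \<in> poly_in {..<n} \<inter> I"
    and gen: "\<And>x. x \<in> I \<inter> poly_in {..<n} \<Longrightarrow> \<exists>H. (\<forall>i<c. H i \<in> poly_in {..<n}) \<and> u * x = (\<Sum>i<c. H i * g i)"
begin

sublocale coeff_ring "poly_in Y" p
  by (rule coeff_ring_poly_in[OF p_prm Y_p])

abbreviation "P \<equiv> poly_in {..<n} :: 'k mpol set"

lemma p_idl: "is_idl p" by (rule is_prmD(1)[OF p_prm])

lemma Y_P: "x \<in> poly_in Y \<Longrightarrow> x \<in> P" using poly_in_mono[OF Y] by auto

text \<open>The contraction of the localisation of \<open>I\<close> at \<open>p\<close>. By
  \<open>q_cancel\<close> and \<open>p_q_power\<close> it is primary to \<open>p\<close>.\<close>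

definition q :: "'k mpol set" where "q = {F. \<exists>w. w \<notin> p \<and> w * F \<in> I}"

lemma q_idl: "is_idl q"
  unfolding is_idl_def
proof (intro conjI ballI allI)
  show "0 \<in> q" using is_prmD(2)[OF p_prm] is_idlD(1)[OF I(1)] by (auto simp: q_def)
next
  fix x y assume "x \<in> q" "y \<in> q"
  then obtain v w where vw: "v \<notin> p" "v * x \<in> I" "w \<notin> p" "w * y \<in> I" by (auto simp: q_def)
  have "(v * w) * (x + y) = w * (v * x) + v * (w * y)" by (simp add: algebra_simps)
  also have "\<dots> \<in> I" by (intro is_idlD(2,3)[OF I(1)] vw)
  finally show "x + y \<in> q" using vw is_prmD(3)[OF p_prm, of v w] by (auto simp: q_def)
next
  fix a x assume "x \<in> q"
  then obtain v where v: "v \<notin> p" "v * x \<in> I" by (auto simp: q_def)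
  have "v * (a * x) \<in> I" using is_idlD(3)[OF I(1) v(2), of a] by (simp add: mult.left_commute)
  then show "a * x \<in> q" using v by (auto simp: q_def)
qed

lemma q_p: "x \<in> q \<Longrightarrow> x \<in> p"
  using I(2) is_prmD(3)[OF p_prm] by (auto simp: q_def)

lemma q_cancel: "w \<notin> p \<Longrightarrow> w * x \<in> q \<Longrightarrow> x \<in> q"
proof -
  assume w: "w \<notin> p" "w * x \<in> q"
  then obtain v where v: "v \<notin> p" "v * (w * x) \<in> I" by (auto simp: q_def)
  then show "x \<in> q" using w is_prmD(3)[OF p_prm, of v w]
    by (auto simp: q_def mult.assoc intro!: exI[of _ "v * w"])
qed

lemma p_q_power: "x \<in> p \<Longrightarrow> \<exists>k. x ^ k \<in> q"
  using rad by (fastforce simp: q_def)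

text \<open>A relation of x_z over \<open>Y\<close> modulo \<open>p\<close> becomes one modulo
  \<open>q\<close> after raising it to a power. Its leading coefficient is a nonzero element of
  \<open>poly_in Y\<close>, hence invertible as a denominator, so powers of x_z from the degree on
  reduce to lower ones.\<close>

lemma var_powers_RG:
  assumes z: "z < n" "z \<notin> Y"
  shows "\<exists>N. \<forall>e. var z ^ e \<in> RG ((\<lambda>e. var z ^ e) ` {..<N}) q"
proof -
  obtain F where F: "F \<in> poly_in (insert z Y)" "F \<in> p" "F \<noteq> 0" using Y_max[OF z] by auto
  obtain k where k: "F ^ k \<in> q" using p_q_power[OF F(2)] by auto
  obtain f where f: "\<And>i. coeff f i \<in> poly_in Y" "poly f (var z) = F ^ k"
    using poly_in_insert_univariate[OF poly_in_power[OF F(1), of k]] by auto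
  have "f \<noteq> 0" using f(2) F(3) by auto
  let ?N = "degree f" and ?x = "var z :: 'k mpol"
  let ?G = "(\<lambda>e. ?x ^ e) ` {..<?N}"
  have lc: "coeff f ?N \<noteq> 0" using \<open>f \<noteq> 0\<close> by simp
  have sub: "amod (RG ?G q)" by (rule amod_RG[OF q_idl])
  have "?x ^ e \<in> RG ?G q" for e
  proof (induction e rule: less_induct)
    case (less e)
    show ?case
    proof (cases "e < ?N")
      case True
      then show ?thesis by (intro RG_gen[OF q_idl]) auto
    next
      case False
      have "F ^ k = (\<Sum>i<?N. coeff f i * ?x ^ i) + coeff f ?N * ?x ^ ?N"
        unfolding f(2)[symmetric] poly_altdef by (simp add: lessThan_Suc_atMost[symmetric])
      then have "?x ^ (e - ?N) * F ^ k = (\<Sum>i<?N. coeff f i * ?x ^ (e - ?N + i)) + coeff f ?N * ?x ^ (e - ?N + ?N)"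
        by (simp add: distrib_left sum_distrib_left power_add ac_simps)
      then have eq: "coeff f ?N * ?x ^ e = ?x ^ (e - ?N) * F ^ k - (\<Sum>i<?N. coeff f i * ?x ^ (e - ?N + i))"
        using False by simp
      have "coeff f ?N * ?x ^ e \<in> RG ?G q"
        unfolding eq
      proof (rule amod_diff[OF sub])
        show "?x ^ (e - ?N) * F ^ k \<in> RG ?G q" by (intro RG_idl[OF q_idl] is_idlD(3)[OF q_idl] k)
        show "(\<Sum>i<?N. coeff f i * ?x ^ (e - ?N + i)) \<in> RG ?G q"
          using False by (intro amod_sum[OF sub] amodD(3)[OF sub] f less) auto
      qed
      then show ?thesis by (rule RG_cancel[OF f(1) lc])
    qed
  qed
  then show ?thesis by blast
qed

text \<open>The variables outside \<open>Y\<close> are added one at a time; products of the old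
  generators with finitely many powers of the new variable suffice. So modulo \<open>q\<close> the
  ring is finite dimensional over the fractions of K[Y].\<close>

lemma finite_generation: "\<exists>G. finite G \<and> G \<subseteq> P \<and> (\<forall>F\<in>P. F \<in> RG G q)"
proof -
  have "\<exists>G. finite G \<and> G \<subseteq> P \<and> (\<forall>F\<in>poly_in (Y \<union> V). F \<in> RG G q)" if "finite V" "V \<subseteq> {..<n} - Y" for V
    using that
  proof (induction V)
    case empty
    have "F \<in> RG {1} q" if "F \<in> poly_in Y" for F
      using amodD(3)[OF amod_RG[OF q_idl] that RG_gen[OF q_idl, of "{1}" 1]] by simp
    then show ?case by (intro exI[of _ "{1}"]) auto
  next
    case (insert z V)
    then obtain G where G: "finite G" "G \<subseteq> P" "\<And>F. F \<in> poly_in (Y \<union> V) \<Longrightarrow> F \<in> RG G q" by auto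
    obtain N where N: "\<And>e. var z ^ e \<in> RG ((\<lambda>e. var z ^ e) ` {..<N}) q"
      using var_powers_RG[of z] insert by auto
    let ?V = "(\<lambda>e. var z ^ e) ` {..<N} :: 'k mpol set"
    let ?G = "(\<lambda>(g, h). g * h) ` (G \<times> ?V)"
    have "F \<in> RG ?G q" if F: "F \<in> poly_in (Y \<union> insert z V)" for F
    proof -
      obtain f where f: "\<And>i. coeff f i \<in> poly_in (Y \<union> V)" "poly f (var z) = F"
        using poly_in_insert_univariate[of F z "Y \<union> V"] F by auto
      have "(\<Sum>i\<le>degree f. coeff f i * var z ^ i) \<in> RG ?G q"
        using f G N by (intro amod_sum[OF amod_RG[OF q_idl]] RG_mult[OF q_idl]) auto
      then show ?thesis using f(2) by (simp add: poly_altdef)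
    qed
    moreover have "?G \<subseteq> P"
      using G(2) insert.prems by (auto intro!: poly_in_mult poly_in_power poly_in_var)
    ultimately show ?case using G(1) by (intro exI[of _ ?G]) auto
  qed
  from this[of "{..<n} - Y"] Y show ?thesis by (simp add: Un_absorb1)
qed

text \<open>In a finite dimensional algebra the powers of \<open>w\<close> satisfy a linear
  relation. Its lowest term can be made constant because powers of \<open>w\<close> cancel modulo
  \<open>q\<close>; solving for this constant exhibits \<open>w\<close> as a divisor of a nonzero
  coefficient.\<close>

lemma unit_up_to_coeff:
  assumes w: "w \<in> P" "w \<notin> p"
  shows "\<exists>w'\<in>P. \<exists>\<kappa>\<in>poly_in Y. \<kappa> \<noteq> 0 \<and> \<kappa> - w * w' \<in> q"
proof -
  obtain G where G: "finite G" "\<And>F. F \<in> P \<Longrightarrow> F \<in> RG G q" using finite_generation by blast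
  let ?m = "card G"
  have "\<exists>a. (\<forall>t\<in>{..?m}. a t \<in> poly_in Y) \<and> (\<exists>t\<in>{..?m}. a t \<noteq> 0) \<and> (\<Sum>t\<in>{..?m}. a t * w ^ t) \<in> q"
    using G w by (intro RG_dependence[OF q_idl G(1)]) (auto intro: poly_in_power)
  then obtain a where a: "\<And>t. t \<le> ?m \<Longrightarrow> a t \<in> poly_in Y" "\<exists>t\<le>?m. a t \<noteq> 0" "(\<Sum>t\<le>?m. a t * w ^ t) \<in> q"
    by auto
  \<comment> \<open>The lowest exponent with nonzero coefficient; the relation is divided by
    \<open>w ^ e\<close>.\<close>
  define e where "e = (LEAST t. t \<le> ?m \<and> a t \<noteq> 0)"
  have e: "e \<le> ?m" "a e \<noteq> 0" using LeastI_ex[OF a(2)] by (auto simp: e_def)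
  have below: "a t = 0" if "t < e" for t
    using not_less_Least[of t "\<lambda>t. t \<le> ?m \<and> a t \<noteq> 0"] that e(1) by (auto simp: e_def)
  let ?w = "- (\<Sum>t\<in>{e<..?m}. a t * w ^ (t - e - 1))"
  have "(\<Sum>t\<le>?m. a t * w ^ t) = (\<Sum>t\<in>{e..?m}. a t * w ^ t)"
    by (rule sum.mono_neutral_right) (use below in \<open>auto simp: not_le\<close>)
  also have "{e..?m} = insert e {e<..?m}" using e(1) by auto
  also have "(\<Sum>t\<in>insert e {e<..?m}. a t * w ^ t) = a e * w ^ e + (\<Sum>t\<in>{e<..?m}. a t * w ^ t)" by simp
  also have "(\<Sum>t\<in>{e<..?m}. a t * w ^ t) = (\<Sum>t\<in>{e<..?m}. w ^ e * (w * (a t * w ^ (t - e - 1))))"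
  proof (rule sum.cong[OF refl])
    fix t assume "t \<in> {e<..?m}"
    then have "t = e + (1 + (t - e - 1))" by auto
    then have "w ^ t = w ^ e * (w * w ^ (t - e - 1))" by (metis power_add power_one_right)
    then show "a t * w ^ t = w ^ e * (w * (a t * w ^ (t - e - 1)))" by (simp add: ac_simps)
  qed
  also have "a e * w ^ e + \<dots> = w ^ e * (a e - w * ?w)"
    by (simp add: sum_distrib_left algebra_simps)
  finally have "w ^ e * (a e - w * ?w) \<in> q" using a(3) by simp
  then have "a e - w * ?w \<in> q" by (rule q_cancel[OF is_prm_power[OF p_prm w(2)]])
  moreover have "?w \<in> P"
    using w a(1) by (auto intro!: poly_in_uminus poly_in_sum poly_in_mult poly_in_power intro: Y_P)
  ultimately show ?thesis using e a(1) by blast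
qed

text \<open>A multiplier outside \<open>p\<close> carries \<open>R\<close> into \<open>I\<close>,
  and a further factor \<open>u\<close> carries it into the ideal of the \<open>g i\<close>. By
  \<open>unit_up_to_coeff\<close> the product of the two divides a coefficient \<kappa> up to some
  \<open>x\<close> in \<open>q\<close>. The error \<open>x * R\<close> is quadratic in
  \<open>q\<close>, which makes iteration profitable.\<close>

lemma q_reduce:
  assumes R: "R \<in> q" "R \<in> P"
  shows "\<exists>\<kappa>\<in>poly_in Y. \<kappa> \<noteq> 0 \<and> (\<exists>H x. (\<forall>i<c. H i \<in> P) \<and> x \<in> q \<and> x \<in> P \<and> \<kappa> * R = (\<Sum>i<c. H i * g i) + x * R)"
proof -
  obtain w where w: "w \<notin> p" "w * R \<in> I" using R by (auto simp: q_def)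
  obtain w1 where w1: "w1 \<in> P" "w - w1 \<in> I" using retract by blast
  have "w1 \<notin> p"
  proof
    assume "w1 \<in> p"
    then have "(w - w1) + w1 \<in> p" using w1(2) I(2) by (intro is_idlD(2)[OF p_idl]) auto
    then show False using w by simp
  qed
  have "w * R - (w - w1) * R \<in> I" by (intro is_idlD(6,4)[OF I(1)] w w1)
  then have "w1 * R \<in> I" by (simp add: algebra_simps)
  then obtain H where H: "\<forall>i<c. H i \<in> P" "u * (w1 * R) = (\<Sum>i<c. H i * g i)"
    using gen[of "w1 * R"] R(2) w1(1) poly_in_mult by blast
  have uw: "u * w1 \<in> P" "u * w1 \<notin> p"
    using u w1(1) \<open>w1 \<notin> p\<close> is_prmD(3)[OF p_prm, of u w1] by (auto intro: poly_in_mult)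
  obtain w' \<kappa> where w': "w' \<in> P" "\<kappa> \<in> poly_in Y" "\<kappa> \<noteq> 0" "\<kappa> - u * w1 * w' \<in> q"
    using unit_up_to_coeff[OF uw] by blast
  have "\<kappa> * R = w' * (u * (w1 * R)) + (\<kappa> - u * w1 * w') * R" by (simp add: algebra_simps)
  also have "w' * (u * (w1 * R)) = (\<Sum>i<c. (w' * H i) * g i)" by (simp only: H(2) sum_distrib_left mult.assoc)
  finally have "\<kappa> * R = (\<Sum>i<c. (w' * H i) * g i) + (\<kappa> - u * w1 * w') * R" .
  moreover have "\<forall>i<c. w' * H i \<in> P" "\<kappa> - u * w1 * w' \<in> P"
    using H(1) w' u(1) w1(1) by (auto intro!: poly_in_mult poly_in_diff intro: Y_P)
  ultimately show ?thesis using w' by (intro bexI[of _ \<kappa>] conjI exI[of _ "\<lambda>i. w' * H i"] exI[of _ "\<kappa> - u * w1 * w'"])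
qed

text \<open>An abstract multiplicative filtration with \<open>p\<close> in level 1;
  \<open>chain_length_le\<close> inserts \<open>taylor_power\<close>.\<close>

context
  fixes Q :: "nat \<Rightarrow> 'k mpol set"
  assumes Q_idl: "\<And>k. is_idl (Q k)" and Q_mult: "\<And>k l x y. x \<in> Q k \<Longrightarrow> y \<in> Q l \<Longrightarrow> x * y \<in> Q (k + l)"
    and p_Q: "\<And>x. x \<in> p \<Longrightarrow> x \<in> Q 1" and Q_0: "1 \<in> Q 0"
begin

text \<open>The reduction is applied again to the factor \<open>x\<close> of the error term
  \<open>x * R\<close>; each round gains one level of the filtration.\<close>

lemma q_reduce_power:
  "R \<in> q \<Longrightarrow> R \<in> P \<Longrightarrow> \<exists>\<kappa>\<in>poly_in Y. \<kappa> \<noteq> 0 \<and> (\<exists>H z. (\<forall>i<c. H i \<in> P) \<and> z \<in> Q (Suc k) \<and> \<kappa> * R = (\<Sum>i<c. H i * g i) + z)"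
proof (induction k arbitrary: R)
  case 0
  then show ?case
    using p_Q[OF q_p] one_nz by (intro bexI[of _ 1] conjI exI[of _ "\<lambda>_. 0"] exI[of _ R]) auto
next
  case (Suc k)
  obtain \<kappa> H x where 1: "\<kappa> \<in> poly_in Y" "\<kappa> \<noteq> 0" "\<forall>i<c. H i \<in> P" "x \<in> q" "x \<in> P" "\<kappa> * R = (\<Sum>i<c. H i * g i) + x * R"
    using q_reduce[OF Suc.prems] by blast
  obtain \<mu> H' z where 2: "\<mu> \<in> poly_in Y" "\<mu> \<noteq> 0" "\<forall>i<c. H' i \<in> P" "z \<in> Q (Suc k)" "\<mu> * x = (\<Sum>i<c. H' i * g i) + z"
    using Suc.IH[OF 1(4,5)] by blast
  have "(\<mu> * \<kappa>) * R = \<mu> * (\<Sum>i<c. H i * g i) + (\<mu> * x) * R" by (simp add: 1(6) mult.assoc distrib_left)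
  also have "\<dots> = (\<Sum>i<c. (\<mu> * H i + H' i * R) * g i) + z * R"
    unfolding 2(5) by (simp add: sum_distrib_left sum_distrib_right sum.distrib algebra_simps)
  finally have "(\<mu> * \<kappa>) * R = (\<Sum>i<c. (\<mu> * H i + H' i * R) * g i) + z * R" .
  moreover have "z * R \<in> Q (Suc (Suc k))" using Q_mult[OF 2(4) p_Q[OF q_p[OF Suc.prems(1)]]] by simp
  moreover have "\<forall>i<c. \<mu> * H i + H' i * R \<in> P"
    using 1 2 Suc.prems by (auto intro!: poly_in_add poly_in_mult intro: Y_P)
  moreover have "\<mu> * \<kappa> \<in> poly_in Y" "\<mu> * \<kappa> \<noteq> 0" using 1 2 by (auto intro: poly_in_mult)
  ultimately show ?case
    by (intro bexI[of _ "\<mu> * \<kappa>"] conjI exI[of _ "\<lambda>i. \<mu> * H i + H' i * R"] exI[of _ "z * R"])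
qed

definition gmon :: "(nat \<Rightarrow> nat) \<Rightarrow> 'k mpol" where
  "gmon \<beta> = (\<Prod>i<c. g i ^ \<beta> i)"

text \<open>The box of exponents below \<open>k\<close> contains all exponents of total degree below
  \<open>k\<close>, and the bound k^c on its size is enough.\<close>

definition gmons :: "nat \<Rightarrow> 'k mpol set \<Rightarrow> 'k mpol set" where
  "gmons k G = (\<lambda>(\<alpha>, \<gamma>). gmon \<alpha> * \<gamma>) ` (PiE {..<c} (\<lambda>_. {..<k}) \<times> G)"

lemma finite_gmons: "finite G \<Longrightarrow> finite (gmons k G)"
  by (auto simp: gmons_def intro!: finite_imageI finite_PiE)

lemma card_gmons: "finite G \<Longrightarrow> card (gmons k G) \<le> k ^ c * card G"
proof -
  assume G: "finite G"
  have "card (gmons k G) \<le> card (PiE {..<c} (\<lambda>_. {..<k}) \<times> G)"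
    unfolding gmons_def by (rule card_image_le) (auto intro!: finite_PiE G)
  then show ?thesis by (simp add: card_cartesian_product card_PiE)
qed

lemma gmon_mem: "gmon \<beta> \<in> Q (\<Sum>i<c. \<beta> i)"
proof -
  have pow: "g i ^ e \<in> Q e" if "i < c" for i e
  proof (induction e)
    case (Suc e)
    have "g i \<in> Q 1" using g[OF that] I(2) p_Q by auto
    then show ?case using Q_mult[OF _ Suc] by fastforce
  qed (use Q_0 in simp)
  have "(\<Prod>i<m. g i ^ \<beta> i) \<in> Q (\<Sum>i<m. \<beta> i)" if "m \<le> c" for m
    using that
  proof (induction m)
    case (Suc m)
    then show ?case using Q_mult[OF Suc.IH pow[of m "\<beta> m"]] by simp
  qed (use Q_0 in simp)
  then show ?thesis by (simp add: gmon_def)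
qed

lemma gmon_Suc: "i < c \<Longrightarrow> gmon \<beta> * g i = gmon (\<beta>(i := Suc (\<beta> i)))"
proof -
  assume i: "i < c"
  have "gmon (\<beta>(i := Suc (\<beta> i))) = g i ^ Suc (\<beta> i) * (\<Prod>j\<in>{..<c} - {i}. g j ^ \<beta> j)"
    unfolding gmon_def using i by (subst prod.remove[of _ i]) (auto intro!: prod.cong)
  moreover have "gmon \<beta> = g i ^ \<beta> i * (\<Prod>j\<in>{..<c} - {i}. g j ^ \<beta> j)"
    unfolding gmon_def using i by (subst prod.remove[of _ i]) auto
  ultimately show ?thesis by (simp add: ac_simps)
qed

text \<open>Downward induction on the total degree of \<beta>: modulo \<open>q\<close> the factor
  \<open>F\<close> is a combination of \<open>G\<close>, and the remainder is a combination of the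
  \<open>g i\<close> up to the filtration, which raises the degree of the monomial by one. At total
  degree \<open>Suc k\<close> the monomial itself lies in the filtration.\<close>

lemma gmon_RG:
  assumes G: "finite G" "G \<subseteq> P" "\<And>F. F \<in> P \<Longrightarrow> F \<in> RG G q"
  shows "(\<Sum>i<c. \<beta> i) \<le> Suc k \<Longrightarrow> F \<in> P \<Longrightarrow> gmon \<beta> * F \<in> RG (gmons (Suc k) G) (Q (Suc k))"
proof (induction "Suc k - (\<Sum>i<c. \<beta> i)" arbitrary: \<beta> F)
  case 0
  then have "gmon \<beta> \<in> Q (Suc k)" using gmon_mem[of \<beta>] by simp
  then show ?case by (intro RG_idl[OF Q_idl] is_idlD(4)[OF Q_idl])
next
  case (Suc d)
  let ?M = "gmons (Suc k) G" and ?Q = "Q (Suc k)"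
  have sub: "amod (RG ?M ?Q)" by (rule amod_RG[OF Q_idl])
  obtain \<kappa> a where 1: "\<kappa> \<in> poly_in Y" "\<kappa> \<noteq> 0" "\<And>h. h \<in> G \<Longrightarrow> a h \<in> poly_in Y" "\<kappa> * F - (\<Sum>h\<in>G. a h * h) \<in> q"
    using G(3)[OF Suc.prems(2)] by (rule RG_E) blast
  have "\<kappa> * F - (\<Sum>h\<in>G. a h * h) \<in> P"
    using 1 Suc.prems G(2) by (auto intro!: poly_in_diff poly_in_mult poly_in_sum intro: Y_P)
  then obtain \<mu> H z where 2: "\<mu> \<in> poly_in Y" "\<mu> \<noteq> 0" "\<forall>i<c. H i \<in> P" "z \<in> ?Q"
      "\<mu> * (\<kappa> * F - (\<Sum>h\<in>G. a h * h)) = (\<Sum>i<c. H i * g i) + z"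
    using q_reduce_power[OF 1(4)] by blast
  have "(\<mu> * \<kappa>) * (gmon \<beta> * F) = gmon \<beta> * (\<mu> * (\<Sum>h\<in>G. a h * h) + \<mu> * (\<kappa> * F - (\<Sum>h\<in>G. a h * h)))"
    by (simp add: algebra_simps)
  also have "\<dots> = (\<Sum>h\<in>G. (\<mu> * a h) * (gmon \<beta> * h)) + ((\<Sum>i<c. (gmon \<beta> * g i) * H i) + gmon \<beta> * z)"
    unfolding 2(5) by (simp add: distrib_left sum_distrib_left ac_simps)
  also have "\<dots> \<in> RG ?M ?Q"
  proof (intro amodD(2)[OF sub] amod_sum[OF sub])
    fix h assume h: "h \<in> G"
    let ?r = "restrict \<beta> {..<c}"
    have "\<beta> i < Suc k" if "i < c" for i
      using member_le_sum[of i "{..<c}" \<beta>] that Suc.hyps(2) by auto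
    then have "?r \<in> PiE {..<c} (\<lambda>_. {..<Suc k})" by auto
    moreover have "gmon \<beta> = gmon ?r" unfolding gmon_def by (rule prod.cong) auto
    ultimately have "gmon \<beta> * h \<in> ?M" unfolding gmons_def using h by (intro image_eqI[of _ _ "(?r, h)"]) auto
    then show "(\<mu> * a h) * (gmon \<beta> * h) \<in> RG ?M ?Q"
      using 1 2 h by (intro amodD(3)[OF sub] RG_gen[OF Q_idl] finite_gmons G(1) poly_in_mult) auto
  next
    fix i assume "i \<in> {..<c}"
    then have i: "i < c" by simp
    have "(\<Sum>j<c. (\<beta>(i := Suc (\<beta> i))) j) = Suc (\<beta> i) + (\<Sum>j\<in>{..<c} - {i}. \<beta> j)"
      using i by (subst sum.remove[of _ i]) (auto intro!: sum.cong)
    also have "\<dots> = Suc (\<Sum>j<c. \<beta> j)" using i by (subst (2) sum.remove[of _ i]) auto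
    finally have s: "(\<Sum>j<c. (\<beta>(i := Suc (\<beta> i))) j) = Suc (\<Sum>j<c. \<beta> j)" .
    show "(gmon \<beta> * g i) * H i \<in> RG ?M ?Q"
      unfolding gmon_Suc[OF i] using s Suc.hyps(2) 2(3) i by (intro Suc.hyps(1)) auto
  next
    show "gmon \<beta> * z \<in> RG ?M ?Q" using 2 by (intro RG_idl[OF Q_idl] is_idlD(3)[OF Q_idl])
  qed
  finally show ?case
    using 1 2 by (intro RG_cancel[of "\<mu> * \<kappa>" "gmon \<beta> * F"]) (auto intro: poly_in_mult)
qed

text \<open>A Hilbert-Samuel type bound: modulo level k + 1 of the filtration the dimension grows at
  most like the c-th power of k + 1.\<close>

lemma RG_Q:
  "\<exists>C. \<forall>k. \<exists>M. finite M \<and> card M \<le> C * Suc k ^ c \<and> (\<forall>F\<in>P. F \<in> RG M (Q (Suc k)))"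
proof -
  obtain G where G: "finite G" "G \<subseteq> P" "\<And>F. F \<in> P \<Longrightarrow> F \<in> RG G q" using finite_generation by blast
  have "F \<in> RG (gmons (Suc k) G) (Q (Suc k))" if "F \<in> P" for F k
    using gmon_RG[OF G, of "\<lambda>_. 0" k F] that by (simp add: gmon_def)
  then show ?thesis
    using finite_gmons[OF G(1)] card_gmons[OF G(1)]
    by (intro exI[of _ "card G"] allI exI[of _ "gmons (Suc _) G"]) (auto simp: mult.commute)
qed

end

end

section \<open>Degrees in the algebraic variables, and monomials along a chain of primes\<close>

definition mdeg_le :: "nat set \<Rightarrow> nat \<Rightarrow> 'k::field mpol \<Rightarrow> bool" where
  "mdeg_le Z b F \<longleftrightarrow> (\<forall>m\<in>mkeys F. mdeg Z m \<le> b)"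

lemma mdeg_le_mult:
  assumes "mdeg_le Z a F" "mdeg_le Z b G"
  shows "mdeg_le Z (a + b) (F * G)"
  unfolding mdeg_le_def
proof
  fix m assume "m \<in> mkeys (F * G)"
  then obtain k l where "m = k + l" "k \<in> mkeys F" "l \<in> mkeys G" using keys_mult[of F G] by auto
  then show "mdeg Z m \<le> a + b" using assms by (auto simp: mdeg_le_def mdeg_add intro!: add_mono)
qed

lemma mdeg_le_1: "mdeg_le Z 0 1"
  by (simp add: mdeg_le_def)

lemma mdeg_le_power: "mdeg_le Z b F \<Longrightarrow> mdeg_le Z (e * b) (F ^ e)"
  by (induction e) (auto simp: mdeg_le_1 intro: mdeg_le_mult)

lemma mdeg_le_prod:
  "finite S \<Longrightarrow> (\<And>i. i \<in> S \<Longrightarrow> mdeg_le Z b (f i)) \<Longrightarrow> mdeg_le Z (card S * b) (prod f S)"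
  by (induction S rule: finite_induct) (auto simp: mdeg_le_1 intro: mdeg_le_mult)

lemma mdeg_le_mono: "mdeg_le Z a F \<Longrightarrow> a \<le> b \<Longrightarrow> mdeg_le Z b F"
  by (auto simp: mdeg_le_def)

lemma mdeg_le_sum: "(\<And>i. i \<in> S \<Longrightarrow> mdeg_le Z b (f i)) \<Longrightarrow> mdeg_le Z b (sum f S)"
proof (induction S rule: infinite_finite_induct)
  case (insert i S)
  then show ?case using keys_add[of "f i" "sum f S"] by (auto simp: mdeg_le_def)
qed (auto simp: mdeg_le_def)

lemma mdeg_le_coeff: "F \<in> poly_in Y \<Longrightarrow> Y \<inter> Z = {} \<Longrightarrow> mdeg_le Z 0 F"
  by (fastforce simp: mdeg_le_def poly_in_def mdeg_def)

text \<open>Downward induction along the chain. The sum is a polynomial in \<open>h j\<close> whose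
  lowest nonzero coefficient lies outside \<open>qc (Suc j)\<close> by induction; the higher terms
  carry a further factor \<open>h j\<close> in \<open>qc (Suc j)\<close>, so after splitting off a
  power of \<open>h j\<close> the rest stays outside \<open>qc (Suc j)\<close>, hence outside
  \<open>qc j\<close>. The power is outside the prime \<open>qc j\<close> because \<open>h j\<close>
  is.\<close>

lemma (in coeff_ring) chain_monomials_independent:
  assumes prm: "\<And>i. i \<le> d \<Longrightarrow> is_prm (qc i)" and p_eq: "qc d = p"
    and sub: "\<And>i. i < d \<Longrightarrow> qc i \<subseteq> qc (Suc i)"
    and h: "\<And>i. i < d \<Longrightarrow> h i \<in> qc (Suc i)" "\<And>i. i < d \<Longrightarrow> h i \<notin> qc i"
    and j: "j \<le> d"
    and a: "\<And>t. t \<in> PiE {j..<d} (\<lambda>_. {..<D}) \<Longrightarrow> a t \<in> A" "\<exists>t\<in>PiE {j..<d} (\<lambda>_. {..<D}). a t \<noteq> 0"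
  shows "(\<Sum>t\<in>PiE {j..<d} (\<lambda>_. {..<D}). a t * (\<Prod>i\<in>{j..<d}. h i ^ t i)) \<notin> qc j"
  using j a
proof (induction j arbitrary: a rule: inc_induct)
  case base
  then show ?case using A_p p_eq by auto
next
  case (step j)
  let ?B = "\<lambda>_::nat. {..<D}"
  let ?T = "PiE {Suc j..<d} ?B"
  have ins: "{j..<d} = insert j {Suc j..<d}" using step.hyps by auto
  have T: "PiE {j..<d} ?B = (\<lambda>(e, t). t(j := e)) ` ({..<D} \<times> ?T)"
    unfolding ins by (rule PiE_insert_eq)
  have inj: "inj_on (\<lambda>(e, t). t(j := e)) ({..<D} \<times> ?T)"
    by (rule inj_combinator) simp
  define G where "G e = (\<Sum>t\<in>?T. a (t(j := e)) * (\<Prod>i\<in>{Suc j..<d}. h i ^ t i))" for e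
  have "(\<Sum>t\<in>PiE {j..<d} ?B. a t * (\<Prod>i\<in>{j..<d}. h i ^ t i)) =
     (\<Sum>(e, t)\<in>{..<D} \<times> ?T. a (t(j := e)) * (\<Prod>i\<in>{j..<d}. h i ^ (t(j := e)) i))"
    unfolding T by (subst sum.reindex[OF inj]) (simp add: case_prod_unfold)
  also have "\<dots> = (\<Sum>e<D. \<Sum>t\<in>?T. h j ^ e * (a (t(j := e)) * (\<Prod>i\<in>{Suc j..<d}. h i ^ t i)))"
    unfolding sum.cartesian_product[symmetric] ins
    by (intro sum.cong refl) (auto simp: ac_simps intro!: prod.cong arg_cong2[of _ _ _ _ "(*)"])
  also have "\<dots> = (\<Sum>e<D. h j ^ e * G e)" by (simp add: G_def sum_distrib_left)
  finally have eq: "(\<Sum>t\<in>PiE {j..<d} ?B. a t * (\<Prod>i\<in>{j..<d}. h i ^ t i)) = (\<Sum>e<D. h j ^ e * G e)" .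
  have "\<exists>e<D. \<exists>t\<in>?T. a (t(j := e)) \<noteq> 0" using step.prems(2) unfolding T by auto
  then obtain e where e: "e < D" "\<exists>t\<in>?T. a (t(j := e)) \<noteq> 0"
    and least: "\<And>e'. e' < e \<Longrightarrow> \<not> (e' < D \<and> (\<exists>t\<in>?T. a (t(j := e')) \<noteq> 0))"
    using exists_least_iff[of "\<lambda>e. e < D \<and> (\<exists>t\<in>?T. a (t(j := e)) \<noteq> 0)"] by blast
  have G0: "G e' = 0" if "e' < e" for e'
    using least[OF that] that e(1) unfolding G_def by (intro sum.neutral) auto
  have Ge: "G e \<notin> qc (Suc j)"
    unfolding G_def
  proof (rule step.IH)
    show "a (t(j := e)) \<in> A" if "t \<in> ?T" for t
      unfolding T using that e(1) by (intro step.prems(1)[unfolded T] image_eqI[of _ _ "(e, t)"]) auto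
    show "\<exists>t\<in>?T. a (t(j := e)) \<noteq> 0" by (rule e(2))
  qed
  have "(\<Sum>e'<D. h j ^ e' * G e') = (\<Sum>e'\<in>{e..<D}. h j ^ e' * G e')"
    by (rule sum.mono_neutral_right) (use G0 in \<open>auto simp: not_le\<close>)
  also have "\<dots> = h j ^ e * G e + (\<Sum>e'\<in>{Suc e..<D}. h j ^ e' * G e')"
    using e(1) by (simp add: sum.atLeast_Suc_lessThan)
  also have "(\<Sum>e'\<in>{Suc e..<D}. h j ^ e' * G e') = (\<Sum>e'\<in>{Suc e..<D}. h j ^ e * (h j * (h j ^ (e' - Suc e) * G e')))"
  proof (rule sum.cong[OF refl])
    fix e' assume "e' \<in> {Suc e..<D}"
    then have "e' = e + (1 + (e' - Suc e))" by auto
    then have "h j ^ e' = h j ^ e * (h j * h j ^ (e' - Suc e))" by (metis power_add power_one_right)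
    then show "h j ^ e' * G e' = h j ^ e * (h j * (h j ^ (e' - Suc e) * G e'))" by (simp add: mult.assoc)
  qed
  also have "h j ^ e * G e + \<dots> = h j ^ e * (G e + h j * (\<Sum>e'\<in>{Suc e..<D}. h j ^ (e' - Suc e) * G e'))"
    by (simp add: distrib_left sum_distrib_left)
  finally have sum_eq: "(\<Sum>e'<D. h j ^ e' * G e') = h j ^ e * (G e + h j * (\<Sum>e'\<in>{Suc e..<D}. h j ^ (e' - Suc e) * G e'))" .
  let ?r = "h j * (\<Sum>e'\<in>{Suc e..<D}. h j ^ (e' - Suc e) * G e')"
  have idl: "is_idl (qc (Suc j))" using prm[of "Suc j"] step.hyps by (simp add: is_prmD)
  have r: "?r \<in> qc (Suc j)" using h(1)[of j] step.hyps by (intro is_idlD(4)[OF idl]) auto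
  have "G e + ?r \<notin> qc (Suc j)"
  proof
    assume "G e + ?r \<in> qc (Suc j)"
    then have "(G e + ?r) - ?r \<in> qc (Suc j)" by (intro is_idlD(6)[OF idl] r)
    then show False using Ge by simp
  qed
  then have "G e + ?r \<notin> qc j" using sub[of j] step.hyps by auto
  moreover have "h j ^ e \<notin> qc j" using is_prm_power[OF prm h(2), of j e] step.hyps by simp
  ultimately have "h j ^ e * (G e + ?r) \<notin> qc j"
    using is_prmD(3)[OF prm, of j "h j ^ e" "G e + ?r"] step.hyps by auto
  then show ?case unfolding eq sum_eq .
qed

theorem (in height_setting) chain_length_le:
  assumes prm: "\<And>i. i \<le> d \<Longrightarrow> is_prm (qc i)" and p_eq: "qc d = p"
    and sub: "\<And>i. i < d \<Longrightarrow> qc i \<subseteq> qc (Suc i)"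
    and strict: "\<And>i. i < d \<Longrightarrow> \<exists>h\<in>poly_in {..<n}. h \<in> qc (Suc i) \<and> h \<notin> qc i"
  shows "d \<le> c"
proof (rule ccontr)
  assume "\<not> d \<le> c"
  then have d: "Suc c \<le> d" by simp
  obtain h where h: "\<And>i. i < d \<Longrightarrow> h i \<in> P" "\<And>i. i < d \<Longrightarrow> h i \<in> qc (Suc i)" "\<And>i. i < d \<Longrightarrow> h i \<notin> qc i"
    using strict by metis
  let ?Z = "{..<n} - Y"
  have YZ: "Y \<union> ?Z = {..<n}" "Y \<inter> ?Z = {}" using Y by auto
  let ?Q = "taylor_power ?Z p"
  have "\<exists>C. \<forall>k. \<exists>M. finite M \<and> card M \<le> C * Suc k ^ c \<and> (\<forall>F\<in>P. F \<in> RG M (?Q (Suc k)))"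
  proof (rule RG_Q)
    show "1 \<in> ?Q 0" by (simp add: taylor_power_def)
    show "x \<in> ?Q 1" if "x \<in> p" for x by (rule ideal_subset_taylor_power[OF that])
  qed (auto intro: is_idl_taylor_power[OF p_idl] taylor_power_mult[OF p_idl])
  then obtain C where C: "\<And>k. \<exists>M. finite M \<and> card M \<le> C * Suc k ^ c \<and> (\<forall>F\<in>P. F \<in> RG M (?Q (Suc k)))"
    by blast
  \<comment> \<open>A common bound for the degrees of all \<open>h i\<close> in the variables of
    \<open>?Z\<close>.\<close>
  define \<delta> where "\<delta> = (\<Sum>i<d. \<Sum>m\<in>mkeys (h i). mdeg ?Z m)"
  have \<delta>: "mdeg_le ?Z \<delta> (h i)" if i: "i < d" for i
    unfolding mdeg_le_def
  proof
    fix m assume "m \<in> mkeys (h i)"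
    then have "mdeg ?Z m \<le> (\<Sum>m\<in>mkeys (h i). mdeg ?Z m)" by (intro member_le_sum) auto
    also have "\<dots> \<le> \<delta>" unfolding \<delta>_def using i by (intro member_le_sum[of i]) auto
    finally show "mdeg ?Z m \<le> \<delta>" .
  qed
  \<comment> \<open>There are D^d monomials with exponents below D, of degree at most k = d D
    \<delta> in \<open>?Z\<close>. As k + 1 \<le> D (d \<delta> + 1) and D exceeds C (d \<delta> +
    1)^c, the dimension C (k + 1)^c is less than D^(c + 1), which is at most D^d if d > c.\<close>
  define D where "D = C * (d * \<delta> + 1) ^ c + 1"
  define k where "k = d * (D * \<delta>)"
  obtain M where M: "finite M" "card M \<le> C * Suc k ^ c" "\<And>F. F \<in> P \<Longrightarrow> F \<in> RG M (?Q (Suc k))"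
    using C[of k] by blast
  let ?T = "PiE {0..<d} (\<lambda>_. {..<D})"
  let ?w = "\<lambda>t. \<Prod>i\<in>{0..<d}. h i ^ t i"
  have "card M < card ?T"
  proof -
    have "Suc k \<le> D * (d * \<delta> + 1)" by (simp add: k_def D_def algebra_simps)
    then have "Suc k ^ c \<le> D ^ c * (d * \<delta> + 1) ^ c" by (metis power_mono power_mult_distrib zero_le)
    then have "C * Suc k ^ c \<le> D ^ c * (C * (d * \<delta> + 1) ^ c)" by (metis mult.left_commute mult_le_mono2)
    also have "\<dots> < D ^ c * D" by (simp add: D_def)
    also have "D ^ c * D = D ^ Suc c" by simp
    also have "\<dots> \<le> D ^ d" by (rule power_increasing[OF d]) (simp add: D_def)
    finally show ?thesis using M(2) by (simp add: card_PiE)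
  qed
  moreover have "finite ?T" by (auto intro: finite_PiE)
  moreover have w: "?w t \<in> P" for t using h(1) by (auto intro!: poly_in_prod poly_in_power)
  ultimately have "\<exists>a. (\<forall>t\<in>?T. a t \<in> poly_in Y) \<and> (\<exists>t\<in>?T. a t \<noteq> 0) \<and> (\<Sum>t\<in>?T. a t * ?w t) \<in> ?Q (Suc k)"
    by (intro RG_dependence[OF is_idl_taylor_power[OF p_idl] M(1)] M(3))
  then obtain a where a: "\<And>t. t \<in> ?T \<Longrightarrow> a t \<in> poly_in Y" "\<exists>t\<in>?T. a t \<noteq> 0"
    and F: "(\<Sum>t\<in>?T. a t * ?w t) \<in> ?Q (Suc k)" by blast
  let ?F = "\<Sum>t\<in>?T. a t * ?w t"
  \<comment> \<open>Lying outside the smallest prime of the chain makes the relation a nonzero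
    polynomial, which its degree of at most \<open>k\<close> in \<open>?Z\<close> forbids.\<close>
  have "?F \<notin> qc 0"
    by (rule chain_monomials_independent[OF prm p_eq sub h(2,3) _ a]) auto
  moreover have "?F = 0"
  proof (rule taylor_power_degree[OF Y_p _ F _ p_idl])
    show "?F \<in> poly_in (Y \<union> ?Z)" unfolding YZ(1) using w a(1) by (auto intro!: poly_in_sum poly_in_mult intro: Y_P)
    have "mdeg_le ?Z k ?F"
    proof (rule mdeg_le_sum)
      fix t assume t: "t \<in> ?T"
      have "mdeg_le ?Z (D * \<delta>) (h i ^ t i)" if "i \<in> {0..<d}" for i
        by (rule mdeg_le_mono[OF mdeg_le_power[OF \<delta>]]) (use that PiE_mem[OF t that] in \<open>auto intro!: mult_right_mono\<close>)
      then have "mdeg_le ?Z (card {0..<d} * (D * \<delta>)) (?w t)" by (intro mdeg_le_prod) auto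
      then show "mdeg_le ?Z k (a t * ?w t)"
        using mdeg_le_mult[OF mdeg_le_coeff[OF a(1)[OF t] YZ(2)]] by (simp add: k_def)
    qed
    then show "mdeg ?Z m < Suc k" if "m \<in> mkeys ?F" for m using that by (auto simp: mdeg_le_def)
  qed
  ultimately show False using is_idlD(1)[OF is_prmD(1)[OF prm[of 0]]] by simp
qed

section \<open>Prime ideals from maximal multiplicative sets\<close>

definition mult_closed :: "'a::comm_ring_1 set \<Rightarrow> bool" where
  "mult_closed S \<longleftrightarrow> 1 \<in> S \<and> (\<forall>x\<in>S. \<forall>y\<in>S. x * y \<in> S)"

lemma mult_closed_power: "mult_closed S \<Longrightarrow> x \<in> S \<Longrightarrow> x ^ k \<in> S"
  by (induction k) (auto simp: mult_closed_def)

lemma maximal_mult_closed_exists: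
  assumes "mult_closed S0" "S0 \<inter> J = {}"
  shows "\<exists>S. (mult_closed S \<and> S0 \<subseteq> S \<and> S \<inter> J = {}) \<and>
    (\<forall>T. mult_closed T \<and> S \<subseteq> T \<and> T \<inter> J = {} \<longrightarrow> T = S)"
proof -
  let ?A = "{S. mult_closed S \<and> S0 \<subseteq> S \<and> S \<inter> J = {}}"
  have "\<exists>M\<in>?A. \<forall>S\<in>?A. M \<subseteq> S \<longrightarrow> S = M"
  proof (rule subset_Zorn_nonempty)
    show "?A \<noteq> {}" using assms by auto
  next
    fix C assume C: "C \<noteq> {}" "subset.chain ?A C"
    have "x * y \<in> \<Union>C" if xy: "x \<in> \<Union>C" "y \<in> \<Union>C" for x y
    proof -
      obtain S T where ST: "S \<in> C" "x \<in> S" "T \<in> C" "y \<in> T" using xy by auto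
      then have "S \<subseteq> T \<or> T \<subseteq> S" using C(2) by (auto simp: subset_chain_def)
      then obtain U where "U \<in> C" "x \<in> U" "y \<in> U" using ST by auto
      moreover have "mult_closed U" using C(2) \<open>U \<in> C\<close> by (auto simp: subset_chain_def)
      ultimately show ?thesis unfolding mult_closed_def by blast
    qed
    moreover obtain S1 where S1: "S1 \<in> C" using C(1) by auto
    moreover have A: "S \<in> ?A" if "S \<in> C" for S using C(2) that by (auto simp: subset_chain_def)
    moreover have "1 \<in> \<Union>C" "S0 \<subseteq> \<Union>C" using A[OF S1] S1 by (auto simp: mult_closed_def)
    moreover have "\<Union>C \<inter> J = {}" using A by blast
    ultimately show "\<Union>C \<in> ?A" unfolding mult_closed_def by blast
  qed
  then obtain S where S: "S \<in> ?A" and max: "\<forall>T\<in>?A. S \<subseteq> T \<longrightarrow> T = S" by (rule bexE)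
  show ?thesis
  proof (intro exI[of _ S] conjI allI impI)
    fix T assume T: "mult_closed T \<and> S \<subseteq> T \<and> T \<inter> J = {}"
    then have "T \<in> ?A" using S by auto
    then show "T = S" using max T by simp
  qed (use S in auto)
qed

text \<open>If x is outside S, the multiplicative set generated by S and x must meet J, which is the
  radical statement. It implies that the complement of S is closed under sums: in (x + y)^(k + l)
  every term contains x^k or y^l. This provides a minimal prime together with the nilpotence that
  \<open>height_setting\<close> asks for.\<close>

lemma
  assumes J: "is_idl J" and S: "mult_closed S" "S \<inter> J = {}"
    and max: "\<And>T. mult_closed T \<Longrightarrow> S \<subseteq> T \<Longrightarrow> T \<inter> J = {} \<Longrightarrow> T = S"
  shows maximal_mult_closed_radical: "\<And>x. x \<notin> S \<Longrightarrow> \<exists>s k. s \<in> S \<and> s * x ^ k \<in> J"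
    and maximal_mult_closed_prime: "is_prm (- S)"
proof -
  show rad: "\<exists>s k. s \<in> S \<and> s * x ^ k \<in> J" if x: "x \<notin> S" for x
  proof (rule ccontr)
    assume no: "\<not> (\<exists>s k. s \<in> S \<and> s * x ^ k \<in> J)"
    let ?T = "{s * x ^ k | s k. s \<in> S}"
    have "mult_closed ?T"
      unfolding mult_closed_def
    proof (intro conjI ballI)
      show "1 \<in> ?T" using S(1) by (intro CollectI exI[of _ 1] exI[of _ 0]) (auto simp: mult_closed_def)
    next
      fix a b assume "a \<in> ?T" "b \<in> ?T"
      then obtain s k t l where "a = s * x ^ k" "s \<in> S" "b = t * x ^ l" "t \<in> S" by auto
      then show "a * b \<in> ?T" using S(1)
        by (intro CollectI exI[of _ "s * t"] exI[of _ "k + l"]) (auto simp: mult_closed_def power_add ac_simps)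
    qed
    moreover have "S \<subseteq> ?T" by (force intro: exI[of _ 0])
    moreover have "?T \<inter> J = {}" using no by auto
    ultimately have "?T = S" by (rule max)
    moreover have "x \<in> ?T" using S(1) by (intro CollectI exI[of _ 1] exI[of _ 1]) (auto simp: mult_closed_def)
    ultimately show False using x by auto
  qed
  have mult: "a * b \<in> S" if "a \<in> S" "b \<in> S" for a b using S(1) that by (auto simp: mult_closed_def)
  show "is_prm (- S)"
    unfolding is_prm_def is_idl_def
  proof (intro conjI ballI allI impI)
    show "0 \<in> - S" using S(2) is_idlD(1)[OF J] by auto
    show "1 \<notin> - S" using S(1) by (auto simp: mult_closed_def)
    show "x \<in> - S \<or> y \<in> - S" if "x * y \<in> - S" for x y using that mult by auto
  next
    fix c x assume "x \<in> - S"
    then obtain s k where s: "s \<in> S" "s * x ^ k \<in> J" using rad[of x] by auto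
    show "c * x \<in> - S"
    proof
      assume "c * x \<in> S"
      then have "s * (c * x) ^ k \<in> S" by (intro mult[OF s(1) mult_closed_power[OF S(1)]])
      moreover have "s * (c * x) ^ k = c ^ k * (s * x ^ k)" by (simp add: power_mult_distrib ac_simps)
      ultimately show False using S(2) is_idlD(3)[OF J s(2), of "c ^ k"] by auto
    qed
  next
    fix x y assume "x \<in> - S" "y \<in> - S"
    then obtain s k t l where s: "s \<in> S" "s * x ^ k \<in> J" "t \<in> S" "t * y ^ l \<in> J" using rad[of x] rad[of y] by auto
    show "x + y \<in> - S"
    proof
      assume "x + y \<in> S"
      then have in_S: "(s * t) * (x + y) ^ (k + l) \<in> S" by (intro mult[OF mult[OF s(1) s(3)] mult_closed_power[OF S(1)]])
      have "(s * t) * (of_nat ((k + l) choose i) * x ^ i * y ^ (k + l - i)) \<in> J" if "i \<le> k + l" for i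
      proof (cases "k \<le> i")
        case True
        then have "x ^ i = x ^ k * x ^ (i - k)" by (simp add: power_add[symmetric])
        then have eq: "(s * t) * (of_nat ((k + l) choose i) * x ^ i * y ^ (k + l - i)) =
          (t * of_nat ((k + l) choose i) * x ^ (i - k) * y ^ (k + l - i)) * (s * x ^ k)" by (simp add: ac_simps)
        show ?thesis unfolding eq by (rule is_idlD(3)[OF J s(2)])
      next
        case False
        then have "y ^ (k + l - i) = y ^ l * y ^ (k - i)" using that by (simp add: power_add[symmetric] add.commute)
        then have eq: "(s * t) * (of_nat ((k + l) choose i) * x ^ i * y ^ (k + l - i)) =
          (s * of_nat ((k + l) choose i) * x ^ i * y ^ (k - i)) * (t * y ^ l)" by (simp add: ac_simps)
        show ?thesis unfolding eq by (rule is_idlD(3)[OF J s(4)])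
      qed
      then have "(s * t) * (x + y) ^ (k + l) \<in> J"
        unfolding binomial_ring sum_distrib_left by (intro is_idl_sum[OF J]) auto
      then show False using in_S S(2) by auto
    qed
  qed
qed

section \<open>Ideals of the polynomial ring\<close>

lemma mpoly_ring_simps [simp]:
  "carrier (mpoly_ring n) = poly_in {..<n}" "x \<otimes>\<^bsub>mpoly_ring n\<^esub> y = x * y" "x \<oplus>\<^bsub>mpoly_ring n\<^esub> y = x + y"
  "\<one>\<^bsub>mpoly_ring n\<^esub> = 1" "\<zero>\<^bsub>mpoly_ring n\<^esub> = 0"
  by (simp_all add: mpoly_ring_def poly_in_def ring_of_type_algebra_def)

lemma cring_mpoly_ring: "cring (mpoly_ring n :: 'k::field mpol ring)"
proof (rule cringI)
  show "abelian_group (mpoly_ring n :: 'k mpol ring)"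
    by (rule abelian_groupI)
      (auto simp: add.assoc add.commute intro: poly_in_add poly_in_uminus intro!: bexI[of _ "- _"])
  show "comm_monoid (mpoly_ring n :: 'k mpol ring)"
    by (rule comm_monoidI) (auto simp: ac_simps intro: poly_in_mult)
qed (simp add: distrib_right)

lemma a_inv_mpoly_ring: "x \<in> poly_in {..<n} \<Longrightarrow> \<ominus>\<^bsub>mpoly_ring n\<^esub> x = - (x :: 'k::field mpol)"
proof -
  interpret cring "mpoly_ring n :: 'k mpol ring" by (rule cring_mpoly_ring)
  assume "x \<in> poly_in {..<n}"
  then show ?thesis using minus_equality[of "- x" x] poly_in_uminus[of x] by simp
qed

lemma a_minus_mpoly_ring: "y \<in> poly_in {..<n} \<Longrightarrow> x \<ominus>\<^bsub>mpoly_ring n\<^esub> y = x - (y :: 'k::field mpol)"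
  by (simp add: a_minus_def a_inv_mpoly_ring)

lemma ideal_mpoly_ringI:
  fixes J :: "'k::field mpol set"
  assumes "J \<subseteq> poly_in {..<n}" "0 \<in> J" "\<And>x y. x \<in> J \<Longrightarrow> y \<in> J \<Longrightarrow> x + y \<in> J"
    and "\<And>a x. a \<in> poly_in {..<n} \<Longrightarrow> x \<in> J \<Longrightarrow> a * x \<in> J"
  shows "ideal J (mpoly_ring n)"
proof (rule idealI)
  interpret cring "mpoly_ring n :: 'k mpol ring" by (rule cring_mpoly_ring)
  show "ring (mpoly_ring n :: 'k mpol ring)" by (rule ring_axioms)
  show "subgroup J (add_monoid (mpoly_ring n))"
  proof (rule add.subgroupI)
    fix x assume "x \<in> J"
    then show "\<ominus>\<^bsub>mpoly_ring n\<^esub> x \<in> J"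
      using assms(1) assms(4)[of "- 1" x] by (auto simp: a_inv_mpoly_ring poly_in_uminus)
  qed (use assms in auto)
  have "x * a \<in> J" if "a \<in> poly_in {..<n}" "x \<in> J" for a x using assms(4)[OF that] by (simp add: mult.commute)
  then show "a \<in> J \<Longrightarrow> x \<in> carrier (mpoly_ring n) \<Longrightarrow> a \<otimes>\<^bsub>mpoly_ring n\<^esub> x \<in> J"
    "a \<in> J \<Longrightarrow> x \<in> carrier (mpoly_ring n) \<Longrightarrow> x \<otimes>\<^bsub>mpoly_ring n\<^esub> a \<in> J" for a x
    using assms(4) by auto
qed

lemma ideal_mpoly_ringD:
  fixes J :: "'k::field mpol set"
  assumes "ideal J (mpoly_ring n)"
  shows "J \<subseteq> poly_in {..<n}" "0 \<in> J" "x \<in> J \<Longrightarrow> y \<in> J \<Longrightarrow> x + y \<in> J"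
    "a \<in> poly_in {..<n} \<Longrightarrow> x \<in> J \<Longrightarrow> a * x \<in> J"
  using additive_subgroup.a_subset[OF ideal.axioms(1)[OF assms]] additive_subgroup.zero_closed[OF ideal.axioms(1)[OF assms]]
    additive_subgroup.a_closed[OF ideal.axioms(1)[OF assms], of x y] ideal.I_l_closed[OF assms, of x a]
  by auto

text \<open>The ideal generated by \<open>J\<close> and the variables from the n-th on, if
  \<open>J\<close> is an ideal of \<open>mpoly_ring n\<close>: the residue ring is unchanged, but
  the ideal lives in the whole polynomial type.\<close>

definition ext_ideal :: "nat \<Rightarrow> 'k::field mpol set \<Rightarrow> 'k mpol set" where
  "ext_ideal n J = {F. retr n F \<in> J}"

lemma ext_ideal_iff: "F \<in> poly_in {..<n} \<Longrightarrow> F \<in> ext_ideal n J \<longleftrightarrow> F \<in> J"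
  by (simp add: ext_ideal_def retr_id)

lemma is_idl_ext_ideal: "ideal J (mpoly_ring n) \<Longrightarrow> is_idl (ext_ideal n J)"
  unfolding is_idl_def ext_ideal_def
  by (auto simp: retr_hom ideal_mpoly_ringD intro: ideal_mpoly_ringD(4)[OF _ retr_in])

lemma ext_ideal_retr: "ideal J (mpoly_ring n) \<Longrightarrow> F - retr n F \<in> ext_ideal n J"
  by (simp add: ext_ideal_def retr_hom retr_id retr_in ideal_mpoly_ringD)

lemma is_prm_ext_ideal:
  assumes "primeideal q (mpoly_ring n)"
  shows "is_prm (ext_ideal n q)"
proof -
  interpret primeideal q "mpoly_ring n" by fact
  have "1 \<notin> q"
  proof
    assume "1 \<in> q"
    then have "a \<in> q" if "a \<in> poly_in {..<n}" for a using ideal_mpoly_ringD(4)[OF is_ideal that, of 1] by simp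
    then show False using I_notcarr ideal_mpoly_ringD(1)[OF is_ideal] by auto
  qed
  moreover have "x \<in> ext_ideal n q \<or> y \<in> ext_ideal n q" if "x * y \<in> ext_ideal n q" for x y
    using that I_prime[of "retr n x" "retr n y"] by (simp add: ext_ideal_def retr_hom retr_in)
  ultimately show ?thesis
    using is_idl_ext_ideal[OF is_ideal] by (auto simp: is_prm_def ext_ideal_def retr_hom)
qed

lemma primeideal_of_is_prm:
  fixes p :: "'k::field mpol set"
  assumes p: "is_prm p"
  shows "primeideal (p \<inter> poly_in {..<n}) (mpoly_ring n)"
proof (rule primeidealI)
  note idl = is_prmD(1)[OF p]
  show "ideal (p \<inter> poly_in {..<n}) (mpoly_ring n)"
    by (rule ideal_mpoly_ringI) (auto intro: is_idlD(1,2,3)[OF idl] poly_in_add poly_in_mult)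
  show "cring (mpoly_ring n :: 'k mpol ring)" by (rule cring_mpoly_ring)
  show "carrier (mpoly_ring n) \<noteq> p \<inter> poly_in {..<n}" 
  proof
    assume "carrier (mpoly_ring n) = p \<inter> poly_in {..<n}"
    moreover have "(1 :: 'k mpol) \<in> carrier (mpoly_ring n)" by simp
    ultimately show False using is_prmD(2)[OF p] by blast
  qed
qed (use is_prmD(3)[OF p] in auto)

text \<open>The complement of a maximal multiplicative set \<open>S\<close> disjoint from \<open>I\<close> is a minimal prime
  over \<open>I\<close>. Its height is bounded as in Krull's theorem if some multiplier in \<open>S\<close> carries \<open>I\<close>
  into an ideal with \<open>c\<close> generators.\<close>

lemma prime_height_le:
  fixes I :: "'k::field mpol set" and g :: "nat \<Rightarrow> 'k mpol"
  assumes I: "ideal I (mpoly_ring n)" and S: "mult_closed S" "S \<inter> ext_ideal n I = {}"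
    and max: "\<And>T. mult_closed T \<Longrightarrow> S \<subseteq> T \<Longrightarrow> T \<inter> ext_ideal n I = {} \<Longrightarrow> T = S"
    and u: "u \<in> poly_in {..<n}" "u \<in> S"
    and g: "\<And>i. i < c \<Longrightarrow> g i \<in> I"
    and gen: "\<And>x. x \<in> I \<Longrightarrow> \<exists>H. (\<forall>i<c. H i \<in> poly_in {..<n}) \<and> u * x = (\<Sum>i<c. H i * g i)"
  shows "minimal_prime_over (mpoly_ring n) I (- S \<inter> poly_in {..<n})"
    and "prime_height (mpoly_ring n) (- S \<inter> poly_in {..<n}) \<le> enat c"
proof -
  let ?R = "mpoly_ring n :: 'k mpol ring" and ?J = "ext_ideal n I" and ?P = "poly_in {..<n} :: 'k mpol set"
  have J: "is_idl ?J" by (rule is_idl_ext_ideal[OF I])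
  have prm: "is_prm (- S)" by (rule maximal_mult_closed_prime[OF J S max])
  have J_S: "?J \<subseteq> - S" using S(2) by auto
  \<comment> \<open>The prime contains the extension of \<open>I\<close>, hence all differences
    \<open>F - retr n F\<close>, so membership in it is decided by the retraction.\<close>
  have ext_eq: "ext_ideal n (- S \<inter> ?P) = - S"
  proof -
    have "F \<in> - S \<longleftrightarrow> retr n F \<in> - S" for F
    proof -
      have d: "F - retr n F \<in> - S" using ext_ideal_retr[OF I] J_S by auto
      show ?thesis using is_idlD(6)[OF is_prmD(1)[OF prm] _ d, of F] is_idlD(2)[OF is_prmD(1)[OF prm] d, of "retr n F"] by auto
    qed
    then show ?thesis by (auto simp: ext_ideal_def retr_in)
  qed
  show "minimal_prime_over ?R I (- S \<inter> ?P)"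
    unfolding minimal_prime_over_def
  proof (intro conjI allI impI)
    show "primeideal (- S \<inter> ?P) ?R" by (rule primeideal_of_is_prm[OF prm])
    show "I \<subseteq> - S \<inter> ?P" using J_S ideal_mpoly_ringD(1)[OF I] by (auto simp: ext_ideal_iff subset_eq)
    fix q assume q: "primeideal q ?R \<and> I \<subseteq> q \<and> q \<subseteq> - S \<inter> ?P"
    have q_prm: "is_prm (ext_ideal n q)" using q is_prm_ext_ideal by blast
    \<comment> \<open>A smaller prime over \<open>I\<close> has a larger complement, which is again
      multiplicative and disjoint from \<open>I\<close>; maximality of \<open>S\<close> leaves no
      room.\<close>
    have "- ext_ideal n q = S"
    proof (rule max)
      show "mult_closed (- ext_ideal n q)" using q_prm by (auto simp: is_prm_def mult_closed_def)
      show "S \<subseteq> - ext_ideal n q" using q ext_eq by (auto simp: ext_ideal_def)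
      show "- ext_ideal n q \<inter> ?J = {}" using q by (auto simp: ext_ideal_def)
    qed
    then show "q = - S \<inter> ?P" using q ext_ideal_iff[of _ n q] by auto
  qed
  show "prime_height ?R (- S \<inter> ?P) \<le> enat c"
    unfolding prime_height_def
  proof (rule Sup_least)
    fix e assume "e \<in> {enat d |d. \<exists>q. (\<forall>i\<le>d. primeideal (q i) ?R) \<and> (\<forall>i<d. q i \<subset> q (Suc i)) \<and> q d = - S \<inter> ?P}"
    then obtain d q where e: "e = enat d" and q: "\<And>i. i \<le> d \<Longrightarrow> primeideal (q i) ?R"
      "\<And>i. i < d \<Longrightarrow> q i \<subset> q (Suc i)" "q d = - S \<inter> ?P" by blast
    let ?indep = "\<lambda>Y. Y \<subseteq> {..<n} \<and> (\<forall>x\<in>poly_in Y. x \<in> - S \<longrightarrow> x = 0)"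
    have const: "x = 0" if x: "x \<in> poly_in {}" "x \<in> - S" for x
    proof -
      have "x = const (coef x 0)"
      proof (rule poly_mapping_eqI)
        fix m
        show "coef x m = coef (const (coef x 0)) m"
          using x(1) by (auto simp: const_def lookup_single when_def poly_in_def in_keys_iff)
      qed
      moreover have "const (inverse (coef x 0)) * x \<in> - S" by (rule is_idlD(3)[OF is_prmD(1)[OF prm] x(2)])
      ultimately show ?thesis
        using is_prmD(2)[OF prm] by (metis const_mult const_one const_zero left_inverse)
    qed
    \<comment> \<open>An independent set of variables of largest cardinality is a transcendence
      basis; the empty set qualifies by \<open>const\<close>, because a nonzero constant in the
      prime would be a unit.\<close>
    obtain Y where Y: "?indep Y" and Y_max: "\<And>Y'. ?indep Y' \<Longrightarrow> card Y' \<le> card Y"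
      using ex_has_greatest_nat[of ?indep "{}" card "Suc n"] const
      by (metis (no_types, lifting) card_lessThan card_mono empty_subsetI finite_lessThan less_Suc_eq_le)
    have rad: "\<exists>s k. s \<in> S \<and> s * x ^ k \<in> ?J" if "x \<notin> S" for x
      by (rule maximal_mult_closed_radical[OF J S max that])
    interpret height_setting n c Y "- S" ?J g u
    proof
      show "is_prm (- S)" by (rule prm)
      show "Y \<subseteq> {..<n}" "\<And>x. x \<in> poly_in Y \<Longrightarrow> x \<in> - S \<Longrightarrow> x = 0" using Y by auto
      fix z assume z: "z < n" "z \<notin> Y"
      then have "card (insert z Y) > card Y" using Y finite_subset[of Y "{..<n}"] by simp
      then have "\<not> ?indep (insert z Y)" using Y_max[of "insert z Y"] by auto
      then show "\<exists>F\<in>poly_in (insert z Y). F \<in> - S \<and> F \<noteq> 0" using Y z by auto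
    next
      show "\<exists>s k. s \<notin> - S \<and> s * x ^ k \<in> ?J" if "x \<in> - S" for x
        using rad[of x] that by simp
      show "\<exists>w'\<in>?P. w - w' \<in> ?J" for w using ext_ideal_retr[OF I] retr_in by blast
      show "g i \<in> ?P \<inter> ?J" if "i < c" for i
        using g[OF that] ideal_mpoly_ringD(1)[OF I] by (auto simp: ext_ideal_iff subset_eq)
      show "\<exists>H. (\<forall>i<c. H i \<in> ?P) \<and> u * x = (\<Sum>i<c. H i * g i)" if "x \<in> ?J \<inter> ?P" for x
        using gen that by (auto simp: ext_ideal_iff)
    qed (use J J_S u in auto)
    have "d \<le> c"
    proof (rule chain_length_le)
      show "is_prm (ext_ideal n (q i))" if "i \<le> d" for i by (rule is_prm_ext_ideal[OF q(1)[OF that]])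
      show "ext_ideal n (q d) = - S" unfolding q(3) by (rule ext_eq)
      show "ext_ideal n (q i) \<subseteq> ext_ideal n (q (Suc i))" if "i < d" for i
        using q(2)[OF that] by (auto simp: ext_ideal_def)
      show "\<exists>h\<in>?P. h \<in> ext_ideal n (q (Suc i)) \<and> h \<notin> ext_ideal n (q i)" if i: "i < d" for i
      proof -
        obtain h where h: "h \<in> q (Suc i)" "h \<notin> q i" using q(2)[OF i] by auto
        have "h \<in> ?P" using h(1) q(1)[of "Suc i"] i ideal_mpoly_ringD(1)[OF primeideal.axioms(1)] by (meson Suc_leI subsetD)
        then show ?thesis using h by (auto simp: ext_ideal_iff)
      qed
    qed
    then show "e \<le> enat c" by (simp add: e)
  qed
qed

lemma a_coset_eq_iff:
  fixes J :: "'k::field mpol set"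
  assumes "ideal J (mpoly_ring n)" "x \<in> poly_in {..<n}" "y \<in> poly_in {..<n}"
  shows "J +>\<^bsub>mpoly_ring n\<^esub> x = J +>\<^bsub>mpoly_ring n\<^esub> y \<longleftrightarrow> x - y \<in> J"
  using ring.quotient_eq_iff_same_a_r_cos[OF cring.axioms(1)[OF cring_mpoly_ring] assms(1), of x y] assms
  by (simp add: a_minus_mpoly_ring)

lemma a_coset_eq_self_iff:
  assumes "ideal J S" "x \<in> carrier S"
  shows "J +>\<^bsub>S\<^esub> x = J \<longleftrightarrow> x \<in> J"
proof -
  interpret ideal J S by fact
  show ?thesis using a_rcos_const a_rcos_self[OF assms(2)] by auto
qed

text \<open>With \<open>V\<close> the polynomial ring this is the ideal generated by the
  \<open>fs i\<close>; with \<open>V\<close> this ideal itself it is the square of that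
  ideal.\<close>

definition gen_ideal :: "'k::field mpol set \<Rightarrow> nat \<Rightarrow> (nat \<Rightarrow> 'k mpol) \<Rightarrow> 'k mpol set" where
  "gen_ideal V r fs = {\<Sum>i<r. H i * fs i | H. \<forall>i<r. H i \<in> V}"

lemma ideal_gen_ideal:
  assumes V: "ideal V (mpoly_ring n)" and fs: "\<And>i. i < r \<Longrightarrow> fs i \<in> poly_in {..<n}"
  shows "ideal (gen_ideal V r fs) (mpoly_ring n)"
proof (rule ideal_mpoly_ringI)
  note V' = ideal_mpoly_ringD[OF V]
  show "gen_ideal V r fs \<subseteq> poly_in {..<n}"
    using V'(1) fs by (auto simp: gen_ideal_def intro!: poly_in_sum poly_in_mult)
  show "0 \<in> gen_ideal V r fs"
    unfolding gen_ideal_def by (rule CollectI, rule exI[of _ "\<lambda>_. 0"]) (simp add: V'(2))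
  show "x + y \<in> gen_ideal V r fs" if xy: "x \<in> gen_ideal V r fs" "y \<in> gen_ideal V r fs" for x y
  proof -
    obtain H G where "x = (\<Sum>i<r. H i * fs i)" "y = (\<Sum>i<r. G i * fs i)" "\<forall>i<r. H i \<in> V" "\<forall>i<r. G i \<in> V"
      using xy by (auto simp: gen_ideal_def)
    then show ?thesis unfolding gen_ideal_def
      by (intro CollectI exI[of _ "\<lambda>i. H i + G i"]) (auto simp: distrib_right sum.distrib V'(3))
  qed
  show "a * x \<in> gen_ideal V r fs" if a: "a \<in> poly_in {..<n}" "x \<in> gen_ideal V r fs" for a x
  proof -
    obtain H where "x = (\<Sum>i<r. H i * fs i)" "\<forall>i<r. H i \<in> V" using a(2) by (auto simp: gen_ideal_def)
    then show ?thesis using a(1) unfolding gen_ideal_def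
      by (intro CollectI exI[of _ "\<lambda>i. a * H i"]) (auto simp: sum_distrib_left mult.assoc V'(4))
  qed
qed

lemma ideal_poly_in: "ideal (poly_in {..<n} :: 'k::field mpol set) (mpoly_ring n)"
  by (rule ideal_mpoly_ringI) (auto intro: poly_in_add poly_in_mult)

lemma gen_mem_gen_ideal: "l < r \<Longrightarrow> fs l \<in> gen_ideal (poly_in {..<n}) r fs"
proof -
  assume l: "l < r"
  have "(\<Sum>i<r. (if i = l then 1 else 0) * fs i) = (\<Sum>i<r. if i = l then fs l else 0)"
    by (rule sum.cong) auto
  also have "\<dots> = fs l" using l by simp
  finally show ?thesis unfolding gen_ideal_def
    by (intro CollectI exI[of _ "\<lambda>i. if i = l then 1 else 0"]) auto
qed

lemma ci_ideal_eq:
  assumes fs: "\<And>i. i < r \<Longrightarrow> fs i \<in> poly_in {..<n}"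
  shows "ci_ideal n r fs = gen_ideal (poly_in {..<n}) r fs"
proof -
  interpret cring "mpoly_ring n :: 'a mpol ring" by (rule cring_mpoly_ring)
  let ?G = "gen_ideal (poly_in {..<n}) r fs"
  have G: "ideal ?G (mpoly_ring n)" by (rule ideal_gen_ideal[OF ideal_poly_in fs])
  have "fs ` {..<r} \<subseteq> ?G" using gen_mem_gen_ideal by auto
  then have 1: "ci_ideal n r fs \<subseteq> ?G" unfolding ci_ideal_def by (rule genideal_minimal[OF G])
  have carr: "fs ` {..<r} \<subseteq> carrier (mpoly_ring n)" using fs by auto
  have idl: "ideal (ci_ideal n r fs) (mpoly_ring n)" unfolding ci_ideal_def by (rule genideal_ideal[OF carr])
  have mem: "fs i \<in> ci_ideal n r fs" if "i < r" for i
    using genideal_self[OF carr] that by (auto simp: ci_ideal_def)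
  have "(\<Sum>i<m. H i * fs i) \<in> ci_ideal n r fs" if "\<forall>i<r. H i \<in> poly_in {..<n}" "m \<le> r" for H m
    using that(2)
  proof (induction m)
    case (Suc m)
    then show ?case using ideal_mpoly_ringD(3,4)[OF idl] mem that(1) by (simp add: Suc_le_eq)
  qed (simp add: ideal_mpoly_ringD(2)[OF idl])
  then have "?G \<subseteq> ci_ideal n r fs" by (auto simp: gen_ideal_def)
  then show ?thesis using 1 by simp
qed

lemma gen_ideal_mono: "V \<subseteq> W \<Longrightarrow> gen_ideal V r fs \<subseteq> gen_ideal W r fs"
  unfolding gen_ideal_def by (rule Collect_mono) blast

section \<open>The Jacobian matrix of a smooth complete intersection\<close>

text \<open>A lift \<open>v\<close> of the identity of \<open>P/I\<close> to a homomorphism \<open>P/I \<rightarrow> P/I\<^sup>2\<close> maps the class of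
  \<open>x\<^sub>j\<close> to the class of \<open>x\<^sub>j + s\<^sub>j\<close> with \<open>s\<^sub>j \<in> I\<close>, hence the class of \<open>p\<close> to the class of
  \<open>p + \<Sum>\<^sub>j \<partial>\<^sub>j p \<cdot> s\<^sub>j\<close>.\<close>

lemma formally_smooth_splitting:
  fixes fs :: "nat \<Rightarrow> 'k::field mpol"
  assumes fs: "\<And>i. i < r \<Longrightarrow> fs i \<in> poly_in {..<n}"
    and smooth: "formally_smooth TYPE('k mpol set) (ring_of_type_algebra :: 'k ring) (coord_ring n r fs) (coord_const n r fs)"
  shows "\<exists>s. (\<forall>j<n. s j \<in> ci_ideal n r fs) \<and>
    (\<forall>i<r. fs i + (\<Sum>j<n. partial_deriv j (fs i) * s j) \<in> gen_ideal (ci_ideal n r fs) r fs)"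
proof -
  let ?R = "mpoly_ring n :: 'k mpol ring" and ?P = "poly_in {..<n} :: 'k mpol set"
  let ?I = "ci_ideal n r fs"
  let ?I2 = "gen_ideal ?I r fs"
  interpret R: cring ?R by (rule cring_mpoly_ring)
  have ci: "?I = gen_ideal ?P r fs" by (rule ci_ideal_eq) (rule fs)
  have I: "ideal ?I ?R" unfolding ci by (rule ideal_gen_ideal[OF ideal_poly_in fs])
  have I2: "ideal ?I2 ?R" by (rule ideal_gen_ideal[OF I fs])
  note ID = ideal_mpoly_ringD[OF I] and I2D = ideal_mpoly_ringD[OF I2]
  have I2_I: "?I2 \<subseteq> ?I"
    using gen_ideal_mono[OF ID(1), of r fs] ci by simp
  have prod_I2: "x * y \<in> ?I2" if xy: "x \<in> ?I" "y \<in> ?I" for x y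
  proof -
    obtain H where H: "y = (\<Sum>i<r. H i * fs i)" "\<forall>i<r. H i \<in> ?P"
      using xy(2) unfolding ci gen_ideal_def by blast
    have "x * y = (\<Sum>i<r. (H i * x) * fs i)" unfolding H(1) sum_distrib_left by (simp add: ac_simps)
    then show ?thesis using H(2) ID(4) xy(1) unfolding gen_ideal_def by (intro CollectI exI[of _ "\<lambda>i. H i * x"]) auto
  qed
  let ?C = "?R Quot ?I2"
  let ?N = "(+>\<^bsub>?R\<^esub>) ?I2 ` ?I"
  have C: "cring ?C" by (rule ideal.quotient_is_cring[OF I2 cring_mpoly_ring])
  interpret C: cring ?C by (rule C)
  have N: "ideal ?N ?C" by (rule R.ring_ideal_imp_quot_ideal[OF I2 I])
  let ?c2 = "\<lambda>p. ?I2 +>\<^bsub>?R\<^esub> p"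
  have hom2: "?c2 \<in> Ring.ring_hom ?R ?C" by (rule ideal.rcos_ring_hom[OF I2])
  have homN: "(+>\<^bsub>?C\<^esub>) ?N \<in> Ring.ring_hom ?C (?C Quot ?N)" by (rule ideal.rcos_ring_hom[OF N])
  have c2_closed: "?c2 p \<in> carrier ?C" if "p \<in> ?P" for p using ring_hom_closed[OF hom2, of p] that by simp
  have c2_add: "?c2 (p + q) = ?c2 p \<oplus>\<^bsub>?C\<^esub> ?c2 q" if "p \<in> ?P" "q \<in> ?P" for p q
    using ring_hom_add[OF hom2, of p q] that by simp
  have c2_mult: "?c2 (p * q) = ?c2 p \<otimes>\<^bsub>?C\<^esub> ?c2 q" if "p \<in> ?P" "q \<in> ?P" for p q
    using ring_hom_mult[OF hom2, of p q] that by simp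
  have c2_eq: "?c2 p = ?c2 q \<longleftrightarrow> p - q \<in> ?I2" if "p \<in> ?P" "q \<in> ?P" for p q
    by (rule a_coset_eq_iff[OF I2 that])
  have c2_N: "?c2 p \<in> ?N \<longleftrightarrow> p \<in> ?I" if p: "p \<in> ?P" for p
  proof
    assume "?c2 p \<in> ?N"
    then obtain x where x: "x \<in> ?I" "?c2 p = ?c2 x" by auto
    then have "p - x \<in> ?I2" using c2_eq[OF p] ID(1) by auto
    then have "(p - x) + x \<in> ?I" using I2_I x(1) by (intro ID(3)) auto
    then show "p \<in> ?I" by simp
  qed auto
  define \<psi> where "\<psi> = (+>\<^bsub>?C\<^esub>) ?N \<circ> ?c2"
  have \<psi>_hom: "\<psi> \<in> Ring.ring_hom ?R (?C Quot ?N)" unfolding \<psi>_def by (rule ring_hom_trans[OF hom2 homN])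
  have \<psi>_ring_hom: "ring_hom_ring ?R (?C Quot ?N) \<psi>"
    by (rule ring_hom_ringI2[OF R.ring_axioms ideal.quotient_is_ring[OF N] \<psi>_hom])
  have \<psi>_eq: "\<psi> p = ?N +>\<^bsub>?C\<^esub> ?c2 p" for p by (simp only: \<psi>_def comp_apply)
  have \<psi>_0: "\<psi> p = ?N \<longleftrightarrow> p \<in> ?I" if "p \<in> ?P" for p
    unfolding \<psi>_eq a_coset_eq_self_iff[OF N c2_closed[OF that]] by (rule c2_N[OF that])
  have zero_CN: "\<zero>\<^bsub>?C Quot ?N\<^esub> = ?N" by (simp only: FactRing_def ring_record_simps)
  have ker: "a_kernel ?R (?C Quot ?N) \<psi> = ?I"
    unfolding a_kernel_def' zero_CN using \<psi>_0 ID(1) by auto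
  \<comment> \<open>The canonical map from P to the quotient of P/I^2 by I/I^2 has kernel I. The
    induced map \<open>u\<close> is the identity of P/I in the shape in which formal smoothness
    lifts it.\<close>
  define u where "u = (\<lambda>T. the_elem (\<psi> ` T))"
  have u_hom: "u \<in> Ring.ring_hom (coord_ring n r fs) (?C Quot ?N)"
    using ring_hom_ring.the_elem_hom[OF \<psi>_ring_hom] unfolding u_def ker coord_ring_def .
  have u: "u (coord_class n r fs p) = \<psi> p" if "p \<in> ?P" for p
    using ring_hom_ring.the_elem_simp[OF \<psi>_ring_hom, of p] that unfolding u_def ker coord_class_def by simp
  define \<gamma> where "\<gamma> c = ?c2 (const c)" for c :: 'k
  have \<gamma>_hom: "\<gamma> \<in> Ring.ring_hom (ring_of_type_algebra :: 'k ring) ?C"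
  proof (rule ring_hom_memI)
    show "\<gamma> \<one>\<^bsub>ring_of_type_algebra\<^esub> = \<one>\<^bsub>?C\<^esub>"
      using ring_hom_one[OF hom2] by (simp add: \<gamma>_def ring_of_type_algebra_def)
  qed (auto simp: \<gamma>_def ring_of_type_algebra_def c2_add c2_mult const_add const_mult intro: c2_closed)
  have \<kappa>: "coord_const n r fs c = coord_class n r fs (const c)" for c
    by (simp add: coord_const_def const_def)
  have N2: "x \<otimes>\<^bsub>?C\<^esub> y = \<zero>\<^bsub>?C\<^esub>" if xy: "x \<in> ?N" "y \<in> ?N" for x y
  proof -
    obtain a b where ab: "a \<in> ?I" "b \<in> ?I" "x = ?c2 a" "y = ?c2 b" using xy by auto
    then have "a \<in> ?P" "b \<in> ?P" using ID(1) by auto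
    then have "x \<otimes>\<^bsub>?C\<^esub> y = ?c2 (a * b)" using ab c2_mult by simp
    also have "\<dots> = ?I2" using a_coset_eq_self_iff[OF I2, of "a * b"] prod_I2[OF ab(1,2)] I2D(1) by auto
    finally show ?thesis by (simp add: FactRing_def)
  qed
  have "\<exists>v\<in>Ring.ring_hom (coord_ring n r fs) ?C. (\<forall>c\<in>carrier (ring_of_type_algebra :: 'k ring). v (coord_const n r fs c) = \<gamma> c) \<and>
    (\<forall>b\<in>carrier (coord_ring n r fs). ?N +>\<^bsub>?C\<^esub> v b = u b)"
    using smooth[unfolded formally_smooth_def, rule_format, of ?C \<gamma> ?N u] C \<gamma>_hom N N2 u_hom
    by (simp add: \<kappa> u \<psi>_def \<gamma>_def)
  then obtain v where v_hom: "v \<in> Ring.ring_hom (coord_ring n r fs) ?C"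
    and v_const: "\<And>c. v (coord_class n r fs (const c)) = ?c2 (const c)"
    and v_lift: "\<And>b. b \<in> carrier (coord_ring n r fs) \<Longrightarrow> ?N +>\<^bsub>?C\<^esub> v b = u b"
    by (auto simp: \<kappa> \<gamma>_def ring_of_type_algebra_def)
  have class_hom: "coord_class n r fs \<in> Ring.ring_hom ?R (coord_ring n r fs)"
    using ideal.rcos_ring_hom[OF I] by (simp add: coord_class_def[abs_def] coord_ring_def)
  define w where "w = v \<circ> coord_class n r fs"
  have w_hom: "w \<in> Ring.ring_hom ?R ?C" unfolding w_def by (rule ring_hom_trans[OF class_hom v_hom])
  have w_closed: "w p \<in> carrier ?C" if "p \<in> ?P" for p using ring_hom_closed[OF w_hom, of p] that by simp
  have "\<exists>t\<in>?P. w p = ?c2 t" if "p \<in> ?P" for p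
    using w_closed[OF that] by (auto simp: FactRing_def A_RCOSETS_def')
  then have "\<forall>j. \<exists>t\<in>?P. j < n \<longrightarrow> w (var j) = ?c2 t"
    by (metis lessThan_iff poly_in_0 poly_in_var)
  then obtain t where t: "\<And>j. t j \<in> ?P" "\<And>j. j < n \<Longrightarrow> w (var j) = ?c2 (t j)" by metis
  define s where "s j = t j - var j" for j
  have var_P: "var j \<in> ?P" if "j < n" for j using that by (intro poly_in_var) simp
  have s_I: "s j \<in> ?I" if j: "j < n" for j
  proof -
    have "?N +>\<^bsub>?C\<^esub> w (var j) = \<psi> (var j)"
      using v_lift[of "coord_class n r fs (var j)"] u[OF var_P[OF j]] ring_hom_closed[OF class_hom, of "var j"] var_P[OF j]
      by (simp add: w_def)
    then have "?N +>\<^bsub>?C\<^esub> ?c2 (t j) = ?N +>\<^bsub>?C\<^esub> ?c2 (var j)" using t(2)[OF j] by (simp only: \<psi>_eq)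
    then have mem: "?c2 (t j) \<ominus>\<^bsub>?C\<^esub> ?c2 (var j) \<in> ?N"
      using ring.quotient_eq_iff_same_a_r_cos[OF C.ring_axioms N c2_closed[OF t(1)] c2_closed[OF var_P[OF j]]] by simp
    have s_P: "s j \<in> ?P" using t(1) var_P[OF j] by (simp add: s_def poly_in_diff)
    have "?c2 (t j) = ?c2 (s j) \<oplus>\<^bsub>?C\<^esub> ?c2 (var j)"
      using c2_add[OF s_P var_P[OF j]] by (simp add: s_def)
    then have "?c2 (t j) \<ominus>\<^bsub>?C\<^esub> ?c2 (var j) = ?c2 (s j)"
      using c2_closed[OF s_P] c2_closed[OF var_P[OF j]] by (simp add: C.minus_eq C.a_assoc C.r_neg)
    then show ?thesis using mem c2_N[OF s_P] by simp
  qed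
  define \<delta> where "\<delta> p = (\<Sum>j<n. partial_deriv j p * s j)" for p
  have s_P: "s j \<in> ?P" if "j < n" for j using s_I[OF that] ID(1) by auto
  have \<delta>_I: "\<delta> p \<in> ?I" if "p \<in> ?P" for p
  proof -
    have "(\<Sum>j<m. partial_deriv j p * s j) \<in> ?I" if "m \<le> n" for m
      using that
    proof (induction m)
      case (Suc m)
      then show ?case using \<open>p \<in> ?P\<close> s_I by (auto intro!: ID(3) ID(4) partial_deriv_in)
    qed (simp add: ID(2))
    then show ?thesis by (simp add: \<delta>_def)
  qed
  have \<delta>_P: "\<delta> p \<in> ?P" if "p \<in> ?P" for p using \<delta>_I[OF that] ID(1) by auto
  \<comment> \<open>The first order formula is compatible with products because its quadratic error
    \<open>\<delta> p * \<delta> q\<close> lies in I^2.\<close>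
  have w: "w p = ?c2 (p + \<delta> p)" if "p \<in> ?P" for p
    using that
  proof (induction rule: poly_in_induct)
    case (const c)
    then show ?case using v_const by (simp add: w_def \<delta>_def)
  next
    case (var j)
    have "\<delta> (var j) = (\<Sum>i<n. if i = j then s j else 0)"
      unfolding \<delta>_def by (rule sum.cong) (auto simp: partial_deriv_var)
    then have "\<delta> (var j) = s j" using var by simp
    then show ?case using t(2)[of j] var by (simp add: s_def)
  next
    case (add p q)
    have "\<delta> (p + q) = \<delta> p + \<delta> q" by (simp add: \<delta>_def partial_deriv_add distrib_right sum.distrib)
    then have eq: "p + q + \<delta> (p + q) = (p + \<delta> p) + (q + \<delta> q)" by simp
    have "w (p + q) = w p \<oplus>\<^bsub>?C\<^esub> w q" using ring_hom_add[OF w_hom, of p q] add by simp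
    also have "\<dots> = ?c2 ((p + \<delta> p) + (q + \<delta> q))"
      unfolding add by (rule c2_add[symmetric]) (use add \<delta>_P in \<open>auto intro: poly_in_add\<close>)
    finally show ?case unfolding eq .
  next
    case (mult p q)
    have \<delta>_mult: "\<delta> (p * q) = p * \<delta> q + q * \<delta> p"
      by (simp add: \<delta>_def partial_deriv_mult sum.distrib sum_distrib_left algebra_simps)
    have "w (p * q) = w p \<otimes>\<^bsub>?C\<^esub> w q" using ring_hom_mult[OF w_hom, of p q] mult by simp
    also have "\<dots> = ?c2 ((p + \<delta> p) * (q + \<delta> q))"
      unfolding mult by (rule c2_mult[symmetric]) (use mult \<delta>_P in \<open>auto intro: poly_in_add\<close>)
    also have "\<dots> = ?c2 (p * q + \<delta> (p * q))"
    proof (subst c2_eq)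
      have "(p + \<delta> p) * (q + \<delta> q) - (p * q + \<delta> (p * q)) = \<delta> p * \<delta> q"
        unfolding \<delta>_mult by (simp add: algebra_simps)
      then show "(p + \<delta> p) * (q + \<delta> q) - (p * q + \<delta> (p * q)) \<in> ?I2" using prod_I2 \<delta>_I mult by simp
    qed (use mult \<delta>_P in \<open>auto intro!: poly_in_add poly_in_mult\<close>)
    finally show ?case .
  qed
  \<comment> \<open>The class of \<open>fs i\<close> in P/I is 0, and therefore so is its
    lift.\<close>
  have "fs i + \<delta> (fs i) \<in> ?I2" if i: "i < r" for i
  proof -
    have mem: "fs i \<in> ?I" using gen_mem_gen_ideal[OF i] ci by simp
    then have "coord_class n r fs (fs i) = coord_class n r fs 0"
      using a_coset_eq_iff[OF I fs[OF i], of 0] by (simp add: coord_class_def)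
    then have "w (fs i) = w 0" by (simp add: w_def)
    then have "?c2 (fs i + \<delta> (fs i)) = ?c2 0" using w[OF fs[OF i]] w[of 0] by (simp add: \<delta>_def)
    then show ?thesis using c2_eq[of "fs i + \<delta> (fs i)" 0] fs[OF i] \<delta>_P by (simp add: poly_in_add)
  qed
  then show ?thesis using s_I by (intro exI[of _ s]) (auto simp: \<delta>_def)
qed

lemma prod_diff_mem_idl:
  assumes J: "is_idl J" and "finite S" "\<And>i. i \<in> S \<Longrightarrow> f i - g i \<in> J"
  shows "prod f S - prod g S \<in> J"
  using assms(2,3)
proof (induction S rule: finite_induct)
  case (insert i S)
  have "f i * prod f S - g i * prod g S = f i * (prod f S - prod g S) + (f i - g i) * prod g S"
    by (simp add: algebra_simps)
  also have "\<dots> \<in> J" using insert by (intro is_idlD(2)[OF J] is_idlD(3)[OF J] is_idlD(4)[OF J]) auto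
  finally show ?case using insert by simp
qed (simp add: is_idlD[OF J])

lemma det_diff_mem_idl:
  assumes J: "is_idl J" and A: "A \<in> carrier_mat r r" "B \<in> carrier_mat r r"
    and "\<And>i j. i < r \<Longrightarrow> j < r \<Longrightarrow> A $$ (i, j) - B $$ (i, j) \<in> J"
  shows "det A - det B \<in> J"
proof -
  have "det A - det B = (\<Sum>p | p permutes {0..<r}. signof p * ((\<Prod>i = 0..<r. A $$ (i, p i)) - (\<Prod>i = 0..<r. B $$ (i, p i))))"
    by (simp add: det_def'[OF A(1)] det_def'[OF A(2)] sum_subtractf right_diff_distrib)
  also have "\<dots> \<in> J"
  proof (intro is_idl_sum[OF J] is_idlD(3)[OF J] prod_diff_mem_idl[OF J])
    fix p i assume "p \<in> {p. p permutes {0..<r}}" "i \<in> {0..<r}"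
    then have "i < r" "p i < r" using permutes_in_image[of p "{0..<r}" i] by auto
    then show "A $$ (i, p i) - B $$ (i, p i) \<in> J" by (rule assms(4))
  qed simp
  finally show ?thesis .
qed

lemma sum_remove_reindex:
  fixes F :: "nat \<Rightarrow> 'a::comm_monoid_add"
  assumes "l < r"
  shows "(\<Sum>k<r. F k) = F l + (\<Sum>k<r - 1. F (if k < l then k else Suc k))"
proof -
  have "(\<Sum>k\<in>{..<r} - {l}. F k) = (\<Sum>k<r - 1. F (if k < l then k else Suc k))"
    by (rule sum.reindex_bij_witness[of _ "\<lambda>k. if k < l then k else Suc k" "\<lambda>k. if k < l then k else k - 1"])
      (use assms in \<open>auto split: if_splits\<close>)
  then show ?thesis using assms by (simp add: sum.remove[of "{..<r}" l])
qed

text \<open>Writing \<open>s\<^sub>j = \<Sum>\<^sub>l a\<^sub>j\<^sub>l f\<^sub>l\<close> in the splitting, the vector \<open>f\<close> is annihilated by a matrix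
  \<open>G \<equiv> 1 - M\<close> modulo \<open>I\<close>, where \<open>M\<close> is minus the product of the Jacobian matrix and \<open>a\<close>. If
  an entry of \<open>G\<close> is outside a prime \<open>m\<close> containing \<open>I\<close>, then near \<open>m\<close> one of the equations is
  superfluous, against the codimension. So \<open>M \<equiv> 1\<close> modulo every such \<open>m\<close>.\<close>

theorem jacobian_right_inverse:
  fixes fs :: "nat \<Rightarrow> 'k::field mpol"
  assumes fs: "\<And>i. i < r \<Longrightarrow> fs i \<in> poly_in {..<n}" and "r \<ge> 1"
    and sci: "smooth_complete_intersection n r fs"
  shows "\<exists>a. \<forall>i<r. \<forall>k<r. (\<Sum>j<n. partial_deriv j (fs i) * a j k) - (if i = k then 1 else 0)
    \<in> ext_ideal n (ci_ideal n r fs)"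
proof -
  let ?R = "mpoly_ring n :: 'k mpol ring" and ?P = "poly_in {..<n} :: 'k mpol set"
  let ?I = "ci_ideal n r fs"
  let ?J = "ext_ideal n ?I"
  have ci: "?I = gen_ideal ?P r fs" by (rule ci_ideal_eq) (rule fs)
  have I: "ideal ?I ?R" unfolding ci by (rule ideal_gen_ideal[OF ideal_poly_in fs])
  note ID = ideal_mpoly_ringD[OF I]
  have J: "is_idl ?J" by (rule is_idl_ext_ideal[OF I])
  have I_J: "?I \<subseteq> ?J" using ID(1) by (auto simp: ext_ideal_iff subset_eq)
  have fsm: "formally_smooth TYPE('k mpol set) (ring_of_type_algebra :: 'k ring) (coord_ring n r fs) (coord_const n r fs)"
    using sci unfolding smooth_complete_intersection_def by (rule conjunct1)
  have "\<exists>s. (\<forall>j<n. s j \<in> ?I) \<and> (\<forall>i<r. fs i + (\<Sum>j<n. partial_deriv j (fs i) * s j) \<in> gen_ideal ?I r fs)"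
    by (rule formally_smooth_splitting[OF _ fsm]) (rule fs)
  then obtain s where s: "\<forall>j<n. s j \<in> ?I" "\<forall>i<r. fs i + (\<Sum>j<n. partial_deriv j (fs i) * s j) \<in> gen_ideal ?I r fs"
    by blast
  have "\<forall>j. \<exists>H. j < n \<longrightarrow> (\<forall>l<r. H l \<in> ?P) \<and> s j = (\<Sum>l<r. H l * fs l)"
    using s(1) unfolding ci gen_ideal_def by blast
  then obtain a where a: "\<And>j l. j < n \<Longrightarrow> l < r \<Longrightarrow> a j l \<in> ?P" "\<And>j. j < n \<Longrightarrow> s j = (\<Sum>l<r. a j l * fs l)"
    by metis
  have "\<forall>i. \<exists>H. i < r \<longrightarrow> (\<forall>l<r. H l \<in> ?I) \<and> fs i + (\<Sum>j<n. partial_deriv j (fs i) * s j) = (\<Sum>l<r. H l * fs l)"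
    using s(2) unfolding gen_ideal_def by blast
  from choice[OF this] obtain b where b': "\<forall>i. i < r \<longrightarrow> (\<forall>l<r. b i l \<in> ?I) \<and>
      fs i + (\<Sum>j<n. partial_deriv j (fs i) * s j) = (\<Sum>l<r. b i l * fs l)" by (rule exE)
  have b: "\<And>i l. i < r \<Longrightarrow> l < r \<Longrightarrow> b i l \<in> ?I"
    "\<And>i. i < r \<Longrightarrow> fs i + (\<Sum>j<n. partial_deriv j (fs i) * s j) = (\<Sum>l<r. b i l * fs l)"
    using b' by auto
  define M where "M i l = - (\<Sum>j<n. partial_deriv j (fs i) * a j l)" for i l
  \<comment> \<open>Subtracting \<open>b\<close>, the coefficients of the error in I^2, makes
    \<open>G\<close> annihilate the vector of the \<open>fs l\<close> exactly and not just modulo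
    I^2.\<close>
  define G where "G i l = (if i = l then 1 else 0) - M i l - b i l" for i l
  have M_P: "M i l \<in> ?P" if "i < r" "l < r" for i l
    using that a(1) fs by (auto simp: M_def intro!: poly_in_uminus poly_in_sum poly_in_mult partial_deriv_in)
  have G_P: "G i l \<in> ?P" if "i < r" "l < r" for i l
    using that M_P b(1) ID(1) by (auto simp: G_def intro!: poly_in_diff poly_in_uminus)
  have G_fs: "(\<Sum>l<r. G i l * fs l) = 0" if i: "i < r" for i
  proof -
    have "(\<Sum>l<r. M i l * fs l) = - (\<Sum>l<r. \<Sum>j<n. partial_deriv j (fs i) * (a j l * fs l))"
      by (simp add: M_def sum_distrib_right mult.assoc sum_negf)
    also have "\<dots> = - (\<Sum>j<n. partial_deriv j (fs i) * s j)"
      by (subst sum.swap) (simp add: a(2) sum_distrib_left)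
    finally have 1: "(\<Sum>l<r. M i l * fs l) = - (\<Sum>j<n. partial_deriv j (fs i) * s j)" .
    have "(\<Sum>l<r. (if i = l then 1 else 0) * fs l) = (\<Sum>l<r. if l = i then fs i else 0)"
      by (rule sum.cong) auto
    then have 2: "(\<Sum>l<r. (if i = l then 1 else 0) * fs l) = fs i" using i by simp
    have "(\<Sum>l<r. G i l * fs l) = (\<Sum>l<r. (if i = l then 1 else 0) * fs l) - (\<Sum>l<r. M i l * fs l) - (\<Sum>l<r. b i l * fs l)"
      by (simp add: G_def left_diff_distrib sum_subtractf)
    then show ?thesis unfolding 1 2 b(2)[OF i, symmetric] by simp
  qed
  let ?M = "mat r r (\<lambda>(i, l). M i l)"
  have "\<exists>w. 1 - w * det ?M \<in> ?J"
  proof (rule ccontr)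
    assume no: "\<not> (\<exists>w. 1 - w * det ?M \<in> ?J)"
    \<comment> \<open>The ideal generated by \<open>?J\<close> and det M. It is proper by
      assumption, so it is contained in a prime m, namely the complement of the set
      \<open>S1\<close> obtained below.\<close>
    let ?K = "{x. \<exists>w. x - w * det ?M \<in> ?J}"
    have K: "is_idl ?K"
      unfolding is_idl_def
    proof (intro conjI ballI allI)
      show "0 \<in> ?K" by (rule CollectI, rule exI[of _ 0]) (simp add: is_idlD(1)[OF J])
    next
      fix x y assume "x \<in> ?K" "y \<in> ?K"
      then obtain v w where "x - v * det ?M \<in> ?J" "y - w * det ?M \<in> ?J" by auto
      then have "(x - v * det ?M) + (y - w * det ?M) \<in> ?J" by (rule is_idlD(2)[OF J])
      then show "x + y \<in> ?K" by (intro CollectI exI[of _ "v + w"]) (simp add: algebra_simps)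
    next
      fix c x assume "x \<in> ?K"
      then obtain v where "x - v * det ?M \<in> ?J" by auto
      then have "c * (x - v * det ?M) \<in> ?J" by (rule is_idlD(3)[OF J])
      then show "c * x \<in> ?K" by (intro CollectI exI[of _ "c * v"]) (simp add: algebra_simps)
    qed
    have one: "mult_closed {1 :: 'k mpol}" by (simp add: mult_closed_def)
    have "{1} \<inter> ?K = {}" using no by auto
    from maximal_mult_closed_exists[OF one this] obtain S1
      where S1': "(mult_closed S1 \<and> {1} \<subseteq> S1 \<and> S1 \<inter> ?K = {}) \<and>
        (\<forall>T. mult_closed T \<and> S1 \<subseteq> T \<and> T \<inter> ?K = {} \<longrightarrow> T = S1)" by (rule exE)
    have S1: "mult_closed S1" "S1 \<inter> ?K = {}" using S1' by simp_all
    have max1: "T = S1" if "mult_closed T" "S1 \<subseteq> T" "T \<inter> ?K = {}" for T using S1' that by simp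
    have J_K: "?J \<subseteq> ?K" by (auto intro: exI[of _ 0])
    have m: "is_prm (- S1)" by (rule maximal_mult_closed_prime[OF K S1 max1])
    note m_idl = is_prmD(1)[OF m]
    \<comment> \<open>Now \<open>S1\<close> is enlarged as long as \<open>?J\<close> is avoided. The
      complement of the result is a minimal prime over I inside m, and what lies outside m lies
      outside this smaller prime as well.\<close>
    have "S1 \<inter> ?J = {}" using S1(2) J_K by blast
    from maximal_mult_closed_exists[OF S1(1) this] obtain S
      where S': "(mult_closed S \<and> S1 \<subseteq> S \<and> S \<inter> ?J = {}) \<and>
        (\<forall>T. mult_closed T \<and> S \<subseteq> T \<and> T \<inter> ?J = {} \<longrightarrow> T = S)" by (rule exE)
    have S: "mult_closed S" "S1 \<subseteq> S" "S \<inter> ?J = {}" using S' by simp_all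
    have max: "T = S" if "mult_closed T" "S \<subseteq> T" "T \<inter> ?J = {}" for T using S' that by simp
    \<comment> \<open>Otherwise row i of G f = 0 expresses \<open>G i l * fs l\<close> by the other
      r - 1 equations. With the multiplier \<open>G i l\<close>, which is outside the minimal prime,
      that prime would have height at most r - 1.\<close>
    have G_m: "G i l \<in> - S1" if il: "i < r" "l < r" for i l
    proof (rule ccontr)
      assume "G i l \<notin> - S1"
      then have u: "G i l \<in> S" using S(2) by auto
      define g where "g k = fs (if k < l then k else Suc k)" for k
      have g: "g k \<in> ?I" if "k < r - 1" for k
        using gen_mem_gen_ideal[of _ r fs n] that il unfolding ci g_def by auto
      have gen: "\<exists>H. (\<forall>k<r - 1. H k \<in> ?P) \<and> G i l * x = (\<Sum>k<r - 1. H k * g k)" if x: "x \<in> ?I" for x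
      proof -
        obtain H where H: "\<forall>k<r. H k \<in> ?P" "x = (\<Sum>k<r. H k * fs k)"
          using x unfolding ci gen_ideal_def by blast
        let ?e = "\<lambda>k. if k < l then k else Suc k"
        have "0 = G i l * fs l + (\<Sum>k<r - 1. G i (?e k) * g k)"
          using G_fs[OF il(1)] sum_remove_reindex[OF il(2), of "\<lambda>k. G i k * fs k"] by (simp add: g_def)
        then have l: "G i l * fs l = - (\<Sum>k<r - 1. G i (?e k) * g k)" by (simp add: eq_neg_iff_add_eq_0)
        have "G i l * x = H l * (G i l * fs l) + G i l * (\<Sum>k<r - 1. H (?e k) * g k)"
          unfolding H(2) sum_remove_reindex[OF il(2), of "\<lambda>k. H k * fs k"] by (simp add: g_def algebra_simps)
        also have "\<dots> = (\<Sum>k<r - 1. (G i l * H (?e k) - H l * G i (?e k)) * g k)"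
          unfolding l by (simp add: sum_distrib_left sum_subtractf left_diff_distrib mult.assoc)
        finally have "G i l * x = (\<Sum>k<r - 1. (G i l * H (?e k) - H l * G i (?e k)) * g k)" .
        moreover have "\<forall>k<r - 1. G i l * H (?e k) - H l * G i (?e k) \<in> ?P"
          using H(1) G_P il by (auto intro!: poly_in_diff poly_in_mult)
        ultimately show ?thesis by (intro exI[of _ "\<lambda>k. G i l * H (?e k) - H l * G i (?e k)"] conjI)
      qed
      have "minimal_prime_over ?R ?I (- S \<inter> ?P)" "prime_height ?R (- S \<inter> ?P) \<le> enat (r - 1)"
        by (rule prime_height_le[OF I S(1,3) max G_P[OF il] u g gen]; assumption)+
      moreover have "purely_of_codim ?R ?I r" using sci by (simp add: smooth_complete_intersection_def)
      ultimately have "enat r \<le> enat (r - 1)" by (simp add: purely_of_codim_def)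
      then show False using \<open>r \<ge> 1\<close> by simp
    qed
    \<comment> \<open>Modulo m both \<open>G\<close> and \<open>b\<close> vanish, so M becomes the
      identity matrix with determinant 1, although det M lies in m.\<close>
    have d1: "det ?M - det (1\<^sub>m r) \<in> - S1"
    proof (rule det_diff_mem_idl[OF m_idl])
      fix i l assume il: "i < r" "l < r"
      have "b i l \<in> - S1" using b(1)[OF il] I_J J_K S1(2) by blast
      then have "- (G i l + b i l) \<in> - S1" by (intro is_idlD(5)[OF m_idl] is_idlD(2)[OF m_idl] G_m il)
      then show "?M $$ (i, l) - 1\<^sub>m r $$ (i, l) \<in> - S1" using il by (simp add: G_def algebra_simps split: if_splits)
    qed auto
    have d2: "det ?M \<in> - S1"
    proof -
      have "det ?M \<in> ?K" by (rule CollectI, rule exI[of _ 1]) (simp add: is_idlD(1)[OF J])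
      then show ?thesis using S1(2) by blast
    qed
    have "det ?M - (det ?M - det (1\<^sub>m r)) \<in> - S1" by (rule is_idlD(6)[OF m_idl d2 d1])
    then show False using is_prmD(2)[OF m] by simp
  qed
  then obtain w where w: "1 - w * det ?M \<in> ?J" by blast
  \<comment> \<open>The inverse of M modulo I is w times the adjugate, and the sign undoes the one
    in the definition of \<open>M\<close>.\<close>
  define a' where "a' j k = - (w * (\<Sum>l<r. a j l * adj_mat ?M $$ (l, k)))" for j k
  have "(\<Sum>j<n. partial_deriv j (fs i) * a' j k) - (if i = k then 1 else 0) \<in> ?J" if ik: "i < r" "k < r" for i k
  proof -
    have M: "?M \<in> carrier_mat r r" by simp
    have "(\<Sum>j<n. partial_deriv j (fs i) * a' j k) = - (w * (\<Sum>j<n. \<Sum>l<r. partial_deriv j (fs i) * a j l * adj_mat ?M $$ (l, k)))"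
      by (simp add: a'_def sum_negf sum_distrib_left ac_simps)
    also have "\<dots> = w * (\<Sum>l<r. M i l * adj_mat ?M $$ (l, k))"
      by (subst sum.swap) (simp add: M_def sum_distrib_right sum_negf)
    also have "(\<Sum>l<r. M i l * adj_mat ?M $$ (l, k)) = (?M * adj_mat ?M) $$ (i, k)"
      using ik adj_mat(1)[OF M] by (simp add: scalar_prod_def atLeast0LessThan)
    also have "\<dots> = (if i = k then det ?M else 0)"
      unfolding adj_mat(2)[OF M] using ik by simp
    finally have "(\<Sum>j<n. partial_deriv j (fs i) * a' j k) - (if i = k then 1 else 0) = - ((if i = k then 1 else 0) * (1 - w * det ?M))"
      by simp
    then show ?thesis by (simp only: is_idlD(5)[OF J is_idlD(3)[OF J w]])
  qed
  then show ?thesis by blast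
qed

section \<open>Quotient modules\<close>

context Module.module
begin

lemma submodule_span_is_submodule:
  assumes "S \<subseteq> carrier M"
  shows "submodule (submodule_span R M S) R M"
proof -
  let ?T = "{t. submodule t R M \<and> S \<subseteq> t}"
  have span: "submodule_span R M S = \<Inter>?T"
    by (simp add: submodule_span_def hull_def)
  have carr: "carrier M \<in> ?T" using carrier_is_submodule assms by auto
  show ?thesis
    unfolding span
  proof (rule submoduleI)
    show "\<Inter>?T \<subseteq> carrier M" using carr by blast
    show "\<zero>\<^bsub>M\<^esub> \<in> \<Inter>?T"
      by (auto simp: submodule_def subgroup_def)
    show "\<ominus>\<^bsub>M\<^esub> a \<in> \<Inter>?T" if "a \<in> \<Inter>?T" for a using that by (auto intro: submoduleE(3))
    show "a \<oplus>\<^bsub>M\<^esub> b \<in> \<Inter>?T" if "a \<in> \<Inter>?T" "b \<in> \<Inter>?T" for a b using that by (auto intro: submoduleE(5))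
    show "a \<odot>\<^bsub>M\<^esub> x \<in> \<Inter>?T" if "a \<in> carrier R" "x \<in> \<Inter>?T" for a x using that by (auto intro: submoduleE(4))
  qed
qed

lemma submodule_span_superset: "S \<subseteq> submodule_span R M S"
  by (simp add: submodule_span_def hull_subset)

lemma submodule_span_minimal: "submodule N R M \<Longrightarrow> S \<subseteq> N \<Longrightarrow> submodule_span R M S \<subseteq> N"
  unfolding submodule_span_def by (rule hull_minimal)

context
  fixes N
  assumes N: "submodule N R M"
begin

lemma N_subset: "N \<subseteq> carrier M" using submoduleE(1)[OF N] .
lemma N_zero_mem: "\<zero>\<^bsub>M\<^esub> \<in> N" using N by (simp add: submodule_def subgroup_def)

lemma coset_eq_iff:
  assumes "x \<in> carrier M" "y \<in> carrier M"
  shows "N +>\<^bsub>M\<^esub> x = N +>\<^bsub>M\<^esub> y \<longleftrightarrow> x \<ominus>\<^bsub>M\<^esub> y \<in> N"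
proof -
  have mem: "z \<in> N +>\<^bsub>M\<^esub> x \<longleftrightarrow> z \<ominus>\<^bsub>M\<^esub> x \<in> N" if xz: "x \<in> carrier M" "z \<in> carrier M" for x z
  proof
    assume "z \<in> N +>\<^bsub>M\<^esub> x"
    then obtain n where n: "n \<in> N" "z = n \<oplus>\<^bsub>M\<^esub> x" by (auto simp: a_r_coset_def')
    then show "z \<ominus>\<^bsub>M\<^esub> x \<in> N" using N_subset xz by (auto simp: M.minus_eq M.a_assoc M.r_neg)
  next
    assume "z \<ominus>\<^bsub>M\<^esub> x \<in> N"
    moreover have "z = (z \<ominus>\<^bsub>M\<^esub> x) \<oplus>\<^bsub>M\<^esub> x" using xz by (simp add: M.minus_eq M.a_assoc M.l_neg)
    ultimately show "z \<in> N +>\<^bsub>M\<^esub> x" by (auto simp: a_r_coset_def')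
  qed
  have self: "x \<in> N +>\<^bsub>M\<^esub> x" if "x \<in> carrier M" for x
    using mem[OF that that] that N_zero_mem by (simp add: M.minus_eq M.r_neg)
  have sub: "N +>\<^bsub>M\<^esub> x \<subseteq> carrier M" if "x \<in> carrier M" for x
    using that N_subset by (auto simp: a_r_coset_def')
  have le: "N +>\<^bsub>M\<^esub> x \<subseteq> N +>\<^bsub>M\<^esub> y" if xy: "x \<in> carrier M" "y \<in> carrier M" "x \<ominus>\<^bsub>M\<^esub> y \<in> N" for x y
  proof
    fix z assume z: "z \<in> N +>\<^bsub>M\<^esub> x"
    then have zc: "z \<in> carrier M" using sub xy by auto
    have "(z \<ominus>\<^bsub>M\<^esub> x) \<oplus>\<^bsub>M\<^esub> (x \<ominus>\<^bsub>M\<^esub> y) \<in> N"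
      using z zc xy mem by (intro submoduleE(5)[OF N]) auto
    moreover have "(z \<ominus>\<^bsub>M\<^esub> x) \<oplus>\<^bsub>M\<^esub> (x \<ominus>\<^bsub>M\<^esub> y) = z \<ominus>\<^bsub>M\<^esub> y"
      using zc xy by (simp add: M.minus_eq M.a_assoc) (simp add: M.a_assoc[symmetric] M.l_neg)
    ultimately show "z \<in> N +>\<^bsub>M\<^esub> y" using mem zc xy by simp
  qed
  show ?thesis
  proof
    assume "N +>\<^bsub>M\<^esub> x = N +>\<^bsub>M\<^esub> y"
    then show "x \<ominus>\<^bsub>M\<^esub> y \<in> N" using self[OF assms(1)] mem[OF assms(2,1)] by simp
  next
    assume xy: "x \<ominus>\<^bsub>M\<^esub> y \<in> N"
    have "\<ominus>\<^bsub>M\<^esub> (x \<ominus>\<^bsub>M\<^esub> y) = y \<ominus>\<^bsub>M\<^esub> x" using assms by (simp add: M.minus_eq M.minus_add M.a_comm)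
    then have "y \<ominus>\<^bsub>M\<^esub> x \<in> N" using submoduleE(3)[OF N xy] by simp
    then show "N +>\<^bsub>M\<^esub> x = N +>\<^bsub>M\<^esub> y" using le xy assms by blast
  qed
qed

lemma quot_carrier: "carrier (quot_module M N) = {N +>\<^bsub>M\<^esub> x | x. x \<in> carrier M}"
  by (auto simp: quot_module_def A_RCOSETS_def')

lemma quot_zero: "\<zero>\<^bsub>quot_module M N\<^esub> = N +>\<^bsub>M\<^esub> \<zero>\<^bsub>M\<^esub>"
  using N_subset by (force simp: quot_module_def a_r_coset_def')

lemma quot_add:
  assumes "x \<in> carrier M" "y \<in> carrier M"
  shows "(N +>\<^bsub>M\<^esub> x) \<oplus>\<^bsub>quot_module M N\<^esub> (N +>\<^bsub>M\<^esub> y) = N +>\<^bsub>M\<^esub> (x \<oplus>\<^bsub>M\<^esub> y)"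
proof -
  have "(\<Union>h\<in>N. {h \<oplus>\<^bsub>M\<^esub> x}) <+>\<^bsub>M\<^esub> (\<Union>h\<in>N. {h \<oplus>\<^bsub>M\<^esub> y}) = (\<Union>h\<in>N. {h \<oplus>\<^bsub>M\<^esub> (x \<oplus>\<^bsub>M\<^esub> y)})"
  proof (intro equalityI subsetI)
    fix z assume "z \<in> (\<Union>h\<in>N. {h \<oplus>\<^bsub>M\<^esub> x}) <+>\<^bsub>M\<^esub> (\<Union>h\<in>N. {h \<oplus>\<^bsub>M\<^esub> y})"
    then obtain h k where hk: "h \<in> N" "k \<in> N" "z = (h \<oplus>\<^bsub>M\<^esub> x) \<oplus>\<^bsub>M\<^esub> (k \<oplus>\<^bsub>M\<^esub> y)" by (auto simp: set_add_def')
    then have c: "h \<in> carrier M" "k \<in> carrier M" using N_subset by auto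
    have "z = (h \<oplus>\<^bsub>M\<^esub> k) \<oplus>\<^bsub>M\<^esub> (x \<oplus>\<^bsub>M\<^esub> y)" using c assms hk(3) by (simp add: M.a_ac)
    then show "z \<in> (\<Union>h\<in>N. {h \<oplus>\<^bsub>M\<^esub> (x \<oplus>\<^bsub>M\<^esub> y)})" using submoduleE(5)[OF N hk(1,2)] by auto
  next
    fix z assume "z \<in> (\<Union>h\<in>N. {h \<oplus>\<^bsub>M\<^esub> (x \<oplus>\<^bsub>M\<^esub> y)})"
    then obtain h where h: "h \<in> N" "z = h \<oplus>\<^bsub>M\<^esub> (x \<oplus>\<^bsub>M\<^esub> y)" by auto
    then have "z = (h \<oplus>\<^bsub>M\<^esub> x) \<oplus>\<^bsub>M\<^esub> (\<zero>\<^bsub>M\<^esub> \<oplus>\<^bsub>M\<^esub> y)" using assms N_subset by (auto simp: M.a_assoc)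
    then show "z \<in> (\<Union>h\<in>N. {h \<oplus>\<^bsub>M\<^esub> x}) <+>\<^bsub>M\<^esub> (\<Union>h\<in>N. {h \<oplus>\<^bsub>M\<^esub> y})"
      using h(1) N_zero_mem by (auto simp: set_add_def')
  qed
  then show ?thesis by (simp add: quot_module_def a_r_coset_def')
qed

lemma quot_smult:
  assumes "a \<in> carrier R" "x \<in> carrier M"
  shows "a \<odot>\<^bsub>quot_module M N\<^esub> (N +>\<^bsub>M\<^esub> x) = N +>\<^bsub>M\<^esub> (a \<odot>\<^bsub>M\<^esub> x)"
proof -
  have "N +>\<^bsub>M\<^esub> (a \<odot>\<^bsub>M\<^esub> z) = N +>\<^bsub>M\<^esub> (a \<odot>\<^bsub>M\<^esub> x)" if z: "z \<in> N +>\<^bsub>M\<^esub> x" for z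
  proof -
    obtain h where h: "h \<in> N" "z = h \<oplus>\<^bsub>M\<^esub> x" using z by (auto simp: a_r_coset_def')
    then have c: "h \<in> carrier M" using N_subset by auto
    have "(a \<odot>\<^bsub>M\<^esub> z) \<ominus>\<^bsub>M\<^esub> (a \<odot>\<^bsub>M\<^esub> x) = a \<odot>\<^bsub>M\<^esub> h"
      using h(2) c assms by (simp add: smult_r_distr M.minus_eq M.a_assoc M.r_neg)
    then show ?thesis using submoduleE(4)[OF N assms(1) h(1)] h c assms by (subst coset_eq_iff) auto
  qed
  moreover have "x \<in> N +>\<^bsub>M\<^esub> x" using N_zero_mem assms by (force simp: a_r_coset_def')
  then have "N +>\<^bsub>M\<^esub> x \<noteq> {}" by blast
  ultimately show ?thesis unfolding quot_module_def by (simp add: SUP_eq_const)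
qed

lemma module_quot: "Module.module R (quot_module M N)"
proof -
  let ?Q = "quot_module M N"
  have rep: "\<exists>z\<in>carrier M. x = N +>\<^bsub>M\<^esub> z" if "x \<in> carrier ?Q" for x
    using that by (auto simp: quot_carrier)
  have closed: "N +>\<^bsub>M\<^esub> z \<in> carrier ?Q" if "z \<in> carrier M" for z
    using that by (auto simp: quot_carrier)
  have grp: "abelian_group ?Q"
  proof (rule abelian_groupI)
    fix x assume "x \<in> carrier ?Q"
    then obtain a where a: "a \<in> carrier M" "x = N +>\<^bsub>M\<^esub> a" using rep by blast
    show "\<exists>y\<in>carrier ?Q. y \<oplus>\<^bsub>?Q\<^esub> x = \<zero>\<^bsub>?Q\<^esub>"
      using a by (intro bexI[of _ "N +>\<^bsub>M\<^esub> (\<ominus>\<^bsub>M\<^esub> a)"]) (simp_all add: quot_add quot_zero M.l_neg closed)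
    show "\<zero>\<^bsub>?Q\<^esub> \<oplus>\<^bsub>?Q\<^esub> x = x" using a by (simp add: quot_add quot_zero)
    fix y assume "y \<in> carrier ?Q"
    then obtain b where b: "b \<in> carrier M" "y = N +>\<^bsub>M\<^esub> b" using rep by blast
    show "x \<oplus>\<^bsub>?Q\<^esub> y \<in> carrier ?Q" "x \<oplus>\<^bsub>?Q\<^esub> y = y \<oplus>\<^bsub>?Q\<^esub> x"
      using a b by (simp_all add: quot_add closed M.a_comm)
    fix z assume "z \<in> carrier ?Q"
    then obtain c where c: "c \<in> carrier M" "z = N +>\<^bsub>M\<^esub> c" using rep by blast
    show "x \<oplus>\<^bsub>?Q\<^esub> y \<oplus>\<^bsub>?Q\<^esub> z = x \<oplus>\<^bsub>?Q\<^esub> (y \<oplus>\<^bsub>?Q\<^esub> z)"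
      using a b c by (simp add: quot_add M.a_assoc)
  qed (simp add: quot_zero closed)
  show ?thesis
  proof (rule moduleI[OF R.is_cring grp])
    fix a x assume a: "a \<in> carrier R" and "x \<in> carrier ?Q"
    then obtain v where v: "v \<in> carrier M" "x = N +>\<^bsub>M\<^esub> v" using rep by blast
    show "a \<odot>\<^bsub>?Q\<^esub> x \<in> carrier ?Q" using a v by (simp add: quot_smult closed)
    fix b y assume b: "b \<in> carrier R" and "y \<in> carrier ?Q"
    then obtain w where w: "w \<in> carrier M" "y = N +>\<^bsub>M\<^esub> w" using rep by blast
    show "(a \<oplus> b) \<odot>\<^bsub>?Q\<^esub> x = a \<odot>\<^bsub>?Q\<^esub> x \<oplus>\<^bsub>?Q\<^esub> b \<odot>\<^bsub>?Q\<^esub> x"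
      "a \<odot>\<^bsub>?Q\<^esub> (x \<oplus>\<^bsub>?Q\<^esub> y) = a \<odot>\<^bsub>?Q\<^esub> x \<oplus>\<^bsub>?Q\<^esub> a \<odot>\<^bsub>?Q\<^esub> y"
      "(a \<otimes> b) \<odot>\<^bsub>?Q\<^esub> x = a \<odot>\<^bsub>?Q\<^esub> (b \<odot>\<^bsub>?Q\<^esub> x)"
      using a b v w by (simp_all add: quot_add quot_smult smult_l_distr smult_r_distr smult_assoc1)
  next
    fix x assume "x \<in> carrier ?Q"
    then obtain v where "v \<in> carrier M" "x = N +>\<^bsub>M\<^esub> v" using rep by blast
    then show "\<one> \<odot>\<^bsub>?Q\<^esub> x = x" by (simp add: quot_smult)
  qed
qed

end

end

theorem first_isomorphism:
  assumes M: "Module.module R M" and Q: "Module.module R Q"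
    and h: "\<And>x. x \<in> carrier M \<Longrightarrow> h x \<in> carrier Q"
      "\<And>x y. x \<in> carrier M \<Longrightarrow> y \<in> carrier M \<Longrightarrow> h (x \<oplus>\<^bsub>M\<^esub> y) = h x \<oplus>\<^bsub>Q\<^esub> h y"
      "\<And>a x. a \<in> carrier R \<Longrightarrow> x \<in> carrier M \<Longrightarrow> h (a \<odot>\<^bsub>M\<^esub> x) = a \<odot>\<^bsub>Q\<^esub> h x"
      "\<And>y. y \<in> carrier Q \<Longrightarrow> \<exists>x\<in>carrier M. h x = y"
    and N: "N = {x \<in> carrier M. h x = \<zero>\<^bsub>Q\<^esub>}"
  shows "module_iso R (quot_module M N) Q"
proof -
  interpret M: Module.module R M by fact
  interpret Q: Module.module R Q by fact
  have minus: "h (\<ominus>\<^bsub>M\<^esub> x) = \<ominus>\<^bsub>Q\<^esub> h x" if "x \<in> carrier M" for x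
    using h(3)[of "\<ominus>\<^bsub>R\<^esub> \<one>\<^bsub>R\<^esub>" x] that h(1)[OF that] by (simp add: M.smult_l_minus Q.smult_l_minus)
  have zero: "h \<zero>\<^bsub>M\<^esub> = \<zero>\<^bsub>Q\<^esub>"
    using h(3)[of "\<zero>\<^bsub>R\<^esub>" "\<zero>\<^bsub>M\<^esub>"] h(1)[of "\<zero>\<^bsub>M\<^esub>"] by simp
  have sub: "submodule N R M"
    by (rule M.submoduleI) (auto simp: N zero minus h)
  have diff: "x \<ominus>\<^bsub>M\<^esub> y \<in> N \<longleftrightarrow> h x = h y" if xy: "x \<in> carrier M" "y \<in> carrier M" for x y
  proof -
    have "h (x \<ominus>\<^bsub>M\<^esub> y) = h x \<ominus>\<^bsub>Q\<^esub> h y" using xy by (simp add: M.M.minus_eq Q.M.minus_eq h minus)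
    moreover have "h x = (h x \<ominus>\<^bsub>Q\<^esub> h y) \<oplus>\<^bsub>Q\<^esub> h y"
      using xy h(1) by (simp add: Q.M.minus_eq Q.M.a_assoc Q.M.l_neg)
    then have "h x \<ominus>\<^bsub>Q\<^esub> h y = \<zero>\<^bsub>Q\<^esub> \<longleftrightarrow> h x = h y"
      using xy h(1) by (metis Q.M.l_zero Q.M.minus_eq Q.M.r_neg)
    ultimately show ?thesis using xy by (simp add: N)
  qed
  define g where "g T = h (SOME x. x \<in> carrier M \<and> T = N +>\<^bsub>M\<^esub> x)" for T
  have g: "g (N +>\<^bsub>M\<^esub> x) = h x" if x: "x \<in> carrier M" for x
  proof -
    let ?y = "SOME y. y \<in> carrier M \<and> N +>\<^bsub>M\<^esub> x = N +>\<^bsub>M\<^esub> y"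
    have y: "?y \<in> carrier M \<and> N +>\<^bsub>M\<^esub> x = N +>\<^bsub>M\<^esub> ?y" by (rule someI[of _ x]) (use x in simp)
    then have "h x = h ?y" using M.coset_eq_iff[OF sub x, of ?y] diff[OF x, of ?y] by simp
    then show ?thesis by (simp add: g_def)
  qed
  have "inj_on g (carrier (quot_module M N))"
  proof (rule inj_onI)
    fix s t assume st: "s \<in> carrier (quot_module M N)" "t \<in> carrier (quot_module M N)" "g s = g t"
    obtain x y where xy: "x \<in> carrier M" "y \<in> carrier M" "s = N +>\<^bsub>M\<^esub> x" "t = N +>\<^bsub>M\<^esub> y"
      using st(1,2) by (auto simp: M.quot_carrier[OF sub])
    then have "h x = h y" using st(3) g by simp
    then show "s = t" using xy diff M.coset_eq_iff[OF sub xy(1,2)] by simp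
  qed
  moreover have "g ` carrier (quot_module M N) = carrier Q"
  proof (intro equalityI subsetI)
    fix y assume "y \<in> carrier Q"
    then obtain x where "x \<in> carrier M" "h x = y" using h(4) by auto
    then show "y \<in> g ` carrier (quot_module M N)"
      by (intro image_eqI[of _ _ "N +>\<^bsub>M\<^esub> x"]) (auto simp: g M.quot_carrier[OF sub])
  qed (auto simp: M.quot_carrier[OF sub] g h)
  ultimately have "bij_betw g (carrier (quot_module M N)) (carrier Q)" by (simp add: bij_betw_def)
  then show ?thesis
    unfolding module_iso_def using M.module_quot[OF sub] Q
    by (intro conjI exI[of _ g])
      (auto simp: M.quot_carrier[OF sub] M.quot_add[OF sub] M.quot_smult[OF sub] g h)
qed

lemma module_free:
  fixes R (structure)
  assumes "cring R"
  shows "Module.module R (free_module R S)"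
proof -
  interpret cring R by fact
  let ?F = "free_module R S"
  have fin_add: "finite {s. g s \<oplus> h s \<noteq> \<zero>}" if gh: "g \<in> carrier ?F" "h \<in> carrier ?F" for g h
  proof (rule finite_subset)
    show "{s. g s \<oplus> h s \<noteq> \<zero>} \<subseteq> {s. g s \<noteq> \<zero>} \<union> {s. h s \<noteq> \<zero>}" by auto
  qed (use gh in \<open>auto simp: free_module_def\<close>)
  have fin_smult: "finite {s. a \<otimes> g s \<noteq> \<zero>}" if ag: "a \<in> carrier R" "g \<in> carrier ?F" for a g
  proof (rule finite_subset)
    show "{s. a \<otimes> g s \<noteq> \<zero>} \<subseteq> {s. g s \<noteq> \<zero>}" using ag by auto
  qed (use ag in \<open>auto simp: free_module_def\<close>)
  have carr: "g s \<in> carrier R" if "g \<in> carrier ?F" for g s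
    using that by (cases "s \<in> S") (auto simp: free_module_def)
  have grp: "abelian_group ?F"
  proof (rule abelian_groupI)
    fix g assume g: "g \<in> carrier ?F"
    have "{s. \<ominus> g s \<noteq> \<zero>} \<subseteq> {s. g s \<noteq> \<zero>}" by auto
    then have "finite {s. \<ominus> g s \<noteq> \<zero>}" using g by (auto simp: free_module_def intro: finite_subset)
    then have "(\<lambda>s. \<ominus> g s) \<in> carrier ?F" using g by (auto simp: free_module_def)
    then show "\<exists>y\<in>carrier ?F. y \<oplus>\<^bsub>?F\<^esub> g = \<zero>\<^bsub>?F\<^esub>"
      using carr[OF g] by (intro bexI[of _ "\<lambda>s. \<ominus> g s"]) (auto simp: free_module_def l_neg)
  next
    fix g h assume "g \<in> carrier ?F" "h \<in> carrier ?F"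
    then show "g \<oplus>\<^bsub>?F\<^esub> h \<in> carrier ?F" "g \<oplus>\<^bsub>?F\<^esub> h = h \<oplus>\<^bsub>?F\<^esub> g"
      using fin_add carr[of g] carr[of h] by (auto simp: free_module_def a_comm)
  next
    fix g h k assume "g \<in> carrier ?F" "h \<in> carrier ?F" "k \<in> carrier ?F"
    then show "g \<oplus>\<^bsub>?F\<^esub> h \<oplus>\<^bsub>?F\<^esub> k = g \<oplus>\<^bsub>?F\<^esub> (h \<oplus>\<^bsub>?F\<^esub> k)"
      using carr[of g] carr[of h] carr[of k] by (auto simp: free_module_def a_assoc)
  next
    fix g assume "g \<in> carrier ?F"
    then show "\<zero>\<^bsub>?F\<^esub> \<oplus>\<^bsub>?F\<^esub> g = g" using carr[of g] by (auto simp: free_module_def)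
  qed (auto simp: free_module_def)
  show ?thesis
  proof (rule moduleI[OF is_cring grp])
    fix a g assume ag: "a \<in> carrier R" "g \<in> carrier ?F"
    then show "a \<odot>\<^bsub>?F\<^esub> g \<in> carrier ?F" using fin_smult[OF ag] by (auto simp: free_module_def)
    fix b h assume bh: "b \<in> carrier R" "h \<in> carrier ?F"
    show "(a \<oplus> b) \<odot>\<^bsub>?F\<^esub> g = a \<odot>\<^bsub>?F\<^esub> g \<oplus>\<^bsub>?F\<^esub> b \<odot>\<^bsub>?F\<^esub> g"
      "a \<odot>\<^bsub>?F\<^esub> (g \<oplus>\<^bsub>?F\<^esub> h) = a \<odot>\<^bsub>?F\<^esub> g \<oplus>\<^bsub>?F\<^esub> a \<odot>\<^bsub>?F\<^esub> h"
      "(a \<otimes> b) \<odot>\<^bsub>?F\<^esub> g = a \<odot>\<^bsub>?F\<^esub> (b \<odot>\<^bsub>?F\<^esub> g)"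
      using ag bh carr[of g] carr[of h] by (auto simp: free_module_def l_distr r_distr m_assoc)
  next
    fix g assume "g \<in> carrier ?F"
    then show "\<one> \<odot>\<^bsub>?F\<^esub> g = g" using carr[of g] by (auto simp: free_module_def)
  qed
qed

section \<open>Presentations lifted along a surjection\<close>

definition sgl :: "'s \<Rightarrow> 's \<Rightarrow> 'a::comm_ring_1" where
  "sgl s = (\<lambda>t. if t = s then 1 else 0)"

definition sc :: "'a::comm_ring_1 \<Rightarrow> ('s \<Rightarrow> 'a) \<Rightarrow> 's \<Rightarrow> 'a" where
  "sc c \<gamma> = (\<lambda>s. c * \<gamma> s)"

text \<open>The lifts of elements of \<open>free_module B S\<close> to coefficients in the type
  class ring.\<close>

definition fsupp :: "'s set \<Rightarrow> ('s \<Rightarrow> 'a::comm_ring_1) set" where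
  "fsupp S = {\<gamma>. finite {s. \<gamma> s \<noteq> 0} \<and> (\<forall>s. s \<notin> S \<longrightarrow> \<gamma> s = 0)}"

definition ev :: "('s \<Rightarrow> 'a::comm_ring_1) \<Rightarrow> ('s \<Rightarrow> 'a) \<Rightarrow> 'a" where
  "ev \<omega> \<gamma> = (\<Sum>s | \<gamma> s \<noteq> 0. \<gamma> s * \<omega> s)"

lemma module_sc: "Modules.module (sc :: 'a::comm_ring_1 \<Rightarrow> ('s \<Rightarrow> 'a) \<Rightarrow> 's \<Rightarrow> 'a)"
  by unfold_locales (auto simp: sc_def fun_eq_iff algebra_simps)

lemma ev_superset: "finite T \<Longrightarrow> {s. \<gamma> s \<noteq> 0} \<subseteq> T \<Longrightarrow> ev \<omega> \<gamma> = (\<Sum>s\<in>T. \<gamma> s * \<omega> s)"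
  unfolding ev_def by (rule sum.mono_neutral_left) auto

lemma ev_add:
  assumes "finite {s. \<gamma> s \<noteq> 0}" "finite {s. \<delta> s \<noteq> 0}"
  shows "ev \<omega> (\<gamma> + \<delta>) = ev \<omega> \<gamma> + ev \<omega> \<delta>"
proof -
  let ?T = "{s. \<gamma> s \<noteq> 0} \<union> {s. \<delta> s \<noteq> 0}"
  have "ev \<omega> (\<gamma> + \<delta>) = (\<Sum>s\<in>?T. (\<gamma> + \<delta>) s * \<omega> s)" by (rule ev_superset) (use assms in auto)
  then show ?thesis
    using assms by (simp add: ev_superset[of ?T \<gamma>] ev_superset[of ?T \<delta>] distrib_right sum.distrib)
qed

lemma ev_sc: "finite {s. \<gamma> s \<noteq> 0} \<Longrightarrow> ev \<omega> (sc c \<gamma>) = c * ev \<omega> \<gamma>"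
  by (subst ev_superset[of "{s. \<gamma> s \<noteq> 0}"]) (auto simp: sc_def ev_def sum_distrib_left mult.assoc)

lemma ev_sgl: "ev \<omega> (sgl s) = \<omega> s"
  by (subst ev_superset[of "{s}"]) (auto simp: sgl_def)

lemma fsupp_sgl: "s \<in> S \<Longrightarrow> sgl s \<in> fsupp S"
  by (auto simp: fsupp_def sgl_def)

lemma fsupp_add: "\<gamma> \<in> fsupp S \<Longrightarrow> \<delta> \<in> fsupp S \<Longrightarrow> \<gamma> + \<delta> \<in> fsupp S"
  unfolding fsupp_def
  by (auto intro: finite_subset[of _ "{s. \<gamma> s \<noteq> 0} \<union> {s. \<delta> s \<noteq> 0}"])

lemma fsupp_sc: "\<gamma> \<in> fsupp S \<Longrightarrow> sc c \<gamma> \<in> fsupp S"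
  unfolding fsupp_def sc_def by (auto intro: finite_subset[of _ "{s. \<gamma> s \<noteq> 0}"])

lemma diff_eq_sc: "\<gamma> - \<delta> = \<gamma> + sc (- 1) \<delta>"
  by (simp add: fun_eq_iff sc_def)

lemma fsupp_diff: "\<gamma> \<in> fsupp S \<Longrightarrow> \<delta> \<in> fsupp S \<Longrightarrow> \<gamma> - \<delta> \<in> fsupp S"
  unfolding diff_eq_sc by (intro fsupp_add fsupp_sc)

lemma fsupp_0: "0 \<in> fsupp S" by (simp add: fsupp_def)

lemma fsuppD: "\<gamma> \<in> fsupp S \<Longrightarrow> finite {s. \<gamma> s \<noteq> 0}"
  by (simp add: fsupp_def)

lemma ev_diff: "\<gamma> \<in> fsupp S \<Longrightarrow> \<delta> \<in> fsupp S \<Longrightarrow> ev \<omega> (\<gamma> - \<delta>) = ev \<omega> \<gamma> - ev \<omega> \<delta>"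
  unfolding diff_eq_sc using fsuppD[of \<gamma> S] fsuppD[of \<delta> S] fsuppD[OF fsupp_sc[of \<delta> S "- 1"]]
  by (simp add: ev_add ev_sc)

lemma fsupp_eq_sum: "\<gamma> \<in> fsupp S \<Longrightarrow> \<gamma> = (\<Sum>s | \<gamma> s \<noteq> 0. sc (\<gamma> s) (sgl s))"
proof
  fix t assume g: "\<gamma> \<in> fsupp S"
  have "(\<Sum>s | \<gamma> s \<noteq> 0. sc (\<gamma> s) (sgl s)) t = (\<Sum>s | \<gamma> s \<noteq> 0. sc (\<gamma> s) (sgl s) t)"
    by (induction rule: infinite_finite_induct) auto
  also have "\<dots> = (\<Sum>s | \<gamma> s \<noteq> 0. if s = t then \<gamma> s else 0)"
    by (rule sum.cong) (auto simp: sc_def sgl_def)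
  also have "\<dots> = \<gamma> t" using fsuppD[OF g] by simp
  finally show "\<gamma> t = (\<Sum>s | \<gamma> s \<noteq> 0. sc (\<gamma> s) (sgl s)) t" by simp
qed

text \<open>The source of \<open>\<pi>\<close> is a whole type, so calculations in modules over the
  carrier-based ring \<open>B\<close> can be lifted to class operations on functions.\<close>

locale surj_hom =
  fixes B :: "('b, 'x) ring_scheme" and \<pi> :: "'a::comm_ring_1 \<Rightarrow> 'b"
  assumes cring_B: "cring B" and \<pi>_closed: "\<pi> a \<in> carrier B" and \<pi>_surj: "b \<in> carrier B \<Longrightarrow> \<exists>a. \<pi> a = b"
    and \<pi>_add: "\<pi> (x + y) = \<pi> x \<oplus>\<^bsub>B\<^esub> \<pi> y" and \<pi>_mult: "\<pi> (x * y) = \<pi> x \<otimes>\<^bsub>B\<^esub> \<pi> y"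
    and \<pi>_one: "\<pi> 1 = \<one>\<^bsub>B\<^esub>"
begin

sublocale B: cring B by (rule cring_B)

lemma \<pi>_zero: "\<pi> 0 = \<zero>\<^bsub>B\<^esub>"
  using \<pi>_add[of 0 0] \<pi>_closed[of 0] by (metis B.add.l_cancel_one' add_0)

lemma \<pi>_minus: "\<pi> (- a) = \<ominus>\<^bsub>B\<^esub> \<pi> a"
  using \<pi>_add[of "- a" a] by (intro B.minus_equality[symmetric]) (auto simp: \<pi>_zero \<pi>_closed)

definition bar :: "('s \<Rightarrow> 'a) \<Rightarrow> 's \<Rightarrow> 'b" where "bar \<gamma> = (\<lambda>s. \<pi> (\<gamma> s))"

lemma bar_sgl: "bar (sgl s) = free_gen B s"
  by (auto simp: bar_def sgl_def free_gen_def fun_eq_iff \<pi>_one \<pi>_zero)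

lemma bar_add: "bar (\<gamma> + \<delta>) = bar \<gamma> \<oplus>\<^bsub>free_module B S\<^esub> bar \<delta>"
  by (simp add: bar_def free_module_def \<pi>_add)

lemma bar_sc: "bar (sc c \<gamma>) = \<pi> c \<odot>\<^bsub>free_module B S\<^esub> bar \<gamma>"
  by (simp add: bar_def free_module_def \<pi>_mult sc_def)

lemma bar_0: "bar 0 = \<zero>\<^bsub>free_module B S\<^esub>"
  by (simp add: bar_def free_module_def \<pi>_zero)

lemma bar_closed: "\<gamma> \<in> fsupp S \<Longrightarrow> bar \<gamma> \<in> carrier (free_module B S)"
  unfolding fsupp_def free_module_def bar_def
  by (auto simp: \<pi>_closed \<pi>_zero intro: finite_subset[of _ "{s. \<gamma> s \<noteq> 0}"])

lemma bar_diff: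
  assumes "bar \<gamma> \<in> carrier (free_module B S)" "bar \<delta> \<in> carrier (free_module B S)"
  shows "bar (\<gamma> - \<delta>) = bar \<gamma> \<ominus>\<^bsub>free_module B S\<^esub> bar \<delta>"
proof -
  interpret F: Module.module B "free_module B S" by (rule module_free[OF cring_B])
  have "bar (\<gamma> - \<delta>) = bar \<gamma> \<oplus>\<^bsub>free_module B S\<^esub> (\<pi> (- 1) \<odot>\<^bsub>free_module B S\<^esub> bar \<delta>)"
    unfolding diff_eq_sc by (simp add: bar_add[of _ _ S] bar_sc[of _ _ S])
  also have "\<pi> (- 1) \<odot>\<^bsub>free_module B S\<^esub> bar \<delta> = \<ominus>\<^bsub>free_module B S\<^esub> bar \<delta>"
    using assms by (simp add: \<pi>_minus \<pi>_one F.smult_l_minus)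
  finally show ?thesis unfolding F.M.minus_eq .
qed

lemma bar_lift:
  assumes g: "g \<in> carrier (free_module B S)"
  shows "\<exists>\<gamma>\<in>fsupp S. bar \<gamma> = g"
proof -
  let ?\<gamma> = "\<lambda>s. if g s = \<zero>\<^bsub>B\<^esub> then 0 else (SOME a. \<pi> a = g s)"
  have "g s \<in> carrier B" for s using g by (cases "s \<in> S") (auto simp: free_module_def)
  then have "bar ?\<gamma> = g"
    using \<pi>_surj by (auto simp: bar_def fun_eq_iff \<pi>_zero intro: someI_ex)
  moreover have "{s. ?\<gamma> s \<noteq> 0} \<subseteq> {s. g s \<noteq> \<zero>\<^bsub>B\<^esub>}" by auto
  then have "?\<gamma> \<in> fsupp S" using g by (auto simp: fsupp_def free_module_def intro: finite_subset)
  ultimately show ?thesis by blast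
qed

end

locale presented = surj_hom B \<pi> for B :: "('b, 'x) ring_scheme" and \<pi> :: "'a::comm_ring_1 \<Rightarrow> 'b" +
  fixes S :: "'s set" and rels :: "('s \<Rightarrow> 'b) set"
  assumes rels: "rels \<subseteq> carrier (free_module B S)"
begin

abbreviation "F \<equiv> free_module B S"
definition "W = submodule_span B F rels"
text \<open>May contain functions of infinite support as long as \<pi> kills almost all of their
  values. This makes \<open>NN\<close> a subspace of the full function space, as
  \<open>form_mod\<close> requires; finiteness is imposed separately by
  \<open>fsupp\<close>.\<close>

definition "NN = {\<gamma>. bar \<gamma> \<in> W}"
definition "cls \<gamma> = W +>\<^bsub>F\<^esub> bar \<gamma>"

sublocale F: Module.module B F by (rule module_free[OF cring_B])

lemma W: "submodule W B F"
  unfolding W_def by (rule F.submodule_span_is_submodule[OF rels])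

lemma form_mod_NN: "form_mod sc NN"
proof -
  interpret sc: Modules.module "sc :: 'a \<Rightarrow> ('s \<Rightarrow> 'a) \<Rightarrow> 's \<Rightarrow> 'a" by (rule module_sc)
  show ?thesis
    by unfold_locales
      (auto simp: sc.subspace_def NN_def bar_add[of _ _ S] bar_sc[of _ _ S] bar_0[of S] F.N_zero_mem[OF W] \<pi>_closed
        intro: F.submoduleE(5)[OF W] F.submoduleE(4)[OF W])
qed

lemma bar_sc_minus_one: "bar \<gamma> \<in> carrier F \<Longrightarrow> bar (sc (- 1) \<gamma>) = \<ominus>\<^bsub>F\<^esub> bar \<gamma>"
  by (simp add: bar_sc[of _ _ S] \<pi>_minus \<pi>_one F.smult_l_minus)

lemma sc_ker_NN: "\<pi> c = \<zero>\<^bsub>B\<^esub> \<Longrightarrow> sc c \<gamma> \<in> NN"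
proof -
  assume "\<pi> c = \<zero>\<^bsub>B\<^esub>"
  then have "bar (sc c \<gamma>) = \<zero>\<^bsub>F\<^esub>" by (simp add: bar_def sc_def \<pi>_mult \<pi>_closed free_module_def)
  then show ?thesis using F.N_zero_mem[OF W] by (simp add: NN_def)
qed

lemma rels_NN: "bar \<gamma> \<in> rels \<Longrightarrow> \<gamma> \<in> NN"
  using F.submodule_span_superset[of rels] by (auto simp: NN_def W_def)

lemma cls_cases: "x \<in> carrier (quot_module F W) \<Longrightarrow> \<exists>\<gamma>\<in>fsupp S. x = cls \<gamma>"
  using bar_lift[of _ S] by (fastforce simp: F.quot_carrier[OF W] cls_def)

lemma cls_closed: "\<gamma> \<in> fsupp S \<Longrightarrow> cls \<gamma> \<in> carrier (quot_module F W)"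
  using bar_closed by (auto simp: F.quot_carrier[OF W] cls_def)

lemma cls_eq_iff: "\<gamma> \<in> fsupp S \<Longrightarrow> \<delta> \<in> fsupp S \<Longrightarrow> cls \<gamma> = cls \<delta> \<longleftrightarrow> \<gamma> - \<delta> \<in> NN"
  using F.coset_eq_iff[OF W bar_closed bar_closed, of \<gamma> \<delta>] bar_diff[OF bar_closed bar_closed, of \<gamma> S \<delta>]
  by (simp add: cls_def NN_def)

lemma cls_add: "\<gamma> \<in> fsupp S \<Longrightarrow> \<delta> \<in> fsupp S \<Longrightarrow> cls \<gamma> \<oplus>\<^bsub>quot_module F W\<^esub> cls \<delta> = cls (\<gamma> + \<delta>)"
  by (simp add: cls_def F.quot_add[OF W] bar_closed bar_add[of _ _ S])

lemma cls_smult: "\<gamma> \<in> fsupp S \<Longrightarrow> \<pi> c \<odot>\<^bsub>quot_module F W\<^esub> cls \<gamma> = cls (sc c \<gamma>)"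
  by (simp add: cls_def F.quot_smult[OF W] bar_closed bar_sc[of _ _ S] \<pi>_closed)

lemma cls_zero: "\<zero>\<^bsub>quot_module F W\<^esub> = cls 0"
  by (simp add: cls_def F.quot_zero[OF W] bar_0[of S])

text \<open>The elements of the free module that have some lift with value in \<open>J\<close> form
  a submodule; it contains the relations and hence their span. Two lifts of one element differ by
  values in the kernel of \<pi>, so the value modulo \<open>J\<close> does not depend on the
  lift.\<close>

lemma ev_mem_of_rels:
  assumes J: "is_idl J" and ker: "\<And>c. \<pi> c = \<zero>\<^bsub>B\<^esub> \<Longrightarrow> c \<in> J"
    and rels_J: "\<And>\<rho>. \<rho> \<in> rels \<Longrightarrow> \<exists>\<gamma>\<in>fsupp S. bar \<gamma> = \<rho> \<and> ev \<omega> \<gamma> \<in> J"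
    and \<gamma>: "\<gamma> \<in> fsupp S" "\<gamma> \<in> NN"
  shows "ev \<omega> \<gamma> \<in> J"
proof -
  have lift0: "ev \<omega> \<gamma> \<in> J" if "bar \<gamma> = \<zero>\<^bsub>F\<^esub>" for \<gamma>
  proof -
    have "\<gamma> s \<in> J" for s using fun_cong[OF that, of s] by (intro ker) (simp add: bar_def free_module_def)
    then show ?thesis unfolding ev_def by (intro is_idl_sum[OF J] is_idlD(4)[OF J])
  qed
  let ?V = "{g \<in> carrier F. \<exists>\<gamma>\<in>fsupp S. bar \<gamma> = g \<and> ev \<omega> \<gamma> \<in> J}"
  have "submodule ?V B F"
  proof (rule F.submoduleI)
    show "\<zero>\<^bsub>F\<^esub> \<in> ?V"
      using fsupp_0[of S] bar_0[of S] lift0[of 0] by (auto intro!: bexI[of _ 0])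
    fix g assume "g \<in> ?V"
    then obtain \<gamma> where \<gamma>: "g \<in> carrier F" "\<gamma> \<in> fsupp S" "bar \<gamma> = g" "ev \<omega> \<gamma> \<in> J" by auto
    show "\<ominus>\<^bsub>F\<^esub> g \<in> ?V"
    proof -
      have "bar (sc (- 1) \<gamma>) = \<ominus>\<^bsub>F\<^esub> g"
        using \<gamma>(1,3) by (simp add: bar_sc[of _ _ S] \<pi>_minus \<pi>_one F.smult_l_minus)
      then show ?thesis
        using \<gamma> fsupp_sc[OF \<gamma>(2), of "- 1"] ev_sc[OF fsuppD[OF \<gamma>(2)], of \<omega> "- 1"] is_idlD(5)[OF J \<gamma>(4)]
        by (auto intro!: bexI[of _ "sc (- 1) \<gamma>"])
    qed
    fix h assume "h \<in> ?V"
    then obtain \<delta> where \<delta>: "h \<in> carrier F" "\<delta> \<in> fsupp S" "bar \<delta> = h" "ev \<omega> \<delta> \<in> J" by auto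
    show "g \<oplus>\<^bsub>F\<^esub> h \<in> ?V"
      using \<gamma> \<delta> fsupp_add[OF \<gamma>(2) \<delta>(2)] ev_add[OF fsuppD[OF \<gamma>(2)] fsuppD[OF \<delta>(2)], of \<omega>] is_idlD(2)[OF J \<gamma>(4) \<delta>(4)]
      by (auto intro!: bexI[of _ "\<gamma> + \<delta>"] simp: bar_add[of _ _ S])
  next
    fix b g assume b: "b \<in> carrier B" and "g \<in> ?V"
    then obtain \<gamma> where \<gamma>: "g \<in> carrier F" "\<gamma> \<in> fsupp S" "bar \<gamma> = g" "ev \<omega> \<gamma> \<in> J" by auto
    obtain c where c: "\<pi> c = b" using \<pi>_surj[OF b] by auto
    show "b \<odot>\<^bsub>F\<^esub> g \<in> ?V"
      using \<gamma> b c fsupp_sc[OF \<gamma>(2), of c] ev_sc[OF fsuppD[OF \<gamma>(2)], of \<omega> c] is_idlD(3)[OF J \<gamma>(4), of c]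
      by (auto intro!: bexI[of _ "sc c \<gamma>"] simp: bar_sc[of _ _ S])
  qed auto
  then have "W \<subseteq> ?V"
    unfolding W_def by (rule F.submodule_span_minimal) (use rels rels_J in blast)
  then obtain \<delta> where \<delta>: "\<delta> \<in> fsupp S" "bar \<delta> = bar \<gamma>" "ev \<omega> \<delta> \<in> J" using \<gamma>(2) by (auto simp: NN_def)
  have "bar (\<gamma> - \<delta>) = \<zero>\<^bsub>F\<^esub>"
    using bar_diff[OF bar_closed[OF \<gamma>(1)] bar_closed[OF \<delta>(1)]] \<delta>(2) bar_closed[OF \<gamma>(1)]
    by (simp add: F.M.minus_eq F.M.r_neg)
  then have "ev \<omega> \<gamma> - ev \<omega> \<delta> \<in> J" using lift0[of "\<gamma> - \<delta>"] ev_diff[OF \<gamma>(1) \<delta>(1)] by simp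
  then have "(ev \<omega> \<gamma> - ev \<omega> \<delta>) + ev \<omega> \<delta> \<in> J" using \<delta>(3) by (rule is_idlD(2)[OF J])
  then show ?thesis by simp
qed

end

section \<open>Exterior powers\<close>

lemma tuples_update: "l \<in> tuples M k \<Longrightarrow> x \<in> carrier M \<Longrightarrow> l[i := x] \<in> tuples M k"
  using set_update_subset_insert[of l i x] by (auto simp: tuples_def)

locale exterior = surj_hom B \<pi> for B :: "('b, 'x) ring_scheme" and \<pi> :: "'a::comm_ring_1 \<Rightarrow> 'b" +
  fixes M :: "('b, 'm, 'y) module_scheme" and k :: int
  assumes M: "Module.module B M"
begin

sublocale M: Module.module B M by (rule M)

lemma rel_lifts:
  shows add_lift: "l \<in> tuples M k \<Longrightarrow> x \<in> carrier M \<Longrightarrow> y \<in> carrier M \<Longrightarrow>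
      bar (sgl (l[i := x \<oplus>\<^bsub>M\<^esub> y]) - (sgl (l[i := x]) + sgl (l[i := y]))) =
      free_gen B (l[i := x \<oplus>\<^bsub>M\<^esub> y]) \<ominus>\<^bsub>free_module B (tuples M k)\<^esub>
        (free_gen B (l[i := x]) \<oplus>\<^bsub>free_module B (tuples M k)\<^esub> free_gen B (l[i := y]))"
    and smult_lift: "l \<in> tuples M k \<Longrightarrow> x \<in> carrier M \<Longrightarrow>
      bar (sgl (l[i := \<pi> c \<odot>\<^bsub>M\<^esub> x]) - sc c (sgl (l[i := x]))) =
      free_gen B (l[i := \<pi> c \<odot>\<^bsub>M\<^esub> x]) \<ominus>\<^bsub>free_module B (tuples M k)\<^esub>
        \<pi> c \<odot>\<^bsub>free_module B (tuples M k)\<^esub> free_gen B (l[i := x])"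
proof -
  let ?F = "free_module B (tuples M k)"
  assume l: "l \<in> tuples M k" and x: "x \<in> carrier M"
  have S: "sgl (l[i := z]) \<in> fsupp (tuples M k)" if "z \<in> carrier M" for z
    by (rule fsupp_sgl[OF tuples_update[OF l that]])
  show "bar (sgl (l[i := x \<oplus>\<^bsub>M\<^esub> y]) - (sgl (l[i := x]) + sgl (l[i := y]))) =
      free_gen B (l[i := x \<oplus>\<^bsub>M\<^esub> y]) \<ominus>\<^bsub>?F\<^esub> (free_gen B (l[i := x]) \<oplus>\<^bsub>?F\<^esub> free_gen B (l[i := y]))"
    if y: "y \<in> carrier M"
    using bar_diff[OF bar_closed[OF S[of "x \<oplus>\<^bsub>M\<^esub> y"]] bar_closed[OF fsupp_add[OF S[OF x] S[OF y]]]] x y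
    by (simp add: bar_add[of _ _ "tuples M k"] bar_sgl)
  show "bar (sgl (l[i := \<pi> c \<odot>\<^bsub>M\<^esub> x]) - sc c (sgl (l[i := x]))) =
      free_gen B (l[i := \<pi> c \<odot>\<^bsub>M\<^esub> x]) \<ominus>\<^bsub>?F\<^esub> \<pi> c \<odot>\<^bsub>?F\<^esub> free_gen B (l[i := x])"
    using bar_diff[OF bar_closed[OF S[of "\<pi> c \<odot>\<^bsub>M\<^esub> x"]] bar_closed[OF fsupp_sc[OF S[OF x], of c]]] x
    by (simp add: bar_sc[of _ _ "tuples M k"] bar_sgl \<pi>_closed)
qed

lemma exterior_rels_cases:
  assumes "\<rho> \<in> exterior_rels B M k"
  obtains l i x y where "l \<in> tuples M k" "i < length l" "x \<in> carrier M" "y \<in> carrier M"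
      "\<rho> = bar (sgl (l[i := x \<oplus>\<^bsub>M\<^esub> y]) - (sgl (l[i := x]) + sgl (l[i := y])))"
  | l i c x where "l \<in> tuples M k" "i < length l" "x \<in> carrier M"
      "\<rho> = bar (sgl (l[i := \<pi> c \<odot>\<^bsub>M\<^esub> x]) - sc c (sgl (l[i := x])))"
  | l i j where "l \<in> tuples M k" "i < j" "j < length l" "l ! i = l ! j" "\<rho> = bar (sgl l)"
proof -
  let ?F = "free_module B (tuples M k)"
  from assms show thesis
    unfolding exterior_rels_def Let_def
  proof (elim UnE CollectE exE conjE)
    fix l i x y
    assume \<rho>: "\<rho> = free_gen B (l[i := x \<oplus>\<^bsub>M\<^esub> y]) \<ominus>\<^bsub>?F\<^esub> (free_gen B (l[i := x]) \<oplus>\<^bsub>?F\<^esub> free_gen B (l[i := y]))"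
      and l: "l \<in> tuples M k" "i < length l" "x \<in> carrier M" "y \<in> carrier M"
    show thesis by (rule that(1)[OF l]) (simp only: \<rho> add_lift[OF l(1,3,4)])
  next
    fix l i a x
    assume \<rho>: "\<rho> = free_gen B (l[i := a \<odot>\<^bsub>M\<^esub> x]) \<ominus>\<^bsub>?F\<^esub> a \<odot>\<^bsub>?F\<^esub> free_gen B (l[i := x])"
      and l: "l \<in> tuples M k" "i < length l" "a \<in> carrier B" "x \<in> carrier M"
    obtain c where c: "\<pi> c = a" using \<pi>_surj[OF l(3)] by auto
    show thesis by (rule that(2)[OF l(1,2,4), of c]) (simp only: \<rho> smult_lift[OF l(1,4)] c[symmetric])
  next
    fix l i j
    assume \<rho>: "\<rho> = free_gen B l" and l: "l \<in> tuples M k" "i < j" "j < length l" "l ! i = l ! j"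
    show thesis by (rule that(3)[OF l]) (simp only: \<rho> bar_sgl)
  qed
qed

lemma rel_lifts_fsupp:
  assumes l: "l \<in> tuples M k" and x: "x \<in> carrier M"
  shows "y \<in> carrier M \<Longrightarrow> sgl (l[i := x \<oplus>\<^bsub>M\<^esub> y]) - (sgl (l[i := x]) + sgl (l[i := y])) \<in> fsupp (tuples M k)"
    and "sgl (l[i := \<pi> c \<odot>\<^bsub>M\<^esub> x]) - sc c (sgl (l[i := x])) \<in> fsupp (tuples M k)"
  using x by (auto intro!: fsupp_diff fsupp_add fsupp_sc fsupp_sgl tuples_update[OF l] \<pi>_closed)

sublocale presented B \<pi> "tuples M k" "exterior_rels B M k"
proof
  show "exterior_rels B M k \<subseteq> carrier (free_module B (tuples M k))"
  proof
    fix \<rho> assume "\<rho> \<in> exterior_rels B M k"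
    then show "\<rho> \<in> carrier (free_module B (tuples M k))"
      by (cases rule: exterior_rels_cases) (auto intro!: bar_closed rel_lifts_fsupp fsupp_sgl)
  qed
qed

lemma W_eq: "W = exterior_rel_span B M k"
  by (simp add: W_def exterior_rel_span_def)

lemma exterior_power_eq: "exterior_power B M k = quot_module F W"
  by (simp add: exterior_power_def W_eq)

lemma NN_add:
  assumes "l \<in> tuples M k" "i < length l" "x \<in> carrier M" "y \<in> carrier M"
  shows "sgl (l[i := x \<oplus>\<^bsub>M\<^esub> y]) - (sgl (l[i := x]) + sgl (l[i := y])) \<in> NN"
  by (rule rels_NN, unfold add_lift[OF assms(1,3,4)] exterior_rels_def Let_def) (use assms in blast)

lemma NN_smult:
  assumes "l \<in> tuples M k" "i < length l" "x \<in> carrier M"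
  shows "sgl (l[i := \<pi> c \<odot>\<^bsub>M\<^esub> x]) - sc c (sgl (l[i := x])) \<in> NN"
  by (rule rels_NN, unfold smult_lift[OF assms(1,3)] exterior_rels_def Let_def) (use assms \<pi>_closed in blast)

lemma NN_alt:
  assumes "l \<in> tuples M k" "i < j" "j < length l" "l ! i = l ! j"
  shows "sgl l \<in> NN"
  by (rule rels_NN, unfold bar_sgl exterior_rels_def Let_def) (use assms in blast)

text \<open>The universal property of the exterior power, for a function on tuples that is
  multilinear and alternating only modulo \<open>J\<close>.\<close>

lemma ev_NN:
  assumes J: "is_idl J" and ker: "\<And>c. \<pi> c = \<zero>\<^bsub>B\<^esub> \<Longrightarrow> c \<in> J"
    and add: "\<And>l i x y. l \<in> tuples M k \<Longrightarrow> i < length l \<Longrightarrow> x \<in> carrier M \<Longrightarrow> y \<in> carrier M \<Longrightarrow>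
      \<omega> (l[i := x \<oplus>\<^bsub>M\<^esub> y]) - (\<omega> (l[i := x]) + \<omega> (l[i := y])) \<in> J"
    and smult: "\<And>l i c x. l \<in> tuples M k \<Longrightarrow> i < length l \<Longrightarrow> x \<in> carrier M \<Longrightarrow>
      \<omega> (l[i := \<pi> c \<odot>\<^bsub>M\<^esub> x]) - c * \<omega> (l[i := x]) \<in> J"
    and alt: "\<And>l i j. l \<in> tuples M k \<Longrightarrow> i < j \<Longrightarrow> j < length l \<Longrightarrow> l ! i = l ! j \<Longrightarrow> \<omega> l \<in> J"
    and \<gamma>: "\<gamma> \<in> fsupp (tuples M k)" "\<gamma> \<in> NN"
  shows "ev \<omega> \<gamma> \<in> J"
proof (rule ev_mem_of_rels[OF J ker _ \<gamma>])
  fix \<rho> assume "\<rho> \<in> exterior_rels B M k"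
  then show "\<exists>\<gamma>\<in>fsupp (tuples M k). bar \<gamma> = \<rho> \<and> ev \<omega> \<gamma> \<in> J"
  proof (cases rule: exterior_rels_cases)
    case (1 l i x y)
    have s: "sgl (l[i := z]) \<in> fsupp (tuples M k)" if "z \<in> carrier M" for z
      by (rule fsupp_sgl[OF tuples_update[OF 1(1) that]])
    have "ev \<omega> (sgl (l[i := x \<oplus>\<^bsub>M\<^esub> y]) - (sgl (l[i := x]) + sgl (l[i := y]))) =
        \<omega> (l[i := x \<oplus>\<^bsub>M\<^esub> y]) - (\<omega> (l[i := x]) + \<omega> (l[i := y]))"
      unfolding ev_diff[OF s[OF M.M.a_closed[OF 1(3,4)]] fsupp_add[OF s[OF 1(3)] s[OF 1(4)]]]
        ev_add[OF fsuppD[OF s[OF 1(3)]] fsuppD[OF s[OF 1(4)]]] ev_sgl ..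
    then have "ev \<omega> (sgl (l[i := x \<oplus>\<^bsub>M\<^esub> y]) - (sgl (l[i := x]) + sgl (l[i := y]))) \<in> J"
      using add[OF 1(1-4)] by (simp only:)
    then show ?thesis using rel_lifts_fsupp(1)[OF 1(1,3,4)] 1(5) by blast
  next
    case (2 l i c x)
    have s: "sgl (l[i := z]) \<in> fsupp (tuples M k)" if "z \<in> carrier M" for z
      by (rule fsupp_sgl[OF tuples_update[OF 2(1) that]])
    have "ev \<omega> (sgl (l[i := \<pi> c \<odot>\<^bsub>M\<^esub> x]) - sc c (sgl (l[i := x]))) = \<omega> (l[i := \<pi> c \<odot>\<^bsub>M\<^esub> x]) - c * \<omega> (l[i := x])"
      unfolding ev_diff[OF s[OF M.smult_closed[OF \<pi>_closed 2(3)]] fsupp_sc[OF s[OF 2(3)]]]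
        ev_sc[OF fsuppD[OF s[OF 2(3)]]] ev_sgl ..
    then have "ev \<omega> (sgl (l[i := \<pi> c \<odot>\<^bsub>M\<^esub> x]) - sc c (sgl (l[i := x]))) \<in> J"
      using smult[OF 2(1-3)] by (simp only:)
    then show ?thesis using rel_lifts_fsupp(2)[OF 2(1,3)] 2(4) by blast
  next
    case (3 l i j)
    have "ev \<omega> (sgl l) \<in> J" unfolding ev_sgl by (rule alt[OF 3(1-4)])
    then show ?thesis using fsupp_sgl[OF 3(1)] 3(5) by blast
  qed
qed

end

section \<open>Exterior multiplication by a fixed element\<close>

definition prep :: "'m \<Rightarrow> ('m list \<Rightarrow> 'a::comm_ring_1) \<Rightarrow> 'm list \<Rightarrow> 'a" where
  "prep m \<gamma> = (\<lambda>l. case l of [] \<Rightarrow> 0 | x # xs \<Rightarrow> if x = m then \<gamma> xs else 0)"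

lemma prep_sgl: "prep m (sgl l) = sgl (m # l)"
  by (auto simp: prep_def sgl_def fun_eq_iff split: list.split)

lemma prep_add: "prep m (\<gamma> + \<delta>) = prep m \<gamma> + prep m \<delta>"
  and prep_diff: "prep m (\<gamma> - \<delta>) = prep m \<gamma> - prep m \<delta>"
  and prep_sc: "prep m (sc c \<gamma>) = sc c (prep m \<gamma>)"
  by (auto simp: prep_def sc_def fun_eq_iff split: list.split)

lemma prep_fsupp:
  assumes m: "m \<in> carrier M" and \<gamma>: "\<gamma> \<in> fsupp (tuples M k)"
  shows "prep m \<gamma> \<in> fsupp (tuples M (k + 1))"
proof -
  have "{l. prep m \<gamma> l \<noteq> 0} \<subseteq> (#) m ` {l. \<gamma> l \<noteq> 0}"
  proof
    fix l assume "l \<in> {l. prep m \<gamma> l \<noteq> 0}"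
    then show "l \<in> (#) m ` {l. \<gamma> l \<noteq> 0}" by (cases l) (auto simp: prep_def split: if_splits)
  qed
  then have "finite {l. prep m \<gamma> l \<noteq> 0}" using fsuppD[OF \<gamma>] by (meson finite_imageI finite_subset)
  moreover have "prep m \<gamma> l = 0" if l: "l \<notin> tuples M (k + 1)" for l
  proof (cases l)
    case (Cons x xs)
    show ?thesis
    proof (cases "x = m")
      case True
      then have "xs \<notin> tuples M k" using l m Cons by (auto simp: tuples_def)
      then show ?thesis using \<gamma> Cons by (auto simp: prep_def fsupp_def)
    qed (simp add: prep_def Cons)
  qed (simp add: prep_def)
  ultimately show ?thesis by (auto simp: fsupp_def)
qed

context surj_hom
begin

lemma bar_prep: "bar (prep m \<gamma>) = prepend B m (bar \<gamma>)"
  by (auto simp: bar_def prep_def prepend_def fun_eq_iff \<pi>_zero split: list.split)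

end

context exterior
begin

text \<open>Prepending \<open>m\<close> turns a defining relation into one of the same kind with
  positions shifted by one, so lifted relations go to lifted relations. All members of a coset then
  yield the same coset, and the union in \<open>wedge_left\<close> collapses.\<close>

lemma wedge_left_cls:
  assumes m: "m \<in> carrier M" and \<gamma>: "\<gamma> \<in> fsupp (tuples M k)"
  shows "wedge_left B M m k (cls \<gamma>) = presented.cls B \<pi> (tuples M (k + 1)) (exterior_rels B M (k + 1)) (prep m \<gamma>)"
proof -
  interpret E': exterior B \<pi> M "k + 1" by unfold_locales
  let ?F' = "free_module B (tuples M (k + 1))"
  have prep_rel: "prep m \<delta> \<in> E'.NN" if \<delta>: "\<delta> \<in> fsupp (tuples M k)" "bar \<delta> \<in> W" for \<delta>
  proof -
    let ?V = "{g \<in> carrier F. \<exists>\<gamma>\<in>fsupp (tuples M k). bar \<gamma> = g \<and> prep m \<gamma> \<in> E'.NN}"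
    interpret N': form_mod sc E'.NN by (rule E'.form_mod_NN)
    have tup: "m # l \<in> tuples M (k + 1)" if "l \<in> tuples M k" for l using that m by (auto simp: tuples_def)
    have "submodule ?V B F"
    proof (rule F.submoduleI)
      have "prep m (0 :: 'm list \<Rightarrow> 'a) = 0" by (auto simp: prep_def fun_eq_iff split: list.split)
      then show "\<zero>\<^bsub>F\<^esub> \<in> ?V"
        using fsupp_0[of "tuples M k"] bar_0[of "tuples M k"] N'.N_zero by (auto intro!: bexI[of _ 0])
      fix g assume "g \<in> ?V"
      then obtain \<gamma> where \<gamma>: "g \<in> carrier F" "\<gamma> \<in> fsupp (tuples M k)" "bar \<gamma> = g" "prep m \<gamma> \<in> E'.NN" by auto
      have "bar (sc (- 1) \<gamma>) = \<ominus>\<^bsub>F\<^esub> g" using bar_sc_minus_one \<gamma>(1,3) by blast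
      moreover have "prep m (sc (- 1) \<gamma>) \<in> E'.NN" unfolding prep_sc by (rule N'.N_scale[OF \<gamma>(4)])
      moreover have "\<ominus>\<^bsub>F\<^esub> g \<in> carrier F" using \<gamma>(1) by simp
      ultimately show "\<ominus>\<^bsub>F\<^esub> g \<in> ?V" using fsupp_sc[OF \<gamma>(2), of "- 1"] by blast
      fix h assume "h \<in> ?V"
      then obtain \<delta> where \<delta>: "h \<in> carrier F" "\<delta> \<in> fsupp (tuples M k)" "bar \<delta> = h" "prep m \<delta> \<in> E'.NN" by auto
      have "bar (\<gamma> + \<delta>) = g \<oplus>\<^bsub>F\<^esub> h" by (simp only: bar_add[of _ _ "tuples M k"] \<gamma>(3) \<delta>(3))
      moreover have "prep m (\<gamma> + \<delta>) \<in> E'.NN" unfolding prep_add by (rule N'.N_add[OF \<gamma>(4) \<delta>(4)])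
      moreover have "g \<oplus>\<^bsub>F\<^esub> h \<in> carrier F" using \<gamma>(1) \<delta>(1) by simp
      ultimately show "g \<oplus>\<^bsub>F\<^esub> h \<in> ?V" using fsupp_add[OF \<gamma>(2) \<delta>(2)] by blast
    next
      fix b g assume b: "b \<in> carrier B" and "g \<in> ?V"
      then obtain \<gamma> where \<gamma>: "g \<in> carrier F" "\<gamma> \<in> fsupp (tuples M k)" "bar \<gamma> = g" "prep m \<gamma> \<in> E'.NN" by auto
      obtain c where c: "\<pi> c = b" using \<pi>_surj[OF b] by auto
      have "bar (sc c \<gamma>) = b \<odot>\<^bsub>F\<^esub> g" by (simp only: bar_sc[of _ _ "tuples M k"] \<gamma>(3) c)
      moreover have "prep m (sc c \<gamma>) \<in> E'.NN" unfolding prep_sc by (rule N'.N_scale[OF \<gamma>(4)])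
      moreover have "b \<odot>\<^bsub>F\<^esub> g \<in> carrier F" using \<gamma>(1) b by simp
      ultimately show "b \<odot>\<^bsub>F\<^esub> g \<in> ?V" using fsupp_sc[OF \<gamma>(2), of c] by blast
    qed auto
    moreover have "exterior_rels B M k \<subseteq> ?V"
    proof
      fix \<rho> assume \<rho>: "\<rho> \<in> exterior_rels B M k"
      have "\<exists>\<gamma>\<in>fsupp (tuples M k). bar \<gamma> = \<rho> \<and> prep m \<gamma> \<in> E'.NN"
        using \<rho>
      proof (cases rule: exterior_rels_cases)
        case (1 l i x y)
        have "prep m (sgl (l[i := x \<oplus>\<^bsub>M\<^esub> y]) - (sgl (l[i := x]) + sgl (l[i := y]))) \<in> E'.NN"
          using E'.NN_add[OF tup[OF 1(1)], of "Suc i" x y] 1 by (simp add: prep_diff prep_add prep_sgl)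
        then show ?thesis using rel_lifts_fsupp(1)[OF 1(1,3,4)] 1(5) by blast
      next
        case (2 l i c x)
        have "prep m (sgl (l[i := \<pi> c \<odot>\<^bsub>M\<^esub> x]) - sc c (sgl (l[i := x]))) \<in> E'.NN"
          using E'.NN_smult[OF tup[OF 2(1)], of "Suc i" x c] 2 by (simp add: prep_diff prep_sc prep_sgl)
        then show ?thesis using rel_lifts_fsupp(2)[OF 2(1,3)] 2(4) by blast
      next
        case (3 l i j)
        have "prep m (sgl l) \<in> E'.NN"
          using E'.NN_alt[OF tup[OF 3(1)], of "Suc i" "Suc j"] 3 by (simp add: prep_sgl)
        then show ?thesis using fsupp_sgl[OF 3(1)] 3(5) by blast
      qed
      then show "\<rho> \<in> ?V" using rels \<rho> by blast
    qed
    ultimately have "W \<subseteq> ?V" unfolding W_def by (rule F.submodule_span_minimal)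
    then obtain \<epsilon> where \<epsilon>: "\<epsilon> \<in> fsupp (tuples M k)" "bar \<epsilon> = bar \<delta>" "prep m \<epsilon> \<in> E'.NN" using \<delta>(2) by auto
    then show ?thesis by (simp add: E'.NN_def bar_prep)
  qed
  have "E'.W +>\<^bsub>?F'\<^esub> prepend B m g = E'.cls (prep m \<gamma>)" if g: "g \<in> cls \<gamma>" for g
  proof -
    obtain w where w: "w \<in> W" "g = w \<oplus>\<^bsub>F\<^esub> bar \<gamma>" using g by (auto simp: cls_def a_r_coset_def')
    have wc: "w \<in> carrier F" using w(1) F.N_subset[OF W] by auto
    then have gc: "g \<in> carrier F" using w(2) bar_closed[OF \<gamma>] by simp
    obtain \<delta> where \<delta>: "\<delta> \<in> fsupp (tuples M k)" "bar \<delta> = g" using bar_lift[OF gc] by auto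
    have "bar (\<delta> - \<gamma>) = w"
      using bar_diff[OF bar_closed[OF \<delta>(1)] bar_closed[OF \<gamma>]] \<delta>(2) w wc bar_closed[OF \<gamma>]
      by (simp add: F.M.minus_eq F.M.a_assoc F.M.r_neg)
    then have "prep m (\<delta> - \<gamma>) \<in> E'.NN" using w(1) by (intro prep_rel fsupp_diff \<delta>(1) \<gamma>) simp
    then have "E'.cls (prep m \<delta>) = E'.cls (prep m \<gamma>)"
      using E'.cls_eq_iff[OF prep_fsupp[OF m \<delta>(1)] prep_fsupp[OF m \<gamma>]] by (simp add: prep_diff)
    then show ?thesis by (simp add: E'.cls_def bar_prep \<delta>(2))
  qed
  moreover have "bar \<gamma> \<in> cls \<gamma>"
    using F.N_zero_mem[OF W] bar_closed[OF \<gamma>] by (force simp: cls_def a_r_coset_def')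
  then have "cls \<gamma> \<noteq> {}" by blast
  ultimately show ?thesis
    unfolding wedge_left_def E'.W_eq[symmetric] by (intro SUP_eq_const)
qed

end

section \<open>Differentials of the coordinate ring\<close>

definition grad :: "nat \<Rightarrow> 'k::field mpol \<Rightarrow> nat \<Rightarrow> 'k mpol" where
  "grad n p = (\<lambda>j. if j < n then partial_deriv j p else 0)"

definition pairing :: "nat \<Rightarrow> (nat \<Rightarrow> 'a::comm_ring_1) \<Rightarrow> (nat \<Rightarrow> 'a) \<Rightarrow> 'a" where
  "pairing n \<phi> v = (\<Sum>j<n. v j * \<phi> j)"

lemma pairing_diff: "pairing n \<phi> (\<lambda>j. v j - w j) = pairing n \<phi> v - pairing n \<phi> w"
  by (simp add: pairing_def left_diff_distrib sum_subtractf)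

lemma pairing_add: "pairing n \<phi> (\<lambda>j. v j + w j) = pairing n \<phi> v + pairing n \<phi> w"
  by (simp add: pairing_def distrib_right sum.distrib)

lemma pairing_scale: "pairing n \<phi> (\<lambda>j. c * v j) = c * pairing n \<phi> v"
  by (simp add: pairing_def sum_distrib_left mult.assoc)

lemma grad_diff: "grad n (p - q) = (\<lambda>j. grad n p j - grad n q j)"
  by (auto simp: grad_def fun_eq_iff partial_deriv_diff)

lemma grad_add: "grad n (p + q) = (\<lambda>j. grad n p j + grad n q j)"
  by (auto simp: grad_def fun_eq_iff partial_deriv_add)

lemma grad_mult: "grad n (p * q) = (\<lambda>j. p * grad n q j + q * grad n p j)"
  by (auto simp: grad_def fun_eq_iff partial_deriv_mult)

lemma grad_const: "grad n (const c) = (\<lambda>_. 0)"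
  by (auto simp: grad_def fun_eq_iff)

lemma grad_var: "j < n \<Longrightarrow> grad n (var j) = unitv j"
  by (auto simp: grad_def unitv_def fun_eq_iff partial_deriv_var)

locale ci =
  fixes n r :: nat and fs :: "nat \<Rightarrow> 'k::field mpol"
  assumes fs: "\<And>i. i < r \<Longrightarrow> fs i \<in> poly_in {..<n}"
begin

abbreviation "PP \<equiv> mpoly_ring n :: 'k mpol ring"
abbreviation "II \<equiv> ci_ideal n r fs"
abbreviation "JJ \<equiv> ext_ideal n II"
abbreviation "BB \<equiv> coord_ring n r fs"
abbreviation "\<kappa> \<equiv> coord_const n r fs"
abbreviation "KK \<equiv> ring_of_type_algebra :: 'k ring"

text \<open>Retracting first extends the projection to the whole polynomial type, as
  \<open>surj_hom\<close> demands.\<close>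

definition pr :: "'k mpol \<Rightarrow> 'k mpol set" where
  "pr p = coord_class n r fs (retr n p)"

lemma II_eq: "II = gen_ideal (poly_in {..<n}) r fs"
  by (rule ci_ideal_eq) (rule fs)

lemma II: "ideal II PP"
  unfolding II_eq by (rule ideal_gen_ideal[OF ideal_poly_in fs])

lemma JJ: "is_idl JJ"
  by (rule is_idl_ext_ideal[OF II])

lemma class_hom: "coord_class n r fs \<in> Ring.ring_hom PP BB"
  using ideal.rcos_ring_hom[OF II] by (simp add: coord_class_def[abs_def] coord_ring_def)

lemma pr_of_poly: "p \<in> poly_in {..<n} \<Longrightarrow> pr p = coord_class n r fs p"
  by (simp add: pr_def retr_id)

sublocale surj_hom BB pr
proof (rule surj_hom.intro)
  show "cring BB" unfolding coord_ring_def by (rule ideal.quotient_is_cring[OF II cring_mpoly_ring])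
  show "pr a \<in> carrier BB" for a
    using ring_hom_closed[OF class_hom, of "retr n a"] by (simp add: pr_def retr_in)
  show "\<exists>a. pr a = b" if b: "b \<in> carrier BB" for b
  proof -
    obtain p where "p \<in> poly_in {..<n}" "b = II +>\<^bsub>PP\<^esub> p"
      using b by (auto simp: coord_ring_def FactRing_def A_RCOSETS_def')
    then show ?thesis using pr_of_poly by (auto simp: coord_class_def)
  qed
  show "pr (x + y) = pr x \<oplus>\<^bsub>BB\<^esub> pr y" for x y
    using ring_hom_add[OF class_hom, of "retr n x" "retr n y"] by (simp add: pr_def retr_hom retr_in)
  show "pr (x * y) = pr x \<otimes>\<^bsub>BB\<^esub> pr y" for x y
    using ring_hom_mult[OF class_hom, of "retr n x" "retr n y"] by (simp add: pr_def retr_hom retr_in)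
  show "pr 1 = \<one>\<^bsub>BB\<^esub>" using ring_hom_one[OF class_hom] by (simp add: pr_def retr_hom)
qed

lemma pr_eq_iff: "pr a = pr b \<longleftrightarrow> a - b \<in> JJ"
  using a_coset_eq_iff[OF II retr_in retr_in, of a b] by (simp add: pr_def coord_class_def ext_ideal_def retr_hom)

lemma pr_zero_iff: "pr a = \<zero>\<^bsub>BB\<^esub> \<longleftrightarrow> a \<in> JJ"
  using pr_eq_iff[of a 0] by (simp add: \<pi>_zero)

lemma kappa_eq: "\<kappa> c = pr (const c)"
  by (simp add: pr_of_poly coord_const_def const_def[symmetric])

lemma mem_JJ: "p \<in> poly_in {..<n} \<Longrightarrow> p \<in> JJ \<longleftrightarrow> p \<in> II"
  by (rule ext_ideal_iff)

lemma fs_JJ: "i < r \<Longrightarrow> fs i \<in> JJ"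
  using gen_mem_gen_ideal[of i r fs n] mem_JJ[OF fs] by (simp add: II_eq)

definition lift :: "'k mpol set \<Rightarrow> 'k mpol" where
  "lift b = (SOME p. p \<in> poly_in {..<n} \<and> pr p = b)"

lemma lift:
  assumes "b \<in> carrier BB"
  shows "lift b \<in> poly_in {..<n}" "pr (lift b) = b"
proof -
  obtain a where "pr a = b" using \<pi>_surj[OF assms] by auto
  moreover have "pr (retr n a) = pr a" by (simp add: pr_def retr_id retr_in)
  ultimately have "\<exists>p. p \<in> poly_in {..<n} \<and> pr p = b" using retr_in by blast
  from someI_ex[OF this] show "lift b \<in> poly_in {..<n}" "pr (lift b) = b" by (auto simp: lift_def)
qed

text \<open>Modulo I these vectors are the B-linear maps from the differentials to B, with
  \<open>\<phi> j\<close> the image of dx_j.\<close>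

definition row_kill :: "(nat \<Rightarrow> 'k mpol) \<Rightarrow> bool" where
  "row_kill \<phi> \<longleftrightarrow> (\<forall>i<r. pairing n \<phi> (grad n (fs i)) \<in> JJ)"

text \<open>By the product rule the gradient of the sum of the H_i f_i consists of multiples of the
  gradients of the f_i, on which the pairing vanishes modulo I, and of multiples of the f_i
  themselves.\<close>

lemma pairing_grad_ideal:
  assumes \<phi>: "row_kill \<phi>" and p: "p \<in> poly_in {..<n}" "p \<in> JJ"
  shows "pairing n \<phi> (grad n p) \<in> JJ"
proof -
  obtain H where H: "p = (\<Sum>i<r. H i * fs i)" using p mem_JJ[OF p(1)] by (auto simp: II_eq gen_ideal_def)
  have "pairing n \<phi> (grad n p) = (\<Sum>j<n. \<Sum>i<r. (H i * grad n (fs i) j + fs i * grad n (H i) j) * \<phi> j)"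
    unfolding pairing_def
  proof (rule sum.cong[OF refl])
    fix j assume "j \<in> {..<n}"
    then show "grad n p j * \<phi> j = (\<Sum>i<r. (H i * grad n (fs i) j + fs i * grad n (H i) j) * \<phi> j)"
      by (simp add: H grad_def partial_deriv_sum partial_deriv_mult sum_distrib_right)
  qed
  also have "\<dots> = (\<Sum>i<r. H i * pairing n \<phi> (grad n (fs i)) + fs i * pairing n \<phi> (grad n (H i)))"
    by (subst sum.swap) (simp add: pairing_def sum_distrib_left distrib_right sum.distrib mult.assoc)
  also have "\<dots> \<in> JJ"
  proof (rule is_idl_sum[OF JJ])
    fix i assume "i \<in> {..<r}"
    then show "H i * pairing n \<phi> (grad n (fs i)) + fs i * pairing n \<phi> (grad n (H i)) \<in> JJ"
      using \<phi> fs_JJ by (intro is_idlD(2)[OF JJ] is_idlD(3)[OF JJ] is_idlD(4)[OF JJ fs_JJ]) (auto simp: row_kill_def)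
  qed
  finally show ?thesis .
qed

lemma pairing_grad_cong:
  assumes "row_kill \<phi>" "p \<in> poly_in {..<n}" "q \<in> poly_in {..<n}" "pr p = pr q"
  shows "pairing n \<phi> (grad n p) - pairing n \<phi> (grad n q) \<in> JJ"
  using pairing_grad_ideal[OF assms(1), of "p - q"] assms(2-4)
  by (simp add: grad_diff pairing_diff pr_eq_iff poly_in_diff)

abbreviation "FB \<equiv> free_module BB (carrier BB)"

lemma kaehler_rels_cases:
  assumes "\<rho> \<in> kaehler_rels KK BB \<kappa>"
  obtains p q where "p \<in> poly_in {..<n}" "q \<in> poly_in {..<n}"
      "\<rho> = bar (sgl (pr (p + q)) - (sgl (pr p) + sgl (pr q)))"
  | p q where "p \<in> poly_in {..<n}" "q \<in> poly_in {..<n}"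
      "\<rho> = bar (sgl (pr (p * q)) - (sc p (sgl (pr q)) + sc q (sgl (pr p))))"
  | c where "\<rho> = bar (sgl (pr (const c)))"
proof -
  have S: "bar (sgl (pr p)) \<in> carrier FB" for p by (intro bar_closed fsupp_sgl \<pi>_closed)
  from assms show thesis
    unfolding kaehler_rels_def Let_def
  proof (elim UnE CollectE exE conjE)
    fix a b
    assume \<rho>: "\<rho> = free_gen BB (a \<oplus>\<^bsub>BB\<^esub> b) \<ominus>\<^bsub>FB\<^esub> (free_gen BB a \<oplus>\<^bsub>FB\<^esub> free_gen BB b)"
      and ab: "a \<in> carrier BB" "b \<in> carrier BB"
    let ?p = "lift a" and ?q = "lift b"
    have "bar (sgl (pr (?p + ?q)) - (sgl (pr ?p) + sgl (pr ?q))) = bar (sgl (pr (?p + ?q))) \<ominus>\<^bsub>FB\<^esub> bar (sgl (pr ?p) + sgl (pr ?q))"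
      by (intro bar_diff bar_closed fsupp_add fsupp_sgl \<pi>_closed)
    also have "\<dots> = \<rho>" unfolding \<rho> bar_add[of _ _ "carrier BB"] bar_sgl \<pi>_add lift(2)[OF ab(1)] lift(2)[OF ab(2)] ..
    finally show thesis using that(1)[OF lift(1)[OF ab(1)] lift(1)[OF ab(2)]] by simp
  next
    fix a b
    assume \<rho>: "\<rho> = free_gen BB (a \<otimes>\<^bsub>BB\<^esub> b) \<ominus>\<^bsub>FB\<^esub> (a \<odot>\<^bsub>FB\<^esub> free_gen BB b \<oplus>\<^bsub>FB\<^esub> b \<odot>\<^bsub>FB\<^esub> free_gen BB a)"
      and ab: "a \<in> carrier BB" "b \<in> carrier BB"
    let ?p = "lift a" and ?q = "lift b"
    have "bar (sgl (pr (?p * ?q)) - (sc ?p (sgl (pr ?q)) + sc ?q (sgl (pr ?p)))) =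
        bar (sgl (pr (?p * ?q))) \<ominus>\<^bsub>FB\<^esub> bar (sc ?p (sgl (pr ?q)) + sc ?q (sgl (pr ?p)))"
      by (intro bar_diff bar_closed fsupp_add fsupp_sc fsupp_sgl \<pi>_closed)
    also have "\<dots> = \<rho>"
      unfolding \<rho> bar_add[of _ _ "carrier BB"] bar_sc[of _ _ "carrier BB"] bar_sgl \<pi>_mult lift(2)[OF ab(1)] lift(2)[OF ab(2)] ..
    finally show thesis using that(2)[OF lift(1)[OF ab(1)] lift(1)[OF ab(2)]] by simp
  next
    fix c assume "\<rho> = free_gen BB (\<kappa> c)"
    then show thesis using that(3)[of c] by (simp add: bar_sgl kappa_eq)
  qed
qed

lemma kaehler_relsI:
  shows "a \<in> carrier BB \<Longrightarrow> b \<in> carrier BB \<Longrightarrow>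
      free_gen BB (a \<oplus>\<^bsub>BB\<^esub> b) \<ominus>\<^bsub>FB\<^esub> (free_gen BB a \<oplus>\<^bsub>FB\<^esub> free_gen BB b) \<in> kaehler_rels KK BB \<kappa>"
    and "a \<in> carrier BB \<Longrightarrow> b \<in> carrier BB \<Longrightarrow>
      free_gen BB (a \<otimes>\<^bsub>BB\<^esub> b) \<ominus>\<^bsub>FB\<^esub> (a \<odot>\<^bsub>FB\<^esub> free_gen BB b \<oplus>\<^bsub>FB\<^esub> b \<odot>\<^bsub>FB\<^esub> free_gen BB a) \<in> kaehler_rels KK BB \<kappa>"
    and "free_gen BB (\<kappa> c) \<in> kaehler_rels KK BB \<kappa>"
proof -
  show "free_gen BB (a \<oplus>\<^bsub>BB\<^esub> b) \<ominus>\<^bsub>FB\<^esub> (free_gen BB a \<oplus>\<^bsub>FB\<^esub> free_gen BB b) \<in> kaehler_rels KK BB \<kappa>"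
    if "a \<in> carrier BB" "b \<in> carrier BB"
    unfolding kaehler_rels_def Let_def by (rule UnI1, rule UnI1) (use that in blast)
  show "free_gen BB (a \<otimes>\<^bsub>BB\<^esub> b) \<ominus>\<^bsub>FB\<^esub> (a \<odot>\<^bsub>FB\<^esub> free_gen BB b \<oplus>\<^bsub>FB\<^esub> b \<odot>\<^bsub>FB\<^esub> free_gen BB a) \<in> kaehler_rels KK BB \<kappa>"
    if "a \<in> carrier BB" "b \<in> carrier BB"
    unfolding kaehler_rels_def Let_def by (rule UnI1, rule UnI2) (use that in blast)
  show "free_gen BB (\<kappa> c) \<in> kaehler_rels KK BB \<kappa>"
    unfolding kaehler_rels_def Let_def by (rule UnI2) (auto simp: ring_of_type_algebra_def)
qed

sublocale K: presented BB pr "carrier BB" "kaehler_rels KK BB \<kappa>"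
proof
  show "kaehler_rels KK BB \<kappa> \<subseteq> carrier FB"
  proof
    fix \<rho> assume "\<rho> \<in> kaehler_rels KK BB \<kappa>"
    then show "\<rho> \<in> carrier FB"
      by (cases rule: kaehler_rels_cases)
        (auto intro!: bar_closed fsupp_diff fsupp_add fsupp_sc fsupp_sgl \<pi>_closed)
  qed
qed

sublocale KN: form_mod sc K.NN by (rule K.form_mod_NN)

abbreviation "\<Omega> \<equiv> kaehler KK BB \<kappa>"

lemma \<Omega>_eq: "\<Omega> = quot_module FB K.W"
  by (simp add: kaehler_def kaehler_rel_span_def K.W_def)

lemma module_\<Omega>: "Module.module BB \<Omega>"
  unfolding \<Omega>_eq by (rule K.F.module_quot[OF K.W])

lemma sgl_fsupp: "sgl (pr p) \<in> fsupp (carrier BB)"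
  by (intro fsupp_sgl \<pi>_closed)

lemma NN_add: "sgl (pr (p + q)) - (sgl (pr p) + sgl (pr q)) \<in> K.NN"
proof (rule K.rels_NN)
  have "bar (sgl (pr (p + q)) - (sgl (pr p) + sgl (pr q))) = bar (sgl (pr (p + q))) \<ominus>\<^bsub>FB\<^esub> bar (sgl (pr p) + sgl (pr q))"
    by (intro bar_diff bar_closed fsupp_add sgl_fsupp)
  then show "bar (sgl (pr (p + q)) - (sgl (pr p) + sgl (pr q))) \<in> kaehler_rels KK BB \<kappa>"
    unfolding bar_add[of _ _ "carrier BB"] bar_sgl \<pi>_add by (simp only: kaehler_relsI(1)[OF \<pi>_closed \<pi>_closed])
qed

lemma NN_mult: "sgl (pr (p * q)) - (sc p (sgl (pr q)) + sc q (sgl (pr p))) \<in> K.NN"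
proof (rule K.rels_NN)
  have "bar (sgl (pr (p * q)) - (sc p (sgl (pr q)) + sc q (sgl (pr p)))) =
      bar (sgl (pr (p * q))) \<ominus>\<^bsub>FB\<^esub> bar (sc p (sgl (pr q)) + sc q (sgl (pr p)))"
    by (intro bar_diff bar_closed fsupp_add fsupp_sc sgl_fsupp)
  then show "bar (sgl (pr (p * q)) - (sc p (sgl (pr q)) + sc q (sgl (pr p)))) \<in> kaehler_rels KK BB \<kappa>"
    unfolding bar_add[of _ _ "carrier BB"] bar_sc[of _ _ "carrier BB"] bar_sgl \<pi>_mult
    by (simp only: kaehler_relsI(2)[OF \<pi>_closed \<pi>_closed])
qed

lemma NN_const: "sgl (pr (const c)) \<in> K.NN"
  using kaehler_relsI(3)[of c] by (intro K.rels_NN) (simp add: bar_sgl kappa_eq)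

lemma telescope: "(x - (u + v)) + ((u - u') + (v - v')) = x - (u' + v')" for x :: "'g::ab_group_add"
  by (simp add: algebra_simps)

text \<open>A lift of the differential that is the sum of the w_j dx_j.\<close>

definition sgm :: "(nat \<Rightarrow> 'k mpol) \<Rightarrow> 'k mpol set \<Rightarrow> 'k mpol" where
  "sgm w = (\<Sum>j<n. sc (w j) (sgl (pr (var j))))"

lemma sgm_fsupp: "sgm w \<in> fsupp (carrier BB)"
proof -
  have "(\<Sum>j\<in>T. sc (w j) (sgl (pr (var j)))) \<in> fsupp (carrier BB)" for T :: "nat set"
  proof (induction T rule: infinite_finite_induct)
    case (infinite T)
    show ?case unfolding sum.infinite[OF infinite.hyps] by (rule fsupp_0)
  next
    case empty
    show ?case unfolding sum.empty by (rule fsupp_0)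
  next
    case (insert j T)
    show ?case unfolding sum.insert[OF insert(1,2)] by (rule fsupp_add[OF fsupp_sc[OF sgl_fsupp] insert(3)])
  qed
  then show ?thesis unfolding sgm_def .
qed

lemma sgm_lin: "sgm (\<lambda>j. c * x j + y j) = sc c (sgm x) + sgm y"
  unfolding sgm_def KN.scale_sum_right sum.distrib[symmetric]
  by (rule sum.cong) (simp_all add: KN.scale_left_distrib)

lemma sgm_add: "sgm (\<lambda>j. x j + y j) = sgm x + sgm y"
  using sgm_lin[of 1 x y] by simp

lemma sgm_zero: "sgm (\<lambda>_. 0) = 0"
  by (simp add: sgm_def)

lemma sgm_unitv: "j < n \<Longrightarrow> sgm (unitv j) = sgl (pr (var j))"
proof -
  assume j: "j < n"
  have "sgm (unitv j) = (\<Sum>i<n. if i = j then sgl (pr (var j)) else 0)"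
    unfolding sgm_def by (rule sum.cong) (auto simp: unitv_def)
  then show ?thesis using j by simp
qed

text \<open>Both terms are derivations in \<open>p\<close> modulo the relations, and they agree on
  constants and on variables.\<close>

lemma sgl_grad:
  assumes "p \<in> poly_in {..<n}"
  shows "sgl (pr p) - sgm (grad n p) \<in> K.NN"
  using assms
proof (induction rule: poly_in_induct)
  case (const c)
  then show ?case using NN_const[of c] by (simp add: grad_const sgm_zero)
next
  case (var j)
  then have j: "j < n" by simp
  show ?case unfolding grad_var[OF j] sgm_unitv[OF j] diff_self by (rule KN.N_zero)
next
  case (add p q)
  have "(sgl (pr (p + q)) - (sgl (pr p) + sgl (pr q))) + ((sgl (pr p) - sgm (grad n p)) + (sgl (pr q) - sgm (grad n q))) \<in> K.NN"
    by (intro KN.N_add NN_add add)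
  then show ?case unfolding grad_add sgm_add telescope .
next
  case (mult p q)
  have g: "sgm (grad n (p * q)) = sc p (sgm (grad n q)) + sc q (sgm (grad n p))"
    unfolding grad_mult using sgm_lin[of p "grad n q" "\<lambda>j. q * grad n p j"] sgm_lin[of q "grad n p" "\<lambda>_. 0"]
    by (simp add: sgm_zero)
  have "(sgl (pr (p * q)) - (sc p (sgl (pr q)) + sc q (sgl (pr p)))) +
      (sc p (sgl (pr q) - sgm (grad n q)) + sc q (sgl (pr p) - sgm (grad n p))) \<in> K.NN"
    by (intro KN.N_add KN.N_scale NN_mult mult)
  then show ?case unfolding g KN.scale_right_diff_distrib telescope .
qed

definition sig :: "(nat \<Rightarrow> 'k mpol) \<Rightarrow> ('k mpol set \<Rightarrow> 'k mpol set) set" where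
  "sig w = K.cls (sgm w)"

lemma sig_closed: "sig w \<in> carrier \<Omega>"
  unfolding sig_def \<Omega>_eq by (rule K.cls_closed[OF sgm_fsupp])

lemma sig_lin: "sig (\<lambda>j. c * x j + y j) = (pr c \<odot>\<^bsub>\<Omega>\<^esub> sig x) \<oplus>\<^bsub>\<Omega>\<^esub> sig y"
  unfolding sig_def \<Omega>_eq K.cls_smult[OF sgm_fsupp] K.cls_add[OF fsupp_sc[OF sgm_fsupp] sgm_fsupp] sgm_lin ..

lemma sig_grad: "p \<in> poly_in {..<n} \<Longrightarrow> sig (grad n p) = kaehler_d KK BB \<kappa> (coord_class n r fs p)"
proof -
  assume p: "p \<in> poly_in {..<n}"
  have "K.cls (sgl (pr p)) = K.cls (sgm (grad n p))"
    using K.cls_eq_iff[OF sgl_fsupp sgm_fsupp] sgl_grad[OF p] by simp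
  then show ?thesis
    by (simp add: sig_def kaehler_d_def kaehler_rel_span_def K.cls_def K.W_def bar_sgl pr_of_poly[OF p])
qed

text \<open>In B the classes of \<open>fs i\<close> and of the constant 0 coincide, and the
  differential of a constant is zero.\<close>

lemma sig_row: "i < r \<Longrightarrow> sig (grad n (fs i)) = \<zero>\<^bsub>\<Omega>\<^esub>"
proof -
  assume i: "i < r"
  have "pr (fs i) = pr (const 0)" using fs_JJ[OF i] by (simp add: pr_eq_iff)
  then have "sgl (pr (fs i)) \<in> K.NN" using NN_const[of 0] by simp
  moreover have "sgl (pr (fs i)) - sgm (grad n (fs i)) \<in> K.NN" by (rule sgl_grad[OF fs[OF i]])
  ultimately have "sgl (pr (fs i)) - (sgl (pr (fs i)) - sgm (grad n (fs i))) \<in> K.NN" by (rule KN.N_diff)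
  then have "sgm (grad n (fs i)) - 0 \<in> K.NN" by simp
  then show ?thesis
    unfolding sig_def \<Omega>_eq K.cls_zero using K.cls_eq_iff[OF sgm_fsupp fsupp_0] by blast
qed

text \<open>The coordinates of a differential depend on choices, but only up to the rows of the Jacobian
  matrix and modulo \<open>I\<close>.\<close>

definition coords :: "('k mpol set \<Rightarrow> 'k mpol) \<Rightarrow> nat \<Rightarrow> 'k mpol" where
  "coords \<gamma> = (\<lambda>j. ev (\<lambda>b. grad n (lift b) j) \<gamma>)"

definition rep :: "('k mpol set \<Rightarrow> 'k mpol set) set \<Rightarrow> nat \<Rightarrow> 'k mpol" where
  "rep x = coords (SOME \<gamma>. \<gamma> \<in> fsupp (carrier BB) \<and> x = K.cls \<gamma>)"

lemma coords_supp: "j \<ge> n \<Longrightarrow> coords \<gamma> j = 0"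
  by (simp add: coords_def ev_def grad_def)

lemma rep_supp: "j \<ge> n \<Longrightarrow> rep x j = 0"
  by (simp add: rep_def coords_supp)

lemma rep_some:
  assumes "x \<in> carrier \<Omega>"
  shows "\<exists>\<gamma>. \<gamma> \<in> fsupp (carrier BB) \<and> x = K.cls \<gamma> \<and> rep x = coords \<gamma>"
proof -
  have "\<exists>\<gamma>. \<gamma> \<in> fsupp (carrier BB) \<and> x = K.cls \<gamma>"
    using K.cls_cases[of x] assms by (auto simp: \<Omega>_eq)
  from someI_ex[OF this] show ?thesis unfolding rep_def by blast
qed

lemma pairing_coords: "pairing n \<phi> (coords \<gamma>) = ev (\<lambda>b. pairing n \<phi> (grad n (lift b))) \<gamma>"
  unfolding pairing_def coords_def ev_def sum_distrib_right sum_distrib_left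
  by (subst sum.swap) (simp add: mult.assoc)

text \<open>A vector that kills the rows defines a derivation of B by
  \<open>pairing_grad_cong\<close>, so its linear extension respects sums, products and
  constants.\<close>

lemma pairing_coords_NN:
  assumes \<phi>: "row_kill \<phi>" and \<gamma>: "\<gamma> \<in> fsupp (carrier BB)" "\<gamma> \<in> K.NN"
  shows "pairing n \<phi> (coords \<gamma>) \<in> JJ"
  unfolding pairing_coords
proof (rule K.ev_mem_of_rels[OF JJ _ _ \<gamma>])
  let ?\<omega> = "\<lambda>b. pairing n \<phi> (grad n (lift b))"
  have \<omega>: "?\<omega> (pr p) - pairing n \<phi> (grad n p) \<in> JJ" if "p \<in> poly_in {..<n}" for p
    by (rule pairing_grad_cong[OF \<phi> lift(1)[OF \<pi>_closed] that lift(2)[OF \<pi>_closed]])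
  fix \<rho> assume "\<rho> \<in> kaehler_rels KK BB \<kappa>"
  then show "\<exists>\<gamma>\<in>fsupp (carrier BB). bar \<gamma> = \<rho> \<and> ev ?\<omega> \<gamma> \<in> JJ"
  proof (cases rule: kaehler_rels_cases)
    case (1 p q)
    have "ev ?\<omega> (sgl (pr (p + q)) - (sgl (pr p) + sgl (pr q))) = ?\<omega> (pr (p + q)) - (?\<omega> (pr p) + ?\<omega> (pr q))"
      unfolding ev_diff[OF sgl_fsupp fsupp_add[OF sgl_fsupp sgl_fsupp]] ev_add[OF fsuppD[OF sgl_fsupp] fsuppD[OF sgl_fsupp]] ev_sgl ..
    also have "\<dots> = (?\<omega> (pr (p + q)) - pairing n \<phi> (grad n (p + q))) -
        ((?\<omega> (pr p) - pairing n \<phi> (grad n p)) + (?\<omega> (pr q) - pairing n \<phi> (grad n q)))"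
      by (simp add: grad_add pairing_add)
    also have "\<dots> \<in> JJ" using 1 by (intro is_idlD(6)[OF JJ] is_idlD(2)[OF JJ] \<omega>) (auto intro: poly_in_add)
    finally have "ev ?\<omega> (sgl (pr (p + q)) - (sgl (pr p) + sgl (pr q))) \<in> JJ" .
    then show ?thesis using 1(3) fsupp_diff[OF sgl_fsupp fsupp_add[OF sgl_fsupp sgl_fsupp]] by blast
  next
    case (2 p q)
    have "ev ?\<omega> (sgl (pr (p * q)) - (sc p (sgl (pr q)) + sc q (sgl (pr p)))) = ?\<omega> (pr (p * q)) - (p * ?\<omega> (pr q) + q * ?\<omega> (pr p))"
      unfolding ev_diff[OF sgl_fsupp fsupp_add[OF fsupp_sc[OF sgl_fsupp] fsupp_sc[OF sgl_fsupp]]]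
        ev_add[OF fsuppD[OF fsupp_sc[OF sgl_fsupp]] fsuppD[OF fsupp_sc[OF sgl_fsupp]]] ev_sc[OF fsuppD[OF sgl_fsupp]] ev_sgl ..
    also have "\<dots> = (?\<omega> (pr (p * q)) - pairing n \<phi> (grad n (p * q))) -
        (p * (?\<omega> (pr q) - pairing n \<phi> (grad n q)) + q * (?\<omega> (pr p) - pairing n \<phi> (grad n p)))"
      by (simp add: grad_mult pairing_add pairing_scale algebra_simps)
    also have "\<dots> \<in> JJ" using 2 by (intro is_idlD(6)[OF JJ] is_idlD(2)[OF JJ] is_idlD(3)[OF JJ] \<omega>) (auto intro: poly_in_mult)
    finally have "ev ?\<omega> (sgl (pr (p * q)) - (sc p (sgl (pr q)) + sc q (sgl (pr p)))) \<in> JJ" .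
    then show ?thesis using 2(3) fsupp_diff[OF sgl_fsupp fsupp_add[OF fsupp_sc[OF sgl_fsupp] fsupp_sc[OF sgl_fsupp]]] by blast
  next
    case (3 c)
    have "pairing n \<phi> (grad n (const c)) = 0" by (simp add: grad_const pairing_def)
    then have "ev ?\<omega> (sgl (pr (const c))) \<in> JJ" unfolding ev_sgl using \<omega>[of "const c"] by simp
    then show ?thesis using 3 sgl_fsupp by blast
  qed
qed (simp add: pr_zero_iff)

lemma pairing_rep:
  assumes \<phi>: "row_kill \<phi>" and \<gamma>: "\<gamma> \<in> fsupp (carrier BB)"
  shows "pairing n \<phi> (rep (K.cls \<gamma>)) - pairing n \<phi> (coords \<gamma>) \<in> JJ"
proof -
  have "K.cls \<gamma> \<in> carrier \<Omega>" unfolding \<Omega>_eq by (rule K.cls_closed[OF \<gamma>])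
  then obtain \<delta> where \<delta>: "\<delta> \<in> fsupp (carrier BB)" "K.cls \<gamma> = K.cls \<delta>" "rep (K.cls \<gamma>) = coords \<delta>"
    using rep_some by blast
  then have "\<delta> - \<gamma> \<in> K.NN" using K.cls_eq_iff[OF \<delta>(1) \<gamma>] by simp
  from pairing_coords_NN[OF \<phi> fsupp_diff[OF \<delta>(1) \<gamma>] this]
  show ?thesis unfolding \<delta>(3) pairing_coords ev_diff[OF \<delta>(1) \<gamma>] .
qed

lemma pairing_rep_add:
  assumes \<phi>: "row_kill \<phi>" and xy: "x \<in> carrier \<Omega>" "y \<in> carrier \<Omega>"
  shows "pairing n \<phi> (rep (x \<oplus>\<^bsub>\<Omega>\<^esub> y)) - (pairing n \<phi> (rep x) + pairing n \<phi> (rep y)) \<in> JJ"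
proof -
  obtain \<gamma> where \<gamma>: "\<gamma> \<in> fsupp (carrier BB)" "x = K.cls \<gamma>" "rep x = coords \<gamma>" using rep_some[OF xy(1)] by blast
  obtain \<delta> where \<delta>: "\<delta> \<in> fsupp (carrier BB)" "y = K.cls \<delta>" "rep y = coords \<delta>" using rep_some[OF xy(2)] by blast
  have s: "x \<oplus>\<^bsub>\<Omega>\<^esub> y = K.cls (\<gamma> + \<delta>)" unfolding \<gamma>(2) \<delta>(2) \<Omega>_eq by (rule K.cls_add[OF \<gamma>(1) \<delta>(1)])
  show ?thesis
    using pairing_rep[OF \<phi> fsupp_add[OF \<gamma>(1) \<delta>(1)]]
    unfolding s \<gamma>(3) \<delta>(3) pairing_coords ev_add[OF fsuppD[OF \<gamma>(1)] fsuppD[OF \<delta>(1)]] .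
qed

lemma pairing_rep_smult:
  assumes \<phi>: "row_kill \<phi>" and x: "x \<in> carrier \<Omega>"
  shows "pairing n \<phi> (rep (pr c \<odot>\<^bsub>\<Omega>\<^esub> x)) - c * pairing n \<phi> (rep x) \<in> JJ"
proof -
  obtain \<gamma> where \<gamma>: "\<gamma> \<in> fsupp (carrier BB)" "x = K.cls \<gamma>" "rep x = coords \<gamma>" using rep_some[OF x] by blast
  have s: "pr c \<odot>\<^bsub>\<Omega>\<^esub> x = K.cls (sc c \<gamma>)" unfolding \<gamma>(2) \<Omega>_eq by (rule K.cls_smult[OF \<gamma>(1)])
  show ?thesis
    using pairing_rep[OF \<phi> fsupp_sc[OF \<gamma>(1), of c]]
    unfolding s \<gamma>(3) pairing_coords ev_sc[OF fsuppD[OF \<gamma>(1)]] .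
qed

text \<open>The coordinates chosen for the differential with coefficients \<open>w\<close> need not
  be \<open>w\<close>, but a functional that kills the rows cannot tell them apart modulo I. It
  suffices to compare on the variables.\<close>

lemma pairing_rep_sig:
  assumes \<phi>: "row_kill \<phi>"
  shows "pairing n \<phi> (rep (sig w)) - pairing n \<phi> w \<in> JJ"
proof -
  let ?\<omega> = "\<lambda>b. pairing n \<phi> (grad n (lift b))"
  have "finite T \<Longrightarrow> ev ?\<omega> (\<Sum>j\<in>T. sc (w j) (sgl (pr (var j)))) = (\<Sum>j\<in>T. w j * ?\<omega> (pr (var j))) \<and>
      (\<Sum>j\<in>T. sc (w j) (sgl (pr (var j)))) \<in> fsupp (carrier BB)" for T
  proof (induction T rule: finite_induct)
    case empty
    have "ev ?\<omega> (0 :: 'k mpol set \<Rightarrow> 'k mpol) = 0" by (simp add: ev_def)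
    then show ?case unfolding sum.empty using fsupp_0 by blast
  next
    case (insert j T)
    note IH = insert(3)[THEN conjunct1] insert(3)[THEN conjunct2]
    show ?case
      unfolding sum.insert[OF insert(1,2)] ev_add[OF fsuppD[OF fsupp_sc[OF sgl_fsupp]] fsuppD[OF IH(2)]]
        ev_sc[OF fsuppD[OF sgl_fsupp]] ev_sgl IH(1)
      by (intro conjI refl fsupp_add[OF fsupp_sc[OF sgl_fsupp] IH(2)])
  qed
  then have "pairing n \<phi> (coords (sgm w)) = (\<Sum>j<n. w j * ?\<omega> (pr (var j)))"
    by (simp add: pairing_coords sgm_def)
  then have "pairing n \<phi> (coords (sgm w)) - pairing n \<phi> w = (\<Sum>j<n. w j * (?\<omega> (pr (var j)) - \<phi> j))"
    by (simp add: pairing_def right_diff_distrib sum_subtractf)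
  also have "\<dots> \<in> JJ"
  proof (intro is_idl_sum[OF JJ] is_idlD(3)[OF JJ])
    fix j assume "j \<in> {..<n}"
    then have j: "j < n" by simp
    have v: "var j \<in> poly_in {..<n}" using j by (intro poly_in_var) simp
    have "pairing n \<phi> (grad n (var j)) = (\<Sum>i<n. if i = j then \<phi> j else 0)"
      unfolding pairing_def grad_var[OF j] by (rule sum.cong) (auto simp: unitv_def)
    then have "pairing n \<phi> (grad n (var j)) = \<phi> j" using j by simp
    then show "?\<omega> (pr (var j)) - \<phi> j \<in> JJ"
      using pairing_grad_cong[OF \<phi> lift(1)[OF \<pi>_closed] v lift(2)[OF \<pi>_closed]] by simp
  qed
  finally have "(pairing n \<phi> (rep (sig w)) - pairing n \<phi> (coords (sgm w))) + (pairing n \<phi> (coords (sgm w)) - pairing n \<phi> w) \<in> JJ"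
    using pairing_rep[OF \<phi> sgm_fsupp] unfolding sig_def by (intro is_idlD(2)[OF JJ])
  then show ?thesis by simp
qed

lemma sig_rep: "x \<in> carrier \<Omega> \<Longrightarrow> sig (rep x) = x"
proof -
  assume x: "x \<in> carrier \<Omega>"
  then obtain \<gamma> where \<gamma>: "\<gamma> \<in> fsupp (carrier BB)" "x = K.cls \<gamma>" "rep x = coords \<gamma>" using rep_some by blast
  let ?T = "{s. \<gamma> s \<noteq> 0}"
  have T: "?T \<subseteq> carrier BB" "finite ?T" using \<gamma>(1) by (auto simp: fsupp_def)
  have lin: "sgm (\<lambda>j. \<Sum>s\<in>T. \<gamma> s * grad n (lift s) j) = (\<Sum>s\<in>T. sc (\<gamma> s) (sgm (grad n (lift s))))" if "finite T" for T
    using that by (induction T rule: finite_induct) (simp_all add: sgm_zero sgm_lin)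
  have "sgl s - sgm (grad n (lift s)) \<in> K.NN" if s: "s \<in> ?T" for s
  proof -
    have b: "s \<in> carrier BB" by (rule subsetD[OF T(1) s])
    show ?thesis using sgl_grad[OF lift(1)[OF b]] unfolding lift(2)[OF b] .
  qed
  then have "(\<Sum>s\<in>?T. sc (\<gamma> s) (sgl s - sgm (grad n (lift s)))) \<in> K.NN"
    by (rule KN.subspace_sum[OF KN.N KN.N_scale])
  also have "(\<Sum>s\<in>?T. sc (\<gamma> s) (sgl s - sgm (grad n (lift s)))) = \<gamma> - sgm (rep x)"
    unfolding KN.scale_right_diff_distrib sum_subtractf fsupp_eq_sum[OF \<gamma>(1), symmetric] \<gamma>(3) coords_def ev_def lin[OF T(2)] ..
  finally have "K.cls \<gamma> = K.cls (sgm (rep x))" unfolding K.cls_eq_iff[OF \<gamma>(1) sgm_fsupp] .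
  then show ?thesis by (simp add: sig_def \<gamma>(2))
qed

end

lemma ev_0: "ev \<omega> 0 = 0"
  by (simp add: ev_def)

section \<open>The target module and the Jacobian ideal\<close>

context ci
begin

text \<open>The union in \<open>rcoset_mult\<close> ranges over representatives modulo I of the
  scalar and modulo \<open>L\<close> of the element; since I is contained in \<open>L\<close>, all
  products fall into one coset.\<close>

lemma module_quot_as_module:
  assumes L: "ideal L PP" and IL: "II \<subseteq> L"
  defines "qc \<equiv> \<lambda>x. L +>\<^bsub>PP\<^esub> retr n x"
  shows qc_eq_iff: "qc x = qc y \<longleftrightarrow> x - y \<in> ext_ideal n L"
    and qc_cases: "z \<in> carrier (quot_as_module PP L) \<Longrightarrow> \<exists>x. z = qc x"
    and qc_closed: "qc x \<in> carrier (quot_as_module PP L)"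
    and qc_add: "qc x \<oplus>\<^bsub>quot_as_module PP L\<^esub> qc y = qc (x + y)"
    and qc_zero: "\<zero>\<^bsub>quot_as_module PP L\<^esub> = qc 0"
    and qc_smult: "pr a \<odot>\<^bsub>quot_as_module PP L\<^esub> qc x = qc (a * x)"
    and "Module.module BB (quot_as_module PP L)"
proof -
  let ?Q = "quot_as_module PP L"
  have hom: "(+>\<^bsub>PP\<^esub>) L \<in> Ring.ring_hom PP (PP Quot L)" by (rule ideal.rcos_ring_hom[OF L])
  show eq: "qc x = qc y \<longleftrightarrow> x - y \<in> ext_ideal n L" for x y
    using a_coset_eq_iff[OF L retr_in retr_in, of x y] by (simp add: qc_def ext_ideal_def retr_hom)
  show cases: "\<exists>x. z = qc x" if z: "z \<in> carrier ?Q" for z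
  proof -
    obtain p where "p \<in> poly_in {..<n}" "z = L +>\<^bsub>PP\<^esub> p"
      using z by (auto simp: quot_as_module_def FactRing_def A_RCOSETS_def')
    then show ?thesis by (auto simp: qc_def retr_id intro!: exI[of _ p])
  qed
  show closed: "qc x \<in> carrier ?Q" for x
    using ring_hom_closed[OF hom, of "retr n x"] by (simp add: qc_def retr_in quot_as_module_def)
  show add: "qc x \<oplus>\<^bsub>?Q\<^esub> qc y = qc (x + y)" for x y
    using ring_hom_add[OF hom, of "retr n x" "retr n y"] by (simp add: qc_def retr_hom retr_in quot_as_module_def)
  show zero: "\<zero>\<^bsub>?Q\<^esub> = qc 0"
    using a_coset_eq_self_iff[OF L, of 0] ideal_mpoly_ringD(2)[OF L]
    by (simp add: qc_def retr_hom quot_as_module_def FactRing_def)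
  show smult: "pr a \<odot>\<^bsub>?Q\<^esub> qc x = qc (a * x)" for a x
  proof -
    let ?a = "retr n a" and ?x = "retr n x"
    have e: "L +>\<^bsub>PP\<^esub> (u \<otimes>\<^bsub>PP\<^esub> v) = qc (a * x)" if uv: "u \<in> II +>\<^bsub>PP\<^esub> ?a" "v \<in> L +>\<^bsub>PP\<^esub> ?x" for u v
    proof -
      obtain i where i: "i \<in> II" "u = i + ?a" using uv(1) by (auto simp: a_r_coset_def')
      obtain l where l: "l \<in> L" "v = l + ?x" using uv(2) by (auto simp: a_r_coset_def')
      have c: "i \<in> poly_in {..<n}" "l \<in> poly_in {..<n}"
        using i(1) l(1) ideal_mpoly_ringD(1)[OF L] IL by auto
      have "v \<in> poly_in {..<n}" "u \<in> poly_in {..<n}" using c retr_in by (auto simp: i(2) l(2) intro: poly_in_add)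
      moreover have "v * i + ?a * l \<in> L"
        using i(1) l(1) IL \<open>v \<in> poly_in {..<n}\<close> retr_in by (intro ideal_mpoly_ringD(3,4)[OF L]) auto
      moreover have "u * v - ?a * ?x = v * i + ?a * l" by (simp add: i(2) l(2) algebra_simps)
      ultimately have "L +>\<^bsub>PP\<^esub> (u * v) = L +>\<^bsub>PP\<^esub> (?a * ?x)"
        by (subst a_coset_eq_iff[OF L]) (auto intro: poly_in_mult retr_in)
      then show ?thesis by (simp add: qc_def retr_hom)
    qed
    have "?a \<in> II +>\<^bsub>PP\<^esub> ?a" "?x \<in> L +>\<^bsub>PP\<^esub> ?x"
      using ideal_mpoly_ringD(2)[OF L] ideal_mpoly_ringD(2)[OF II] by (force simp: a_r_coset_def')+
    then have ne: "II +>\<^bsub>PP\<^esub> ?a \<noteq> {}" "L +>\<^bsub>PP\<^esub> ?x \<noteq> {}" by blast+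
    have "pr a \<odot>\<^bsub>?Q\<^esub> qc x = (\<Union>u\<in>II +>\<^bsub>PP\<^esub> ?a. \<Union>v\<in>L +>\<^bsub>PP\<^esub> ?x. L +>\<^bsub>PP\<^esub> (u \<otimes>\<^bsub>PP\<^esub> v))"
      by (simp only: quot_as_module_def rcoset_mult_def module.simps pr_def coord_class_def qc_def)
    also have "\<dots> = qc (a * x)" by (rule SUP_eq_const[OF ne(1) SUP_eq_const[OF ne(2) e]])
    finally show ?thesis .
  qed
  have grp: "abelian_group ?Q"
  proof (rule abelian_groupI)
    fix x assume "x \<in> carrier ?Q"
    then obtain a where a: "x = qc a" using cases by blast
    show "\<exists>y\<in>carrier ?Q. y \<oplus>\<^bsub>?Q\<^esub> x = \<zero>\<^bsub>?Q\<^esub>"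
      using closed[of "- a"] by (intro bexI[of _ "qc (- a)"]) (simp_all add: a add zero)
    show "\<zero>\<^bsub>?Q\<^esub> \<oplus>\<^bsub>?Q\<^esub> x = x" by (simp add: a add zero)
    fix y assume "y \<in> carrier ?Q"
    then obtain b where b: "y = qc b" using cases by blast
    show "x \<oplus>\<^bsub>?Q\<^esub> y \<in> carrier ?Q" "x \<oplus>\<^bsub>?Q\<^esub> y = y \<oplus>\<^bsub>?Q\<^esub> x"
      by (simp_all add: a b add closed add.commute)
    fix z assume "z \<in> carrier ?Q"
    then obtain c where c: "z = qc c" using cases by blast
    show "x \<oplus>\<^bsub>?Q\<^esub> y \<oplus>\<^bsub>?Q\<^esub> z = x \<oplus>\<^bsub>?Q\<^esub> (y \<oplus>\<^bsub>?Q\<^esub> z)"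
      by (simp add: a b c add add.assoc)
  qed (simp add: zero closed)
  show "Module.module BB ?Q"
  proof (rule moduleI[OF cring_B grp])
    fix a x assume "a \<in> carrier BB" "x \<in> carrier ?Q"
    then obtain c v where v: "a = pr c" "x = qc v" using cases \<pi>_surj by blast
    show "a \<odot>\<^bsub>?Q\<^esub> x \<in> carrier ?Q" by (simp add: v smult closed)
    fix b y assume "b \<in> carrier BB" "y \<in> carrier ?Q"
    then obtain d w where w: "b = pr d" "y = qc w" using cases \<pi>_surj by blast
    show "(a \<oplus>\<^bsub>BB\<^esub> b) \<odot>\<^bsub>?Q\<^esub> x = a \<odot>\<^bsub>?Q\<^esub> x \<oplus>\<^bsub>?Q\<^esub> b \<odot>\<^bsub>?Q\<^esub> x"
      "a \<odot>\<^bsub>?Q\<^esub> (x \<oplus>\<^bsub>?Q\<^esub> y) = a \<odot>\<^bsub>?Q\<^esub> x \<oplus>\<^bsub>?Q\<^esub> a \<odot>\<^bsub>?Q\<^esub> y"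
      "(a \<otimes>\<^bsub>BB\<^esub> b) \<odot>\<^bsub>?Q\<^esub> x = a \<odot>\<^bsub>?Q\<^esub> (b \<odot>\<^bsub>?Q\<^esub> x)"
      by (simp_all add: v w \<pi>_add[symmetric] \<pi>_mult[symmetric] add smult algebra_simps)
  next
    fix x assume "x \<in> carrier ?Q"
    then obtain v where "x = qc v" using cases by blast
    then show "\<one>\<^bsub>BB\<^esub> \<odot>\<^bsub>?Q\<^esub> x = x" by (simp add: \<pi>_one[symmetric] smult)
  qed
qed

abbreviation "jrows \<equiv> map (\<lambda>i. grad n (fs i)) [0..<r]"

lemma detl_in:
  assumes "set cs \<subseteq> {..<n}" "length vs = length cs" "\<And>v j. v \<in> set vs \<Longrightarrow> v j \<in> poly_in {..<n}"
  shows "detl cs vs \<in> poly_in {..<n}"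
proof -
  have sg: "signof p \<in> poly_in {..<n}" for p :: "nat \<Rightarrow> nat"
    by (cases rule: sign_cases[of p]) (auto intro: poly_in_uminus)
  show ?thesis
    unfolding detl_def det_def'[OF mat_carrier]
  proof (intro poly_in_sum poly_in_mult poly_in_prod sg)
    fix p i assume p: "p \<in> {p. p permutes {0..<length cs}}" and i: "i \<in> {0..<length cs}"
    then have "p i < length cs" using permutes_in_image[of p "{0..<length cs}" i] by simp
    then show "mat (length cs) (length cs) (\<lambda>(i, j). (vs ! i) (cs ! j)) $$ (i, p i) \<in> poly_in {..<n}"
      using i assms by simp
  qed
qed

lemma grad_in: "p \<in> poly_in {..<n} \<Longrightarrow> grad n p j \<in> poly_in {..<n}"
  by (simp add: grad_def partial_deriv_in)

end

locale ci_fun = ci n r fs for n r :: nat and fs :: "nat \<Rightarrow> 'k::field mpol" +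
  fixes f :: "'k mpol"
  assumes f: "f \<in> poly_in {..<n}"
begin

abbreviation "tops \<equiv> jrows @ [grad n f]"
abbreviation "Jac \<equiv> jacobian_ideal n r fs f"
abbreviation "QQ \<equiv> ext_ideal n (II <+>\<^bsub>PP\<^esub> Jac)"

lemma jacobian_eq: "jacobian n r fs f = mat (r + 1) n (\<lambda>(i, j). (tops ! i) j)"
  unfolding jacobian_def by (rule cong_mat) (auto simp: nth_append grad_def less_Suc_eq)

lemma minors_cases:
  assumes "p \<in> minors (r + 1) (jacobian n r fs f)"
  shows "\<exists>cs. distinct cs \<and> set cs \<subseteq> {..<n} \<and> length cs = r + 1 \<and> p = detl cs tops"
  using assms unfolding jacobian_eq by (intro minors_eq_detl) simp_all

lemma minors_in: "minors (r + 1) (jacobian n r fs f) \<subseteq> poly_in {..<n}"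
proof
  fix p assume "p \<in> minors (r + 1) (jacobian n r fs f)"
  then obtain cs where cs: "set cs \<subseteq> {..<n}" "length cs = r + 1" "p = detl cs tops" using minors_cases by blast
  show "p \<in> poly_in {..<n}"
    unfolding cs(3) by (rule detl_in) (use cs fs f in \<open>auto intro: grad_in\<close>)
qed

lemma Jac: "ideal Jac PP" "minors (r + 1) (jacobian n r fs f) \<subseteq> Jac"
proof -
  interpret P: cring PP by (rule cring_mpoly_ring)
  show "ideal Jac PP" unfolding jacobian_ideal_def by (rule P.genideal_ideal) (use minors_in in simp)
  show "minors (r + 1) (jacobian n r fs f) \<subseteq> Jac"
    unfolding jacobian_ideal_def by (rule P.genideal_self) (use minors_in in simp)
qed

lemma sum_ideal: "ideal (II <+>\<^bsub>PP\<^esub> Jac) PP" "II \<subseteq> II <+>\<^bsub>PP\<^esub> Jac" "Jac \<subseteq> II <+>\<^bsub>PP\<^esub> Jac"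
proof -
  interpret P: cring PP by (rule cring_mpoly_ring)
  show "ideal (II <+>\<^bsub>PP\<^esub> Jac) PP" by (rule P.add_ideals[OF II Jac(1)])
  show "II \<subseteq> II <+>\<^bsub>PP\<^esub> Jac" using ideal_mpoly_ringD(2)[OF Jac(1)] by (force simp: set_add_def')
  show "Jac \<subseteq> II <+>\<^bsub>PP\<^esub> Jac" using ideal_mpoly_ringD(2)[OF II] by (force simp: set_add_def')
qed

lemma QQ: "is_idl QQ" by (rule is_idl_ext_ideal[OF sum_ideal(1)])

lemma JJ_QQ: "JJ \<subseteq> QQ" using sum_ideal(2) by (auto simp: ext_ideal_def)

lemma minors_QQ: "minors (r + 1) (jacobian n r fs f) \<subseteq> QQ"
proof
  fix p assume p: "p \<in> minors (r + 1) (jacobian n r fs f)"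
  then have "p \<in> poly_in {..<n}" "p \<in> II <+>\<^bsub>PP\<^esub> Jac" using minors_in Jac(2) sum_ideal(3) by auto
  then show "p \<in> QQ" by (simp add: ext_ideal_iff)
qed

text \<open>Lets inclusions of \<open>QQ\<close> be tested on I and on the minors, for ideals of the
  whole polynomial type.\<close>

lemma QQ_minimal:
  assumes A: "is_idl A" "JJ \<subseteq> A" "minors (r + 1) (jacobian n r fs f) \<subseteq> A"
  shows "QQ \<subseteq> A"
proof
  interpret P: cring PP by (rule cring_mpoly_ring)
  have "ideal (A \<inter> poly_in {..<n}) PP"
    by (rule ideal_mpoly_ringI) (auto intro: is_idlD(1-3)[OF A(1)] poly_in_add poly_in_mult)
  then have J: "Jac \<subseteq> A \<inter> poly_in {..<n}"
    unfolding jacobian_ideal_def by (rule P.genideal_minimal) (use A(3) minors_in in auto)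
  fix x assume "x \<in> QQ"
  then obtain i j where ij: "i \<in> II" "j \<in> Jac" "retr n x = i + j" by (auto simp: ext_ideal_def set_add_def')
  have "i \<in> JJ" using mem_JJ[of i] ideal_mpoly_ringD(1)[OF II] ij(1) by auto
  then have "(x - retr n x) + (i + j) \<in> A"
    using ext_ideal_retr[OF II, of x] J A(2) ij(2) by (intro is_idlD(2)[OF A(1)]) auto
  then show "x \<in> A" by (simp add: ij(3))
qed

lemma detl_tops_QQ: "length ws + r + 1 = n \<Longrightarrow> detl [0..<n] (tops @ ws) \<in> QQ"
proof (rule detl_mem_of_minors[OF QQ])
  fix cs assume "distinct cs" "set cs \<subseteq> {..<n}" "length cs = length tops"
  then show "detl cs tops \<in> QQ" by (intro detl_mem_idl_minors[OF QQ minors_QQ[unfolded jacobian_eq]]) simp_all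
qed auto

end

section \<open>Forms of top degree as determinants\<close>

locale ci_split = ci_fun n r fs f for n r :: nat and fs :: "nat \<Rightarrow> 'k::field mpol" and f +
  fixes a :: "nat \<Rightarrow> nat \<Rightarrow> 'k mpol"
  assumes split: "i < r \<Longrightarrow> k < r \<Longrightarrow> (\<Sum>j<n. partial_deriv j (fs i) * a j k) - (if i = k then 1 else 0) \<in> JJ"
begin

text \<open>The product of the Jacobian matrix with \<open>a\<close> is the identity modulo I, while
  by Cauchy-Binet its determinant lies in every ideal that contains the maximal minors.\<close>

lemma one_mem_of_minors:
  assumes A: "is_idl A" "JJ \<subseteq> A" and min: "\<And>cs. set cs \<subseteq> {..<n} \<Longrightarrow> length cs = r \<Longrightarrow> detl cs jrows \<in> A"
  shows "1 \<in> A"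
proof -
  let ?M = "mat r r (\<lambda>(i, k). \<Sum>j<n. (jrows ! i) j * a j k)"
  have M: "det ?M \<in> A"
    using det_prod_mem_minors[OF A(1), where Ds = jrows and n = n and a = "\<lambda>k j. a j k"] min by simp
  have "det ?M - det (1\<^sub>m r) \<in> JJ"
  proof (rule det_diff_mem_idl[OF JJ])
    fix i k assume ik: "i < r" "k < r"
    have "(\<Sum>j<n. (jrows ! i) j * a j k) = (\<Sum>j<n. partial_deriv j (fs i) * a j k)"
      by (rule sum.cong) (use ik in \<open>auto simp: grad_def\<close>)
    then show "?M $$ (i, k) - 1\<^sub>m r $$ (i, k) \<in> JJ" using split[OF ik] ik by simp
  qed auto
  then have "det ?M - det (1\<^sub>m r) \<in> A" using A(2) by (rule rev_subsetD)
  from is_idlD(6)[OF A(1) M this] show ?thesis by simp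
qed

text \<open>With fewer columns than rows every list of r columns repeats one, so all maximal minors
  vanish. B is then the zero ring.\<close>

lemma one_JJ: "n < r \<Longrightarrow> 1 \<in> JJ"
proof (rule one_mem_of_minors[OF JJ subset_refl])
  fix cs :: "nat list" assume r: "n < r" and cs: "set cs \<subseteq> {..<n}" "length cs = r"
  have "card (set cs) \<le> n" using card_mono[OF _ cs(1)] by simp
  then have "\<not> distinct cs" using r cs(2) distinct_card[of cs] by auto
  then have "detl cs jrows = 0" by (rule detl_columns_eq_zero)
  then show "detl cs jrows \<in> JJ" by (simp only: is_idlD(1)[OF JJ])
qed

text \<open>The columns of \<open>a\<close>; by \<open>split\<close> they are dual to the rows of
  the Jacobian matrix modulo I.\<close>

definition functionals :: "((nat \<Rightarrow> 'k mpol) \<Rightarrow> 'k mpol) list" where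
  "functionals = map (\<lambda>k v. \<Sum>j<n. v j * a j k) [0..<r]"

lemma functionals_linfun: "b \<in> set functionals \<Longrightarrow> linfun b"
  by (auto simp: functionals_def linfun_def distrib_right sum.distrib sum_distrib_left mult.assoc)

lemma functionals_dual:
  assumes "i < r" "j < r"
  shows "(functionals ! i) (jrows ! j) - (if i = j then 1 else 0) \<in> JJ"
proof -
  have "(functionals ! i) (jrows ! j) = (\<Sum>l<n. partial_deriv l (fs j) * a l i)"
    using assms by (simp add: functionals_def grad_def)
  moreover have "(if i = j then 1 else 0 :: 'k mpol) = (if j = i then 1 else 0)" by simp
  ultimately show ?thesis using split[OF assms(2,1)] by (simp only:)
qed

lemma jrows_supp: "v \<in> set jrows \<Longrightarrow> j \<ge> n \<Longrightarrow> v j = 0"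
  by (auto simp: grad_def)

text \<open>The determinant is linear in each single slot, and a row of the Jacobian matrix put into
  that slot would occur twice.\<close>

lemma detl_jrows_at:
  assumes "length xs + length ys + r + 1 = n"
  shows "\<exists>\<phi>. row_kill \<phi> \<and> (\<forall>v. detl [0..<n] (jrows @ xs @ v # ys) = pairing n \<phi> v)"
proof -
  have "length (jrows @ xs) + length ys + 1 = length [0..<n]" using assms by simp
  from detl_expand_at[OF this] obtain \<phi> where
    "\<forall>v. detl [0..<n] ((jrows @ xs) @ v # ys) = (\<Sum>j<length [0..<n]. v ([0..<n] ! j) * \<phi> j)" by (elim exE)
  then have \<phi>: "detl [0..<n] (jrows @ xs @ v # ys) = pairing n \<phi> v" for v
    by (simp add: pairing_def)
  have "pairing n \<phi> (grad n (fs i)) = 0" if i: "i < r" for i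
    unfolding \<phi>[symmetric] by (rule detl_eq_zero[of i "r + length xs"]) (use i assms in \<open>simp_all add: nth_append\<close>)
  then have "row_kill \<phi>" using is_idlD(1)[OF JJ] by (simp add: row_kill_def)
  with \<phi> show ?thesis by blast
qed

text \<open>The arguments are exchanged one at a time from the left. By \<open>detl_jrows_at\<close>
  each exchange compares pairings with a vector that kills the rows, where
  \<open>pairing_rep_sig\<close> applies.\<close>

lemma detl_rep_sig:
  "length us + length ws + r = n \<Longrightarrow>
    detl [0..<n] (jrows @ us @ map rep (map sig ws)) - detl [0..<n] (jrows @ us @ ws) \<in> JJ"
proof (induction ws arbitrary: us)
  case Nil
  then show ?case by (simp add: is_idlD(1)[OF JJ])
next
  case (Cons w ws)
  have "length us + length (map rep (map sig ws)) + r + 1 = n" using Cons.prems by simp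
  from detl_jrows_at[OF this] obtain \<phi> where \<phi>: "row_kill \<phi>"
    "\<And>v. detl [0..<n] (jrows @ us @ v # map rep (map sig ws)) = pairing n \<phi> v" by (elim exE conjE) simp
  have "length (us @ [w]) + length ws + r = n" using Cons.prems by simp
  from Cons.IH[OF this] have "detl [0..<n] (jrows @ us @ w # map rep (map sig ws)) - detl [0..<n] (jrows @ us @ w # ws) \<in> JJ"
    by simp
  from is_idlD(2)[OF JJ pairing_rep_sig[OF \<phi>(1), of w, folded \<phi>(2)] this] show ?case by simp
qed

text \<open>Relies on the coordinates chosen by \<open>rep\<close>; in degree n - r its linear
  extension depends modulo I only on the form, by \<open>ev_om_NN\<close>.\<close>

definition om :: "('k mpol set \<Rightarrow> 'k mpol set) set list \<Rightarrow> 'k mpol" where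
  "om l = detl [0..<n] (jrows @ map rep l)"

end

locale ci_forms = ci_split n r fs f a for n r :: nat and fs :: "nat \<Rightarrow> 'k::field mpol" and f a +
  fixes k :: int
begin

sublocale E: exterior BB pr \<Omega> k
  by (intro exterior.intro exterior_axioms.intro surj_hom_axioms module_\<Omega>)

sublocale EN: form_mod sc E.NN by (rule E.form_mod_NN)

definition form :: "(nat \<Rightarrow> 'k mpol) list \<Rightarrow> ('k mpol set \<Rightarrow> 'k mpol set) set list \<Rightarrow> 'k mpol" where
  "form ws = sgl (map sig ws)"

lemma map_sig_tuples: "int (length ws) = k \<Longrightarrow> map sig ws \<in> tuples \<Omega> k"
  by (auto simp: tuples_def sig_closed)

lemma form_fsupp: "int (length ws) = k \<Longrightarrow> form ws \<in> fsupp (tuples \<Omega> k)"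
  unfolding form_def by (rule fsupp_sgl[OF map_sig_tuples])

lemma altform_form:
  assumes k: "k = int s"
  shows "EN.altform s form"
  unfolding EN.altform_def
proof (intro conjI allI impI)
  fix c x y and xs ys :: "(nat \<Rightarrow> 'k mpol) list"
  assume l: "length xs + length ys + 1 = s"
  let ?l = "map sig xs @ sig x # map sig ys"
  have upd: "?l[length xs := z] = map sig xs @ z # map sig ys" for z
    by (simp add: list_update_append)
  have tup: "?l \<in> tuples \<Omega> k" using map_sig_tuples[of "xs @ x # ys"] l k by simp
  have i: "length xs < length ?l" by simp
  have cx: "pr c \<odot>\<^bsub>\<Omega>\<^esub> sig x \<in> carrier \<Omega>" by (rule E.M.smult_closed[OF \<pi>_closed sig_closed])
  have s1: "sgl (map sig xs @ sig (\<lambda>j. c * x j + y j) # map sig ys) -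
      (sgl (map sig xs @ (pr c \<odot>\<^bsub>\<Omega>\<^esub> sig x) # map sig ys) + sgl (map sig xs @ sig y # map sig ys)) \<in> E.NN"
    using E.NN_add[OF tup i cx sig_closed[of y]] unfolding upd sig_lin .
  have s2: "sgl (map sig xs @ (pr c \<odot>\<^bsub>\<Omega>\<^esub> sig x) # map sig ys) - sc c (sgl (map sig xs @ sig x # map sig ys)) \<in> E.NN"
    using E.NN_smult[OF tup i sig_closed[of x], of c] unfolding upd .
  have s3: "sgl (map sig xs @ sig y # map sig ys) - sgl (map sig xs @ sig y # map sig ys) \<in> E.NN"
    unfolding diff_self by (rule EN.N_zero)
  show "EN.eqN (form (xs @ (\<lambda>j. c * x j + y j) # ys)) (sc c (form (xs @ x # ys)) + form (xs @ y # ys))"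
    using EN.N_add[OF s1 EN.N_add[OF s2 s3]] unfolding telescope EN.eqN_def form_def list.map map_append .
next
  fix x and xs ys :: "(nat \<Rightarrow> 'k mpol) list"
  assume l: "length xs + length ys + 2 = s"
  have "map sig (xs @ x # x # ys) \<in> tuples \<Omega> k" by (rule map_sig_tuples) (use l k in simp)
  then show "form (xs @ x # x # ys) \<in> E.NN"
    unfolding form_def by (rule E.NN_alt[of _ "length xs" "Suc (length xs)"]) (simp_all add: nth_append)
qed

text \<open>The differential of \<open>fs i\<close> is zero, so its slot may be multiplied by 0;
  moving this scalar out of the slot kills the symbol.\<close>

lemma kills_form:
  assumes i: "i < r" and k: "k = int s"
  shows "EN.kills s form (grad n (fs i))"
  unfolding EN.kills_def
proof (intro allI impI)
  fix l :: "(nat \<Rightarrow> 'k mpol) list" assume l: "length l = s" "grad n (fs i) \<in> set l"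
  then obtain j where j: "j < length l" "l ! j = grad n (fs i)" by (auto simp: in_set_conv_nth)
  have tup: "map sig l \<in> tuples \<Omega> k" by (rule map_sig_tuples) (simp add: l(1) k)
  have z: "pr 0 \<odot>\<^bsub>\<Omega>\<^esub> sig (grad n (fs i)) = \<zero>\<^bsub>\<Omega>\<^esub>"
    unfolding \<pi>_zero by (rule E.M.smult_l_null[OF sig_closed])
  have "(map sig l) ! j = \<zero>\<^bsub>\<Omega>\<^esub>" using j sig_row[OF i] by simp
  then have u: "(map sig l)[j := \<zero>\<^bsub>\<Omega>\<^esub>] = map sig l" by (metis list_update_id)
  have "sgl (map sig l) - sc 0 (sgl ((map sig l)[j := sig (grad n (fs i))])) \<in> E.NN"
    using E.NN_smult[OF tup _ sig_closed[of "grad n (fs i)"], of j 0] j(1) unfolding z u by simp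
  then show "form l \<in> E.NN" unfolding form_def EN.scale_zero_left diff_0_right .
qed

text \<open>The element theta of which all forms of degree n - r are multiples: the tautological
  form \<open>form\<close>, wedged with the dual functionals and evaluated at the standard
  basis.\<close>

definition top_form :: "('k mpol set \<Rightarrow> 'k mpol set) set list \<Rightarrow> 'k mpol" where
  "top_form = EN.contrs functionals form (map unitv [0..<n])"

lemma form_eq_scale:
  assumes k: "k = int s" and w: "length ws = s" "\<And>v j. v \<in> set ws \<Longrightarrow> j \<ge> n \<Longrightarrow> v j = 0"
  shows form_eq: "r + s = n \<Longrightarrow> EN.eqN (form ws) (sc (detl [0..<n] (jrows @ ws)) top_form)"
    and form_zero: "n < r + s \<Longrightarrow> form ws \<in> E.NN"
proof -
  have dual: "sc ((functionals ! i) (jrows ! j) - (if i = j then 1 else 0)) g \<in> E.NN"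
    if ij: "i < length jrows" "j < length jrows" for i j g
    using functionals_dual[of i j] ij by (intro E.sc_ker_NN) (simp add: pr_zero_iff)
  have kl: "EN.kills s form D" if D: "D \<in> set jrows" for D using D kills_form[OF _ k] by auto
  have supp: "v j = 0" if v: "v \<in> set jrows \<union> set ws" "j \<ge> n" for v j using v jrows_supp w(2) by blast
  have len: "length functionals = length jrows" by (simp add: functionals_def)
  show "EN.eqN (form ws) (sc (detl [0..<n] (jrows @ ws)) top_form)" if "r + s = n"
    unfolding top_form_def
    by (rule EN.altform_eq_detl_scale(1)[where Ds = jrows and as = functionals and T = form and w = ws and n = n and s = s])
      (rule altform_form[OF k] len w(1) | erule functionals_linfun kl | erule (1) dual supp | simp add: that)+
  show "form ws \<in> E.NN" if "n < r + s"
    by (rule EN.altform_eq_detl_scale(2)[where Ds = jrows and as = functionals and T = form and w = ws and n = n and s = s])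
      (rule altform_form[OF k] len w(1) | erule functionals_linfun kl | erule (1) dual supp | simp add: that)+
qed

lemma sgl_eq_form: "l \<in> tuples \<Omega> k \<Longrightarrow> sgl l = form (map rep l)"
proof -
  assume "l \<in> tuples \<Omega> k"
  then have "map sig (map rep l) = map id l"
    unfolding map_map by (intro map_cong refl) (auto simp: tuples_def sig_rep)
  then show ?thesis by (simp add: form_def)
qed

lemma above_top_degree:
  assumes k: "k = int s" "n < r + s" and \<gamma>: "\<gamma> \<in> fsupp (tuples \<Omega> k)"
  shows "\<gamma> \<in> E.NN"
proof -
  have "(\<Sum>l | \<gamma> l \<noteq> 0. sc (\<gamma> l) (sgl l)) \<in> E.NN"
  proof (rule EN.subspace_sum[OF EN.N EN.N_scale])
    fix l assume "l \<in> {l. \<gamma> l \<noteq> 0}"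
    then have l: "l \<in> tuples \<Omega> k" using \<gamma> by (auto simp: fsupp_def)
    have "length (map rep l) = s" using l k(1) by (simp add: tuples_def)
    moreover have "v j = 0" if "v \<in> set (map rep l)" "j \<ge> n" for v j using that by (auto simp: rep_supp)
    ultimately show "sgl l \<in> E.NN" unfolding sgl_eq_form[OF l] by (rule form_zero[OF k(1) _ _ k(2)])
  qed
  then show ?thesis unfolding fsupp_eq_sum[OF \<gamma>, symmetric] .
qed

lemma eq_scale_top_form:
  assumes k: "k = int s" "r + s = n" and \<gamma>: "\<gamma> \<in> fsupp (tuples \<Omega> k)"
  shows "EN.eqN \<gamma> (sc (ev om \<gamma>) top_form)"
proof -
  let ?T = "{l. \<gamma> l \<noteq> 0}"
  have "EN.eqN (\<Sum>l\<in>?T. sc (\<gamma> l) (sgl l)) (\<Sum>l\<in>?T. sc (\<gamma> l) (sc (om l) top_form))"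
  proof (rule EN.eqN_sum, rule EN.eqN_scale)
    fix l assume "l \<in> {l. \<gamma> l \<noteq> 0}"
    then have l: "l \<in> tuples \<Omega> k" using \<gamma> by (auto simp: fsupp_def)
    have "length (map rep l) = s" using l k(1) by (simp add: tuples_def)
    moreover have "v j = 0" if "v \<in> set (map rep l)" "j \<ge> n" for v j using that by (auto simp: rep_supp)
    ultimately show "EN.eqN (sgl l) (sc (om l) top_form)"
      unfolding sgl_eq_form[OF l] om_def by (rule form_eq[OF k(1) _ _ k(2)])
  qed
  moreover have "(\<Sum>l\<in>?T. sc (\<gamma> l) (sc (om l) top_form)) = sc (\<Sum>l\<in>?T. \<gamma> l * om l) top_form"
    unfolding EN.scale_scale by (rule EN.scale_sum_left[symmetric])
  moreover have "(\<Sum>l\<in>?T. sc (\<gamma> l) (sgl l)) = \<gamma>" by (rule fsupp_eq_sum[OF \<gamma>, symmetric])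
  ultimately show ?thesis by (simp only: ev_def)
qed

lemma ev_om_NN:
  assumes k: "k = int s" "r + s = n" and \<gamma>: "\<gamma> \<in> fsupp (tuples \<Omega> k)" "\<gamma> \<in> E.NN"
  shows "ev om \<gamma> \<in> JJ"
proof (rule E.ev_NN[OF JJ _ _ _ _ \<gamma>])
  have at: "\<exists>\<phi>. row_kill \<phi> \<and> (\<forall>z. om (l[i := z]) = pairing n \<phi> (rep z))" if l: "l \<in> tuples \<Omega> k" "i < length l" for l i
  proof -
    have s: "length l = s" using l(1) k(1) by (simp add: tuples_def)
    have "length (map rep (take i l)) + length (map rep (drop (Suc i) l)) + r + 1 = n"
      unfolding length_map length_take length_drop s using l(2) s k(2) by arith
    from detl_jrows_at[OF this] obtain \<phi> where \<phi>: "row_kill \<phi>"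
      "\<And>v. detl [0..<n] (jrows @ map rep (take i l) @ v # map rep (drop (Suc i) l)) = pairing n \<phi> v"
      by (elim exE conjE) (simp only:)
    have "om (l[i := z]) = pairing n \<phi> (rep z)" for z
      unfolding \<phi>(2)[symmetric] om_def upd_conv_take_nth_drop[OF l(2)] map_append list.map ..
    with \<phi>(1) show ?thesis by blast
  qed
  fix l i x assume l: "l \<in> tuples \<Omega> k" "i < length l" and x: "x \<in> carrier \<Omega>"
  obtain \<phi> where \<phi>: "row_kill \<phi>" "\<And>z. om (l[i := z]) = pairing n \<phi> (rep z)"
    using at[OF l] by (elim exE conjE) (simp only:)
  show "om (l[i := x \<oplus>\<^bsub>\<Omega>\<^esub> y]) - (om (l[i := x]) + om (l[i := y])) \<in> JJ" if y: "y \<in> carrier \<Omega>" for y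
    unfolding \<phi>(2) by (rule pairing_rep_add[OF \<phi>(1) x y])
  show "om (l[i := pr c \<odot>\<^bsub>\<Omega>\<^esub> x]) - c * om (l[i := x]) \<in> JJ" for c
    unfolding \<phi>(2) by (rule pairing_rep_smult[OF \<phi>(1) x])
next
  fix l i j assume l: "l \<in> tuples \<Omega> k" "i < j" "j < length l" "l ! i = l ! j"
  have "om l = 0" unfolding om_def
    by (rule detl_eq_zero[of "r + i" "r + j"]) (use l k in \<open>simp_all add: nth_append tuples_def\<close>)
  then show "om l \<in> JJ" using is_idlD(1)[OF JJ] by simp
qed (simp add: pr_zero_iff)

text \<open>The values taken modulo I form an ideal. It contains the determinants with rows
  \<open>jrows @ ws\<close>, hence by bordering all maximal minors of the Jacobian matrix of the
  \<open>fs i\<close>, hence 1.\<close>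

lemma ev_om_surj:
  assumes k: "k = int s" "r + s = n"
  shows "\<exists>\<gamma>\<in>fsupp (tuples \<Omega> k). c - ev om \<gamma> \<in> JJ"
proof -
  let ?A = "{c. \<exists>\<gamma>\<in>fsupp (tuples \<Omega> k). c - ev om \<gamma> \<in> JJ}"
  have A: "is_idl ?A"
    unfolding is_idl_def
  proof (intro conjI allI ballI impI)
    have "0 - ev om 0 \<in> JJ" unfolding ev_0 diff_self by (rule is_idlD(1)[OF JJ])
    then show "0 \<in> ?A" by (intro CollectI bexI[OF _ fsupp_0])
  next
    fix x y assume xy: "x \<in> ?A" "y \<in> ?A"
    obtain \<gamma> where g: "\<gamma> \<in> fsupp (tuples \<Omega> k)" "x - ev om \<gamma> \<in> JJ" using xy(1) by (elim CollectE bexE)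
    obtain \<delta> where d: "\<delta> \<in> fsupp (tuples \<Omega> k)" "y - ev om \<delta> \<in> JJ" using xy(2) by (elim CollectE bexE)
    have "(x + y) - ev om (\<gamma> + \<delta>) = (x - ev om \<gamma>) + (y - ev om \<delta>)"
      unfolding ev_add[OF fsuppD[OF g(1)] fsuppD[OF d(1)]] by simp
    then have "(x + y) - ev om (\<gamma> + \<delta>) \<in> JJ" by (simp only: is_idlD(2)[OF JJ g(2) d(2)])
    then show "x + y \<in> ?A" by (intro CollectI bexI[OF _ fsupp_add[OF g(1) d(1)]])
  next
    fix c x assume x: "x \<in> ?A"
    obtain \<gamma> where g: "\<gamma> \<in> fsupp (tuples \<Omega> k)" "x - ev om \<gamma> \<in> JJ" using x by (elim CollectE bexE)
    have "c * x - ev om (sc c \<gamma>) = c * (x - ev om \<gamma>)"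
      unfolding ev_sc[OF fsuppD[OF g(1)]] by (simp add: right_diff_distrib)
    then have "c * x - ev om (sc c \<gamma>) \<in> JJ" by (simp only: is_idlD(3)[OF JJ g(2)])
    then show "c * x \<in> ?A" by (intro CollectI bexI[OF _ fsupp_sc[OF g(1)]])
  qed
  have JA: "JJ \<subseteq> ?A"
  proof
    fix x assume "x \<in> JJ"
    then have "x - ev om 0 \<in> JJ" unfolding ev_0 diff_0_right .
    then show "x \<in> ?A" by (intro CollectI bexI[OF _ fsupp_0])
  qed
  have full: "detl [0..<n] (jrows @ ws) \<in> ?A" if ws: "length jrows + length ws = n" for ws
  proof -
    have "detl [0..<n] (jrows @ map rep (map sig ws)) - detl [0..<n] (jrows @ ws) \<in> JJ"
      using detl_rep_sig[of "[]" ws] ws by simp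
    then have "- (om (map sig ws) - detl [0..<n] (jrows @ ws)) \<in> JJ" unfolding om_def by (rule is_idlD(5)[OF JJ])
    then have "detl [0..<n] (jrows @ ws) - ev om (form ws) \<in> JJ" unfolding form_def ev_sgl minus_diff_eq .
    moreover have "form ws \<in> fsupp (tuples \<Omega> k)" by (rule form_fsupp) (use ws k in simp)
    ultimately show ?thesis by (intro CollectI bexI)
  qed
  have "detl cs (jrows @ []) \<in> ?A" if cs: "set cs \<subseteq> {..<n}" "length cs = r" for cs
    by (rule detl_mem_of_extensions[OF A full cs(1)]) (use cs in simp_all)
  then have "1 \<in> ?A" by (intro one_mem_of_minors[OF A JA]) simp
  then have "c * 1 \<in> ?A" by (rule is_idlD(3)[OF A])
  then show ?thesis by simp
qed

end

section \<open>The image of the exterior product with df\<close>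

lemma prep_0: "prep m 0 = 0"
  by (auto simp: prep_def fun_eq_iff split: list.split)

context ci_forms
begin

text \<open>Over the zero ring every formal sum is a relation.\<close>

lemma NN_trivial: "n < r \<Longrightarrow> \<gamma> \<in> E.NN"
proof -
  assume "n < r"
  then have "pr 1 = \<zero>\<^bsub>BB\<^esub>" unfolding pr_zero_iff by (rule one_JJ)
  from E.sc_ker_NN[OF this, of \<gamma>] show ?thesis unfolding EN.scale_one .
qed

abbreviation "df \<equiv> sig (grad n f)"

text \<open>Modulo I the coordinates of df may be replaced by the gradient of f; the determinant
  then expands into minors that generate the Jacobian ideal.\<close>

lemma om_df_QQ:
  assumes "length xs + r + 1 = n"
  shows "om (df # xs) \<in> QQ"
proof -
  have "length ([] :: (nat \<Rightarrow> 'k mpol) list) + length (map rep xs) + r + 1 = n" using assms by simp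
  from detl_jrows_at[OF this] obtain \<phi> where \<phi>: "row_kill \<phi>"
    "\<And>v. detl [0..<n] (jrows @ [] @ v # map rep xs) = pairing n \<phi> v" by (elim exE conjE) (simp only:)
  have "detl [0..<n] (tops @ map rep xs) \<in> QQ" by (rule detl_tops_QQ) (use assms in simp)
  then have "pairing n \<phi> (grad n f) \<in> QQ" unfolding \<phi>(2)[symmetric] by simp
  moreover have "pairing n \<phi> (rep df) - pairing n \<phi> (grad n f) \<in> QQ"
    using pairing_rep_sig[OF \<phi>(1)] JJ_QQ by (rule rev_subsetD)
  ultimately have "(pairing n \<phi> (rep df) - pairing n \<phi> (grad n f)) + pairing n \<phi> (grad n f) \<in> QQ"
    by (intro is_idlD(2)[OF QQ])
  then have "pairing n \<phi> (rep df) \<in> QQ" unfolding diff_add_cancel .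
  then show ?thesis unfolding om_def \<phi>(2)[symmetric] by simp
qed

lemma prep_df_fsupp: "\<delta> \<in> fsupp (tuples \<Omega> (k - 1)) \<Longrightarrow> prep df \<delta> \<in> fsupp (tuples \<Omega> k)"
  using prep_fsupp[OF sig_closed, of \<delta> "k - 1" "grad n f"] by (simp only: diff_add_cancel)

lemma ev_om_prep_df:
  assumes k: "k = int s" "r + s = n" and \<delta>: "\<delta> \<in> fsupp (tuples \<Omega> (k - 1))"
  shows "ev om (prep df \<delta>) \<in> QQ"
  unfolding ev_def
proof (intro is_idl_sum[OF QQ] is_idlD(3)[OF QQ])
  fix l assume l: "l \<in> {l. prep df \<delta> l \<noteq> 0}"
  then have tup: "l \<in> tuples \<Omega> k" using prep_df_fsupp[OF \<delta>] unfolding fsupp_def by blast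
  show "om l \<in> QQ"
  proof (cases l)
    case Nil
    then show ?thesis using l by (simp add: prep_def)
  next
    case (Cons x xs)
    then have "x = df" using l by (auto simp: prep_def split: if_splits)
    moreover have "length xs + r + 1 = n" using tup k unfolding tuples_def Cons by simp
    ultimately show ?thesis unfolding Cons by (simp only: om_df_QQ)
  qed
qed

text \<open>The multipliers that send \<open>top_form\<close> into the image of df form an ideal. It
  contains the determinants with rows \<open>tops @ ws\<close>, because such a multiple of
  \<open>top_form\<close> is df wedge the form given by \<open>ws\<close>; by bordering it contains
  all minors of \<open>tops\<close>, and so \<open>QQ\<close>.\<close>

lemma QQ_prep_df:
  assumes k: "k = int s" "r + s = n" and c: "c \<in> QQ"
  shows "\<exists>\<delta>\<in>fsupp (tuples \<Omega> (k - 1)). sc c top_form - prep df \<delta> \<in> E.NN"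
proof -
  let ?S = "fsupp (tuples \<Omega> (k - 1))"
  let ?A = "{c. \<exists>\<delta>\<in>?S. sc c top_form - prep df \<delta> \<in> E.NN}"
  have JA: "JJ \<subseteq> ?A"
  proof
    fix x assume "x \<in> JJ"
    then have "pr x = \<zero>\<^bsub>BB\<^esub>" by (simp only: pr_zero_iff)
    then have "sc x top_form - prep df 0 \<in> E.NN" unfolding prep_0 diff_0_right by (rule E.sc_ker_NN)
    then show "x \<in> ?A" by (intro CollectI bexI[OF _ fsupp_0])
  qed
  have A: "is_idl ?A"
    unfolding is_idl_def
  proof (intro conjI allI ballI impI)
    show "0 \<in> ?A" using JA is_idlD(1)[OF JJ] by (rule subsetD)
  next
    fix x y assume xy: "x \<in> ?A" "y \<in> ?A"
    obtain \<gamma> where g: "\<gamma> \<in> ?S" "sc x top_form - prep df \<gamma> \<in> E.NN" using xy(1) by (elim CollectE bexE)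
    obtain \<delta> where d: "\<delta> \<in> ?S" "sc y top_form - prep df \<delta> \<in> E.NN" using xy(2) by (elim CollectE bexE)
    have "sc (x + y) top_form - prep df (\<gamma> + \<delta>) \<in> E.NN"
      unfolding EN.scale_left_distrib prep_add add_diff_add by (rule EN.N_add[OF g(2) d(2)])
    then show "x + y \<in> ?A" by (intro CollectI bexI[OF _ fsupp_add[OF g(1) d(1)]])
  next
    fix c x assume x: "x \<in> ?A"
    obtain \<gamma> where g: "\<gamma> \<in> ?S" "sc x top_form - prep df \<gamma> \<in> E.NN" using x by (elim CollectE bexE)
    have "sc (c * x) top_form - prep df (sc c \<gamma>) \<in> E.NN"
      unfolding prep_sc EN.scale_scale[symmetric] EN.scale_right_diff_distrib[symmetric] by (rule EN.N_scale[OF g(2)])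
    then show "c * x \<in> ?A" by (intro CollectI bexI[OF _ fsupp_sc[OF g(1)]])
  qed
  have full: "detl [0..<n] (tops @ ws) \<in> ?A"
    if ws: "length tops + length ws = n" "\<And>w j. w \<in> set ws \<Longrightarrow> j \<ge> n \<Longrightarrow> w j = 0" for ws
  proof -
    have l: "length (grad n f # ws) = s" using ws(1) k(2) by simp
    have supp: "v j = 0" if "v \<in> set (grad n f # ws)" "j \<ge> n" for v j using that ws(2)[of v j] by (auto simp: grad_def)
    have "EN.eqN (form (grad n f # ws)) (sc (detl [0..<n] (jrows @ grad n f # ws)) top_form)"
      by (rule form_eq[OF k(1) l _ k(2)]) (rule supp)
    from EN.eqN_sym[OF this] have "sc (detl [0..<n] (jrows @ grad n f # ws)) top_form - form (grad n f # ws) \<in> E.NN"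
      unfolding EN.eqN_def .
    then have "sc (detl [0..<n] (tops @ ws)) top_form - prep df (sgl (map sig ws)) \<in> E.NN"
      unfolding form_def prep_sgl append_assoc append_Cons append_Nil list.map .
    moreover have "int (length (map sig ws)) = k - 1" using l k(1) by simp
    moreover have "set (map sig ws) \<subseteq> carrier \<Omega>" using sig_closed by auto
    ultimately have t: "sc (detl [0..<n] (tops @ ws)) top_form - prep df (sgl (map sig ws)) \<in> E.NN"
      "map sig ws \<in> tuples \<Omega> (k - 1)" unfolding tuples_def by (simp_all only: mem_Collect_eq)
    from t(2) have m: "sgl (map sig ws) \<in> ?S" by (rule fsupp_sgl)
    show ?thesis by (rule CollectI, rule bexI[OF _ m]) (rule t(1))
  qed
  have "minors (r + 1) (jacobian n r fs f) \<subseteq> ?A"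
  proof
    fix p assume "p \<in> minors (r + 1) (jacobian n r fs f)"
    from minors_cases[OF this] obtain cs where cs: "set cs \<subseteq> {..<n}" "length cs = r + 1" "p = detl cs tops"
      by (elim exE conjE)
    have "detl cs (tops @ []) \<in> ?A" by (rule detl_mem_of_extensions[OF A full cs(1)]) (use cs in simp_all)
    then show "p \<in> ?A" unfolding cs(3) append_Nil2 .
  qed
  from subsetD[OF QQ_minimal[OF A JA this] c] show ?thesis by (rule CollectD)
qed

lemma top_degree:
  assumes k: "k = int n - int r"
  shows ev_om_QQ: "\<gamma> \<in> fsupp (tuples \<Omega> k) \<Longrightarrow> \<gamma> \<in> E.NN \<Longrightarrow> ev om \<gamma> \<in> QQ"
    and ev_om_onto: "\<exists>\<gamma>\<in>fsupp (tuples \<Omega> k). c - ev om \<gamma> \<in> QQ"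
    and ev_om_QQ_iff: "\<gamma> \<in> fsupp (tuples \<Omega> k) \<Longrightarrow>
      (\<exists>\<delta>\<in>fsupp (tuples \<Omega> (k - 1)). \<gamma> - prep df \<delta> \<in> E.NN) \<longleftrightarrow> ev om \<gamma> \<in> QQ"
proof -
  \<comment> \<open>Settles the case n < r, in which B is the zero ring and both modules
    vanish.\<close>
  have all: "x \<in> QQ" if r: "n < r" for x
  proof -
    have "1 \<in> QQ" using one_JJ[OF r] JJ_QQ by (rule rev_subsetD)
    then have "x * 1 \<in> QQ" by (rule is_idlD(3)[OF QQ])
    then show ?thesis by simp
  qed
  have s: "k = int (n - r)" "r + (n - r) = n" if "\<not> n < r" using that k by auto
  show ev: "ev om \<gamma> \<in> QQ" if g: "\<gamma> \<in> fsupp (tuples \<Omega> k)" "\<gamma> \<in> E.NN" for \<gamma>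
  proof (cases "n < r")
    case False
    show ?thesis using ev_om_NN[OF s[OF False] g] JJ_QQ by (rule rev_subsetD)
  qed (rule all)
  show "\<exists>\<gamma>\<in>fsupp (tuples \<Omega> k). c - ev om \<gamma> \<in> QQ"
  proof (cases "n < r")
    case True
    show ?thesis by (rule bexI[OF _ fsupp_0]) (rule all[OF True])
  next
    case False
    obtain \<gamma> where g: "\<gamma> \<in> fsupp (tuples \<Omega> k)" "c - ev om \<gamma> \<in> JJ"
      using ev_om_surj[OF s[OF False], of c] by (elim bexE)
    show ?thesis by (rule bexI[OF _ g(1)]) (rule subsetD[OF JJ_QQ g(2)])
  qed
  show "(\<exists>\<delta>\<in>fsupp (tuples \<Omega> (k - 1)). \<gamma> - prep df \<delta> \<in> E.NN) \<longleftrightarrow> ev om \<gamma> \<in> QQ" (is "?L \<longleftrightarrow> ?R")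
    if g: "\<gamma> \<in> fsupp (tuples \<Omega> k)" for \<gamma>
  proof (cases "n < r")
    case True
    have ?L by (rule bexI[OF _ fsupp_0]) (rule NN_trivial[OF True])
    with all[OF True] show ?thesis by blast
  next
    case False
    show ?thesis
    proof
      assume ?L
      then obtain \<delta> where d: "\<delta> \<in> fsupp (tuples \<Omega> (k - 1))" "\<gamma> - prep df \<delta> \<in> E.NN" by (elim bexE)
      note p = prep_df_fsupp[OF d(1)]
      have "ev om \<gamma> - ev om (prep df \<delta>) \<in> QQ"
        using ev[OF fsupp_diff[OF g p] d(2)] unfolding ev_diff[OF g p] .
      from is_idlD(2)[OF QQ this ev_om_prep_df[OF s[OF False] d(1)]] show ?R by simp
    next
      assume ?R
      from QQ_prep_df[OF s[OF False] this] obtain \<delta> where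
        d: "\<delta> \<in> fsupp (tuples \<Omega> (k - 1))" "sc (ev om \<gamma>) top_form - prep df \<delta> \<in> E.NN" by (elim bexE)
      have "EN.eqN (sc (ev om \<gamma>) top_form) (prep df \<delta>)" unfolding EN.eqN_def by (rule d(2))
      from EN.eqN_trans[OF eq_scale_top_form[OF s[OF False] g] this]
      have "\<gamma> - prep df \<delta> \<in> E.NN" unfolding EN.eqN_def .
      then show ?L by (rule bexI[OF _ d(1)])
    qed
  qed
qed

end

section \<open>Assembling the isomorphism\<close>

context ci_split
begin

lemma cohomology_iso:
  "module_iso BB
    (cohomology (kaehler_forms KK BB \<kappa>) (d_wedge KK BB \<kappa> (coord_class n r fs f)) (int n - int r))
    (quot_as_module PP (II <+>\<^bsub>PP\<^esub> Jac))"
proof -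
  let ?k = "int n - int r"
  interpret E: ci_forms n r fs f a ?k by unfold_locales
  interpret E0: ci_forms n r fs f a "?k - 1" by unfold_locales
  interpret E1: ci_forms n r fs f a "?k + 1" by unfold_locales
  let ?C = "kaehler_forms KK BB \<kappa>" and ?d = "d_wedge KK BB \<kappa> (coord_class n r fs f)"
  let ?df = "sig (grad n f)" and ?S = "fsupp (tuples \<Omega> ?k)" and ?T = "fsupp (tuples \<Omega> (?k - 1))"
  let ?L = "II <+>\<^bsub>PP\<^esub> Jac"
  let ?Q = "quot_as_module PP ?L" and ?M = "?C ?k"
  note qc = qc_eq_iff[OF sum_ideal(1,2)] qc_cases[OF sum_ideal(1,2)] qc_closed[OF sum_ideal(1,2)]
    qc_add[OF sum_ideal(1,2)] qc_zero[OF sum_ideal(1,2)] qc_smult[OF sum_ideal(1,2)]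
  let ?qc = "\<lambda>x. ?L +>\<^bsub>PP\<^esub> retr n x"
  have C: "?M = quot_module E.E.F E.E.W" "?C (?k - 1) = quot_module E0.E.F E0.E.W" "?C (?k + 1) = quot_module E1.E.F E1.E.W"
    unfolding kaehler_forms_def by (rule E.E.exterior_power_eq E0.E.exterior_power_eq E1.E.exterior_power_eq)+
  have cases: "\<exists>\<gamma>\<in>?S. x = E.E.cls \<gamma>" if "x \<in> carrier ?M" for x
    using that unfolding C(1) by (rule E.E.cls_cases)
  have cases0: "\<exists>\<delta>\<in>?T. x = E0.E.cls \<delta>" if "x \<in> carrier (?C (?k - 1))" for x
    using that unfolding C(2) by (rule E0.E.cls_cases)
  have d: "?d ?k (E.E.cls \<gamma>) = E1.E.cls (prep ?df \<gamma>)" if "\<gamma> \<in> ?S" for \<gamma>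
    unfolding d_wedge_def sig_grad[OF f, symmetric] by (rule E.E.wedge_left_cls[OF sig_closed that])
  have d0: "?d (?k - 1) (E0.E.cls \<delta>) = E.E.cls (prep ?df \<delta>)" if "\<delta> \<in> ?T" for \<delta>
    unfolding d_wedge_def sig_grad[OF f, symmetric]
    using E0.E.wedge_left_cls[OF sig_closed that, of "grad n f"] by (simp only: diff_add_cancel)
  have top: "\<gamma> \<in> E1.E.NN" if g: "\<gamma> \<in> fsupp (tuples \<Omega> (?k + 1))" for \<gamma>
  proof (cases "n < r")
    case True
    then show ?thesis by (rule E1.NN_trivial)
  next
    case False
    then have "?k + 1 = int (n - r + 1)" "n < r + (n - r + 1)" by auto
    then show ?thesis using g by (rule E1.above_top_degree)
  qed
  \<comment> \<open>There are no nonzero forms above degree n - r, so every form of this degree is a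
    cocycle and the cohomology is a plain cokernel.\<close>
  have "?d ?k x = \<zero>\<^bsub>?C (?k + 1)\<^esub>" if x: "x \<in> carrier ?M" for x
  proof -
    obtain \<gamma> where g: "\<gamma> \<in> ?S" "x = E.E.cls \<gamma>" using cases[OF x] by (elim bexE)
    have p: "prep ?df \<gamma> \<in> fsupp (tuples \<Omega> (?k + 1))" by (rule prep_fsupp[OF sig_closed g(1)])
    show ?thesis
      unfolding g(2) d[OF g(1)] C(3) E1.E.cls_zero E1.E.cls_eq_iff[OF p fsupp_0] by (rule top[OF fsupp_diff[OF p fsupp_0]])
  qed
  then have ker: "a_kernel ?M (?C (?k + 1)) (?d ?k) = carrier ?M" unfolding a_kernel_def' by blast
  let ?N = "?d (?k - 1) ` carrier (?C (?k - 1))"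
  have coh: "cohomology ?C ?d ?k = quot_module ?M ?N"
    unfolding cohomology_def ker by simp
  have N: "E.E.cls \<gamma> \<in> ?N \<longleftrightarrow> ev om \<gamma> \<in> QQ" if g: "\<gamma> \<in> ?S" for \<gamma>
    unfolding E.ev_om_QQ_iff[OF refl g, symmetric]
  proof
    assume "E.E.cls \<gamma> \<in> ?N"
    then obtain y where y: "E.E.cls \<gamma> = ?d (?k - 1) y" "y \<in> carrier (?C (?k - 1))" by (rule imageE)
    obtain \<delta> where \<delta>: "\<delta> \<in> ?T" "y = E0.E.cls \<delta>" using cases0[OF y(2)] by (elim bexE)
    have "E.E.cls \<gamma> = E.E.cls (prep ?df \<delta>)" unfolding y(1) \<delta>(2) by (rule d0[OF \<delta>(1)])
    then have "\<gamma> - prep ?df \<delta> \<in> E.E.NN" unfolding E.E.cls_eq_iff[OF g E.prep_df_fsupp[OF \<delta>(1)]] .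
    then show "\<exists>\<delta>\<in>?T. \<gamma> - prep ?df \<delta> \<in> E.E.NN" by (rule bexI[OF _ \<delta>(1)])
  next
    assume "\<exists>\<delta>\<in>?T. \<gamma> - prep ?df \<delta> \<in> E.E.NN"
    then obtain \<delta> where \<delta>: "\<delta> \<in> ?T" "\<gamma> - prep ?df \<delta> \<in> E.E.NN" by (elim bexE)
    have "E.E.cls \<gamma> = ?d (?k - 1) (E0.E.cls \<delta>)"
      unfolding d0[OF \<delta>(1)] E.E.cls_eq_iff[OF g E.prep_df_fsupp[OF \<delta>(1)]] by (rule \<delta>(2))
    moreover have "E0.E.cls \<delta> \<in> carrier (?C (?k - 1))" unfolding C(2) by (rule E0.E.cls_closed[OF \<delta>(1)])
    ultimately show "E.E.cls \<gamma> \<in> ?N" by (rule image_eqI)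
  qed
  \<comment> \<open>The value at a chosen lift; by \<open>ev_om_QQ\<close> another lift of the same
    form changes it only within \<open>QQ\<close>.\<close>
  define h where "h x = ?qc (ev om (SOME \<gamma>. \<gamma> \<in> ?S \<and> x = E.E.cls \<gamma>))" for x
  have h: "h (E.E.cls \<gamma>) = ?qc (ev om \<gamma>)" if g: "\<gamma> \<in> ?S" for \<gamma>
  proof -
    let ?\<delta> = "SOME \<delta>. \<delta> \<in> ?S \<and> E.E.cls \<gamma> = E.E.cls \<delta>"
    have \<delta>: "?\<delta> \<in> ?S \<and> E.E.cls \<gamma> = E.E.cls ?\<delta>" by (rule someI[of _ \<gamma>]) (intro conjI g refl)
    note \<delta>S = \<delta>[THEN conjunct1]
    have "?\<delta> - \<gamma> \<in> E.E.NN" using \<delta>[THEN conjunct2, symmetric] unfolding E.E.cls_eq_iff[OF \<delta>S g] .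
    from E.ev_om_QQ[OF refl fsupp_diff[OF \<delta>S g] this] show ?thesis
      unfolding h_def qc(1) ev_diff[OF \<delta>S g] .
  qed
  have clsM: "E.E.cls \<gamma> \<in> carrier ?M" if "\<gamma> \<in> ?S" for \<gamma>
    unfolding C(1) by (rule E.E.cls_closed[OF that])
  have "module_iso BB (quot_module ?M ?N) ?Q"
  proof (rule first_isomorphism)
    show "Module.module BB ?M" unfolding C(1) by (rule E.E.F.module_quot[OF E.E.W])
    show "Module.module BB ?Q" by (rule module_quot_as_module(7)[OF sum_ideal(1,2)])
    fix x assume "x \<in> carrier ?M"
    from cases[OF this] obtain \<gamma> where x: "\<gamma> \<in> ?S" "x = E.E.cls \<gamma>" by (elim bexE)
    show "h x \<in> carrier ?Q" unfolding x(2) h[OF x(1)] by (rule qc(3))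
    show "h (b \<odot>\<^bsub>?M\<^esub> x) = b \<odot>\<^bsub>?Q\<^esub> h x" if b: "b \<in> carrier BB" for b
    proof -
      obtain c where c: "pr c = b" using \<pi>_surj[OF b] by (elim exE)
      show ?thesis
        unfolding x(2) c[symmetric] C(1) E.E.cls_smult[OF x(1)] h[OF x(1)] h[OF fsupp_sc[OF x(1)]]
          ev_sc[OF fsuppD[OF x(1)]] by (rule qc(6)[symmetric])
    qed
    fix y assume "y \<in> carrier ?M"
    from cases[OF this] obtain \<delta> where y: "\<delta> \<in> ?S" "y = E.E.cls \<delta>" by (elim bexE)
    show "h (x \<oplus>\<^bsub>?M\<^esub> y) = h x \<oplus>\<^bsub>?Q\<^esub> h y"
      unfolding x(2) y(2) C(1) E.E.cls_add[OF x(1) y(1)] h[OF x(1)] h[OF y(1)] h[OF fsupp_add[OF x(1) y(1)]]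
        ev_add[OF fsuppD[OF x(1)] fsuppD[OF y(1)]] by (rule qc(4)[symmetric])
  next
    fix y assume "y \<in> carrier ?Q"
    from qc(2)[OF this] obtain c where c: "y = ?qc c" by (elim exE)
    obtain \<gamma> where g: "\<gamma> \<in> ?S" "c - ev om \<gamma> \<in> QQ" using E.ev_om_onto[OF refl, of c] by (elim bexE)
    have "h (E.E.cls \<gamma>) = y" unfolding h[OF g(1)] c by (rule sym) (simp only: qc(1) g(2))
    then show "\<exists>x\<in>carrier ?M. h x = y" by (rule bexI[OF _ clsM[OF g(1)]])
  next
    have hz: "h (E.E.cls \<gamma>) = \<zero>\<^bsub>?Q\<^esub> \<longleftrightarrow> E.E.cls \<gamma> \<in> ?N" if g: "\<gamma> \<in> ?S" for \<gamma>
      unfolding h[OF g] qc(5) qc(1) N[OF g] diff_0_right ..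
    have sub: "?N \<subseteq> carrier ?M"
    proof
      fix x assume "x \<in> ?N"
      then obtain y where y: "x = ?d (?k - 1) y" "y \<in> carrier (?C (?k - 1))" by (rule imageE)
      obtain \<delta> where \<delta>: "\<delta> \<in> ?T" "y = E0.E.cls \<delta>"
        using cases0[OF y(2)] by (elim bexE)
      show "x \<in> carrier ?M" unfolding y(1) \<delta>(2) d0[OF \<delta>(1)] by (rule clsM[OF E.prep_df_fsupp[OF \<delta>(1)]])
    qed
    have iff: "h x = \<zero>\<^bsub>?Q\<^esub> \<longleftrightarrow> x \<in> ?N" if x: "x \<in> carrier ?M" for x
    proof -
      obtain \<gamma> where g: "\<gamma> \<in> ?S" "x = E.E.cls \<gamma>" using cases[OF x] by (elim bexE)
      show ?thesis unfolding g(2) by (rule hz[OF g(1)])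
    qed
    show "?N = {x \<in> carrier ?M. h x = \<zero>\<^bsub>?Q\<^esub>}" using iff sub by blast
  qed
  then show ?thesis unfolding coh .
qed

end

theorem corollary1p4:
  fixes f :: "'k::field mpol" and fs :: "nat \<Rightarrow> 'k mpol" and n r :: nat
  assumes "r \<ge> 1"
    and "f \<in> carrier (mpoly_ring n)"
    and "\<And>i. i < r \<Longrightarrow> fs i \<in> carrier (mpoly_ring n)"
    and "smooth_complete_intersection n r fs"
  shows "let K = (ring_of_type_algebra :: 'k ring);
             B = coord_ring n r fs;
             \<kappa> = coord_const n r fs
         in module_iso B
              (cohomology (kaehler_forms K B \<kappa>) (d_wedge K B \<kappa> (coord_class n r fs f)) (int n - int r))
              (quot_as_module (mpoly_ring n)
                 (ci_ideal n r fs <+>\<^bsub>mpoly_ring n\<^esub> jacobian_ideal n r fs f))"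
proof -
  have fs: "fs i \<in> poly_in {..<n}" if "i < r" for i
    using assms(2,3) that by simp_all
  have "\<exists>a. \<forall>i<r. \<forall>k<r. (\<Sum>j<n. partial_deriv j (fs i) * a j k) - (if i = k then 1 else 0)
      \<in> ext_ideal n (ci_ideal n r fs)"
    by (rule jacobian_right_inverse[OF fs assms(1,4)])
  then obtain a where a: "\<forall>i<r. \<forall>k<r. (\<Sum>j<n. partial_deriv j (fs i) * a j k) - (if i = k then 1 else 0)
      \<in> ext_ideal n (ci_ideal n r fs)" by (elim exE)
  interpret ci_split n r fs f a
    by unfold_locales (use assms(2) fs a in simp_all)
  show ?thesis unfolding Let_def by (rule cohomology_iso)
qed

end
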